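(* Let $Z\in\Lambda^F$ have a visible-invisible fold-fold at $\mathbf 0$ with $X^1\cdot Y^1(\mathbf 0)<0$ and $(\det Z)_x(\mathbf 0)<0$. Then, for $\alpha=\delta\varepsilon$, the stable and unstable Fenichel manifolds $\Lambda^{\alpha,s}_\varepsilon$ and $\Lambda^{\alpha,u}_\varepsilon$ of the regularized system $Z^\alpha_\varepsilon$ can be extended up to $x=0$. Moreover $$\Lambda^{\alpha,s,u}_\varepsilon\cap\{x=0\}=(0,\bar v+\mathcal O(\varepsilon^{1/2})),$$ and the system has a maximal Canard for $$\mathcal C=\{(\alpha,\varepsilon):\ \alpha=\alpha_{\mathcal C}(\varepsilon)=\delta_{\mathcal C}\varepsilon+\mathcal O(\varepsilon^{3/2})\}$$ and $\varepsilon$ small enough, where $\delta_{\mathcal C}=-\dfrac{M_0M_3+M_1M_4}{M_2M_4}$ and $$M_0=\left(X^1+Y^1+\varphi(\bar v)(X^1-Y^1)\right)(\mathbf 0),\qquad M_1=\bar v\left(X^2_y+Y^2_y+\varphi(\bar v)(X^2_y-Y^2_y)\right)(\mathbf 0),$$ $$M_2=\left(\tilde X^2+\tilde Y^2+\varphi(\bar v)(\tilde X^2-\tilde Y^2)\right)(\mathbf 0),\qquad M_3=\tfrac12\left(X^2_{xx}+Y^2_{xx}+\varphi(\bar v)(X^2_{xx}-Y^2_{xx})\right)(\mathbf 0),$$ $$M_4=\varphi'(\bar v)\left(X^2_x-Y^2_x\right)(\mathbf 0).$$ Moreover, for $\alpha=\alpha_{\mathcal C}(\varepsilon)$ one has $\Lambda^{\alpha,s}_\varepsilon\cap\{x=0\}=\Lambda^{\alpha,u}_\varepsilon\cap\{x=0\}=(0,\bar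 v+\mathcal O(\varepsilon))$.
   Context: Setting. $Z=(X,Y)$ is a planar Filippov system near $\mathbf 0\in\mathbb R^2$ ($Z=X$ for $y>0$, $Z=Y$ for $y<0$, $X=(X^1,X^2)$, $Y=(Y^1,Y^2)$ sufficiently smooth). Subscripts $x,y$ are partial derivatives; $\det Z=X^1Y^2-X^2Y^1$. $\mathbf 0$ is a visible fold of $X$ ($X^2=0$, $X^2_xX^1>0$ at $\mathbf 0$) and an invisible fold of $Y$ ($Y^2=0$, $Y^2_xY^1>0$ at $\mathbf 0$), and $X^1(\mathbf 0)>0$ (standing conventions). Here $Z\in\Lambda^F$ amounts to these conditions together with $(\det Z)_x(\mathbf 0)\ne0$. Unfolding: $Z^\alpha=(X^\alpha,Y^\alpha)=Z+\alpha\tilde Z+O(\alpha^2)$, $\tilde Z=(\tilde X,\tilde Y)$, with $\frac{\tilde Y^2(\mathbf 0)}{Y^2_x(\mathbf 0)}-\frac{\tilde X^2(\mathbf 0)}{X^2_x(\mathbf 0)}>0$ (versality and orientation of the parameter). Regularization: $Z^\alpha_\varepsilon(x,y)=\frac12[(X^\alpha+Y^\alpha)+\varphi(y/\varepsilon)(X^\alpha-Y^\alpha)](x,y)$, $\varphi$ sufficiently smooth, $\varphi=1$ for $v\ge1$, $\varphi=-1$ for $v\le-1$, $\varphi'>0$ on $(-1,1)$. With $y=\varepsilon v$ and time rescaled by $2$ this is the slow-fast system $\dot x=F^1(x,v;\alpha,\varepsilon)$, $\varepsilon\dot v=F^2(x,v;\alpha,\varepsilon)$, $F^i=(X^{\alpha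 i}+Y^{\alpha i})(x,\varepsilon v)+\varphi(v)(X^{\alpha i}-Y^{\alpha i})(x,\varepsilon v)$. Fenichel manifolds: for $\alpha=\delta\varepsilon$ the critical manifolds (at $\varepsilon=0$) are $\Lambda_0^s=\{v=m_0(x),x<0\}$ (attracting) and $\Lambda^u_0=\{v=m_0(x),x>0\}$ (repelling), where $m_0(x)=\varphi^{-1}\!\left(\frac{X^2+Y^2}{Y^2-X^2}(x,0)\right)$, extended smoothly to $x=0$ with $m_0(0)=\bar v=\varphi^{-1}\!\left(\frac{X^2_x+Y^2_x}{Y^2_x-X^2_x}(\mathbf 0)\right)$. For a small fixed $\kappa>0$, in compact sets and for $\varepsilon$ small, Fenichel theory gives normally hyperbolic invariant manifolds $\Lambda^{\alpha,s}_\varepsilon=\{v=m^s(x;\varepsilon),x<-\kappa\}$ and $\Lambda^{\alpha,u}_\varepsilon=\{v=m^u(x;\varepsilon),x>\kappa\}$ with $m^{s,u}=m_0+O(\varepsilon)$; they are extended by the flow. A maximal Canard occurs when the extended manifolds $\Lambda^{\alpha,s}_\varepsilon$ and $\Lambda^{\alpha,u}_\varepsilon$ coincide. Points are written $(x,v)$. *)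

theory Defs
  imports "HOL-Analysis.Analysis"
begin

text \<open>Functions of class C^k on an open set of a normed space; for finite-dimensional domains this
  is the usual notion.\<close>

primrec Ck_on :: "nat \<Rightarrow> 'a::real_normed_vector set \<Rightarrow> ('a \<Rightarrow> 'b::real_normed_vector) \<Rightarrow> bool" where
  "Ck_on 0 S f \<longleftrightarrow> continuous_on S f"
| "Ck_on (Suc k) S f \<longleftrightarrow>
     (\<forall>p\<in>S. f differentiable (at p)) \<and> (\<forall>h. Ck_on k S (\<lambda>p. frechet_derivative f (at p) h))"

definition dx :: "(real \<times> real \<Rightarrow> real) \<Rightarrow> real \<times> real \<Rightarrow> real" where
  "dx f p = deriv (\<lambda>s. f (s, snd p)) (fst p)"

definition dy :: "(real \<times> real \<Rightarrow> real) \<Rightarrow> real \<times> real \<Rightarrow> real" where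
  "dy f p = deriv (\<lambda>s. f (fst p, s)) (snd p)"

type_synonym vfield = "real \<times> real \<Rightarrow> real \<times> real"

abbreviation c1 :: "vfield \<Rightarrow> real \<times> real \<Rightarrow> real" where "c1 V \<equiv> \<lambda>p. fst (V p)"
abbreviation c2 :: "vfield \<Rightarrow> real \<times> real \<Rightarrow> real" where "c2 V \<equiv> \<lambda>p. snd (V p)"


section \<open>Filippov systems and their unfoldings\<close>

definition det_Z :: "vfield \<Rightarrow> vfield \<Rightarrow> real \<times> real \<Rightarrow> real" where
  "det_Z X Y p = c1 X p * c2 Y p - c2 X p * c1 Y p"

text \<open>Since Y lives in the lower half plane, the sign that makes the fold of X visible makes
  the fold of Y invisible.\<close>

definition visible_fold_upper :: "vfield \<Rightarrow> bool" where
  "visible_fold_upper X \<longleftrightarrow> c2 X 0 = 0 \<and> dx (c2 X) 0 * c1 X 0 > 0"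

definition invisible_fold_lower :: "vfield \<Rightarrow> bool" where
  "invisible_fold_lower Y \<longleftrightarrow> c2 Y 0 = 0 \<and> dx (c2 Y) 0 * c1 Y 0 > 0"

definition in_Lambda_F :: "vfield \<Rightarrow> vfield \<Rightarrow> bool" where
  "in_Lambda_F X Y \<longleftrightarrow>
     visible_fold_upper X \<and> invisible_fold_lower Y \<and> c1 X 0 > 0 \<and> dx (det_Z X Y) 0 \<noteq> 0"

text \<open>\<open>X \<alpha>\<close> is the perturbed field, \<open>X 0\<close> the unperturbed one. Three derivatives, jointly in the
  parameter and the phase variables, are what ``sufficiently smooth'' amounts to. The quadratic
  remainder is only required pointwise in p.\<close>

definition smooth_unfolding ::
  "real set \<Rightarrow> (real \<times> real) set \<Rightarrow> (real \<Rightarrow> vfield) \<Rightarrow> vfield \<Rightarrow> bool" where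
  "smooth_unfolding A U X X' \<longleftrightarrow>
     Ck_on 3 (A \<times> U) (\<lambda>(\<alpha>, p). X \<alpha> p) \<and>
     (\<forall>p\<in>U. \<exists>C. \<forall>\<^sub>F \<alpha> in nhds 0. norm (X \<alpha> p - X 0 p - \<alpha> *\<^sub>R X' p) \<le> C * \<alpha>\<^sup>2)"

definition versal :: "vfield \<Rightarrow> vfield \<Rightarrow> vfield \<Rightarrow> vfield \<Rightarrow> bool" where
  "versal X Y X' Y' \<longleftrightarrow> c2 Y' 0 / dx (c2 Y) 0 - c2 X' 0 / dx (c2 X) 0 > 0"


section \<open>Regularization\<close>

definition transition_function :: "(real \<Rightarrow> real) \<Rightarrow> bool" where
  "transition_function \<phi> \<longleftrightarrow> Ck_on 3 UNIV \<phi> \<and> (\<forall>v\<ge>1. \<phi> v = 1) \<and> (\<forall>v\<le>-1. \<phi> v = -1) \<and>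
     (\<forall>v\<in>{-1<..<1}. deriv \<phi> v > 0)"

definition regularization :: "vfield \<Rightarrow> vfield \<Rightarrow> (real \<Rightarrow> real) \<Rightarrow> real \<Rightarrow> vfield" where
  "regularization X Y \<phi> \<epsilon> p =
     (1/2) *\<^sub>R ((X p + Y p) + \<phi> (snd p / \<epsilon>) *\<^sub>R (X p - Y p))"

text \<open>The right-hand sides \<open>(F\<^sup>1, F\<^sup>2)\<close> of the system \<open>x' = F\<^sup>1\<close>, \<open>\<epsilon> v' = F\<^sup>2\<close>.\<close>

definition slow_fast :: "vfield \<Rightarrow> vfield \<Rightarrow> (real \<Rightarrow> real) \<Rightarrow> real \<Rightarrow> vfield" where
  "slow_fast X Y \<phi> \<epsilon> = (\<lambda>(x, v).
     (X (x, \<epsilon> * v) + Y (x, \<epsilon> * v)) + \<phi> v *\<^sub>R (X (x, \<epsilon> * v) - Y (x, \<epsilon> * v)))"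

lemma slow_fast_regularization:
  assumes "\<epsilon> \<noteq> 0"
  shows "slow_fast X Y \<phi> \<epsilon> (x, v) = 2 *\<^sub>R regularization X Y \<phi> \<epsilon> (x, \<epsilon> * v)"
  using assms by (simp add: slow_fast_def regularization_def)

text \<open>Trajectories of the slow-fast system that stay in a set W of the (x,v)-plane.\<close>

definition trajectory ::
  "vfield \<Rightarrow> real \<Rightarrow> (real \<times> real) set \<Rightarrow> real \<Rightarrow> real \<Rightarrow> (real \<Rightarrow> real \<times> real) \<Rightarrow> bool" where
  "trajectory F \<epsilon> W a b \<gamma> \<longleftrightarrow> a \<le> b \<and>
     (\<forall>t\<in>{a..b}. \<gamma> t \<in> W \<and>
        (\<gamma> has_vector_derivative (c1 F (\<gamma> t), c2 F (\<gamma> t) / \<epsilon>)) (at t within {a..b}))"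

definition locally_invariant ::
  "vfield \<Rightarrow> real \<Rightarrow> (real \<times> real) set \<Rightarrow> (real \<times> real) set \<Rightarrow> bool" where
  "locally_invariant F \<epsilon> W M \<longleftrightarrow>
     (\<forall>a b \<gamma>. trajectory F \<epsilon> W a b \<gamma> \<and> (\<exists>t\<in>{a..b}. \<gamma> t \<in> M) \<longrightarrow> \<gamma> ` {a..b} \<subseteq> M)"

definition forward_extension ::
  "vfield \<Rightarrow> real \<Rightarrow> (real \<times> real) set \<Rightarrow> (real \<times> real) set \<Rightarrow> (real \<times> real) set" where
  "forward_extension F \<epsilon> W M = {\<gamma> b |\<gamma> a b. trajectory F \<epsilon> W a b \<gamma> \<and> \<gamma> a \<in> M}"

definition backward_extension ::
  "vfield \<Rightarrow> real \<Rightarrow> (real \<times> real) set \<Rightarrow> (real \<times> real) set \<Rightarrow> (real \<times> real) set" where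
  "backward_extension F \<epsilon> W M = {\<gamma> a |\<gamma> a b. trajectory F \<epsilon> W a b \<gamma> \<and> \<gamma> b \<in> M}"

text \<open>The part over \<open>x \<in> I\<close> of the domain of the system in the coordinates (x,v), where
  \<open>y = \<epsilon> v\<close> and U is the domain of the fields.\<close>

definition strip :: "(real \<times> real) set \<Rightarrow> real \<Rightarrow> real set \<Rightarrow> (real \<times> real) set" where
  "strip U \<epsilon> I = {(x, v). x \<in> I \<and> (x, \<epsilon> * v) \<in> U}"

definition graph_over :: "real set \<Rightarrow> (real \<Rightarrow> real) \<Rightarrow> (real \<times> real) set" where
  "graph_over I m = {(x, m x) |x. x \<in> I}"


section \<open>Critical and Fenichel manifolds\<close>

abbreviation phi_inv :: "(real \<Rightarrow> real) \<Rightarrow> real \<Rightarrow> real" where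
  "phi_inv \<phi> \<equiv> inv_into {-1<..<1} \<phi>"

definition v_bar :: "vfield \<Rightarrow> vfield \<Rightarrow> (real \<Rightarrow> real) \<Rightarrow> real" where
  "v_bar X Y \<phi> = phi_inv \<phi> ((dx (c2 X) 0 + dx (c2 Y) 0) / (dx (c2 Y) 0 - dx (c2 X) 0))"

definition m_0 :: "vfield \<Rightarrow> vfield \<Rightarrow> (real \<Rightarrow> real) \<Rightarrow> real \<Rightarrow> real" where
  "m_0 X Y \<phi> x = (if x = 0 then v_bar X Y \<phi>
     else phi_inv \<phi> ((c2 X (x, 0) + c2 Y (x, 0)) / (c2 Y (x, 0) - c2 X (x, 0))))"

text \<open>A choice \<open>m \<alpha> \<epsilon>\<close> of Fenichel manifolds over the compact interval I, for parameters
  \<open>\<alpha> = \<delta> \<epsilon>\<close>: invariant graphs, depending continuously on the parameter and \<open>O(\<epsilon>)\<close>-close to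
  the critical manifold, uniformly for \<open>\<delta>\<close> in compact sets. Fenichel manifolds are not unique, so
  they enter as an arbitrary choice. They are of stable type for I to the left of 0 and of
  unstable type for I to the right.\<close>

definition fenichel_manifolds ::
  "(real \<times> real) set \<Rightarrow> (real \<Rightarrow> vfield) \<Rightarrow> (real \<Rightarrow> vfield) \<Rightarrow> (real \<Rightarrow> real) \<Rightarrow> real set \<Rightarrow>
   (real \<Rightarrow> real \<Rightarrow> real \<Rightarrow> real) \<Rightarrow> bool" where
  "fenichel_manifolds U X Y \<phi> I m \<longleftrightarrow>
     (\<forall>D>0. \<exists>C. \<forall>\<^sub>F \<epsilon> in at_right 0.
        continuous_on ({-(D*\<epsilon>)..D*\<epsilon>} \<times> I) (\<lambda>(\<alpha>, x). m \<alpha> \<epsilon> x) \<and>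
        (\<forall>\<alpha>\<in>{-(D*\<epsilon>)..D*\<epsilon>}.
           locally_invariant (slow_fast (X \<alpha>) (Y \<alpha>) \<phi> \<epsilon>) \<epsilon> (strip U \<epsilon> I) (graph_over I (m \<alpha> \<epsilon>)) \<and>
           (\<forall>x\<in>I. \<bar>m \<alpha> \<epsilon> x - m_0 (X 0) (Y 0) \<phi> x\<bar> \<le> C * \<epsilon>)))"

text \<open>The manifolds over \<open>[-L,-\<kappa>]\<close> and \<open>[\<kappa>,L]\<close>, extended by the flow (forward for the stable one,
  backward for the unstable one) within \<open>x \<in> J\<close>.\<close>

definition ext_stable ::
  "(real \<times> real) set \<Rightarrow> (real \<Rightarrow> vfield) \<Rightarrow> (real \<Rightarrow> vfield) \<Rightarrow> (real \<Rightarrow> real) \<Rightarrow> real \<Rightarrow> real \<Rightarrow>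
   (real \<Rightarrow> real \<Rightarrow> real \<Rightarrow> real) \<Rightarrow> real set \<Rightarrow> real \<Rightarrow> real \<Rightarrow> (real \<times> real) set" where
  "ext_stable U X Y \<phi> L \<kappa> m J \<alpha> \<epsilon> =
     forward_extension (slow_fast (X \<alpha>) (Y \<alpha>) \<phi> \<epsilon>) \<epsilon> (strip U \<epsilon> J) (graph_over {-L..-\<kappa>} (m \<alpha> \<epsilon>))"

definition ext_unstable ::
  "(real \<times> real) set \<Rightarrow> (real \<Rightarrow> vfield) \<Rightarrow> (real \<Rightarrow> vfield) \<Rightarrow> (real \<Rightarrow> real) \<Rightarrow> real \<Rightarrow> real \<Rightarrow>
   (real \<Rightarrow> real \<Rightarrow> real \<Rightarrow> real) \<Rightarrow> real set \<Rightarrow> real \<Rightarrow> real \<Rightarrow> (real \<times> real) set" where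
  "ext_unstable U X Y \<phi> L \<kappa> m J \<alpha> \<epsilon> =
     backward_extension (slow_fast (X \<alpha>) (Y \<alpha>) \<phi> \<epsilon>) \<epsilon> (strip U \<epsilon> J) (graph_over {\<kappa>..L} (m \<alpha> \<epsilon>))"

definition maximal_canard ::
  "(real \<times> real) set \<Rightarrow> (real \<Rightarrow> vfield) \<Rightarrow> (real \<Rightarrow> vfield) \<Rightarrow> (real \<Rightarrow> real) \<Rightarrow> real \<Rightarrow> real \<Rightarrow>
   (real \<Rightarrow> real \<Rightarrow> real \<Rightarrow> real) \<Rightarrow> (real \<Rightarrow> real \<Rightarrow> real \<Rightarrow> real) \<Rightarrow> real \<Rightarrow> real \<Rightarrow> bool" where
  "maximal_canard U X Y \<phi> L \<kappa> ms mu \<alpha> \<epsilon> \<longleftrightarrow>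
     ext_stable U X Y \<phi> L \<kappa> ms {-L..L} \<alpha> \<epsilon> = ext_unstable U X Y \<phi> L \<kappa> mu {-L..L} \<alpha> \<epsilon>"

abbreviation section_0 :: "(real \<times> real) set" where
  "section_0 \<equiv> {p. fst p = 0}"


section \<open>The coefficients\<close>

definition M0 :: "vfield \<Rightarrow> vfield \<Rightarrow> (real \<Rightarrow> real) \<Rightarrow> real" where
  "M0 X Y \<phi> = c1 X 0 + c1 Y 0 + \<phi> (v_bar X Y \<phi>) * (c1 X 0 - c1 Y 0)"

definition M1 :: "vfield \<Rightarrow> vfield \<Rightarrow> (real \<Rightarrow> real) \<Rightarrow> real" where
  "M1 X Y \<phi> = v_bar X Y \<phi> *
     (dy (c2 X) 0 + dy (c2 Y) 0 + \<phi> (v_bar X Y \<phi>) * (dy (c2 X) 0 - dy (c2 Y) 0))"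

definition M2 :: "vfield \<Rightarrow> vfield \<Rightarrow> vfield \<Rightarrow> vfield \<Rightarrow> (real \<Rightarrow> real) \<Rightarrow> real" where
  "M2 X Y X' Y' \<phi> = c2 X' 0 + c2 Y' 0 + \<phi> (v_bar X Y \<phi>) * (c2 X' 0 - c2 Y' 0)"

definition M3 :: "vfield \<Rightarrow> vfield \<Rightarrow> (real \<Rightarrow> real) \<Rightarrow> real" where
  "M3 X Y \<phi> = (1/2) * (dx (dx (c2 X)) 0 + dx (dx (c2 Y)) 0
     + \<phi> (v_bar X Y \<phi>) * (dx (dx (c2 X)) 0 - dx (dx (c2 Y)) 0))"

definition M4 :: "vfield \<Rightarrow> vfield \<Rightarrow> (real \<Rightarrow> real) \<Rightarrow> real" where
  "M4 X Y \<phi> = deriv \<phi> (v_bar X Y \<phi>) * (dx (c2 X) 0 - dx (c2 Y) 0)"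

definition delta_C :: "vfield \<Rightarrow> vfield \<Rightarrow> vfield \<Rightarrow> vfield \<Rightarrow> (real \<Rightarrow> real) \<Rightarrow> real" where
  "delta_C X Y X' Y' \<phi> =
     - (M0 X Y \<phi> * M3 X Y \<phi> + M1 X Y \<phi> * M4 X Y \<phi>) / (M2 X Y X' Y' \<phi> * M4 X Y \<phi>)"

end

theory Submission
  imports Defs
begin

text \<open>With \<open>y = \<epsilon> v\<close>, the critical manifold is the level set \<open>\<phi>(v) = \<psi>(x)\<close> with
  \<open>\<psi> = - (X\<^sup>2 + Y\<^sup>2) / (X\<^sup>2 - Y\<^sup>2)\<close> on \<open>y = 0\<close>, which extends smoothly over the fold. Along a trajectory
  the deviation \<open>\<zeta> = \<phi>(v) - \<psi>(x)\<close> satisfies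
  \<open>d\<zeta>/dx = g x \<zeta> / \<epsilon> + (c\<^sub>0 (\<alpha> / \<epsilon> - \<delta>\<^sub>C) + O(\<bar>x\<bar> + \<bar>\<zeta>\<bar> + \<epsilon>)) / F\<^sup>1\<close>
  with \<open>g\<close> and \<open>F\<^sup>1\<close> bounded between positive constants, so that x < 0 attracts. Explicit barriers carry an
  initial deviation \<open>O(\<epsilon>)\<close> at \<open>x = -L\<close> to \<open>O(sqrt \<epsilon>)\<close> at \<open>x = 0\<close>, improve this to \<open>O(\<epsilon>)\<close> when
  \<open>\<alpha> - \<delta>\<^sub>C \<epsilon> = O(\<epsilon> sqrt \<epsilon>)\<close>, and give \<open>\<zeta>(0)\<close> the sign of \<open>c\<^sub>0 (\<alpha> - \<delta>\<^sub>C \<epsilon>)\<close> once this is at least a large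
  multiple of \<open>\<epsilon> sqrt \<epsilon>\<close>. The reflection \<open>x \<mapsto> -x\<close> with time reversal turns the unstable manifold
  into a stable one with \<open>c\<^sub>0\<close> negated, so the distance of the two manifolds on \<open>x = 0\<close> changes sign
  within \<open>O(\<epsilon> sqrt \<epsilon>)\<close> of \<open>\<alpha> = \<delta>\<^sub>C \<epsilon>\<close>; the intermediate value theorem yields the canard.\<close>

section \<open>Scalar differential equations and inequalities\<close>

text \<open>Normal hyperbolicity is lost at x = 0; scalar comparison up to the fold takes the place
  of Fenichel theory there. Measuring the deviation by \<open>\<phi>(v) - \<psi>(x)\<close> instead
  of \<open>v - m_0 x\<close> makes the attraction exactly linear: at
  \<open>\<alpha> = \<epsilon> = 0\<close> the second component is
  \<open>p + \<phi> q = q (\<phi> - \<psi>)\<close>, and \<open>q\<close> has a simple zero at the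
  fold. The next order of \<open>\<phi>' F2 - \<epsilon> F1 \<psi>'\<close> at the fold is
  \<open>\<phi>'(v_bar) (\<alpha> M2 + \<epsilon> M1) - \<epsilon> M0 \<psi>'(0)\<close>; its zero
  is \<open>\<alpha> = \<delta>\<^sub>C \<epsilon>\<close>, and
  \<open>c\<^sub>0 = \<phi>'(v_bar) M2\<close> is nonzero by versality. The factor
  \<open>x / \<epsilon>\<close> sets the width \<open>sqrt \<epsilon>\<close>: over it a bounded
  drive builds up a deviation of order \<open>sqrt \<epsilon>\<close>, and a drive of order
  \<open>sqrt \<epsilon>\<close>, the size of the remainder there, builds up order
  \<open>\<epsilon>\<close>. So \<open>\<alpha> / \<epsilon> - \<delta>\<^sub>C\<close> fixes the
  sign only when it exceeds a multiple of \<open>sqrt \<epsilon>\<close>. A zero found by the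
  intermediate value theorem need not be unique; \<open>\<alpha>C \<epsilon>\<close> is chosen for
  each \<open>\<epsilon>\<close> separately.\<close>

lemma continuous_on_integral_upper_limit:
  fixes g :: "'p::topological_space \<Rightarrow> real \<Rightarrow> real"
  assumes g: "continuous_on (S \<times> {p..q}) (\<lambda>(a, s). g a s)"
  shows "continuous_on (S \<times> {p..q}) (\<lambda>(a, x). integral {p..x} (g a))"
proof -
  \<comment> \<open>The substitution \<open>s = p + t * (x - p)\<close> moves the variable upper
    limit into the integrand, so that continuity of a parametric integral over a fixed interval
    applies.\<close>
  have "continuous_on ((S \<times> {p..q}) \<times> cbox 0 (1::real))
      (\<lambda>(ax, t). (snd ax - p) * g (fst ax) (p + t * (snd ax - p)))"
  proof -
    have "p + t * (x - p) \<le> q" if "x \<le> q" "p \<le> x" "0 \<le> t" "t \<le> 1" for x t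
      using mult_left_le_one_le[of "x - p" t] that by auto
    then have "continuous_on ((S \<times> {p..q}) \<times> cbox 0 (1::real))
        (\<lambda>z. (\<lambda>(a, s). g a s) (fst (fst z), p + snd z * (snd (fst z) - p)))"
      by (intro continuous_on_compose2[OF g] continuous_intros) (auto simp: mult_nonneg_nonneg)
    then show ?thesis
      by (auto simp: case_prod_unfold intro!: continuous_intros)
  qed
  then have cont: "continuous_on (S \<times> {p..q})
      (\<lambda>ax. integral (cbox 0 1) (\<lambda>t. (snd ax - p) * g (fst ax) (p + t * (snd ax - p))))"
    by (rule integral_continuous_on_param)
  have "integral (cbox 0 1) (\<lambda>t. (x - p) * g a (p + t * (x - p))) = integral {p..x} (g a)"
    if a: "a \<in> S" and x: "x \<in> {p..q}" for a x
  proof -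
    define G where "G = (\<lambda>y. integral {p..y} (g a))"
    have "continuous_on {p..x} (\<lambda>s. (\<lambda>(a, s). g a s) (a, s))"
      using a x by (intro continuous_on_compose2[OF g] continuous_intros) auto
    then have G': "(G has_real_derivative g a y) (at y within {p..x})" if "y \<in> {p..x}" for y
      unfolding G_def using that by (intro integral_has_real_derivative) auto
    have im: "(\<lambda>t. p + t * (x - p)) ` {0..1} \<subseteq> {p..x}"
    proof -
      have "p + t * (x - p) \<le> x" if "0 \<le> t" "t \<le> 1" for t
        using mult_right_mono[of t 1 "x - p"] that x by auto
      then show ?thesis using x by (auto simp: mult_nonneg_nonneg)
    qed
    have "((\<lambda>t. G (p + t * (x - p))) has_real_derivative (x - p) * g a (p + t * (x - p)))
        (at t within {0..1})" if t: "t \<in> {0..1}" for t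
    proof -
      have 1: "((\<lambda>t. p + t * (x - p)) has_real_derivative x - p) (at t within {0..1})"
        by (auto intro!: derivative_eq_intros)
      have 2: "(G has_real_derivative g a (p + t * (x - p)))
          (at (p + t * (x - p)) within (\<lambda>t. p + t * (x - p)) ` {0..1})"
        by (rule has_field_derivative_subset[OF G' im]) (use im t in blast)
      show ?thesis
        using DERIV_image_chain[OF 2 1] unfolding o_def by (rule DERIV_cong) (rule mult.commute)
    qed
    then have "((\<lambda>t. (x - p) * g a (p + t * (x - p))) has_integral
        (G (p + 1 * (x - p)) - G (p + 0 * (x - p)))) {0..1}"
      by (intro fundamental_theorem_of_calculus)
        (simp_all add: has_real_derivative_iff_has_vector_derivative)
    moreover have "G (p + 1 * (x - p)) - G (p + 0 * (x - p)) = integral {p..x} (g a)"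
      by (simp add: G_def)
    ultimately show ?thesis
      by (simp only: cbox_interval integral_unique)
  qed
  then show ?thesis
    using cont by (subst continuous_on_cong[OF refl]) (auto simp: case_prod_unfold)
qed

text \<open>Joint continuity comes with the solution itself: every Picard iterate is jointly
  continuous in parameter and argument, and the iterates converge uniformly on the whole product.
  This is what later makes the value of a branch at x = 0 continuous in \<alpha>. The global bounds
  are met in the application by clamping v to a box.\<close>

lemma picard_lindelof_parametric:
  fixes f :: "'p::topological_space \<Rightarrow> real \<Rightarrow> real \<Rightarrow> real"
  assumes pq: "p \<le> q"
    and f: "continuous_on (S \<times> {p..q} \<times> UNIV) (\<lambda>(a, x, v). f a x v)"
    and w0: "continuous_on S w0"
    and Lip: "\<And>a x u v. a \<in> S \<Longrightarrow> x \<in> {p..q} \<Longrightarrow> \<bar>f a x u - f a x v\<bar> \<le> K * \<bar>u - v\<bar>"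
    and B: "\<And>a x v. a \<in> S \<Longrightarrow> x \<in> {p..q} \<Longrightarrow> \<bar>f a x v\<bar> \<le> B"
  obtains w where "continuous_on (S \<times> {p..q}) (\<lambda>(a, x). w a x)"
    "\<And>a. a \<in> S \<Longrightarrow> w a p = w0 a"
    "\<And>a x. a \<in> S \<Longrightarrow> x \<in> {p..q} \<Longrightarrow>
       (w a has_real_derivative f a x (w a x)) (at x within {p..q})"
proof -
  \<comment> \<open>\<open>K\<close> may be 0 or negative; \<open>H\<close> is at least 1, so the
    rate \<open>2 * H\<close> of the weight can be divided by.\<close>
  define H where "H = max K 1"
  have H: "H \<ge> 1" "K \<le> H" by (auto simp: H_def)
  define T where "T = (\<lambda>u a x. w0 a + integral {p..x} (\<lambda>s. f a s (u a s)))"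
  define W where "W = (\<lambda>n. (T ^^ n) (\<lambda>a x. w0 a))"
  have W0: "W 0 = (\<lambda>a x. w0 a)" and WS: "W (Suc n) = T (W n)" for n
    by (simp_all add: W_def)
  have cf: "continuous_on (S \<times> {p..q}) (\<lambda>(a, s). f a s (u a s))"
    if "continuous_on (S \<times> {p..q}) (\<lambda>(a, x). u a x)" for u
  proof -
    have "continuous_on (S \<times> {p..q})
        (\<lambda>z. (\<lambda>(a, x, v). f a x v) (fst z, snd z, (\<lambda>(a, x). u a x) z))"
      by (intro continuous_on_compose2[OF f] continuous_intros that) auto
    then show ?thesis by (simp add: case_prod_unfold)
  qed
  have cT: "continuous_on (S \<times> {p..q}) (\<lambda>(a, x). T u a x)"
    if "continuous_on (S \<times> {p..q}) (\<lambda>(a, x). u a x)" for u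
    using continuous_on_integral_upper_limit[OF cf[OF that]] w0
    unfolding T_def case_prod_unfold
    by (intro continuous_intros continuous_on_compose2[OF w0]) auto
  have cW: "continuous_on (S \<times> {p..q}) (\<lambda>(a, x). W n a x)" for n
  proof (induction n)
    case 0
    show ?case unfolding W0 case_prod_unfold
      by (intro continuous_intros continuous_on_compose2[OF w0]) auto
  next
    case (Suc n)
    then show ?case unfolding WS by (rule cT)
  qed
  have int: "(\<lambda>s. f a s (u a s)) integrable_on {p..x}"
    if "continuous_on (S \<times> {p..q}) (\<lambda>(a, x). u a x)" "a \<in> S" "x \<in> {p..q}" for u a x
  proof -
    have "continuous_on {p..x} (\<lambda>s. (\<lambda>(a, s). f a s (u a s)) (a, s))"
      using that by (intro continuous_on_compose2[OF cf[OF that(1)]] continuous_intros) auto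
    then show ?thesis by (auto intro: integrable_continuous_real)
  qed
  define E where "E = (\<lambda>x. exp (2 * H * (x - p)))"
  have intE: "(E has_integral (E x - 1) / (2 * H)) {p..x}" if "p \<le> x" for x
  proof -
    have "(E has_integral (E x / (2 * H) - E p / (2 * H))) {p..x}"
      using H that unfolding E_def
      by (intro fundamental_theorem_of_calculus)
        (auto intro!: derivative_eq_intros simp flip: has_real_derivative_iff_has_vector_derivative)
    then show ?thesis by (simp add: E_def diff_divide_distrib)
  qed
  \<comment> \<open>The weight \<open>exp (2 H (x - p))\<close> makes the integral operator a contraction by the factor 1/2.\<close>
  have contr: "\<bar>T u a x - T v a x\<bar> \<le> M / 2 * E x"
    if u: "continuous_on (S \<times> {p..q}) (\<lambda>(a, x). u a x)"
      and v: "continuous_on (S \<times> {p..q}) (\<lambda>(a, x). v a x)"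
      and a: "a \<in> S" and x: "x \<in> {p..q}" and M: "0 \<le> M"
      and uv: "\<And>s. s \<in> {p..q} \<Longrightarrow> \<bar>u a s - v a s\<bar> \<le> M * E s" for u v a x M
  proof -
    have "T u a x - T v a x = integral {p..x} (\<lambda>s. f a s (u a s) - f a s (v a s))"
      by (simp add: T_def integral_diff[OF int[OF u a x] int[OF v a x]])
    also have "norm \<dots> \<le> integral {p..x} (\<lambda>s. H * M * E s)"
    proof (intro integral_norm_bound_integral integrable_diff int u v a x)
      show "(\<lambda>s. H * M * E s) integrable_on {p..x}"
        using intE[of x] x by (intro integrable_on_mult_right) (auto simp: integrable_on_def)
    next
      fix s assume s: "s \<in> {p..x}"
      have "\<bar>f a s (u a s) - f a s (v a s)\<bar> \<le> K * \<bar>u a s - v a s\<bar>"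
        using s x a by (intro Lip) auto
      also have "\<dots> \<le> H * \<bar>u a s - v a s\<bar>" using H by (intro mult_right_mono) auto
      also have "\<dots> \<le> H * (M * E s)" using H s x uv by (intro mult_left_mono) auto
      finally show "norm (f a s (u a s) - f a s (v a s)) \<le> H * M * E s" by (simp add: mult.assoc)
    qed
    also have "\<dots> = H * M * ((E x - 1) / (2 * H))"
      using intE[of x] x by (auto simp: integral_unique)
    also have "\<dots> \<le> M / 2 * E x" using H M by (simp add: field_simps)
    finally show ?thesis by simp
  qed
  \<comment> \<open>\<open>B\<close> bounds the first increment of the iteration; by
    \<open>contr\<close> each later increment has at most half the weighted bound of the one
    before.\<close>
  have T0: "\<bar>W 1 a x - W 0 a x\<bar> \<le> \<bar>B\<bar> * (q - p)" if a: "a \<in> S" and x: "x \<in> {p..q}" for a x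
  proof -
    have "norm (integral {p..x} (\<lambda>s. f a s (w0 a))) \<le> integral {p..x} (\<lambda>s. \<bar>B\<bar>)"
      using int[OF cW[of 0] a x] a x B
      by (intro integral_norm_bound_integral) (auto simp: W0 intro: order_trans[OF _ abs_ge_self])
    also have "\<dots> = \<bar>B\<bar> * (x - p)" using x by simp
    also have "\<dots> \<le> \<bar>B\<bar> * (q - p)" using x by (intro mult_left_mono) auto
    finally show ?thesis using WS[of 0] by (simp add: W0 T_def)
  qed
  define M where "M = (\<lambda>n::nat. \<bar>B\<bar> * (q - p) * (1 / 2) ^ n)"
  have step: "\<bar>W (Suc n) a x - W n a x\<bar> \<le> M n * E x" if "a \<in> S" "x \<in> {p..q}" for n a x
    using that
  proof (induction n arbitrary: a x)
    case 0
    have "\<bar>B\<bar> * (q - p) * 1 \<le> \<bar>B\<bar> * (q - p) * E x"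
      using 0 H by (intro mult_left_mono) (auto simp: E_def)
    with T0[OF 0] show ?case by (simp add: M_def)
  next
    case (Suc n)
    have "\<bar>T (W (Suc n)) a x - T (W n) a x\<bar> \<le> M n / 2 * E x"
      using Suc by (intro contr cW Suc.IH) (auto simp: M_def)
    then show ?case by (simp add: WS M_def)
  qed
  define D where "D = (\<lambda>i (z::'p \<times> real). W (Suc i) (fst z) (snd z) - W i (fst z) (snd z))"
  have "uniform_limit (S \<times> {p..q}) (\<lambda>n z. \<Sum>i<n. D i z) (\<lambda>z. suminf (\<lambda>i. D i z)) sequentially"
  proof (rule Weierstrass_m_test[where M="\<lambda>n. M n * E q"])
    fix n and z :: "'p \<times> real" assume z: "z \<in> S \<times> {p..q}"
    have "norm (D n z) \<le> M n * E (snd z)" unfolding D_def using z step by auto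
    also have "\<dots> \<le> M n * E q"
      using z H by (intro mult_left_mono) (auto simp: E_def M_def)
    finally show "norm (D n z) \<le> M n * E q" .
  next
    show "summable (\<lambda>n. M n * E q)"
      unfolding M_def by (intro summable_mult summable_mult2 summable_geometric) auto
  qed
  then have ul0: "uniform_limit (S \<times> {p..q}) (\<lambda>n z. W n (fst z) (snd z) - W 0 (fst z) (snd z))
      (\<lambda>z. suminf (\<lambda>i. D i z)) sequentially"
    by (simp add: D_def sum_lessThan_telescope[where f="\<lambda>i. W i (fst z) (snd z)" for z])
  define w where "w = (\<lambda>a x. w0 a + suminf (\<lambda>i. D i (a, x)))"
  have ul: "uniform_limit (S \<times> {p..q}) (\<lambda>n (a, x). W n a x) (\<lambda>(a, x). w a x) sequentially"
    using ul0 by (simp add: uniform_limit_iff dist_real_def w_def W0 case_prod_unfold algebra_simps)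
  have cw: "continuous_on (S \<times> {p..q}) (\<lambda>(a, x). w a x)"
    by (rule uniform_limit_theorem[OF _ ul]) (auto intro: always_eventually cW)
  \<comment> \<open>The limit is taken in \<open>W (Suc n) = T (W n)\<close>. On the right side
    \<open>contr\<close> turns uniform closeness \<open>r / E x\<close> of the iterates into
    closeness below \<open>r\<close> at x.\<close>
  have fixpoint: "w a x = T w a x" if a: "a \<in> S" and x: "x \<in> {p..q}" for a x
  proof -
    have "(\<lambda>n. T (W n) a x) \<longlonglongrightarrow> T w a x"
    proof (rule LIMSEQ_I)
      fix r :: real assume r: "r > 0"
      have "E x > 0" by (simp add: E_def)
      with r have "r / E x > 0" by simp
      then have "\<forall>\<^sub>F n in sequentially. \<forall>z\<in>S \<times> {p..q}.
          dist ((\<lambda>(a, x). W n a x) z) ((\<lambda>(a, x). w a x) z) < r / E x"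
        using ul by (simp only: uniform_limit_iff)
      then obtain N where N: "\<And>n s. n \<ge> N \<Longrightarrow> s \<in> {p..q} \<Longrightarrow> \<bar>W n a s - w a s\<bar> < r / E x"
        using a unfolding eventually_sequentially by (force simp: dist_real_def)
      have "\<bar>T (W n) a x - T w a x\<bar> < r" if "n \<ge> N" for n
      proof -
        have "\<bar>T (W n) a x - T w a x\<bar> \<le> (r / E x) / 2 * E x"
        proof (rule contr[OF cW cw a x])
          fix s assume s: "s \<in> {p..q}"
          have "r / E x * 1 \<le> r / E x * E s"
            using s H \<open>r / E x > 0\<close> by (intro mult_left_mono) (auto simp: E_def)
          with N[OF that s] show "\<bar>W n a s - w a s\<bar> \<le> r / E x * E s" by simp
        qed (use \<open>r / E x > 0\<close> in auto)
        then show ?thesis using r \<open>E x > 0\<close> by simp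
      qed
      then show "\<exists>no. \<forall>n\<ge>no. norm (T (W n) a x - T w a x) < r" by auto
    qed
    moreover have "(\<lambda>n. W (Suc n) a x) \<longlonglongrightarrow> w a x"
      using tendsto_uniform_limitI[OF ul, of "(a, x)"] a x by (auto intro: LIMSEQ_Suc)
    ultimately show ?thesis using LIMSEQ_unique by (auto simp: WS)
  qed
  show thesis
  proof (rule that[OF cw])
    fix a assume a: "a \<in> S"
    show "w a p = w0 a"
      using fixpoint[OF a, of p] pq by (simp add: T_def)
    fix x assume x: "x \<in> {p..q}"
    have "continuous_on {p..q} (\<lambda>s. (\<lambda>(a, s). f a s (w a s)) (a, s))"
      using a by (intro continuous_on_compose2[OF cf[OF cw]] continuous_intros) auto
    then have "((\<lambda>x. integral {p..x} (\<lambda>s. f a s (w a s))) has_real_derivative f a x (w a x))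
        (at x within {p..q})"
      using x by (intro integral_has_real_derivative) auto
    then have "(T w a has_real_derivative f a x (w a x)) (at x within {p..q})"
      unfolding T_def by (auto intro!: derivative_eq_intros)
    then show "(w a has_real_derivative f a x (w a x)) (at x within {p..q})"
      unfolding has_field_derivative_def
      by (rule has_derivative_transform[OF x, rotated]) (use fixpoint[OF a] in auto)
  qed
qed

section \<open>Continuation and comparison for scalar functions\<close>

text \<open>At the first point with \<open>h \<ge> 0\<close>, the infimum of a closed set,
  continuity from the left gives \<open>h \<le> 0\<close> up to and including that point, so
  \<open>step\<close> applies there and contradicts the choice. It serves estimates that hold only
  inside a box and, where they hold, keep the curve strictly inside it.\<close>

lemma continuation_induct:
  fixes h :: "real \<Rightarrow> real"
  assumes h: "continuous_on {a..b} h" and ha: "h a \<le> 0"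
    and step: "\<And>x. x \<in> {a..b} \<Longrightarrow> \<forall>y\<in>{a..x}. h y \<le> 0 \<Longrightarrow> h x < 0"
    and x: "x \<in> {a..b}"
  shows "h x < 0"
proof (rule ccontr)
  assume "\<not> h x < 0"
  define Z where "Z = {y \<in> {a..b}. 0 \<le> h y}"
  have Z: "x \<in> Z" using x \<open>\<not> h x < 0\<close> by (auto simp: Z_def)
  have "closed Z"
    unfolding Z_def using continuous_on_closed_Collect_le[OF continuous_on_const h, of 0] by simp
  moreover have bdd: "bdd_below Z" unfolding Z_def by (auto intro!: bdd_belowI[of _ a])
  ultimately have I: "Inf Z \<in> Z" using Z closed_contains_Inf by blast
  have neg: "h y < 0" if "y \<in> {a..<Inf Z}" for y
    using cInf_lower[OF _ bdd, of y] that I by (force simp: Z_def)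
  have ge: "h (Inf Z) \<ge> 0" and ab: "Inf Z \<in> {a..b}" using I by (auto simp: Z_def)
  have "h (Inf Z) \<le> 0"
  proof (cases "Inf Z = a")
    case False
    have "(h \<longlongrightarrow> h (Inf Z)) (at (Inf Z) within {a..b})"
      using h ab unfolding continuous_on_def by blast
    then have lim: "(h \<longlongrightarrow> h (Inf Z)) (at (Inf Z) within {a..<Inf Z})"
      by (rule tendsto_within_subset) (use ab in auto)
    have "at (Inf Z) within {a..<Inf Z} \<noteq> bot"
      using False ab by (simp add: at_within_eq_bot_iff)
    moreover have "\<forall>\<^sub>F y in at (Inf Z) within {a..<Inf Z}. h y \<le> 0"
      unfolding eventually_at_filter
      by (rule always_eventually) (use neg in \<open>auto intro: less_imp_le\<close>)
    ultimately show ?thesis using tendsto_upperbound[OF lim] by blast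
  qed (use ha in simp)
  then have "\<forall>y\<in>{a..Inf Z}. h y \<le> 0"
    using neg by (metis atLeastAtMost_iff atLeastLessThan_iff less_eq_real_def)
  from step[OF ab this] ge show False by simp
qed

text \<open>At a first zero the derivative is negative, so h would be positive just before it. The
  derivative condition is required only in the open interval, so a zero at b itself remains
  possible; hence the weak inequality.\<close>

lemma barrier:
  fixes h :: "real \<Rightarrow> real"
  assumes h: "continuous_on {a..b} h" and ha: "h a < 0"
    and h': "\<And>x. a < x \<Longrightarrow> x < b \<Longrightarrow> h x = 0 \<Longrightarrow> \<exists>D<0. (h has_real_derivative D) (at x)"
    and x: "x \<in> {a..b}"
  shows "h x \<le> 0"
proof (rule ccontr)
  assume nx: "\<not> h x \<le> 0"
  have "h y < 0" if "y \<in> {a..x}" for y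
  proof (rule continuation_induct[of a x h y])
    show "continuous_on {a..x} h" using h x by (auto intro: continuous_on_subset)
    show "h a \<le> 0" using ha by simp
    fix z assume z: "z \<in> {a..x}" and le: "\<forall>y\<in>{a..z}. h y \<le> 0"
    show "h z < 0"
    proof (rule ccontr)
      assume "\<not> h z < 0"
      with le z have hz: "h z = 0" by force
      then have az: "a < z" "z < b" using ha nx z x by (auto simp: less_le)
      then obtain D where "D < 0" "(h has_real_derivative D) (at z)" using h' hz by blast
      then obtain d where d: "d > 0" "\<And>k. k > 0 \<Longrightarrow> k < d \<Longrightarrow> h z < h (z - k)"
        using DERIV_neg_dec_left by blast
      define k where "k = min (d / 2) (z - a)"
      have "0 < k" "k < d" "z - k \<in> {a..z}" using d az by (auto simp: k_def)
      then show False using d(2)[of k] le hz by force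
    qed
  qed (fact that)
  from this[of x] nx x show False by auto
qed

text \<open>The square of d is differentiable where the absolute value is not, and the weight
  \<open>exp (- 2 * K * t)\<close> makes it nonincreasing. This is the uniqueness argument for
  trajectories that start on a graph.\<close>

lemma gronwall_zero:
  fixes d :: "real \<Rightarrow> real"
  assumes d: "\<And>t. t \<in> {a..b} \<Longrightarrow> (d has_real_derivative d' t) (at t within {a..b})"
    and d': "\<And>t. t \<in> {a..b} \<Longrightarrow> \<bar>d' t\<bar> \<le> K * \<bar>d t\<bar>"
    and "d a = 0" and t: "t \<in> {a..b}"
  shows "d t = 0"
proof -
  define e where "e = (\<lambda>t. (d t)\<^sup>2 * exp (- 2 * K * t))"
  have "e a \<ge> e t"
  proof (rule DERIV_nonpos_imp_decreasing_open[of a t e])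
    show "a \<le> t" using t by simp
    have "continuous_on {a..b} d" using d by (rule DERIV_continuous_on)
    then show "continuous_on {a..t} e"
      unfolding e_def using t by (intro continuous_intros) (auto intro: continuous_on_subset)
    fix s assume s: "a < s" "s < t"
    have "(d has_real_derivative d' s) (at s)"
      using d[of s] s t by (simp add: at_within_Icc_at)
    then have "(e has_real_derivative (2 * (d s * d' s - K * (d s)\<^sup>2)) * exp (- 2 * K * s)) (at s)"
      unfolding e_def by (auto intro!: derivative_eq_intros simp: power2_eq_square algebra_simps)
    moreover have "d s * d' s \<le> \<bar>d s\<bar> * \<bar>d' s\<bar>" by (metis abs_ge_self abs_mult)
    moreover have "\<dots> \<le> \<bar>d s\<bar> * (K * \<bar>d s\<bar>)" using s t d' by (intro mult_left_mono) auto
    moreover have "\<bar>d s\<bar> * (K * \<bar>d s\<bar>) = K * (d s)\<^sup>2" by (simp add: power2_eq_square)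
    ultimately show "\<exists>y. (e has_real_derivative y) (at s) \<and> y \<le> 0"
      by (intro exI conjI) (auto intro!: mult_nonpos_nonneg)
  qed
  then have "(d t)\<^sup>2 \<le> 0" using \<open>d a = 0\<close> by (simp add: e_def mult_le_0_iff)
  then show ?thesis by simp
qed

lemma has_field_derivative_within_union:
  assumes "(f has_field_derivative D) (at x within S)" "(f has_field_derivative D) (at x within T)"
  shows "(f has_field_derivative D) (at x within S \<union> T)"
  using assms unfolding has_field_derivative_iff unfolding at_within_union by (rule filterlim_sup)

text \<open>The barriers are \<open>\<epsilon> (P + Q / (sqrt \<epsilon> - x))\<close>: the second term captures the growth of the
  deviation from \<open>O(\<epsilon>)\<close> to \<open>O(sqrt \<epsilon>)\<close> as attraction is lost at \<open>x = 0\<close>.\<close>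

lemma fold_barrier:
  fixes z :: "real \<Rightarrow> real"
  assumes \<epsilon>: "\<epsilon> > 0" and "b \<le> 0" and z: "continuous_on {a..b} z"
    and z': "\<And>x. a < x \<Longrightarrow> x < b \<Longrightarrow> (z has_real_derivative g x * x * z x / \<epsilon> + \<rho> x) (at x)"
    and za: "z a < \<epsilon> * (P + Q / (sqrt \<epsilon> - a))"
    and \<rho>: "\<And>x. a < x \<Longrightarrow> x < b \<Longrightarrow>
      \<rho> x < \<epsilon> * Q / (sqrt \<epsilon> - x)\<^sup>2 - g x * x * (P + Q / (sqrt \<epsilon> - x))"
    and x: "x \<in> {a..b}"
  shows "z x \<le> \<epsilon> * (P + Q / (sqrt \<epsilon> - x))"
proof -
  have pos: "sqrt \<epsilon> - x > 0" if "x \<le> b" for x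
    using that \<epsilon> \<open>b \<le> 0\<close> by (smt (verit) real_sqrt_gt_zero)
  define h where "h = (\<lambda>x. z x - \<epsilon> * (P + Q / (sqrt \<epsilon> - x)))"
  have "h x \<le> 0"
  proof (rule barrier[of a b h x])
    show "continuous_on {a..b} h"
      unfolding h_def using pos by (intro continuous_intros z) force
    show "h a < 0" using za by (simp add: h_def)
    fix x assume x: "a < x" "x < b" and 0: "h x = 0"
    have "((\<lambda>x. \<epsilon> * (P + Q / (sqrt \<epsilon> - x))) has_real_derivative \<epsilon> * Q / (sqrt \<epsilon> - x)\<^sup>2) (at x)"
      using pos[of x] x by (auto intro!: derivative_eq_intros simp: power2_eq_square)
    with z'[OF x] have "(h has_real_derivative g x * x * z x / \<epsilon> + \<rho> x - \<epsilon> * Q / (sqrt \<epsilon> - x)\<^sup>2) (at x)"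
      unfolding h_def by (rule DERIV_diff)
    \<comment> \<open>At a point of contact z equals the barrier, so the attraction term
      \<open>g x * x * z x / \<epsilon>\<close> becomes an explicit function of x and cancels the
      \<epsilon> of the barrier.\<close>
    moreover have "z x = \<epsilon> * (P + Q / (sqrt \<epsilon> - x))" using 0 by (simp add: h_def)
    ultimately show "\<exists>D<0. (h has_real_derivative D) (at x)"
      using \<rho>[OF x] \<epsilon> by (intro exI[of _ "g x * x * z x / \<epsilon> + \<rho> x - \<epsilon> * Q / (sqrt \<epsilon> - x)\<^sup>2"]) auto
  qed (fact x)
  then show ?thesis by (simp add: h_def)
qed

text \<open>Two regimes split at \<open>- x = sqrt \<epsilon>\<close>. Close to the fold the growth
  of the barrier alone gives at least 1/4; farther away \<open>- x\<close> is at least half of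
  \<open>sqrt \<epsilon> - x\<close>, and the attraction alone gives at least \<open>g0 / 2\<close>.
  Both terms are nonnegative, so the smaller constant is valid throughout.\<close>

lemma fold_barrier_profile:
  assumes \<epsilon>: "\<epsilon> > 0" and x: "x \<le> 0" and g: "0 < g0" "g0 \<le> g"
  shows "min (1/4) (g0 / 2) \<le> \<epsilon> / (sqrt \<epsilon> - x)\<^sup>2 - g * x / (sqrt \<epsilon> - x)"
proof -
  have s: "sqrt \<epsilon> > 0" "\<epsilon> = (sqrt \<epsilon>)\<^sup>2" using \<epsilon> by auto
  have pos: "sqrt \<epsilon> - x > 0" using s x by linarith
  define e1 e2 where "e1 = \<epsilon> / (sqrt \<epsilon> - x)\<^sup>2" and "e2 = g * (- x) / (sqrt \<epsilon> - x)"
  have nonneg: "e1 \<ge> 0" "e2 \<ge> 0"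
    unfolding e1_def e2_def using \<epsilon> g x pos
    by (intro divide_nonneg_nonneg mult_nonneg_nonneg; simp)+
  have "min (1/4) (g0 / 2) \<le> e1 + e2"
  proof (cases "- x \<le> sqrt \<epsilon>")
    case True
    then have "(sqrt \<epsilon> - x)\<^sup>2 \<le> (2 * sqrt \<epsilon>)\<^sup>2" using pos by (intro power_mono) auto
    also have "\<dots> = 4 * \<epsilon>" using \<epsilon> by (simp add: power_mult_distrib)
    finally have "1 / 4 \<le> e1" using pos by (simp add: e1_def pos_le_divide_eq)
    with nonneg show ?thesis by linarith
  next
    case False
    then have "(sqrt \<epsilon> - x) / 2 \<le> - x" using s by simp
    then have "g0 * ((sqrt \<epsilon> - x) / 2) \<le> g * (- x)" using g pos by (intro mult_mono) auto
    then have "g0 / 2 \<le> e2" using pos unfolding e2_def by (subst pos_le_divide_eq) auto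
    with nonneg show ?thesis by linarith
  qed
  then show ?thesis by (simp add: e1_def e2_def)
qed

text \<open>The barrier with P = 0 and Q = K absorbs any bounded forcing; its value
  \<open>\<epsilon> * K / sqrt \<epsilon>\<close> at the fold is the claimed
  \<open>K * sqrt \<epsilon>\<close>. The same inequality \<open>key\<close> serves z and its
  negative.\<close>

lemma fold_bound_sqrt:
  fixes z :: "real \<Rightarrow> real"
  assumes \<epsilon>: "\<epsilon> > 0" and b: "b \<le> 0" and z: "continuous_on {a..b} z"
    and z': "\<And>x. a < x \<Longrightarrow> x < b \<Longrightarrow> (z has_real_derivative g x * x * z x / \<epsilon> + \<rho> x) (at x)"
    and g: "0 < g0" "\<And>x. a < x \<Longrightarrow> x < b \<Longrightarrow> g0 \<le> g x"
    and \<rho>: "\<And>x. a < x \<Longrightarrow> x < b \<Longrightarrow> \<bar>\<rho> x\<bar> \<le> R"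
    and K: "R < K * min (1/4) (g0 / 2)" "0 \<le> K"
    and za: "\<bar>z a\<bar> < \<epsilon> * (K / (sqrt \<epsilon> - a))"
    and x: "x \<in> {a..b}"
  shows "\<bar>z x\<bar> \<le> K * sqrt \<epsilon>"
proof -
  have key: "R < \<epsilon> * K / (sqrt \<epsilon> - x)\<^sup>2 - g x * x * (0 + K / (sqrt \<epsilon> - x))" if x: "a < x" "x < b" for x
  proof -
    have "R < K * min (1/4) (g0 / 2)" by fact
    also have "\<dots> \<le> K * (\<epsilon> / (sqrt \<epsilon> - x)\<^sup>2 - g x * x / (sqrt \<epsilon> - x))"
      using fold_barrier_profile[OF \<epsilon>, of x g0 "g x"] g x b K by (intro mult_left_mono) auto
    finally show ?thesis by (simp add: algebra_simps)
  qed
  have "z x \<le> \<epsilon> * (0 + K / (sqrt \<epsilon> - x))"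
  proof (rule fold_barrier[OF \<epsilon> b z z' _ _ x])
    show "\<rho> x < \<epsilon> * K / (sqrt \<epsilon> - x)\<^sup>2 - g x * x * (0 + K / (sqrt \<epsilon> - x))" if "a < x" "x < b" for x
      using key[OF that] \<rho>[OF that] by linarith
  qed (use za in auto)
  moreover have "- z x \<le> \<epsilon> * (0 + K / (sqrt \<epsilon> - x))"
  proof (rule fold_barrier[OF \<epsilon> b _ _ _ _ x, where \<rho>="\<lambda>x. - \<rho> x" and g=g])
    show "- \<rho> x < \<epsilon> * K / (sqrt \<epsilon> - x)\<^sup>2 - g x * x * (0 + K / (sqrt \<epsilon> - x))" if "a < x" "x < b" for x
      using key[OF that] \<rho>[OF that] by linarith
    show "((\<lambda>x. - z x) has_real_derivative g x * x * (- z x) / \<epsilon> + - \<rho> x) (at x)"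
      if "a < x" "x < b" for x
      using DERIV_minus[OF z'[OF that]] by simp
  qed (use za in \<open>auto intro: continuous_intros z\<close>)
  moreover have "\<epsilon> * (K / (sqrt \<epsilon> - x)) \<le> \<epsilon> * (K / sqrt \<epsilon>)"
  proof -
    have "0 < sqrt \<epsilon>" "sqrt \<epsilon> \<le> sqrt \<epsilon> - x" using \<epsilon> x b by auto
    then show ?thesis
      using \<epsilon> K by (intro mult_left_mono divide_left_mono mult_pos_pos) linarith+
  qed
  moreover have "\<epsilon> * (K / sqrt \<epsilon>) = K * sqrt \<epsilon>"
    using \<epsilon> by (simp add: field_simps)
  ultimately show ?thesis unfolding add_0_left abs_le_iff by linarith
qed

text \<open>The forcing bound splits into two parts. The part \<open>R * (- x)\<close> is absorbed
  by the constant P through the attraction, which is at least \<open>g0 * (- x) * P\<close>; the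
  part \<open>R * sqrt \<epsilon>\<close> is absorbed by a second term with coefficient
  \<open>Q * sqrt \<epsilon>\<close>. At x = 0 the barrier is then of order \<epsilon>.\<close>

lemma fold_bound_linear:
  fixes z :: "real \<Rightarrow> real"
  assumes \<epsilon>: "\<epsilon> > 0" and a: "a \<le> 0" and z: "continuous_on {a..0} z"
    and z': "\<And>x. a < x \<Longrightarrow> x < 0 \<Longrightarrow> (z has_real_derivative g x * x * z x / \<epsilon> + \<rho> x) (at x)"
    and g: "0 < g0" "\<And>x. a < x \<Longrightarrow> x < 0 \<Longrightarrow> g0 \<le> g x"
    and \<rho>: "\<And>x. a < x \<Longrightarrow> x < 0 \<Longrightarrow> \<bar>\<rho> x\<bar> \<le> R * (sqrt \<epsilon> - x)"
    and P: "R \<le> P * g0" "0 \<le> P" and Q: "R < Q * min (1/4) (g0 / 2)" "0 \<le> Q"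
    and za: "\<bar>z a\<bar> < \<epsilon> * P"
  shows "\<bar>z 0\<bar> \<le> \<epsilon> * (P + Q)"
proof -
  have s: "sqrt \<epsilon> > 0" using \<epsilon> by simp
  have key: "R * (sqrt \<epsilon> - x)
      < \<epsilon> * (Q * sqrt \<epsilon>) / (sqrt \<epsilon> - x)\<^sup>2 - g x * x * (P + Q * sqrt \<epsilon> / (sqrt \<epsilon> - x))"
    if x: "a < x" "x < 0" for x
  proof -
    have "R * sqrt \<epsilon> < (Q * min (1/4) (g0 / 2)) * sqrt \<epsilon>" using s Q by simp
    also have "\<dots> = (Q * sqrt \<epsilon>) * min (1/4) (g0 / 2)" by simp
    also have "\<dots> \<le> (Q * sqrt \<epsilon>) * (\<epsilon> / (sqrt \<epsilon> - x)\<^sup>2 - g x * x / (sqrt \<epsilon> - x))"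
      using fold_barrier_profile[OF \<epsilon>, of x g0 "g x"] g x Q s by (intro mult_left_mono) auto
    finally have 1: "R * sqrt \<epsilon> < (Q * sqrt \<epsilon>) * (\<epsilon> / (sqrt \<epsilon> - x)\<^sup>2 - g x * x / (sqrt \<epsilon> - x))" .
    have "R * (- x) \<le> (P * g0) * (- x)" using P x by (intro mult_right_mono) auto
    also have "\<dots> \<le> (P * g x) * (- x)" using P g x by (intro mult_right_mono mult_left_mono) auto
    finally show ?thesis using 1 by (simp add: algebra_simps)
  qed
  have Qs: "Q * sqrt \<epsilon> / (sqrt \<epsilon> - a) \<ge> 0" using Q s a by (intro divide_nonneg_nonneg mult_nonneg_nonneg) linarith+
  have "\<epsilon> * P \<le> \<epsilon> * (P + Q * sqrt \<epsilon> / (sqrt \<epsilon> - a))" using Qs \<epsilon> by (intro mult_left_mono) auto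
  with za have za': "\<bar>z a\<bar> < \<epsilon> * (P + Q * sqrt \<epsilon> / (sqrt \<epsilon> - a))" by linarith
  have "z 0 \<le> \<epsilon> * (P + Q * sqrt \<epsilon> / (sqrt \<epsilon> - 0))"
  proof (rule fold_barrier[OF \<epsilon> _ z z'])
    show "\<rho> x < \<epsilon> * (Q * sqrt \<epsilon>) / (sqrt \<epsilon> - x)\<^sup>2 - g x * x * (P + Q * sqrt \<epsilon> / (sqrt \<epsilon> - x))"
      if "a < x" "x < 0" for x using key[OF that] \<rho>[OF that] by linarith
  qed (use za' a in auto)
  moreover have "- z 0 \<le> \<epsilon> * (P + Q * sqrt \<epsilon> / (sqrt \<epsilon> - 0))"
  proof (rule fold_barrier[OF \<epsilon>, where \<rho>="\<lambda>x. - \<rho> x" and g=g and a=a and b=0])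
    show "- \<rho> x < \<epsilon> * (Q * sqrt \<epsilon>) / (sqrt \<epsilon> - x)\<^sup>2 - g x * x * (P + Q * sqrt \<epsilon> / (sqrt \<epsilon> - x))"
      if "a < x" "x < 0" for x using key[OF that] \<rho>[OF that] by linarith
    show "((\<lambda>x. - z x) has_real_derivative g x * x * (- z x) / \<epsilon> + - \<rho> x) (at x)"
      if "a < x" "x < 0" for x
      using DERIV_minus[OF z'[OF that]] by simp
  qed (use za' a in \<open>auto intro: continuous_intros z\<close>)
  ultimately show ?thesis using s by simp
qed

text \<open>The barrier for the negative of z has a negative second coefficient
  \<open>- Q * sqrt \<epsilon>\<close>: a forcing of at least \<open>S * sqrt \<epsilon>\<close>
  near the fold lifts z by \<epsilon> times Q, minus the loss P. Because of this sign the profile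
  has to be bounded from above, by \<open>1 + g1\<close>, which is why an upper bound for g enters
  here.\<close>

lemma fold_lower_bound:
  fixes z :: "real \<Rightarrow> real"
  assumes \<epsilon>: "\<epsilon> > 0" and a: "a \<le> 0" and z: "continuous_on {a..0} z"
    and z': "\<And>x. a < x \<Longrightarrow> x < 0 \<Longrightarrow> (z has_real_derivative g x * x * z x / \<epsilon> + \<rho> x) (at x)"
    and g: "0 < g0" "\<And>x. a < x \<Longrightarrow> x < 0 \<Longrightarrow> g0 \<le> g x \<and> g x \<le> g1"
    and \<rho>: "\<And>x. a < x \<Longrightarrow> x < 0 \<Longrightarrow> S * sqrt \<epsilon> + R * x \<le> \<rho> x"
    and P: "R \<le> P * g0" "0 \<le> P" and Q: "Q * (1 + g1) < S" "0 \<le> Q"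
    and za: "- z a < \<epsilon> * (P - Q * sqrt \<epsilon> / (sqrt \<epsilon> - a))"
  shows "\<epsilon> * (Q - P) \<le> z 0"
proof -
  have s: "sqrt \<epsilon> > 0" using \<epsilon> by simp
  have "- z 0 \<le> \<epsilon> * (P + (- Q * sqrt \<epsilon>) / (sqrt \<epsilon> - 0))"
  proof (rule fold_barrier[OF \<epsilon>, where \<rho>="\<lambda>x. - \<rho> x" and g=g and a=a and b=0])
    show "- \<rho> x < \<epsilon> * (- Q * sqrt \<epsilon>) / (sqrt \<epsilon> - x)\<^sup>2 - g x * x * (P + (- Q * sqrt \<epsilon>) / (sqrt \<epsilon> - x))"
      if x: "a < x" "x < 0" for x
    proof -
      have p: "sqrt \<epsilon> - x > 0" using s x by linarith
      have "R * (- x) \<le> (P * g0) * (- x)" using P x by (intro mult_right_mono) auto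
      also have "\<dots> \<le> (P * g x) * (- x)" using P g x by (intro mult_right_mono mult_left_mono) auto
      finally have 1: "R * (- x) \<le> - g x * x * P" by (simp add: algebra_simps)
      have "\<epsilon> / (sqrt \<epsilon> - x)\<^sup>2 \<le> 1"
      proof -
        have "(sqrt \<epsilon>)\<^sup>2 \<le> (sqrt \<epsilon> - x)\<^sup>2" using s x by (intro power_mono) auto
        then show ?thesis using \<epsilon> p by (simp add: field_simps)
      qed
      moreover have "- (g x * x / (sqrt \<epsilon> - x)) \<le> g1"
      proof -
        have "- x / (sqrt \<epsilon> - x) \<le> 1" using p s by (subst pos_divide_le_eq) auto
        moreover have "0 \<le> - x / (sqrt \<epsilon> - x)" using p x by (intro divide_nonneg_pos) auto
        ultimately have "g x * (- x / (sqrt \<epsilon> - x)) \<le> g1 * 1"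
          using g(1) g(2)[OF x] by (intro mult_mono) auto
        then show ?thesis by (simp only: mult_minus_right times_divide_eq_right divide_minus_left mult_1_right)
      qed
      ultimately have "\<epsilon> / (sqrt \<epsilon> - x)\<^sup>2 - g x * x / (sqrt \<epsilon> - x) \<le> 1 + g1" by linarith
      then have "(Q * sqrt \<epsilon>) * (\<epsilon> / (sqrt \<epsilon> - x)\<^sup>2 - g x * x / (sqrt \<epsilon> - x)) \<le> (Q * sqrt \<epsilon>) * (1 + g1)"
        using Q s by (intro mult_left_mono) auto
      also have "\<dots> = (Q * (1 + g1)) * sqrt \<epsilon>" by simp
      also have "\<dots> < S * sqrt \<epsilon>" using Q s by (intro mult_strict_right_mono) auto
      finally show ?thesis using \<rho>[OF x] 1 by (simp add: algebra_simps)
    qed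
    show "((\<lambda>x. - z x) has_real_derivative g x * x * (- z x) / \<epsilon> + - \<rho> x) (at x)"
      if "a < x" "x < 0" for x
      using DERIV_minus[OF z'[OF that]] by simp
  qed (use za a in \<open>auto intro: continuous_intros z\<close>)
  then show ?thesis using s by (simp add: algebra_simps)
qed

section \<open>Trajectories along graphs\<close>

text \<open>The slope dv/dx of the orbits after time has been eliminated; this is meaningful where
  the first component is nonzero.\<close>

definition slope :: "vfield \<Rightarrow> real \<Rightarrow> real \<Rightarrow> real \<Rightarrow> real" where
  "slope F \<epsilon> x v = c2 F (x, v) / (\<epsilon> * c1 F (x, v))"

text \<open>Separation of variables: \<open>\<tau>\<close> is the travel time, an integral of 1/r,
  and the solution is its inverse function.\<close>

lemma autonomous_reparametrization:
  fixes r :: "real \<Rightarrow> real"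
  assumes "p \<le> q" and r: "continuous_on {p..q} r" and pos: "\<And>x. x \<in> {p..q} \<Longrightarrow> r x > 0"
  obtains b \<xi> where "0 \<le> b" "\<xi> 0 = p" "\<xi> b = q" "\<xi> ` {0..b} = {p..q}"
    "\<And>t. t \<in> {0..b} \<Longrightarrow> (\<xi> has_real_derivative r (\<xi> t)) (at t)"
proof -
  \<comment> \<open>Clamping continues r as a constant beyond both ends. The travel time is then
    defined on a larger open interval, and its inverse has two-sided derivatives also at the times
    that belong to p and q.\<close>
  define c where "c = (\<lambda>x. max p (min q x))"
  have c: "c x \<in> {p..q}" "continuous_on UNIV c" "x \<in> {p..q} \<Longrightarrow> c x = x" for x
    using \<open>p \<le> q\<close> by (auto simp: c_def intro!: continuous_intros)
  define R where "R = (\<lambda>x. 1 / r (c x))"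
  have "continuous_on UNIV (\<lambda>x. r (c x))"
    using c by (intro continuous_on_compose2[OF r c(2)]) auto
  then have cR: "continuous_on UNIV R"
    unfolding R_def using pos c by (intro continuous_intros) (auto simp: less_imp_neq[symmetric])
  have Rpos: "R x > 0" for x using pos c by (simp add: R_def)
  define a0 b0 where "a0 = p - 1" and "b0 = q + 1"
  define \<tau> where "\<tau> = (\<lambda>x. integral {a0..x} R - integral {a0..p} R)"
  have \<tau>': "(\<tau> has_real_derivative R x) (at x)" if "x \<in> {a0<..<b0}" for x
  proof -
    have "((\<lambda>x. integral {a0..x} R) has_real_derivative R x) (at x within {a0..b0})"
      using that by (intro integral_has_real_derivative continuous_on_subset[OF cR]) auto
    then have "((\<lambda>x. integral {a0..x} R) has_real_derivative R x) (at x)"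
      using that by (simp only: at_within_Icc_at greaterThanLessThan_iff)
    from DERIV_diff[OF this DERIV_const] show ?thesis by (simp add: \<tau>_def)
  qed
  have mono: "\<tau> x < \<tau> y" if "x < y" "x \<in> {a0<..<b0}" "y \<in> {a0<..<b0}" for x y
  proof (rule DERIV_pos_imp_increasing[OF \<open>x < y\<close>])
    fix s assume "x \<le> s" "s \<le> y"
    with that have "s \<in> {a0<..<b0}" by auto
    from \<tau>'[OF this] Rpos show "\<exists>D. (\<tau> has_real_derivative D) (at s) \<and> 0 < D" by blast
  qed
  define \<xi> where "\<xi> = inv_into {a0<..<b0} \<tau>"
  have inj: "inj_on \<tau> {a0<..<b0}" 
  proof (rule linorder_inj_onI')
    fix x y assume "x \<in> {a0<..<b0}" "y \<in> {a0<..<b0}" "x < y"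
    then show "\<tau> x \<noteq> \<tau> y" using mono[of x y] by simp
  qed
  have \<xi>: "\<xi> (\<tau> x) = x" if "x \<in> {a0<..<b0}" for x
    unfolding \<xi>_def using inj that by (rule inv_into_f_f)
  have isc: "isCont \<tau> x" if "x \<in> {a0<..<b0}" for x using \<tau>'[OF that] by (rule DERIV_isCont)
  have sub: "{p..q} \<subseteq> {a0<..<b0}" by (auto simp: a0_def b0_def)
  have surj: "\<exists>x\<in>{x1..x2}. \<tau> x = t" if "x1 \<le> x2" "x1 \<in> {a0<..<b0}" "x2 \<in> {a0<..<b0}" "\<tau> x1 \<le> t" "t \<le> \<tau> x2" for t x1 x2
    using IVT[of \<tau> x1 t x2] isc that by fastforce
  have \<tau>p: "\<tau> p = 0" by (simp add: \<tau>_def)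
  have le: "\<tau> x \<le> \<tau> y" if "x \<le> y" "x \<in> {p..q}" "y \<in> {p..q}" for x y
    using mono[of x y] that sub by (cases "x = y") (auto simp: subset_iff)
  have der: "(\<xi> has_real_derivative r (\<xi> t)) (at t)" if t: "t \<in> {0..\<tau> q}" for t
  proof -
    obtain x where x: "x \<in> {p..q}" "\<tau> x = t"
      using surj[of p q t] t \<tau>p sub \<open>p \<le> q\<close> by (auto simp: subset_iff)
    define l u where "l = p - 1/2" and "u = q + 1/2"
    have lu: "l \<in> {a0<..<b0}" "u \<in> {a0<..<b0}" "l < x" "x < u"
      using x \<open>p \<le> q\<close> by (auto simp: l_def u_def a0_def b0_def)
    have "isCont \<xi> (\<tau> x)"
      by (rule isCont_inverse_function2[where a=l and b=u]) (use lu \<xi> isc in auto)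
    moreover have "\<tau> (\<xi> y) = y" if y: "\<tau> l < y" "y < \<tau> u" for y
    proof -
      obtain z where "z \<in> {l..u}" "\<tau> z = y" using surj[of l u y] lu y by auto
      with \<xi>[of z] lu show ?thesis by auto
    qed
    moreover have "\<tau> l < t" "t < \<tau> u" using mono[of l x] mono[of x u] lu x sub by auto
    ultimately have "(\<xi> has_real_derivative inverse (R x)) (at t)"
      using \<tau>'[of x] \<xi>[of x] x sub Rpos[of x]
      by (intro DERIV_inverse_function[where f=\<tau> and a="\<tau> l" and b="\<tau> u"]) auto
    then show ?thesis using \<xi>[of x] x sub c(3)[of x] by (auto simp: R_def)
  qed
  show thesis
  proof (rule that[of "\<tau> q" \<xi>])
    show "0 \<le> \<tau> q" using le[of p q] \<tau>p \<open>p \<le> q\<close> by simp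
    show "\<xi> 0 = p" "\<xi> (\<tau> q) = q" using \<xi>[of p] \<xi>[of q] \<tau>p sub \<open>p \<le> q\<close> by auto
    show "\<xi> ` {0..\<tau> q} = {p..q}"
    proof (intro subset_antisym subsetI)
      fix x assume "x \<in> \<xi> ` {0..\<tau> q}"
      then obtain t where t: "t \<in> {0..\<tau> q}" "x = \<xi> t" by auto
      then obtain y where "y \<in> {p..q}" "\<tau> y = t"
        using surj[of p q t] \<tau>p sub \<open>p \<le> q\<close> by (auto simp: subset_iff)
      then show "x \<in> {p..q}" using \<xi>[of y] t sub by auto
    next
      fix x assume x: "x \<in> {p..q}"
      have "\<tau> x \<in> {0..\<tau> q}" using le[of p x] le[of x q] x \<tau>p by auto
      then show "x \<in> \<xi> ` {0..\<tau> q}" using \<xi>[of x] x sub by (metis image_eqI subsetD)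
    qed
  qed (fact der)
qed

text \<open>Composing a solution of the orbit equation with the motion \<open>\<xi>\<close> along
  the x-axis restores time: the first component of the field cancels in \<open>slope\<close>, and
  the second divided by \<epsilon> remains.\<close>

lemma trajectory_along_graph:
  assumes "p \<le> q" and \<epsilon>: "\<epsilon> \<noteq> 0"
    and w: "\<And>x. x \<in> {p..q} \<Longrightarrow> (w has_real_derivative slope F \<epsilon> x (w x)) (at x within {p..q})"
    and pos: "\<And>x. x \<in> {p..q} \<Longrightarrow> c1 F (x, w x) > 0"
    and cont: "continuous_on {p..q} (\<lambda>x. c1 F (x, w x))"
    and W: "\<And>x. x \<in> {p..q} \<Longrightarrow> (x, w x) \<in> W"
  obtains b \<gamma> where "trajectory F \<epsilon> W 0 b \<gamma>" "\<gamma> 0 = (p, w p)" "\<gamma> b = (q, w q)"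
    "\<gamma> ` {0..b} = graph_over {p..q} w"
proof -
  obtain b \<xi> where b: "0 \<le> b" "\<xi> 0 = p" "\<xi> b = q" "\<xi> ` {0..b} = {p..q}"
    and \<xi>': "\<And>t. t \<in> {0..b} \<Longrightarrow> (\<xi> has_real_derivative c1 F (\<xi> t, w (\<xi> t))) (at t)"
    using autonomous_reparametrization[OF \<open>p \<le> q\<close> cont pos] by blast
  define \<gamma> where "\<gamma> = (\<lambda>t. (\<xi> t, w (\<xi> t)))"
  have "trajectory F \<epsilon> W 0 b \<gamma>"
    unfolding trajectory_def
  proof (intro conjI ballI b)
    fix t assume t: "t \<in> {0..b}"
    then have x: "\<xi> t \<in> {p..q}" using b by auto
    show "\<gamma> t \<in> W" using W x by (simp add: \<gamma>_def)
    have 1: "(\<xi> has_real_derivative c1 F (\<xi> t, w (\<xi> t))) (at t within {0..b})"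
      using \<xi>'[OF t] by (rule has_field_derivative_at_within)
    have "(w has_real_derivative slope F \<epsilon> (\<xi> t) (w (\<xi> t))) (at (\<xi> t) within \<xi> ` {0..b})"
      using w[OF x] b by simp
    from DERIV_image_chain[OF this 1]
    have "((\<lambda>t. w (\<xi> t)) has_real_derivative c2 F (\<xi> t, w (\<xi> t)) / \<epsilon>) (at t within {0..b})"
      using pos[OF x] \<epsilon> by (simp add: o_def slope_def)
    with 1 show "(\<gamma> has_vector_derivative (c1 F (\<gamma> t), c2 F (\<gamma> t) / \<epsilon>)) (at t within {0..b})"
      unfolding \<gamma>_def has_real_derivative_iff_has_vector_derivative
      by (rule has_vector_derivative_Pair)
  qed
  moreover have "\<gamma> ` {0..b} = graph_over {p..q} w"
    by (simp add: \<gamma>_def graph_over_def Setcompr_eq_image image_image flip: b(4))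
  moreover have "\<gamma> 0 = (p, w p)" "\<gamma> b = (q, w q)" using b by (simp_all add: \<gamma>_def)
  ultimately show thesis by (intro that)
qed

text \<open>Invariance is applied to the trajectory that runs along the graph of w: it starts on the
  graph of m, hence stays there. In this way a Fenichel manifold is identified with the solution
  that starts at its end point.\<close>

lemma locally_invariant_graph_unique:
  assumes inv: "locally_invariant F \<epsilon> W (graph_over I m)"
    and "p \<le> q" "\<epsilon> \<noteq> 0"
    and w: "\<And>x. x \<in> {p..q} \<Longrightarrow> (w has_real_derivative slope F \<epsilon> x (w x)) (at x within {p..q})"
    and pos: "\<And>x. x \<in> {p..q} \<Longrightarrow> c1 F (x, w x) > 0"
    and cont: "continuous_on {p..q} (\<lambda>x. c1 F (x, w x))"
    and W: "\<And>x. x \<in> {p..q} \<Longrightarrow> (x, w x) \<in> W"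
    and p: "p \<in> I" "w p = m p"
    and x: "x \<in> {p..q}"
  shows "w x = m x"
proof -
  obtain b \<gamma> where b: "trajectory F \<epsilon> W 0 b \<gamma>" "\<gamma> 0 = (p, w p)" "\<gamma> ` {0..b} = graph_over {p..q} w"
    by (rule trajectory_along_graph[OF \<open>p \<le> q\<close> \<open>\<epsilon> \<noteq> 0\<close> w pos cont W])
  have "0 \<in> {0..b}" using b(1) by (simp add: trajectory_def)
  moreover have "\<gamma> 0 \<in> graph_over I m" using b(2) p by (auto simp: graph_over_def)
  ultimately have "\<gamma> ` {0..b} \<subseteq> graph_over I m"
    using inv b(1) unfolding locally_invariant_def by blast
  then show ?thesis using b(3) x by (auto simp: graph_over_def)
qed

text \<open>One inclusion follows the graph with a trajectory. For the other, \<open>W\<close>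
  imposes no bound on v, so a trajectory could a priori leave the box in which F is controlled;
  uniqueness inside the box and a continuation argument exclude this. That w stays strictly inside,
  while the bounds hold in the closed box, is what makes the continuation work.\<close>

lemma forward_extension_graph:
  assumes \<epsilon>: "\<epsilon> \<noteq> 0" and p': "p' \<in> {p..q}"
    and w: "\<And>x. x \<in> {p..q} \<Longrightarrow> (w has_real_derivative slope F \<epsilon> x (w x)) (at x within {p..q})"
    and wbox: "\<And>x. x \<in> {p..q} \<Longrightarrow> \<bar>w x - v0\<bar> < \<eta>"
    and pos: "\<And>x v. x \<in> {p..q} \<Longrightarrow> \<bar>v - v0\<bar> \<le> \<eta> \<Longrightarrow> c1 F (x, v) > 0"
    and bnd: "\<And>x v. x \<in> {p..q} \<Longrightarrow> \<bar>v - v0\<bar> \<le> \<eta> \<Longrightarrow> c1 F (x, v) \<le> B"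
    and Lip: "\<And>x u v. x \<in> {p..q} \<Longrightarrow> \<bar>u - v0\<bar> \<le> \<eta> \<Longrightarrow> \<bar>v - v0\<bar> \<le> \<eta> \<Longrightarrow>
       \<bar>slope F \<epsilon> x u - slope F \<epsilon> x v\<bar> \<le> K * \<bar>u - v\<bar>"
    and cont: "continuous_on {p..q} (\<lambda>x. c1 F (x, w x))"
    and graph: "\<And>x. x \<in> {p..q} \<Longrightarrow> (x, w x) \<in> W"
    and W: "\<And>z. z \<in> W \<Longrightarrow> fst z \<in> {p..q}"
  shows "forward_extension F \<epsilon> W (graph_over {p..p'} w) = graph_over {p..q} w"
proof (intro subset_antisym subsetI)
  fix z assume "z \<in> graph_over {p..q} w"
  then obtain x where x: "x \<in> {p..q}" and z: "z = (x, w x)" by (auto simp: graph_over_def)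
  have sub: "{p..x} \<subseteq> {p..q}" using x by auto
  obtain b \<gamma> where "trajectory F \<epsilon> W 0 b \<gamma>" "\<gamma> 0 = (p, w p)" "\<gamma> b = (x, w x)"
  proof (rule trajectory_along_graph[of p x \<epsilon> w F W])
    show "continuous_on {p..x} (\<lambda>x. c1 F (x, w x))" using cont sub by (rule continuous_on_subset)
    show "(w has_real_derivative slope F \<epsilon> s (w s)) (at s within {p..x})" if "s \<in> {p..x}" for s
      using has_field_derivative_subset[OF w sub] that sub by blast
    show "c1 F (s, w s) > 0" if "s \<in> {p..x}" for s
      using that sub wbox[of s] by (intro pos) auto
  qed (use sub x graph \<epsilon> in auto)
  moreover have "(p, w p) \<in> graph_over {p..p'} w" using p' by (auto simp: graph_over_def)
  ultimately show "z \<in> forward_extension F \<epsilon> W (graph_over {p..p'} w)"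
    unfolding forward_extension_def mem_Collect_eq z
    by (intro exI[of _ \<gamma>] exI[of _ 0] exI[of _ b]) simp
next
  fix z assume "z \<in> forward_extension F \<epsilon> W (graph_over {p..p'} w)"
  then obtain \<gamma> a b where z: "z = \<gamma> b" and traj: "trajectory F \<epsilon> W a b \<gamma>"
    and start: "\<gamma> a \<in> graph_over {p..p'} w" by (auto simp: forward_extension_def)
  define X V where "X = (\<lambda>t. fst (\<gamma> t))" and "V = (\<lambda>t. snd (\<gamma> t))"
  have \<gamma>: "\<gamma> t = (X t, V t)" for t by (simp add: X_def V_def)
  have ab: "a \<le> b" using traj by (simp add: trajectory_def)
  have X: "X t \<in> {p..q}" if "t \<in> {a..b}" for t
    using traj W that by (simp add: trajectory_def X_def)
  have g': "(\<gamma> has_vector_derivative (c1 F (\<gamma> t), c2 F (\<gamma> t) / \<epsilon>)) (at t within {a..b})"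
    if "t \<in> {a..b}" for t using traj that by (simp add: trajectory_def)
  have X': "(X has_real_derivative c1 F (X t, V t)) (at t within {a..b})" if "t \<in> {a..b}" for t
    using bounded_linear.has_vector_derivative[OF bounded_linear_fst g'[OF that]]
    unfolding X_def V_def has_real_derivative_iff_has_vector_derivative by simp
  have V': "(V has_real_derivative c2 F (X t, V t) / \<epsilon>) (at t within {a..b})" if "t \<in> {a..b}" for t
    using bounded_linear.has_vector_derivative[OF bounded_linear_snd g'[OF that]]
    unfolding X_def V_def has_real_derivative_iff_has_vector_derivative by simp
  define d where "d = (\<lambda>t. V t - w (X t))"
  define d' where "d' = (\<lambda>t. c2 F (X t, V t) / \<epsilon> - slope F \<epsilon> (X t) (w (X t)) * c1 F (X t, V t))"
  have d': "(d has_real_derivative d' t) (at t within {a..b})" if t: "t \<in> {a..b}" for t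
  proof -
    have "X ` {a..b} \<subseteq> {p..q}" using X by auto
    then have "(w has_real_derivative slope F \<epsilon> (X t) (w (X t))) (at (X t) within X ` {a..b})"
      using has_field_derivative_subset[OF w[OF X[OF t]]] by blast
    from DERIV_image_chain[OF this X'[OF t]] V'[OF t]
    show ?thesis unfolding d_def d'_def o_def by (intro DERIV_diff)
  qed
  have zero: "d t = 0" if t: "t \<in> {a..b}" and box: "\<forall>s\<in>{a..t}. \<bar>V s - v0\<bar> \<le> \<eta>" for t
  proof (rule gronwall_zero[of a t d d' "B * K" t])
    fix s assume s: "s \<in> {a..t}"
    then have sb: "s \<in> {a..b}" using t by auto
    show "(d has_real_derivative d' s) (at s within {a..t})"
      using t by (intro has_field_derivative_subset[OF d'[OF sb]]) auto
    have Vs: "\<bar>V s - v0\<bar> \<le> \<eta>" and ws: "\<bar>w (X s) - v0\<bar> \<le> \<eta>"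
      using box s wbox[OF X[OF sb]] by auto
    have F: "0 < c1 F (X s, V s)" "c1 F (X s, V s) \<le> B"
      using pos[OF X[OF sb] Vs] bnd[OF X[OF sb] Vs] by auto
    \<comment> \<open>Along the trajectory the deviation from the graph changes at the rate F1 times
      a difference of two slopes at the same x, so the Lipschitz bound gives the linear inequality
      for \<open>gronwall_zero\<close>.\<close>
    have "d' s = c1 F (X s, V s) * (slope F \<epsilon> (X s) (V s) - slope F \<epsilon> (X s) (w (X s)))"
      using F \<epsilon> by (simp add: d'_def slope_def field_simps)
    also have "\<bar>\<dots>\<bar> \<le> B * (K * \<bar>V s - w (X s)\<bar>)"
      using F Lip[OF X[OF sb] Vs ws] by (auto simp: abs_mult intro!: mult_mono)
    finally show "\<bar>d' s\<bar> \<le> B * K * \<bar>d s\<bar>" by (simp add: d_def)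
  next
    show "d a = 0" using start by (auto simp: d_def graph_over_def \<gamma>)
  qed (use t in auto)
  have cV: "continuous_on {a..b} V" using V' by (rule DERIV_continuous_on)
  have Va: "V a = w (X a)" using start by (auto simp: graph_over_def \<gamma>)
  \<comment> \<open>As long as V remains in the closed box, \<open>zero\<close> forces it onto the
    graph, which lies strictly inside; so the boundary is never reached.\<close>
  have box: "\<bar>V t - v0\<bar> - \<eta> < 0" if t: "t \<in> {a..b}" for t
  proof (rule continuation_induct[of a b "\<lambda>t. \<bar>V t - v0\<bar> - \<eta>"])
    show "continuous_on {a..b} (\<lambda>t. \<bar>V t - v0\<bar> - \<eta>)" by (intro continuous_intros cV)
    show "\<bar>V a - v0\<bar> - \<eta> \<le> 0" using wbox[OF X, of a] ab Va by simp
    fix s assume s: "s \<in> {a..b}" and "\<forall>r\<in>{a..s}. \<bar>V r - v0\<bar> - \<eta> \<le> 0"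
    then have "d s = 0" by (intro zero) auto
    then show "\<bar>V s - v0\<bar> - \<eta> < 0" using wbox[OF X[OF s]] by (simp add: d_def)
  qed (fact t)
  have "d b = 0"
  proof (rule zero)
    show "\<forall>s\<in>{a..b}. \<bar>V s - v0\<bar> \<le> \<eta>" using box by force
  qed (use ab in simp)
  then show "z \<in> graph_over {p..q} w" using X[of b] ab by (auto simp: z \<gamma> d_def graph_over_def)
qed

section \<open>The reflection that exchanges stable and unstable branches\<close>

definition reflect :: "real \<times> real \<Rightarrow> real \<times> real" where
  "reflect = (\<lambda>(x, v). (- x, v))"

text \<open>Conjugation by \<open>x \<mapsto> -x\<close> combined with time reversal.\<close>

definition reversed :: "vfield \<Rightarrow> vfield" where
  "reversed F = (\<lambda>(x, v). (c1 F (- x, v), - c2 F (- x, v)))"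

lemma reflect_reflect [simp]: "reflect (reflect z) = z"
  by (simp add: reflect_def case_prod_unfold)

lemma reversed_reversed [simp]: "reversed (reversed F) = F"
  by (simp add: reversed_def case_prod_unfold)

lemma slope_reversed: "slope (reversed F) \<epsilon> x v = - slope F \<epsilon> (- x) v"
  by (simp add: slope_def reversed_def)

lemma image_reflect_iff [simp]: "z \<in> reflect ` S \<longleftrightarrow> reflect z \<in> S"
  by (metis image_iff reflect_reflect)

lemma image_reflect_image [simp]: "reflect ` reflect ` S = S"
  by (auto simp: image_image)

lemma trajectory_reversed:
  assumes "trajectory F \<epsilon> W a b \<gamma>"
  shows "trajectory (reversed F) \<epsilon> (reflect ` W) (- b) (- a) (\<lambda>t. reflect (\<gamma> (- t)))"
  unfolding trajectory_def
proof (intro conjI ballI)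
  show "- b \<le> - a" using assms by (simp add: trajectory_def)
  fix t assume t: "t \<in> {-b..-a}"
  then have mt: "- t \<in> {a..b}" by auto
  show "reflect (\<gamma> (- t)) \<in> reflect ` W" using assms mt by (simp add: trajectory_def)
  have "(\<gamma> has_vector_derivative (c1 F (\<gamma> (- t)), c2 F (\<gamma> (- t)) / \<epsilon>)) (at (- t) within uminus ` {-b..-a})"
    using assms mt by (simp add: trajectory_def)
  moreover have "(uminus has_vector_derivative -1) (at t within {-b..-a})"
    by (auto intro!: derivative_eq_intros)
  ultimately have "((\<gamma> \<circ> uminus) has_vector_derivative (-1) *\<^sub>R (c1 F (\<gamma> (- t)), c2 F (\<gamma> (- t)) / \<epsilon>))
      (at t within {-b..-a})"
    by (intro vector_diff_chain_within)
  moreover have "bounded_linear reflect"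
    unfolding reflect_def case_prod_unfold
    by (intro bounded_linear_Pair bounded_linear_minus bounded_linear_fst bounded_linear_snd)
  ultimately have "((\<lambda>t. reflect ((\<gamma> \<circ> uminus) t)) has_vector_derivative
      reflect ((-1) *\<^sub>R (c1 F (\<gamma> (- t)), c2 F (\<gamma> (- t)) / \<epsilon>))) (at t within {-b..-a})"
    by (rule bounded_linear.has_vector_derivative[rotated])
  then show "((\<lambda>t. reflect (\<gamma> (- t))) has_vector_derivative
      (c1 (reversed F) (reflect (\<gamma> (- t))), c2 (reversed F) (reflect (\<gamma> (- t))) / \<epsilon>)) (at t within {-b..-a})"
    by (simp add: reflect_def reversed_def case_prod_unfold)
qed

lemma locally_invariant_reversed:
  assumes "locally_invariant F \<epsilon> W M"
  shows "locally_invariant (reversed F) \<epsilon> (reflect ` W) (reflect ` M)"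
  unfolding locally_invariant_def
proof (intro allI impI, elim conjE bexE)
  fix a b \<gamma> t
  assume tr: "trajectory (reversed F) \<epsilon> (reflect ` W) a b \<gamma>" and t: "t \<in> {a..b}" "\<gamma> t \<in> reflect ` M"
  have "trajectory F \<epsilon> W (- b) (- a) (\<lambda>t. reflect (\<gamma> (- t)))"
    using trajectory_reversed[OF tr] by simp
  moreover have "\<exists>s\<in>{-b..-a}. reflect (\<gamma> (- s)) \<in> M"
    using t by (intro bexI[of _ "- t"]) auto
  ultimately have "(\<lambda>t. reflect (\<gamma> (- t))) ` {-b..-a} \<subseteq> M"
    using assms unfolding locally_invariant_def by blast
  moreover have "- s \<in> {-b..-a}" if "s \<in> {a..b}" for s using that by auto
  ultimately have "reflect (\<gamma> (- (- s))) \<in> M" if "s \<in> {a..b}" for s using that by blast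
  then show "\<gamma> ` {a..b} \<subseteq> reflect ` M" by auto
qed

text \<open>With this identity every statement about an unstable branch on x > 0 is read off from
  one about a stable branch on x < 0; nothing about backward flow is proved separately.\<close>

lemma backward_extension_reversed:
  "backward_extension F \<epsilon> W M =
     reflect ` forward_extension (reversed F) \<epsilon> (reflect ` W) (reflect ` M)"
proof (intro subset_antisym subsetI)
  fix z assume "z \<in> backward_extension F \<epsilon> W M"
  then obtain \<gamma> a b where *: "z = \<gamma> a" "trajectory F \<epsilon> W a b \<gamma>" "\<gamma> b \<in> M"
    by (auto simp: backward_extension_def)
  have "reflect z = reflect (\<gamma> (- (- a)))" "reflect (\<gamma> (- (- b))) \<in> reflect ` M" using * by simp_all
  with trajectory_reversed[OF *(2)]
  have "reflect z \<in> forward_extension (reversed F) \<epsilon> (reflect ` W) (reflect ` M)"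
    unfolding forward_extension_def mem_Collect_eq
    by (intro exI[of _ "\<lambda>t. reflect (\<gamma> (- t))"] exI[of _ "- b"] exI[of _ "- a"] conjI)
  then show "z \<in> reflect ` forward_extension (reversed F) \<epsilon> (reflect ` W) (reflect ` M)" by simp
next
  fix z assume "z \<in> reflect ` forward_extension (reversed F) \<epsilon> (reflect ` W) (reflect ` M)"
  then obtain \<gamma> a b where *: "reflect z = \<gamma> b"
    "trajectory (reversed F) \<epsilon> (reflect ` W) a b \<gamma>" "\<gamma> a \<in> reflect ` M"
    by (auto simp: forward_extension_def)
  have "trajectory F \<epsilon> W (- b) (- a) (\<lambda>t. reflect (\<gamma> (- t)))"
    using trajectory_reversed[OF *(2)] by simp
  moreover have "z = reflect (\<gamma> (- (- b)))" "reflect (\<gamma> (- (- a))) \<in> M"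
    using *(1,3) by (simp_all flip: *(1))
  ultimately show "z \<in> backward_extension F \<epsilon> W M"
    unfolding backward_extension_def mem_Collect_eq
    by (intro exI[of _ "\<lambda>t. reflect (\<gamma> (- t))"] exI[of _ "- b"] exI[of _ "- a"] conjI)
qed

lemma reflect_image_graph: "reflect ` graph_over I w = graph_over (uminus ` I) (\<lambda>x. w (- x))"
  by (force simp: graph_over_def reflect_def)

lemma reflect_image_strip: "reflect ` strip U \<epsilon> I = strip (reflect ` U) \<epsilon> (uminus ` I)"
  by (force simp: strip_def reflect_def)

section \<open>Passage of an attracting branch through the fold\<close>

lemma abs_le_by_difference:
  fixes a b :: real
  assumes "\<bar>a - b\<bar> \<le> n" "\<bar>b\<bar> \<le> t"
  shows "\<bar>a\<bar> \<le> t + n"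
  using assms by linarith

text \<open>Abstracts the side x < 0 of the fold in such a way that the side x > 0 becomes a second
  instance after reflection. The normal form is multiplied out by \<epsilon> and F1; dividing by
  both gives the equation for the deviation. The factor g may depend on \<epsilon>, \<alpha>, x and
  v, and only its bounds are kept. D is a bound for the quotient of \<alpha> by \<epsilon>. The
  Lipschitz constant in \<open>field\<close> may depend on \<epsilon>, since \<open>slope\<close>
  carries 1/\<epsilon>; it serves existence and uniqueness and never enters an estimate.\<close>

locale attracting_branch =
  fixes F :: "real \<Rightarrow> real \<Rightarrow> vfield" and \<phi> \<phi>' \<psi> \<psi>' :: "real \<Rightarrow> real"
    and v0 \<eta> L0 g0 g1 f0 f1 d0 c0 \<delta>C :: real
  assumes pos: "0 < \<eta>" "0 < L0" "0 < g0" "0 < f0" "0 < d0"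
    and \<phi>': "\<And>v. \<bar>v - v0\<bar> \<le> \<eta> \<Longrightarrow> (\<phi> has_real_derivative \<phi>' v) (at v)"
    and \<phi>_expand: "\<And>u v. \<bar>u - v0\<bar> \<le> \<eta> \<Longrightarrow> \<bar>v - v0\<bar> \<le> \<eta> \<Longrightarrow> d0 * \<bar>u - v\<bar> \<le> \<bar>\<phi> u - \<phi> v\<bar>"
    and \<psi>': "\<And>x. x \<in> {-L0..<0} \<Longrightarrow> (\<psi> has_real_derivative \<psi>' x) (at x)"
    and \<psi>_cont: "continuous_on {-L0..0} \<psi>"
    and \<psi>_0: "\<psi> 0 = \<phi> v0"
    and \<psi>_close: "\<And>x. x \<in> {-L0..0} \<Longrightarrow> \<bar>\<psi> x - \<phi> v0\<bar> \<le> d0 * \<eta> / 2"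
    and gap: "\<And>x v. x \<in> {-L0..0} \<Longrightarrow> \<bar>v - v0\<bar> \<le> \<eta> \<Longrightarrow> \<bar>\<phi> v - \<psi> x\<bar> \<le> 2"
    and field: "\<And>D. 0 < D \<Longrightarrow> \<forall>\<^sub>F \<epsilon> in at_right 0.
       continuous_on ({-(D*\<epsilon>)..D*\<epsilon>} \<times> {-L0..0} \<times> {v0-\<eta>..v0+\<eta>}) (\<lambda>(\<alpha>, p). F \<alpha> \<epsilon> p) \<and>
       (\<exists>K. \<forall>\<alpha>\<in>{-(D*\<epsilon>)..D*\<epsilon>}. \<forall>x\<in>{-L0..0}. \<forall>u v. \<bar>u - v0\<bar> \<le> \<eta> \<longrightarrow> \<bar>v - v0\<bar> \<le> \<eta> \<longrightarrow>
          \<bar>slope (F \<alpha> \<epsilon>) \<epsilon> x u - slope (F \<alpha> \<epsilon>) \<epsilon> x v\<bar> \<le> K * \<bar>u - v\<bar>) \<and>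
       (\<forall>\<alpha>\<in>{-(D*\<epsilon>)..D*\<epsilon>}. \<forall>x\<in>{-L0..0}. \<forall>v. \<bar>v - v0\<bar> \<le> \<eta> \<longrightarrow>
          f0 \<le> c1 (F \<alpha> \<epsilon>) (x, v) \<and> c1 (F \<alpha> \<epsilon>) (x, v) \<le> f1)"
    and normal_form: "\<And>D. 0 < D \<Longrightarrow> \<exists>C. \<forall>\<^sub>F \<epsilon> in at_right 0.
       \<forall>\<alpha>\<in>{-(D*\<epsilon>)..D*\<epsilon>}. \<forall>x\<in>{-L0..<0}. \<forall>v. \<bar>v - v0\<bar> \<le> \<eta> \<longrightarrow> (\<exists>g\<in>{g0..g1}.
          \<bar>\<phi>' v * c2 (F \<alpha> \<epsilon>) (x, v) - \<epsilon> * c1 (F \<alpha> \<epsilon>) (x, v) * \<psi>' x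
            - g * x * (\<phi> v - \<psi> x) * c1 (F \<alpha> \<epsilon>) (x, v) - c0 * (\<alpha> - \<delta>C * \<epsilon>)\<bar>
          \<le> C * \<epsilon> * (\<bar>x\<bar> + \<bar>\<phi> v - \<psi> x\<bar> + \<epsilon>))"
begin

text \<open>The strict inequality is the room that \<open>forward_extension_graph\<close> asks
  for.\<close>

definition solution :: "real \<Rightarrow> real \<Rightarrow> real \<Rightarrow> (real \<Rightarrow> real) \<Rightarrow> bool" where
  "solution \<alpha> \<epsilon> L w \<longleftrightarrow> (\<forall>x\<in>{-L..0}.
     (w has_real_derivative slope (F \<alpha> \<epsilon>) \<epsilon> x (w x)) (at x within {-L..0}) \<and> \<bar>w x - v0\<bar> < \<eta>)"

definition admissible :: "real \<Rightarrow> real \<Rightarrow> real \<Rightarrow> real \<Rightarrow> bool" where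
  "admissible D C \<alpha> \<epsilon> \<longleftrightarrow> 0 < \<epsilon> \<and> \<epsilon> \<le> 1 \<and> \<bar>\<alpha>\<bar> \<le> D * \<epsilon> \<and>
     (\<forall>x\<in>{-L0..<0}. \<forall>v. \<bar>v - v0\<bar> \<le> \<eta> \<longrightarrow>
        f0 \<le> c1 (F \<alpha> \<epsilon>) (x, v) \<and> c1 (F \<alpha> \<epsilon>) (x, v) \<le> f1 \<and> (\<exists>g\<in>{g0..g1}.
          \<bar>\<phi>' v * c2 (F \<alpha> \<epsilon>) (x, v) - \<epsilon> * c1 (F \<alpha> \<epsilon>) (x, v) * \<psi>' x
            - g * x * (\<phi> v - \<psi> x) * c1 (F \<alpha> \<epsilon>) (x, v) - c0 * (\<alpha> - \<delta>C * \<epsilon>)\<bar>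
          \<le> C * \<epsilon> * (\<bar>x\<bar> + \<bar>\<phi> v - \<psi> x\<bar> + \<epsilon>)))"

text \<open>The chain rule and the normal form, divided by \<epsilon> and F1. The remainder is
  estimated as the product \<open>c x * \<rho> x\<close>, with c the value of F1 along the curve,
  because the drive \<open>c0 * (\<alpha> - \<delta>C * \<epsilon>) / \<epsilon>\<close> stands
  there undivided. The division by c is left to the later estimates, which use different ends of the
  interval from f0 to f1.\<close>

lemma deviation_equation:
  assumes adm: "admissible D C \<alpha> \<epsilon>" and L: "L \<le> L0" "b \<le> 0"
    and w: "\<And>x. x \<in> {-L..b} \<Longrightarrow>
      (w has_real_derivative slope (F \<alpha> \<epsilon>) \<epsilon> x (w x)) (at x within {-L..b})"
    and box: "\<And>x. x \<in> {-L..b} \<Longrightarrow> \<bar>w x - v0\<bar> \<le> \<eta>"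
  obtains g \<rho> c where
    "\<And>x. - L < x \<Longrightarrow> x < b \<Longrightarrow>
       ((\<lambda>x. \<phi> (w x) - \<psi> x) has_real_derivative g x * x * (\<phi> (w x) - \<psi> x) / \<epsilon> + \<rho> x) (at x)"
    "\<And>x. - L < x \<Longrightarrow> x < b \<Longrightarrow> g0 \<le> g x \<and> g x \<le> g1"
    "\<And>x. - L < x \<Longrightarrow> x < b \<Longrightarrow> f0 \<le> c x \<and> c x \<le> f1 \<and>
       \<bar>c x * \<rho> x - c0 * (\<alpha> - \<delta>C * \<epsilon>) / \<epsilon>\<bar> \<le> C * (\<bar>x\<bar> + \<bar>\<phi> (w x) - \<psi> x\<bar> + \<epsilon>)"
proof -
  \<comment> \<open>All properties at one point are bundled, so that g, \<rho> and c can be chosen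
    as functions of x in a single step.\<close>
  define P where "P = (\<lambda>x g \<rho> c. ((\<lambda>x. \<phi> (w x) - \<psi> x) has_real_derivative
        g * x * (\<phi> (w x) - \<psi> x) / \<epsilon> + \<rho>) (at x) \<and> g0 \<le> g \<and> g \<le> g1 \<and> f0 \<le> c \<and> c \<le> f1 \<and>
      \<bar>c * \<rho> - c0 * (\<alpha> - \<delta>C * \<epsilon>) / \<epsilon>\<bar> \<le> C * (\<bar>x\<bar> + \<bar>\<phi> (w x) - \<psi> x\<bar> + \<epsilon>))"
  have "\<exists>g \<rho> c. P x g \<rho> c" if x: "- L < x" "x < b" for x
  proof -
    define c where "c = c1 (F \<alpha> \<epsilon>) (x, w x)"
    define f where "f = c2 (F \<alpha> \<epsilon>) (x, w x)"
    define z where "z = \<phi> (w x) - \<psi> x"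
    have xI: "x \<in> {-L0..<0}" using x L by auto
    have wx: "\<bar>w x - v0\<bar> \<le> \<eta>" using box x by auto
    have \<epsilon>: "\<epsilon> > 0" using adm by (simp add: admissible_def)
    have c: "f0 \<le> c" "c \<le> f1" using adm xI wx by (auto simp: admissible_def c_def)
    obtain g where g: "g0 \<le> g" "g \<le> g1"
      and E: "\<bar>\<phi>' (w x) * f - \<epsilon> * c * \<psi>' x - g * x * z * c - c0 * (\<alpha> - \<delta>C * \<epsilon>)\<bar>
        \<le> C * \<epsilon> * (\<bar>x\<bar> + \<bar>z\<bar> + \<epsilon>)"
      using adm xI wx unfolding admissible_def c_def f_def z_def by fastforce
    \<comment> \<open>What remains of dv/dx times \<open>\<phi>'\<close>, minus
      \<open>\<psi>'\<close>, when the attraction \<open>g * x * z / \<epsilon>\<close> is taken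
      out.\<close>
    define \<rho> where "\<rho> = (\<phi>' (w x) * f - \<epsilon> * c * \<psi>' x - g * x * z * c) / (\<epsilon> * c)"
    have c0': "c > 0" using c pos by linarith
    have "(w has_real_derivative slope (F \<alpha> \<epsilon>) \<epsilon> x (w x)) (at x)"
      using w[of x] x by (simp add: at_within_Icc_at)
    from DERIV_chain'[OF this \<phi>'[OF wx]]
    have "((\<lambda>x. \<phi> (w x)) has_real_derivative \<phi>' (w x) * slope (F \<alpha> \<epsilon>) \<epsilon> x (w x)) (at x)"
      by simp
    then have "((\<lambda>x. \<phi> (w x) - \<psi> x) has_real_derivative
        \<phi>' (w x) * slope (F \<alpha> \<epsilon>) \<epsilon> x (w x) - \<psi>' x) (at x)"
      by (rule DERIV_diff[OF _ \<psi>'[OF xI]])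
    moreover have "\<phi>' (w x) * slope (F \<alpha> \<epsilon>) \<epsilon> x (w x) - \<psi>' x = g * x * z / \<epsilon> + \<rho>"
      using \<epsilon> c0' by (simp add: \<rho>_def slope_def field_simps flip: c_def f_def)
    moreover have "c * \<rho> - c0 * (\<alpha> - \<delta>C * \<epsilon>) / \<epsilon>
        = (\<phi>' (w x) * f - \<epsilon> * c * \<psi>' x - g * x * z * c - c0 * (\<alpha> - \<delta>C * \<epsilon>)) / \<epsilon>"
      using \<epsilon> c0' by (simp add: \<rho>_def field_simps)
    then have "\<bar>c * \<rho> - c0 * (\<alpha> - \<delta>C * \<epsilon>) / \<epsilon>\<bar> \<le> C * (\<bar>x\<bar> + \<bar>z\<bar> + \<epsilon>)"
      using E \<epsilon> by (simp add: pos_divide_le_eq mult.commute mult.left_commute)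
    ultimately have "((\<lambda>x. \<phi> (w x) - \<psi> x) has_real_derivative g * x * z / \<epsilon> + \<rho>) (at x)"
      "\<bar>c * \<rho> - c0 * (\<alpha> - \<delta>C * \<epsilon>) / \<epsilon>\<bar> \<le> C * (\<bar>x\<bar> + \<bar>z\<bar> + \<epsilon>)"
      by (simp_all only:)
    then have "P x g \<rho> c" using g c unfolding z_def P_def by (intro conjI)
    then show ?thesis by blast
  qed
  then obtain g \<rho> c where "\<And>x. - L < x \<Longrightarrow> x < b \<Longrightarrow> P x (g x) (\<rho> x) (c x)" by metis
  then show thesis unfolding P_def by (intro that[of g \<rho> c]) blast+
qed

lemma continuous_on_deviation:
  assumes "L \<le> L0" "b \<le> 0" and w: "continuous_on {-L..b} w"
    and box: "\<And>x. x \<in> {-L..b} \<Longrightarrow> \<bar>w x - v0\<bar> \<le> \<eta>"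
  shows "continuous_on {-L..b} (\<lambda>x. \<phi> (w x) - \<psi> x)"
proof (intro continuous_on_diff)
  have "continuous_on {v. \<bar>v - v0\<bar> \<le> \<eta>} \<phi>"
    using \<phi>' by (intro continuous_at_imp_continuous_on ballI) (auto intro: DERIV_isCont)
  then show "continuous_on {-L..b} (\<lambda>x. \<phi> (w x))"
    by (rule continuous_on_compose2[OF _ w]) (use box in auto)
  show "continuous_on {-L..b} \<psi>"
    using \<psi>_cont by (rule continuous_on_subset) (use assms in auto)
qed

text \<open>First round of a bootstrap: the deviation is bounded crudely by 2, so the forcing is
  bounded and \<open>fold_bound_sqrt\<close> applies. The right end b is arbitrary because the
  estimate is used while the solution is not yet known to stay in the box up to x = 0.\<close>

lemma deviation_le_sqrt:
  assumes adm: "admissible D C \<alpha> \<epsilon>" and L: "0 < L" "L \<le> L0" and b: "- L \<le> b" "b \<le> 0"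
    and w: "\<And>x. x \<in> {-L..b} \<Longrightarrow>
      (w has_real_derivative slope (F \<alpha> \<epsilon>) \<epsilon> x (w x)) (at x within {-L..b})"
    and box: "\<And>x. x \<in> {-L..b} \<Longrightarrow> \<bar>w x - v0\<bar> \<le> \<eta>"
    and init: "\<bar>\<phi> (w (- L)) - \<psi> (- L)\<bar> \<le> Ci * \<epsilon>" and C: "0 \<le> C" "0 \<le> Ci"
    and K: "(\<bar>c0\<bar> * (D + \<bar>\<delta>C\<bar>) + C * (L0 + 3)) / f0 < K * min (1/4) (g0 / 2)"
      "Ci * (1 + L0) < K"
    and x: "x \<in> {-L..b}"
  shows "\<bar>\<phi> (w x) - \<psi> x\<bar> \<le> K * sqrt \<epsilon>"
proof -
  have \<epsilon>: "0 < \<epsilon>" "\<epsilon> \<le> 1" and \<alpha>: "\<bar>\<alpha>\<bar> \<le> D * \<epsilon>" using adm by (auto simp: admissible_def)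
  obtain g \<rho> c where z': "\<And>x. - L < x \<Longrightarrow> x < b \<Longrightarrow>
       ((\<lambda>x. \<phi> (w x) - \<psi> x) has_real_derivative g x * x * (\<phi> (w x) - \<psi> x) / \<epsilon> + \<rho> x) (at x)"
    and g: "\<And>x. - L < x \<Longrightarrow> x < b \<Longrightarrow> g0 \<le> g x \<and> g x \<le> g1"
    and c: "\<And>x. - L < x \<Longrightarrow> x < b \<Longrightarrow> f0 \<le> c x \<and> c x \<le> f1 \<and>
       \<bar>c x * \<rho> x - c0 * (\<alpha> - \<delta>C * \<epsilon>) / \<epsilon>\<bar> \<le> C * (\<bar>x\<bar> + \<bar>\<phi> (w x) - \<psi> x\<bar> + \<epsilon>)"
    using deviation_equation[OF adm L(2) b(2) w box] by blast
  have cK: "0 \<le> K" using K(2) C pos by (smt (verit) mult_nonneg_nonneg)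
  show ?thesis
  proof (rule fold_bound_sqrt[where z="\<lambda>x. \<phi> (w x) - \<psi> x", OF \<epsilon>(1) b(2) _ z' pos(3) _ _ K(1) cK _ x])
    show "continuous_on {-L..b} (\<lambda>x. \<phi> (w x) - \<psi> x)"
      by (rule continuous_on_deviation[OF L(2) b(2) DERIV_continuous_on[OF w] box])
    show "g0 \<le> g x" if "- L < x" "x < b" for x using g that by blast
    fix x assume x: "- L < x" "x < b"
    have "\<bar>\<alpha> - \<delta>C * \<epsilon>\<bar> \<le> (D + \<bar>\<delta>C\<bar>) * \<epsilon>"
    proof -
      have "\<bar>\<delta>C * \<epsilon>\<bar> = \<bar>\<delta>C\<bar> * \<epsilon>" using \<epsilon> by (simp add: abs_mult)
      with \<alpha> show ?thesis unfolding distrib_right by linarith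
    qed
    then have "\<bar>c0\<bar> * \<bar>\<alpha> - \<delta>C * \<epsilon>\<bar> \<le> \<bar>c0\<bar> * ((D + \<bar>\<delta>C\<bar>) * \<epsilon>)" by (rule mult_left_mono) simp
    then have 1: "\<bar>c0 * (\<alpha> - \<delta>C * \<epsilon>) / \<epsilon>\<bar> \<le> \<bar>c0\<bar> * (D + \<bar>\<delta>C\<bar>)"
      using \<epsilon> by (simp add: abs_mult pos_divide_le_eq mult.assoc)
    \<comment> \<open>The constant \<open>L0 + 3\<close> arises here: at most L0 from x, 2 from
      \<open>gap\<close>, and 1 from \<epsilon>.\<close>
    have "\<bar>\<phi> (w x) - \<psi> x\<bar> \<le> 2" using x L b box by (intro gap) auto
    then have "C * (\<bar>x\<bar> + \<bar>\<phi> (w x) - \<psi> x\<bar> + \<epsilon>) \<le> C * (L0 + 3)"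
      using C x L b \<epsilon> by (intro mult_left_mono) auto
    with c[OF x] have "\<bar>c x * \<rho> x - c0 * (\<alpha> - \<delta>C * \<epsilon>) / \<epsilon>\<bar> \<le> C * (L0 + 3)"
      by (blast intro: order_trans)
    then have "\<bar>c x * \<rho> x\<bar> \<le> \<bar>c0\<bar> * (D + \<bar>\<delta>C\<bar>) + C * (L0 + 3)"
      using 1 by (rule abs_le_by_difference)
    moreover have "f0 * \<bar>\<rho> x\<bar> \<le> \<bar>c x * \<rho> x\<bar>"
      unfolding abs_mult using c[OF x] pos by (intro mult_right_mono) auto
    ultimately have "f0 * \<bar>\<rho> x\<bar> \<le> \<bar>c0\<bar> * (D + \<bar>\<delta>C\<bar>) + C * (L0 + 3)" by (rule order_trans[rotated])
    then show "\<bar>\<rho> x\<bar> \<le> (\<bar>c0\<bar> * (D + \<bar>\<delta>C\<bar>) + C * (L0 + 3)) / f0"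
      using pos by (subst pos_le_divide_eq) (auto simp: mult.commute)
  next
    \<comment> \<open>The denominator of the barrier at -L is \<open>sqrt \<epsilon> + L\<close>,
      which is at most \<open>1 + L0\<close>; this is the source of the second condition on
      K.\<close>
    have "Ci < K / (1 + L0)" using K(2) pos by (simp add: pos_less_divide_eq)
    also have "\<dots> \<le> K / (sqrt \<epsilon> - (- L))"
      using cK \<epsilon> L by (intro divide_left_mono mult_pos_pos) (auto intro: add_mono add_pos_pos)
    finally have "Ci * \<epsilon> < \<epsilon> * (K / (sqrt \<epsilon> - (- L)))"
      using mult_strict_left_mono[OF _ \<epsilon>(1)] by (simp only: mult.commute[of Ci])
    with init show "\<bar>\<phi> (w (- L)) - \<psi> (- L)\<bar> < \<epsilon> * (K / (sqrt \<epsilon> - (- L)))" by linarith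
  qed
qed

text \<open>Second round of the bootstrap: once the deviation is known to be at most
  \<open>K * sqrt \<epsilon>\<close>, the remainder falls from a constant to
  \<open>N * (sqrt \<epsilon> - x)\<close>. Near the fold this is of order
  \<open>sqrt \<epsilon>\<close>, which makes an upper bound of order \<epsilon> and a decision
  about the sign possible. The factor \<sigma> treats both signs at once.\<close>

lemma deviation_at_fold:
  assumes adm: "admissible D C \<alpha> \<epsilon>" and L: "0 < L" "L \<le> L0" and w: "solution \<alpha> \<epsilon> L w"
    and init: "\<bar>\<phi> (w (- L)) - \<psi> (- L)\<bar> \<le> Ci * \<epsilon>" and C: "0 \<le> C" "0 \<le> Ci"
    and K: "\<And>x. x \<in> {-L..0} \<Longrightarrow> \<bar>\<phi> (w x) - \<psi> x\<bar> \<le> K * sqrt \<epsilon>" "0 \<le> K"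
    and \<sigma>: "\<sigma> \<in> {1, -1}"
  defines "N \<equiv> C * (K + 1)"
  shows deviation_at_fold_le: "\<bar>c0 * (\<alpha> - \<delta>C * \<epsilon>)\<bar> \<le> B * \<epsilon> * sqrt \<epsilon> \<Longrightarrow> 0 \<le> B \<Longrightarrow>
      \<bar>\<phi> (w 0) - \<phi> v0\<bar>
        \<le> \<epsilon> * ((B + N) / f0 / g0 + Ci + 1 + ((B + N) / f0 + 1) / min (1/4) (g0 / 2))"
    and deviation_at_fold_pos: "\<beta> * \<epsilon> * sqrt \<epsilon> \<le> \<sigma> * (c0 * (\<alpha> - \<delta>C * \<epsilon>)) \<Longrightarrow>
      f1 * (N / f0 + (N / f0 / g0 + Ci + 2) * (1 + g1) + 1) \<le> \<beta> \<Longrightarrow>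
      (N / f0 / g0 + Ci + 2) * sqrt \<epsilon> < L \<Longrightarrow> 0 < \<sigma> * (\<phi> (w 0) - \<phi> v0)"
proof -
  have \<epsilon>: "0 < \<epsilon>" "\<epsilon> \<le> 1" using adm by (auto simp: admissible_def)
  have s: "0 < sqrt \<epsilon>" "\<epsilon> \<le> sqrt \<epsilon>" "sqrt \<epsilon> \<le> 1"
    using \<epsilon> real_le_rsqrt[of \<epsilon> \<epsilon>] by (auto simp: power2_eq_square mult_left_le_one_le)
  have N: "0 \<le> N" using C K by (simp add: N_def)
  have w': "(w has_real_derivative slope (F \<alpha> \<epsilon>) \<epsilon> x (w x)) (at x within {-L..0})"
    and box: "\<bar>w x - v0\<bar> \<le> \<eta>" if "x \<in> {-L..0}" for x
    using w that by (auto simp: solution_def intro: less_imp_le)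
  define z where "z = (\<lambda>x. \<phi> (w x) - \<psi> x)"
  obtain g \<rho> c where z': "\<And>x. - L < x \<Longrightarrow> x < 0 \<Longrightarrow>
       (z has_real_derivative g x * x * z x / \<epsilon> + \<rho> x) (at x)"
    and g: "\<And>x. - L < x \<Longrightarrow> x < 0 \<Longrightarrow> g0 \<le> g x \<and> g x \<le> g1"
    and c: "\<And>x. - L < x \<Longrightarrow> x < 0 \<Longrightarrow> f0 \<le> c x \<and> c x \<le> f1 \<and>
       \<bar>c x * \<rho> x - c0 * (\<alpha> - \<delta>C * \<epsilon>) / \<epsilon>\<bar> \<le> C * (\<bar>x\<bar> + \<bar>z x\<bar> + \<epsilon>)"
    using deviation_equation[OF adm L(2) order_refl w' box] unfolding z_def by blast
  have z: "continuous_on {-L..0} z"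
    unfolding z_def by (rule continuous_on_deviation[OF L(2) order_refl DERIV_continuous_on[OF w'] box])
  have z0: "z 0 = \<phi> (w 0) - \<phi> v0" by (simp add: z_def \<psi>_0)
  \<comment> \<open>Uses \<open>\<epsilon> \<le> sqrt \<epsilon>\<close>; the three summands are
    collected in one multiple of \<open>sqrt \<epsilon> - x\<close>, the form that the linear
    barriers take.\<close>
  have rem: "\<bar>c x * \<rho> x - c0 * (\<alpha> - \<delta>C * \<epsilon>) / \<epsilon>\<bar> \<le> N * (sqrt \<epsilon> - x)" if x: "- L < x" "x < 0" for x
  proof -
    have "\<bar>z x\<bar> \<le> K * sqrt \<epsilon>" using K x by (simp add: z_def)
    moreover have "0 \<le> K * (- x)" using K x by (intro mult_nonneg_nonneg) auto
    ultimately have "\<bar>x\<bar> + \<bar>z x\<bar> + \<epsilon> \<le> (K + 1) * (sqrt \<epsilon> - x)"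
      using x s by (simp add: algebra_simps)
    then have "C * (\<bar>x\<bar> + \<bar>z x\<bar> + \<epsilon>) \<le> N * (sqrt \<epsilon> - x)"
      using C unfolding N_def mult.assoc by (intro mult_left_mono)
    with c[OF x] show ?thesis by linarith
  qed
  have init': "\<bar>z (- L)\<bar> \<le> Ci * \<epsilon>" using init by (simp add: z_def)

  show "\<bar>\<phi> (w 0) - \<phi> v0\<bar>
        \<le> \<epsilon> * ((B + N) / f0 / g0 + Ci + 1 + ((B + N) / f0 + 1) / min (1/4) (g0 / 2))"
    if B: "\<bar>c0 * (\<alpha> - \<delta>C * \<epsilon>)\<bar> \<le> B * \<epsilon> * sqrt \<epsilon>" "0 \<le> B"
  proof -
    define R where "R = (B + N) / f0"
    have R: "0 \<le> R" using B N pos by (simp add: R_def)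
    have mu: "0 < min (1/4) (g0 / 2)" using pos by simp
    have "\<bar>z 0\<bar> \<le> \<epsilon> * ((R / g0 + Ci + 1) + (R + 1) / min (1/4) (g0 / 2))"
    proof (rule fold_bound_linear[OF \<epsilon>(1) _ z z' pos(3)])
      show "g0 \<le> g x" if "- L < x" "x < 0" for x using g that by blast
      show "R \<le> (R / g0 + Ci + 1) * g0" using pos C by (simp add: distrib_right)
      show "R < (R + 1) / min (1/4) (g0 / 2) * min (1/4) (g0 / 2)" using mu by simp
      show "0 \<le> R / g0 + Ci + 1" using R C pos by simp
      show "0 \<le> (R + 1) / min (1/4) (g0 / 2)" using R mu by simp
      have "Ci * \<epsilon> < \<epsilon> * (R / g0 + Ci + 1)"
        using \<epsilon> R pos by (simp add: distrib_left add_nonneg_pos)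
      with init' show "\<bar>z (- L)\<bar> < \<epsilon> * (R / g0 + Ci + 1)" by linarith
      fix x assume x: "- L < x" "x < 0"
      have "\<bar>c0 * (\<alpha> - \<delta>C * \<epsilon>) / \<epsilon>\<bar> \<le> B * sqrt \<epsilon>"
        using B \<epsilon> by (simp add: pos_divide_le_eq mult_ac)
      moreover have "0 \<le> B * (- x)" using B x by (intro mult_nonneg_nonneg) auto
      moreover have "(B + N) * (sqrt \<epsilon> - x) = B * sqrt \<epsilon> + B * (- x) + N * (sqrt \<epsilon> - x)"
        by (simp add: algebra_simps)
      ultimately have 1: "\<bar>c x * \<rho> x\<bar> \<le> (B + N) * (sqrt \<epsilon> - x)"
        using abs_le_by_difference[OF rem[OF x], of "B * sqrt \<epsilon>"] by linarith
      have "f0 * \<bar>\<rho> x\<bar> \<le> \<bar>c x * \<rho> x\<bar>"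
        unfolding abs_mult using c[OF x] pos by (intro mult_right_mono) auto
      with 1 have "f0 * \<bar>\<rho> x\<bar> \<le> (B + N) * (sqrt \<epsilon> - x)" by linarith
      then show "\<bar>\<rho> x\<bar> \<le> R * (sqrt \<epsilon> - x)"
        using pos by (simp add: R_def pos_le_divide_eq mult.commute)
    qed (use L in simp)
    then show ?thesis by (simp add: z0 R_def)
  qed

  show "0 < \<sigma> * (\<phi> (w 0) - \<phi> v0)"
    if \<beta>: "\<beta> * \<epsilon> * sqrt \<epsilon> \<le> \<sigma> * (c0 * (\<alpha> - \<delta>C * \<epsilon>))"
      "f1 * (N / f0 + (N / f0 / g0 + Ci + 2) * (1 + g1) + 1) \<le> \<beta>"
      and small: "(N / f0 / g0 + Ci + 2) * sqrt \<epsilon> < L"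
  proof -
    define P where "P = N / f0 / g0 + Ci + 1"
    have P: "0 \<le> N / f0" "0 \<le> P" using N C pos by (auto simp: P_def)
    have f1: "0 < f1"
      using c[of "- L / 2"] L pos by auto
    have g1: "0 < g1"
      using g[of "- L / 2"] L pos by auto
    have "0 \<le> f1 * (N / f0 + (P + 1) * (1 + g1) + 1)" using P f1 g1 by simp
    then have \<beta>0: "0 \<le> \<beta>" using \<beta>(2) by (simp add: P_def add.commute add.left_commute)
    \<comment> \<open>The lower bound is applied with \<open>Q = P + 1\<close>; the difference 1
      makes the deviation at the fold at least \<epsilon>, hence strictly of the sign
      \<sigma>.\<close>
    have "\<epsilon> * ((P + 1) - P) \<le> \<sigma> * z 0"
    proof (rule fold_lower_bound[where z="\<lambda>x. \<sigma> * z x" and \<rho>="\<lambda>x. \<sigma> * \<rho> x" and g=g and R="N / f0"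
          and S="\<beta> / f1 - N / f0", OF \<epsilon>(1) _ _ _ pos(3)])
      show "continuous_on {-L..0} (\<lambda>x. \<sigma> * z x)" by (intro continuous_intros z)
      show "((\<lambda>x. \<sigma> * z x) has_real_derivative g x * x * (\<sigma> * z x) / \<epsilon> + \<sigma> * \<rho> x) (at x)"
        if "- L < x" "x < 0" for x
        using DERIV_cmult[OF z'[OF that], of \<sigma>] by (simp add: distrib_left mult_ac)
      show "g0 \<le> g x \<and> g x \<le> g1" if "- L < x" "x < 0" for x using g that by blast
      show "N / f0 \<le> P * g0" using pos C by (simp add: P_def distrib_right)
      have "N / f0 + (P + 1) * (1 + g1) + 1 \<le> \<beta> / f1"
        using \<beta>(2) f1 by (simp add: P_def pos_le_divide_eq mult.commute add.commute add.left_commute)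
      then show "(P + 1) * (1 + g1) < \<beta> / f1 - N / f0" by linarith
      show "0 \<le> P" "0 \<le> P + 1" using P by auto
      \<comment> \<open>At -L the negative term of the barrier costs less than 1. The summand 1 in P
        pays for it, so the initial deviation still satisfies the starting condition.\<close>
      have "(P + 1) * sqrt \<epsilon> / (sqrt \<epsilon> - - L) < 1"
        using small s L by (simp add: P_def add.commute add.left_commute)
      moreover have "Ci + 1 \<le> P" using N pos by (simp add: P_def)
      ultimately have "Ci < P - (P + 1) * sqrt \<epsilon> / (sqrt \<epsilon> - - L)" by linarith
      then have "Ci * \<epsilon> < \<epsilon> * (P - (P + 1) * sqrt \<epsilon> / (sqrt \<epsilon> - - L))"
        using mult_strict_left_mono[OF _ \<epsilon>(1)] by (simp only: mult.commute[of Ci])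
      moreover have "- (\<sigma> * z (- L)) \<le> \<bar>z (- L)\<bar>" using \<sigma> by auto
      ultimately show "- (\<sigma> * z (- L)) < \<epsilon> * (P - (P + 1) * sqrt \<epsilon> / (sqrt \<epsilon> - - L))"
        using init' by linarith
      fix x assume x: "- L < x" "x < 0"
      have cx: "0 < c x" "f0 \<le> c x" "c x \<le> f1" using c[OF x] pos by auto
      have sx: "0 \<le> sqrt \<epsilon> - x" using s x by simp
      have "\<beta> * sqrt \<epsilon> \<le> \<sigma> * (c0 * (\<alpha> - \<delta>C * \<epsilon>) / \<epsilon>)"
        using \<beta>(1) \<epsilon> by (simp add: pos_le_divide_eq mult_ac)
      moreover have "\<bar>\<sigma> * (c x * \<rho> x) - \<sigma> * (c0 * (\<alpha> - \<delta>C * \<epsilon>) / \<epsilon>)\<bar> \<le> N * (sqrt \<epsilon> - x)"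
        using rem[OF x] \<sigma> by auto
      ultimately have "\<beta> * sqrt \<epsilon> - N * (sqrt \<epsilon> - x) \<le> c x * (\<sigma> * \<rho> x)"
        by (simp add: mult.left_commute abs_le_iff)
      then have "(\<beta> * sqrt \<epsilon> - N * (sqrt \<epsilon> - x)) / c x \<le> \<sigma> * \<rho> x"
        using cx by (simp add: pos_divide_le_eq mult.commute)
      \<comment> \<open>Division by c: the positive part is smallest at c = f1, the subtracted part
        is largest at c = f0. This is the origin of \<open>S = \<beta> / f1 - N / f0\<close> and
        \<open>R = N / f0\<close>.\<close>
      moreover have "\<beta> * sqrt \<epsilon> / f1 \<le> \<beta> * sqrt \<epsilon> / c x"
        using cx f1 \<beta>0 s by (intro divide_left_mono) auto
      moreover have "N * (sqrt \<epsilon> - x) / c x \<le> N * (sqrt \<epsilon> - x) / f0"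
        using cx pos N sx by (intro divide_left_mono) auto
      moreover have "(\<beta> / f1 - N / f0) * sqrt \<epsilon> + N / f0 * x
          = \<beta> * sqrt \<epsilon> / f1 - N * (sqrt \<epsilon> - x) / f0"
        by (simp add: left_diff_distrib right_diff_distrib diff_divide_distrib)
      ultimately show "(\<beta> / f1 - N / f0) * sqrt \<epsilon> + N / f0 * x \<le> \<sigma> * \<rho> x"
        unfolding diff_divide_distrib by linarith
    qed (use L in simp)
    then show ?thesis using \<epsilon> by (simp add: z0)
  qed
qed


text \<open>The field is controlled only in the box around v0. The orbit equation is therefore
  solved with v clamped to the box, where the right side is bounded and Lipschitz; afterwards the
  deviation bound shows that the clamp is never active.\<close>

lemma solution_family_exists:
  assumes \<epsilon>: "0 < \<epsilon>" and L: "0 < L" "L \<le> L0"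
    and F: "continuous_on (S \<times> {-L0..0} \<times> {v0-\<eta>..v0+\<eta>}) (\<lambda>(\<alpha>, p). F \<alpha> \<epsilon> p)"
    and S: "compact S"
    and F_pos: "\<And>\<alpha> x v. \<alpha> \<in> S \<Longrightarrow> x \<in> {-L0..0} \<Longrightarrow> \<bar>v - v0\<bar> \<le> \<eta> \<Longrightarrow> f0 \<le> c1 (F \<alpha> \<epsilon>) (x, v)"
    and Lip: "\<And>\<alpha> x u v. \<alpha> \<in> S \<Longrightarrow> x \<in> {-L0..0} \<Longrightarrow> \<bar>u - v0\<bar> \<le> \<eta> \<Longrightarrow> \<bar>v - v0\<bar> \<le> \<eta> \<Longrightarrow>
       \<bar>slope (F \<alpha> \<epsilon>) \<epsilon> x u - slope (F \<alpha> \<epsilon>) \<epsilon> x v\<bar> \<le> K * \<bar>u - v\<bar>"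
    and m: "continuous_on S m" "\<And>\<alpha>. \<alpha> \<in> S \<Longrightarrow> \<bar>m \<alpha> - v0\<bar> \<le> \<eta>"
      "\<And>\<alpha>. \<alpha> \<in> S \<Longrightarrow> \<bar>\<phi> (m \<alpha>) - \<psi> (- L)\<bar> \<le> Ci * \<epsilon>"
    and adm: "\<And>\<alpha>. \<alpha> \<in> S \<Longrightarrow> admissible D C \<alpha> \<epsilon>" and C: "0 \<le> C" "0 \<le> Ci"
    and M: "(\<bar>c0\<bar> * (D + \<bar>\<delta>C\<bar>) + C * (L0 + 3)) / f0 < M * min (1/4) (g0 / 2)"
      "Ci * (1 + L0) < M" and small: "M * sqrt \<epsilon> < d0 * \<eta> / 2"
  obtains w where "continuous_on S (\<lambda>\<alpha>. w \<alpha> 0)"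
    "\<And>\<alpha>. \<alpha> \<in> S \<Longrightarrow> w \<alpha> (- L) = m \<alpha>" "\<And>\<alpha>. \<alpha> \<in> S \<Longrightarrow> solution \<alpha> \<epsilon> L (w \<alpha>)"
    "\<And>\<alpha> x. \<alpha> \<in> S \<Longrightarrow> x \<in> {-L..0} \<Longrightarrow> \<bar>\<phi> (w \<alpha> x) - \<psi> x\<bar> \<le> M * sqrt \<epsilon>"
proof -
  define cl where "cl = (\<lambda>v. max (v0 - \<eta>) (min (v0 + \<eta>) v))"
  have cl: "cl v \<in> {v0-\<eta>..v0+\<eta>}" "\<bar>cl v - v0\<bar> \<le> \<eta>" "\<bar>cl u - cl v\<bar> \<le> \<bar>u - v\<bar>"
    "\<bar>v - v0\<bar> \<le> \<eta> \<Longrightarrow> cl v = v" for u v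
    using pos(1) by (auto simp: cl_def)
  define f where "f = (\<lambda>\<alpha> x v. slope (F \<alpha> \<epsilon>) \<epsilon> x v)"
  let ?B = "S \<times> {-L..0} \<times> {v0-\<eta>..v0+\<eta>}"
  have f: "continuous_on ?B (\<lambda>(\<alpha>, x, v). f \<alpha> x v)"
  proof -
    have F': "continuous_on ?B (\<lambda>z. F (fst z) \<epsilon> (snd z))"
      using continuous_on_subset[OF F, of ?B] L by (simp add: case_prod_unfold Sigma_mono)
    have "continuous_on ?B (\<lambda>z. c2 (F (fst z) \<epsilon>) (snd z) / (\<epsilon> * c1 (F (fst z) \<epsilon>) (snd z)))"
    proof (intro continuous_on_divide continuous_on_mult continuous_on_const
        continuous_on_fst[OF F'] continuous_on_snd[OF F'] ballI)
      fix z assume z: "z \<in> ?B"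
      have "f0 \<le> c1 (F (fst z) \<epsilon>) (fst (snd z), snd (snd z))"
        using z L by (intro F_pos) (auto simp: abs_le_iff)
      then show "\<epsilon> * c1 (F (fst z) \<epsilon>) (snd z) \<noteq> 0" using pos(4) \<epsilon> by simp
    qed
    then show ?thesis by (simp add: f_def slope_def case_prod_unfold)
  qed
  have cont: "continuous_on (S \<times> {-L..0} \<times> UNIV) (\<lambda>(\<alpha>, x, v). f \<alpha> x (cl v))"
  proof -
    have "continuous_on (S \<times> {-L..0} \<times> UNIV)
        (\<lambda>z. (\<lambda>(\<alpha>, x, v). f \<alpha> x v) (fst z, fst (snd z), cl (snd (snd z))))"
      by (rule continuous_on_compose2[OF f])
        (use cl(1) in \<open>auto simp: cl_def intro!: continuous_intros\<close>)
    then show ?thesis by (simp add: case_prod_unfold)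
  qed
  have "compact ((\<lambda>(\<alpha>, x, v). f \<alpha> x v) ` ?B)"
    by (intro compact_continuous_image f compact_Times S compact_Icc)
  then have "bounded ((\<lambda>(\<alpha>, x, v). f \<alpha> x v) ` ?B)" by (rule compact_imp_bounded)
  then obtain M0 where M0: "\<forall>y\<in>(\<lambda>(\<alpha>, x, v). f \<alpha> x v) ` ?B. norm y \<le> M0"
    unfolding bounded_iff by (elim exE)
  have f_bound: "\<bar>f \<alpha> x (cl v)\<bar> \<le> M0" if "\<alpha> \<in> S" "x \<in> {-L..0}" for \<alpha> x v
  proof -
    have "f \<alpha> x (cl v) \<in> (\<lambda>(\<alpha>, x, v). f \<alpha> x v) ` ?B"
      by (rule image_eqI[of _ _ "(\<alpha>, x, cl v)"]) (use that cl(1)[of v] in auto)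
    with M0 show ?thesis by (metis real_norm_def)
  qed
  have f_Lip: "\<bar>f \<alpha> x (cl u) - f \<alpha> x (cl v)\<bar> \<le> \<bar>K\<bar> * \<bar>u - v\<bar>"
    if "\<alpha> \<in> S" "x \<in> {-L..0}" for \<alpha> x u v
  proof -
    have "\<bar>f \<alpha> x (cl u) - f \<alpha> x (cl v)\<bar> \<le> K * \<bar>cl u - cl v\<bar>"
      unfolding f_def using that L cl(2) by (intro Lip) auto
    also have "\<dots> \<le> \<bar>K\<bar> * \<bar>u - v\<bar>" using cl(3) by (intro mult_mono) auto
    finally show ?thesis .
  qed
  obtain w where w: "continuous_on (S \<times> {-L..0}) (\<lambda>(\<alpha>, x). w \<alpha> x)"
    "\<And>\<alpha>. \<alpha> \<in> S \<Longrightarrow> w \<alpha> (- L) = m \<alpha>"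
    and w': "\<And>\<alpha> x. \<alpha> \<in> S \<Longrightarrow> x \<in> {-L..0} \<Longrightarrow>
       (w \<alpha> has_real_derivative f \<alpha> x (cl (w \<alpha> x))) (at x within {-L..0})"
    using picard_lindelof_parametric[OF _ cont m(1) f_Lip f_bound] L by auto
  have w_cont: "continuous_on {-L..0} (w \<alpha>)" if "\<alpha> \<in> S" for \<alpha>
    using w'[OF that] by (rule DERIV_continuous_on)
  have dev: "\<bar>\<phi> (w \<alpha> x) - \<psi> x\<bar> \<le> M * sqrt \<epsilon>"
    \<comment> \<open>The clamped and the true equation agree up to x as soon as the curve is in the
      box up to x, which is exactly what the continuation argument supplies.\<close>
    if \<alpha>: "\<alpha> \<in> S" and x: "x \<in> {-L..0}" and box: "\<forall>y\<in>{-L..x}. \<bar>w \<alpha> y - v0\<bar> \<le> \<eta>" for \<alpha> x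
  proof (rule deviation_le_sqrt[OF adm[OF \<alpha>] L _ _ _ _ _ C M])
    show "(w \<alpha> has_real_derivative slope (F \<alpha> \<epsilon>) \<epsilon> y (w \<alpha> y)) (at y within {-L..x})"
      if "y \<in> {-L..x}" for y
    proof -
      have y: "y \<in> {-L..0}" "cl (w \<alpha> y) = w \<alpha> y" using that x box cl(4) by auto
      have "(w \<alpha> has_real_derivative f \<alpha> y (cl (w \<alpha> y))) (at y within {-L..x})"
        by (rule has_field_derivative_subset[OF w'[OF \<alpha> y(1)]]) (use x in auto)
      then show ?thesis by (simp only: y f_def)
    qed
    show "\<bar>\<phi> (w \<alpha> (- L)) - \<psi> (- L)\<bar> \<le> Ci * \<epsilon>" using m(3)[OF \<alpha>] w(2)[OF \<alpha>] by simp
  qed (use x box in auto)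
  \<comment> \<open>While in the box, \<open>\<phi> (w \<alpha> x)\<close> differs from
    \<open>\<phi> v0\<close> by at most \<open>M * sqrt \<epsilon>\<close> from the deviation plus
    \<open>d0 * \<eta> / 2\<close> from \<psi>. Together this is less than
    \<open>d0 * \<eta>\<close>, and the expansion rate d0 of \<phi> brings w strictly
    inside.\<close>
  have box: "\<bar>w \<alpha> x - v0\<bar> - \<eta> < 0" if \<alpha>: "\<alpha> \<in> S" and x: "x \<in> {-L..0}" for \<alpha> x
  proof (rule continuation_induct[of "- L" 0 "\<lambda>x. \<bar>w \<alpha> x - v0\<bar> - \<eta>"])
    show "continuous_on {-L..0} (\<lambda>x. \<bar>w \<alpha> x - v0\<bar> - \<eta>)"
      by (intro continuous_on_diff continuous_on_rabs continuous_on_const w_cont \<alpha>)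
    show "\<bar>w \<alpha> (- L) - v0\<bar> - \<eta> \<le> 0" using m(2)[OF \<alpha>] w(2)[OF \<alpha>] by simp
    fix x assume x: "x \<in> {-L..0}" and le: "\<forall>y\<in>{-L..x}. \<bar>w \<alpha> y - v0\<bar> - \<eta> \<le> 0"
    then have "\<bar>\<phi> (w \<alpha> x) - \<psi> x\<bar> \<le> M * sqrt \<epsilon>" by (intro dev \<alpha>) auto
    moreover have "\<bar>\<psi> x - \<phi> v0\<bar> \<le> d0 * \<eta> / 2" using x L by (intro \<psi>_close) auto
    moreover have "d0 * \<bar>w \<alpha> x - v0\<bar> \<le> \<bar>\<phi> (w \<alpha> x) - \<phi> v0\<bar>"
      using le x pos by (intro \<phi>_expand) auto
    ultimately have "d0 * \<bar>w \<alpha> x - v0\<bar> < d0 * \<eta>" using small by linarith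
    then show "\<bar>w \<alpha> x - v0\<bar> - \<eta> < 0" using pos by simp
  qed (fact x)
  show thesis
  proof (rule that)
    show "continuous_on S (\<lambda>\<alpha>. w \<alpha> 0)"
    proof -
      have "continuous_on S (\<lambda>\<alpha>. (\<lambda>(\<alpha>, x). w \<alpha> x) (\<alpha>, 0))"
        by (rule continuous_on_compose2[OF w(1)]) (use L in \<open>auto intro!: continuous_intros\<close>)
      then show ?thesis by simp
    qed
    fix \<alpha> assume \<alpha>: "\<alpha> \<in> S"
    show "w \<alpha> (- L) = m \<alpha>" using w(2) \<alpha> .
    show "solution \<alpha> \<epsilon> L (w \<alpha>)"
      unfolding solution_def
    proof (intro ballI conjI)
      fix x assume x: "x \<in> {-L..0}"
      show "\<bar>w \<alpha> x - v0\<bar> < \<eta>" using box[OF \<alpha> x] by simp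
      then have "cl (w \<alpha> x) = w \<alpha> x" by (intro cl(4)) simp
      then show "(w \<alpha> has_real_derivative slope (F \<alpha> \<epsilon>) \<epsilon> x (w \<alpha> x)) (at x within {-L..0})"
        using w'[OF \<alpha> x] by (simp only: f_def)
    qed
    show "\<bar>\<phi> (w \<alpha> x) - \<psi> x\<bar> \<le> M * sqrt \<epsilon>" if x: "x \<in> {-L..0}" for x
    proof (rule dev[OF \<alpha> x], rule ballI)
      fix y assume "y \<in> {-L..x}"
      with x have "y \<in> {-L..0}" by auto
      from box[OF \<alpha> this] show "\<bar>w \<alpha> y - v0\<bar> \<le> \<eta>" by simp
    qed
  qed
qed

lemma eventually_sqrt_less:
  assumes "0 < r"
  shows "\<forall>\<^sub>F \<epsilon> in at_right 0. (c::real) * sqrt \<epsilon> < r"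
proof -
  have "((\<lambda>\<epsilon>. c * sqrt \<epsilon>) \<longlongrightarrow> c * sqrt 0) (at_right 0)"
    by (intro tendsto_intros)
  then show ?thesis using assms by (intro order_tendstoD(2)) auto
qed

text \<open>The order of the quantifiers matters: \<beta> is fixed before B, and only C' depends on
  B. The canard argument takes for B the larger of the two thresholds \<beta> that come from the two
  sides.\<close>

theorem branch_at_fold:
  assumes L: "0 < L" "L \<le> L0" and D: "0 < D"
    and m: "\<exists>C. \<forall>\<^sub>F \<epsilon> in at_right 0. continuous_on {-(D*\<epsilon>)..D*\<epsilon>} (\<lambda>\<alpha>. m \<alpha> \<epsilon>) \<and>
      (\<forall>\<alpha>\<in>{-(D*\<epsilon>)..D*\<epsilon>}. \<bar>m \<alpha> \<epsilon> - v0\<bar> \<le> \<eta> \<and> \<bar>\<phi> (m \<alpha> \<epsilon>) - \<psi> (- L)\<bar> \<le> C * \<epsilon>)"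
  shows "\<exists>C \<beta>. \<forall>B\<ge>0. \<exists>C'. \<forall>\<^sub>F \<epsilon> in at_right 0. \<exists>w.
    continuous_on {-(D*\<epsilon>)..D*\<epsilon>} (\<lambda>\<alpha>. w \<alpha> 0) \<and>
    (\<forall>\<alpha>\<in>{-(D*\<epsilon>)..D*\<epsilon>}. w \<alpha> (- L) = m \<alpha> \<epsilon> \<and> solution \<alpha> \<epsilon> L (w \<alpha>) \<and>
       \<bar>\<phi> (w \<alpha> 0) - \<phi> v0\<bar> \<le> C * sqrt \<epsilon> \<and>
       (\<forall>\<sigma>\<in>{1, -1}. \<beta> * \<epsilon> * sqrt \<epsilon> \<le> \<sigma> * (c0 * (\<alpha> - \<delta>C * \<epsilon>)) \<longrightarrow> 0 < \<sigma> * (\<phi> (w \<alpha> 0) - \<phi> v0)) \<and>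
       (\<bar>c0 * (\<alpha> - \<delta>C * \<epsilon>)\<bar> \<le> B * \<epsilon> * sqrt \<epsilon> \<longrightarrow> \<bar>\<phi> (w \<alpha> 0) - \<phi> v0\<bar> \<le> C' * \<epsilon>))"
proof -
  obtain Ci0 where Ci0: "\<forall>\<^sub>F \<epsilon> in at_right 0. continuous_on {-(D*\<epsilon>)..D*\<epsilon>} (\<lambda>\<alpha>. m \<alpha> \<epsilon>) \<and>
      (\<forall>\<alpha>\<in>{-(D*\<epsilon>)..D*\<epsilon>}. \<bar>m \<alpha> \<epsilon> - v0\<bar> \<le> \<eta> \<and> \<bar>\<phi> (m \<alpha> \<epsilon>) - \<psi> (- L)\<bar> \<le> Ci0 * \<epsilon>)"
    using m by (elim exE)
  obtain C0 where C0: "\<forall>\<^sub>F \<epsilon> in at_right 0.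
       \<forall>\<alpha>\<in>{-(D*\<epsilon>)..D*\<epsilon>}. \<forall>x\<in>{-L0..<0}. \<forall>v. \<bar>v - v0\<bar> \<le> \<eta> \<longrightarrow> (\<exists>g\<in>{g0..g1}.
          \<bar>\<phi>' v * c2 (F \<alpha> \<epsilon>) (x, v) - \<epsilon> * c1 (F \<alpha> \<epsilon>) (x, v) * \<psi>' x
            - g * x * (\<phi> v - \<psi> x) * c1 (F \<alpha> \<epsilon>) (x, v) - c0 * (\<alpha> - \<delta>C * \<epsilon>)\<bar>
          \<le> C0 * \<epsilon> * (\<bar>x\<bar> + \<bar>\<phi> v - \<psi> x\<bar> + \<epsilon>))"
    using normal_form[OF D] by (elim exE)
  define C Ci where "C = max C0 0" and "Ci = max Ci0 0"
  have C: "0 \<le> C" "0 \<le> Ci" "C0 \<le> C" "Ci0 \<le> Ci" by (auto simp: C_def Ci_def)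
  define mu where "mu = min (1/4) (g0 / 2)"
  have mu: "0 < mu" using pos by (simp add: mu_def)
  define R where "R = (\<bar>c0\<bar> * (D + \<bar>\<delta>C\<bar>) + C * (L0 + 3)) / f0"
  have R: "0 \<le> R" using C D pos by (simp add: R_def)
  \<comment> \<open>The first summand makes \<open>M * mu\<close> exceed R, the others make M exceed
    \<open>Ci * (1 + L0)\<close>: the two demands of the first round.\<close>
  define M where "M = (R + 1) / mu + Ci * (1 + L0) + 1"
  have CL: "0 \<le> Ci * (1 + L0)" using C pos by simp
  have M: "R < M * mu" "Ci * (1 + L0) < M" "0 \<le> M"
  proof -
    have "0 \<le> (R + 1) / mu" using R mu by simp
    with CL show "Ci * (1 + L0) < M" "0 \<le> M" by (simp_all add: M_def)
    have "(R + 1) / mu \<le> M" using CL by (simp add: M_def)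
    then have "R + 1 \<le> M * mu" using mu by (simp add: pos_divide_le_eq)
    then show "R < M * mu" by simp
  qed
  define N where "N = C * (M + 1)"
  define \<beta> where "\<beta> = f1 * (N / f0 + (N / f0 / g0 + Ci + 2) * (1 + g1) + 1)"
  have dm: "0 < d0 * \<eta> / 2" using pos by simp
  show ?thesis
  proof (rule exI[of _ M], rule exI[of _ \<beta>], intro allI impI)
    fix B :: real assume B: "0 \<le> B"
    define C' where "C' = (B + N) / f0 / g0 + Ci + 1 + ((B + N) / f0 + 1) / min (1/4) (g0 / 2)"
    have "\<forall>\<^sub>F \<epsilon> in at_right 0. 0 < (\<epsilon>::real)" "\<forall>\<^sub>F \<epsilon> in at_right 0. \<epsilon> < (1::real)"
      by (auto simp: eventually_at_right_less intro: eventually_at_rightI[of 0 1])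
    then have "\<forall>\<^sub>F \<epsilon> in at_right 0. \<exists>w.
    continuous_on {-(D*\<epsilon>)..D*\<epsilon>} (\<lambda>\<alpha>. w \<alpha> 0) \<and>
    (\<forall>\<alpha>\<in>{-(D*\<epsilon>)..D*\<epsilon>}. w \<alpha> (- L) = m \<alpha> \<epsilon> \<and> solution \<alpha> \<epsilon> L (w \<alpha>) \<and>
       \<bar>\<phi> (w \<alpha> 0) - \<phi> v0\<bar> \<le> M * sqrt \<epsilon> \<and>
       (\<forall>\<sigma>\<in>{1, -1}. \<beta> * \<epsilon> * sqrt \<epsilon> \<le> \<sigma> * (c0 * (\<alpha> - \<delta>C * \<epsilon>)) \<longrightarrow> 0 < \<sigma> * (\<phi> (w \<alpha> 0) - \<phi> v0)) \<and>
       (\<bar>c0 * (\<alpha> - \<delta>C * \<epsilon>)\<bar> \<le> B * \<epsilon> * sqrt \<epsilon> \<longrightarrow> \<bar>\<phi> (w \<alpha> 0) - \<phi> v0\<bar> \<le> C' * \<epsilon>))"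
      using Ci0 C0 field[OF D] eventually_sqrt_less[OF dm, of M]
        eventually_sqrt_less[OF L(1), of "N / f0 / g0 + Ci + 2"]
    proof eventually_elim
      case (elim \<epsilon>)
      let ?S = "{-(D*\<epsilon>)..D*\<epsilon>}"
      obtain K where K: "\<And>\<alpha> x u v. \<alpha> \<in> ?S \<Longrightarrow> x \<in> {-L0..0} \<Longrightarrow> \<bar>u - v0\<bar> \<le> \<eta> \<Longrightarrow> \<bar>v - v0\<bar> \<le> \<eta> \<Longrightarrow>
          \<bar>slope (F \<alpha> \<epsilon>) \<epsilon> x u - slope (F \<alpha> \<epsilon>) \<epsilon> x v\<bar> \<le> K * \<bar>u - v\<bar>"
        using elim(5) by blast
      have fb: "f0 \<le> c1 (F \<alpha> \<epsilon>) (x, v) \<and> c1 (F \<alpha> \<epsilon>) (x, v) \<le> f1"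
        if "\<alpha> \<in> ?S" "x \<in> {-L0..0}" "\<bar>v - v0\<bar> \<le> \<eta>" for \<alpha> x v
        using elim(5) that by blast
      have adm: "admissible D C \<alpha> \<epsilon>" if \<alpha>: "\<alpha> \<in> ?S" for \<alpha>
        unfolding admissible_def
      proof (intro conjI ballI allI impI)
        fix x v assume x: "x \<in> {-L0..<0}" and v: "\<bar>v - v0\<bar> \<le> \<eta>"
        then show "f0 \<le> c1 (F \<alpha> \<epsilon>) (x, v)" "c1 (F \<alpha> \<epsilon>) (x, v) \<le> f1"
          using fb[OF \<alpha>, of x v] by auto
        have "C0 * \<epsilon> * (\<bar>x\<bar> + \<bar>\<phi> v - \<psi> x\<bar> + \<epsilon>) \<le> C * \<epsilon> * (\<bar>x\<bar> + \<bar>\<phi> v - \<psi> x\<bar> + \<epsilon>)"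
          using C elim(1) by (intro mult_right_mono) auto
        with elim(4)[rule_format, OF \<alpha> x v]
        show "\<exists>g\<in>{g0..g1}.
          \<bar>\<phi>' v * c2 (F \<alpha> \<epsilon>) (x, v) - \<epsilon> * c1 (F \<alpha> \<epsilon>) (x, v) * \<psi>' x
            - g * x * (\<phi> v - \<psi> x) * c1 (F \<alpha> \<epsilon>) (x, v) - c0 * (\<alpha> - \<delta>C * \<epsilon>)\<bar>
          \<le> C * \<epsilon> * (\<bar>x\<bar> + \<bar>\<phi> v - \<psi> x\<bar> + \<epsilon>)"
          by (meson order_trans)
      qed (use elim \<alpha> in auto)
      have mi: "\<bar>\<phi> (m \<alpha> \<epsilon>) - \<psi> (- L)\<bar> \<le> Ci * \<epsilon>" if "\<alpha> \<in> ?S" for \<alpha>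
      proof -
        have "Ci0 * \<epsilon> \<le> Ci * \<epsilon>" using C elim(1) by (intro mult_right_mono) auto
        moreover have "\<bar>\<phi> (m \<alpha> \<epsilon>) - \<psi> (- L)\<bar> \<le> Ci0 * \<epsilon>" using elim(3) that by blast
        ultimately show ?thesis by linarith
      qed
      obtain w where w: "continuous_on ?S (\<lambda>\<alpha>. w \<alpha> 0)"
        "\<And>\<alpha>. \<alpha> \<in> ?S \<Longrightarrow> w \<alpha> (- L) = m \<alpha> \<epsilon>" "\<And>\<alpha>. \<alpha> \<in> ?S \<Longrightarrow> solution \<alpha> \<epsilon> L (w \<alpha>)"
        "\<And>\<alpha> x. \<alpha> \<in> ?S \<Longrightarrow> x \<in> {-L..0} \<Longrightarrow> \<bar>\<phi> (w \<alpha> x) - \<psi> x\<bar> \<le> M * sqrt \<epsilon>"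
      proof (rule solution_family_exists[where S="?S" and m="\<lambda>\<alpha>. m \<alpha> \<epsilon>" and M=M and D=D and C=C
            and Ci=Ci and K=K, OF elim(1) L])
        show "continuous_on (?S \<times> {-L0..0} \<times> {v0-\<eta>..v0+\<eta>}) (\<lambda>(\<alpha>, p). F \<alpha> \<epsilon> p)"
          using elim(5) by (rule conjunct1)
        show "continuous_on ?S (\<lambda>\<alpha>. m \<alpha> \<epsilon>)" using elim(3) by (rule conjunct1)
        show "\<bar>m \<alpha> \<epsilon> - v0\<bar> \<le> \<eta>" if "\<alpha> \<in> ?S" for \<alpha> using elim(3) that by blast
        show "(\<bar>c0\<bar> * (D + \<bar>\<delta>C\<bar>) + C * (L0 + 3)) / f0 < M * min (1/4) (g0 / 2)"
          using M(1) by (simp only: R_def mu_def)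
      qed (use fb K mi adm C M elim(6) in auto)
      show ?case
      proof (rule exI[of _ w], intro conjI ballI w impI)
        fix \<alpha> assume \<alpha>: "\<alpha> \<in> ?S"
        have "\<bar>\<phi> (w \<alpha> (- L)) - \<psi> (- L)\<bar> \<le> Ci * \<epsilon>" using mi[OF \<alpha>] w(2)[OF \<alpha>] by simp
        note dev = adm[OF \<alpha>] L w(3)[OF \<alpha>] this C(1,2) w(4)[OF \<alpha>] M(3)
        show "\<bar>\<phi> (w \<alpha> 0) - \<phi> v0\<bar> \<le> M * sqrt \<epsilon>"
          using w(4)[OF \<alpha>, of 0] L by (simp add: \<psi>_0)
        show "0 < \<sigma> * (\<phi> (w \<alpha> 0) - \<phi> v0)"
          if "\<sigma> \<in> {1, -1}" "\<beta> * \<epsilon> * sqrt \<epsilon> \<le> \<sigma> * (c0 * (\<alpha> - \<delta>C * \<epsilon>))" for \<sigma>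
          using deviation_at_fold_pos[OF dev that(1,2)] elim(7) by (simp add: \<beta>_def N_def)
        show "\<bar>\<phi> (w \<alpha> 0) - \<phi> v0\<bar> \<le> C' * \<epsilon>" if "\<bar>c0 * (\<alpha> - \<delta>C * \<epsilon>)\<bar> \<le> B * \<epsilon> * sqrt \<epsilon>"
          using deviation_at_fold_le[OF dev _ that B, of 1] by (simp add: C'_def N_def mult.commute)
      qed
    qed
    then show "\<exists>C'. \<forall>\<^sub>F \<epsilon> in at_right 0. \<exists>w.
    continuous_on {-(D*\<epsilon>)..D*\<epsilon>} (\<lambda>\<alpha>. w \<alpha> 0) \<and>
    (\<forall>\<alpha>\<in>{-(D*\<epsilon>)..D*\<epsilon>}. w \<alpha> (- L) = m \<alpha> \<epsilon> \<and> solution \<alpha> \<epsilon> L (w \<alpha>) \<and>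
       \<bar>\<phi> (w \<alpha> 0) - \<phi> v0\<bar> \<le> M * sqrt \<epsilon> \<and>
       (\<forall>\<sigma>\<in>{1, -1}. \<beta> * \<epsilon> * sqrt \<epsilon> \<le> \<sigma> * (c0 * (\<alpha> - \<delta>C * \<epsilon>)) \<longrightarrow> 0 < \<sigma> * (\<phi> (w \<alpha> 0) - \<phi> v0)) \<and>
       (\<bar>c0 * (\<alpha> - \<delta>C * \<epsilon>)\<bar> \<le> B * \<epsilon> * sqrt \<epsilon> \<longrightarrow> \<bar>\<phi> (w \<alpha> 0) - \<phi> v0\<bar> \<le> C' * \<epsilon>))"
      by (rule exI[of _ C'])
  qed
qed


text \<open>Complements \<open>admissible\<close> for a single pair of parameters:
  \<open>admissible\<close> carries the normal form and yields estimates, this one carries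
  continuity and the Lipschitz bound and yields uniqueness of trajectories.\<close>

definition regular :: "real \<Rightarrow> real \<Rightarrow> bool" where
  "regular \<alpha> \<epsilon> \<longleftrightarrow> 0 < \<epsilon> \<and> continuous_on ({-L0..0} \<times> {v0-\<eta>..v0+\<eta>}) (F \<alpha> \<epsilon>) \<and>
     (\<exists>K. \<forall>x\<in>{-L0..0}. \<forall>u v. \<bar>u - v0\<bar> \<le> \<eta> \<longrightarrow> \<bar>v - v0\<bar> \<le> \<eta> \<longrightarrow>
        \<bar>slope (F \<alpha> \<epsilon>) \<epsilon> x u - slope (F \<alpha> \<epsilon>) \<epsilon> x v\<bar> \<le> K * \<bar>u - v\<bar>) \<and>
     (\<forall>x\<in>{-L0..0}. \<forall>v. \<bar>v - v0\<bar> \<le> \<eta> \<longrightarrow>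
        f0 \<le> c1 (F \<alpha> \<epsilon>) (x, v) \<and> c1 (F \<alpha> \<epsilon>) (x, v) \<le> f1)"

lemma eventually_regular:
  assumes D: "0 < D"
  shows "\<forall>\<^sub>F \<epsilon> in at_right 0. \<forall>\<alpha>\<in>{-(D*\<epsilon>)..D*\<epsilon>}. regular \<alpha> \<epsilon>"
  using field[OF D] eventually_at_right_less[of 0]
proof eventually_elim
  case (elim \<epsilon>)
  have "regular \<alpha> \<epsilon>" if \<alpha>: "\<alpha> \<in> {-(D*\<epsilon>)..D*\<epsilon>}" for \<alpha>
    unfolding regular_def
  proof (intro conjI)
    show "0 < \<epsilon>" by (fact elim(2))
    have "continuous_on ({-L0..0} \<times> {v0-\<eta>..v0+\<eta>}) (\<lambda>p. (\<lambda>(\<alpha>, p). F \<alpha> \<epsilon> p) (\<alpha>, p))"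
      by (rule continuous_on_compose2[OF conjunct1[OF elim(1)]])
        (use \<alpha> in \<open>auto intro!: continuous_on_Pair continuous_on_const continuous_on_id\<close>)
    then show "continuous_on ({-L0..0} \<times> {v0-\<eta>..v0+\<eta>}) (F \<alpha> \<epsilon>)" by simp
    show "\<exists>K. \<forall>x\<in>{-L0..0}. \<forall>u v. \<bar>u - v0\<bar> \<le> \<eta> \<longrightarrow> \<bar>v - v0\<bar> \<le> \<eta> \<longrightarrow>
        \<bar>slope (F \<alpha> \<epsilon>) \<epsilon> x u - slope (F \<alpha> \<epsilon>) \<epsilon> x v\<bar> \<le> K * \<bar>u - v\<bar>"
      using elim(1) \<alpha> by blast
    show "\<forall>x\<in>{-L0..0}. \<forall>v. \<bar>v - v0\<bar> \<le> \<eta> \<longrightarrow>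
        f0 \<le> c1 (F \<alpha> \<epsilon>) (x, v) \<and> c1 (F \<alpha> \<epsilon>) (x, v) \<le> f1"
      using elim(1) \<alpha> by blast
  qed
  then show ?case by blast
qed

lemma continuous_on_solution: "solution \<alpha> \<epsilon> L w \<Longrightarrow> continuous_on {-L..0} w"
  by (rule DERIV_continuous_on[of _ _ "\<lambda>x. slope (F \<alpha> \<epsilon>) \<epsilon> x (w x)"]) (simp add: solution_def)

lemma continuous_on_field_along_solution:
  assumes "regular \<alpha> \<epsilon>" "solution \<alpha> \<epsilon> L w" "L \<le> L0"
  shows "continuous_on {-L..0} (\<lambda>x. c1 (F \<alpha> \<epsilon>) (x, w x))"
proof -
  have "continuous_on {-L..0} (\<lambda>x. (x, w x))"
    by (intro continuous_on_Pair continuous_on_id continuous_on_solution[OF assms(2)])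
  moreover have "(\<lambda>x. (x, w x)) ` {-L..0} \<subseteq> {-L0..0} \<times> {v0-\<eta>..v0+\<eta>}"
  proof clarify
    fix x assume x: "x \<in> {-L..0}"
    then have "\<bar>w x - v0\<bar> < \<eta>" using assms(2) by (simp add: solution_def)
    then show "x \<in> {-L0..0} \<and> w x \<in> {v0-\<eta>..v0+\<eta>}" using x assms(3) by auto
  qed
  ultimately have "continuous_on {-L..0} (\<lambda>x. F \<alpha> \<epsilon> (x, w x))"
    using assms(1) continuous_on_compose2 unfolding regular_def by blast
  then show ?thesis by (rule continuous_on_fst)
qed

text \<open>The trajectory along w starts on the graph of m over -L and runs in the direction of
  increasing x, so local invariance holds it on that graph as far as -\<kappa>.\<close>

lemma solution_eq_invariant_graph:
  assumes reg: "regular \<alpha> \<epsilon>" and sol: "solution \<alpha> \<epsilon> L w"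
    and L: "L \<le> L0" "0 \<le> \<kappa>" "\<kappa> \<le> L" and m: "w (- L) = m (- L)"
    and inv: "locally_invariant (F \<alpha> \<epsilon>) \<epsilon> W (graph_over {-L..-\<kappa>} m)"
    and W: "\<And>x v. x \<in> {-L..-\<kappa>} \<Longrightarrow> \<bar>v - v0\<bar> \<le> \<eta> \<Longrightarrow> (x, v) \<in> W"
    and x: "x \<in> {-L..-\<kappa>}"
  shows "w x = m x"
proof (rule locally_invariant_graph_unique[where w=w and m=m, OF inv _ _ _ _ _ _ _ m x])
  have sub: "{-L..-\<kappa>} \<subseteq> {-L..0}" using L by auto
  show "\<epsilon> \<noteq> 0" using reg by (simp add: regular_def)
  show "continuous_on {-L..-\<kappa>} (\<lambda>x. c1 (F \<alpha> \<epsilon>) (x, w x))"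
    using continuous_on_field_along_solution[OF reg sol L(1)] sub by (rule continuous_on_subset)
  fix x assume "x \<in> {-L..-\<kappa>}"
  with sub have x: "x \<in> {-L..0}" "x \<in> {-L..-\<kappa>}" by auto
  have wx: "(w has_real_derivative slope (F \<alpha> \<epsilon>) \<epsilon> x (w x)) (at x within {-L..0})"
    "\<bar>w x - v0\<bar> \<le> \<eta>"
    using sol x(1) by (auto simp: solution_def intro: less_imp_le)
  show "(w has_real_derivative slope (F \<alpha> \<epsilon>) \<epsilon> x (w x)) (at x within {-L..-\<kappa>})"
    using wx(1) sub by (rule has_field_derivative_subset)
  have "f0 \<le> c1 (F \<alpha> \<epsilon>) (x, w x)" using reg wx(2) x L unfolding regular_def by auto
  then show "0 < c1 (F \<alpha> \<epsilon>) (x, w x)" using pos(4) by linarith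
  show "(x, w x) \<in> W" using W x(2) wx(2) .
qed (use L in auto)

lemma solution_extension:
  assumes reg: "regular \<alpha> \<epsilon>" and sol: "solution \<alpha> \<epsilon> L w"
    and L: "L \<le> L0" "0 \<le> \<kappa>" "\<kappa> \<le> L" and m: "\<And>x. x \<in> {-L..-\<kappa>} \<Longrightarrow> w x = m x"
    and W: "\<And>x v. x \<in> {-L..0} \<Longrightarrow> \<bar>v - v0\<bar> \<le> \<eta> \<Longrightarrow> (x, v) \<in> W" "\<And>z. z \<in> W \<Longrightarrow> fst z \<in> {-L..0}"
  shows "forward_extension (F \<alpha> \<epsilon>) \<epsilon> W (graph_over {-L..-\<kappa>} m) = graph_over {-L..0} w"
proof -
  obtain K where K: "\<forall>x\<in>{-L0..0}. \<forall>u v. \<bar>u - v0\<bar> \<le> \<eta> \<longrightarrow> \<bar>v - v0\<bar> \<le> \<eta> \<longrightarrow>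
        \<bar>slope (F \<alpha> \<epsilon>) \<epsilon> x u - slope (F \<alpha> \<epsilon>) \<epsilon> x v\<bar> \<le> K * \<bar>u - v\<bar>"
    using reg unfolding regular_def by blast
  have fb: "f0 \<le> c1 (F \<alpha> \<epsilon>) (x, v) \<and> c1 (F \<alpha> \<epsilon>) (x, v) \<le> f1"
    if "x \<in> {-L..0}" "\<bar>v - v0\<bar> \<le> \<eta>" for x v
    using reg that L unfolding regular_def by auto
  have "graph_over {-L..-\<kappa>} m = graph_over {-L..-\<kappa>} w"
    using m by (force simp: graph_over_def)
  moreover have "forward_extension (F \<alpha> \<epsilon>) \<epsilon> W (graph_over {-L..-\<kappa>} w) = graph_over {-L..0} w"
  proof (rule forward_extension_graph[where ?v0.0=v0 and \<eta>=\<eta> and B=f1 and K=K])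
    show "\<epsilon> \<noteq> 0" using reg by (simp add: regular_def)
    show "continuous_on {-L..0} (\<lambda>x. c1 (F \<alpha> \<epsilon>) (x, w x))"
      by (rule continuous_on_field_along_solution[OF reg sol L(1)])
    show "0 < c1 (F \<alpha> \<epsilon>) (x, v)" if "x \<in> {-L..0}" "\<bar>v - v0\<bar> \<le> \<eta>" for x v
      using fb[OF that] pos(4) by linarith
    show "\<bar>slope (F \<alpha> \<epsilon>) \<epsilon> x u - slope (F \<alpha> \<epsilon>) \<epsilon> x v\<bar> \<le> K * \<bar>u - v\<bar>"
      if "x \<in> {-L..0}" "\<bar>u - v0\<bar> \<le> \<eta>" "\<bar>v - v0\<bar> \<le> \<eta>" for x u v
      using K that L by auto
    show "(x, w x) \<in> W" if "x \<in> {-L..0}" for x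
      using sol that by (intro W) (auto simp: solution_def intro: less_imp_le)
  qed (use sol fb L W(2) in \<open>auto simp: solution_def\<close>)
  ultimately show ?thesis by simp
qed

end

lemma graph_derivative_reversed:
  assumes w: "\<And>x. x \<in> {p..q} \<Longrightarrow> (w has_real_derivative slope F \<epsilon> x (w x)) (at x within {p..q})"
    and x: "x \<in> {-q..-p}"
  shows "((\<lambda>x. w (- x)) has_real_derivative slope (reversed F) \<epsilon> x (w (- x))) (at x within {-q..-p})"
proof -
  have "(w has_real_derivative slope F \<epsilon> (- x) (w (- x))) (at (- x) within uminus ` {-q..-p})"
    using w[of "- x"] x by simp
  moreover have "(uminus has_real_derivative - 1) (at x within {-q..-p})"
    by (auto intro!: derivative_eq_intros)
  ultimately have "((w \<circ> uminus) has_real_derivative slope F \<epsilon> (- x) (w (- x)) * - 1)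
      (at x within {-q..-p})"
    by (rule DERIV_image_chain)
  then show ?thesis by (simp add: slope_reversed o_def)
qed

section \<open>Both sides of the fold together\<close>

text \<open>The right side is the same abstract branch for the reflected field. Its critical level
  is \<open>\<psi> (- x)\<close>, whose derivative is \<open>- \<psi>' (- x)\<close>. The drive
  changes sign with the reversal of time, so c0 becomes -c0, while \<delta>C stays the same. This
  opposite response to \<alpha> is what makes the two branches cross.\<close>

locale canard_point =
  left: attracting_branch F \<phi> \<phi>' \<psi> \<psi>' v0 \<eta> L0 g0 g1 f0 f1 d0 c0 \<delta>C +
  right: attracting_branch "\<lambda>\<alpha> \<epsilon>. reversed (F \<alpha> \<epsilon>)" \<phi> \<phi>' "\<lambda>x. \<psi> (- x)" "\<lambda>x. - \<psi>' (- x)"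
    v0 \<eta> L0 g0 g1 f0 f1 d0 "- c0" \<delta>C
  for F \<phi> \<phi>' \<psi> \<psi>' v0 \<eta> L0 g0 g1 f0 f1 d0 c0 \<delta>C +
  fixes U :: "(real \<times> real) set"
  assumes c0: "c0 \<noteq> 0"
    and domain: "\<forall>\<^sub>F \<epsilon> in at_right 0. \<forall>x\<in>{-L0..L0}. \<forall>v. \<bar>v - v0\<bar> \<le> \<eta> \<longrightarrow> (x, \<epsilon> * v) \<in> U"
begin

text \<open>Branches that agree at x = 0 form one solution of the orbit equation over the whole
  interval, because the slope depends only on the common point. The forward extension of its left
  piece and the backward extension of its right piece are then both its entire graph.\<close>

lemma two_sided_extensions:
  assumes reg: "left.regular \<alpha> \<epsilon>" "right.regular \<alpha> \<epsilon>"
    and sol: "left.solution \<alpha> \<epsilon> L ws" "right.solution \<alpha> \<epsilon> L wu" and eq: "ws 0 = wu 0"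
    and L: "L \<le> L0" "0 \<le> \<kappa>" "\<kappa> \<le> L"
    and m: "\<And>x. x \<in> {-L..-\<kappa>} \<Longrightarrow> ws x = ms x" "\<And>x. x \<in> {-L..-\<kappa>} \<Longrightarrow> wu x = mu (- x)"
    and W: "\<And>x v. x \<in> {-L..L} \<Longrightarrow> \<bar>v - v0\<bar> \<le> \<eta> \<Longrightarrow> (x, v) \<in> W" "\<And>z. z \<in> W \<Longrightarrow> fst z \<in> {-L..L}"
  shows "forward_extension (F \<alpha> \<epsilon>) \<epsilon> W (graph_over {-L..-\<kappa>} ms) =
    backward_extension (F \<alpha> \<epsilon>) \<epsilon> W (graph_over {\<kappa>..L} mu)"
proof -
  \<comment> \<open>\<open>wu\<close> belongs to the reflected field, so it enters with the argument
    -x; \<open>eq\<close> makes the two pieces fit at 0.\<close>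
  define w where "w = (\<lambda>x. if x \<le> 0 then ws x else wu (- x))"
  have wl: "w x = ws x" if "x \<in> {-L..0}" for x using that by (simp add: w_def)
  have wr: "w x = wu (- x)" if "x \<in> {0..L}" for x using that eq by (auto simp: w_def)
  let ?F = "F \<alpha> \<epsilon>"
  have box: "\<bar>w x - v0\<bar> < \<eta>" if x: "x \<in> {-L..L}" for x
    using sol x by (cases "x \<le> 0") (auto simp: w_def left.solution_def right.solution_def)
  have w': "(w has_real_derivative slope ?F \<epsilon> x (w x)) (at x within {-L..L})" if x: "x \<in> {-L..L}" for x
  proof -
    have l: "(w has_real_derivative slope ?F \<epsilon> x (w x)) (at x within {-L..0})" if "x \<in> {-L..0}"
    proof -
      have "(ws has_real_derivative slope ?F \<epsilon> x (ws x)) (at x within {-L..0})"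
        using sol(1) that by (simp add: left.solution_def)
      then show ?thesis
        unfolding wl[OF that] has_field_derivative_def
        by (rule has_derivative_transform[OF that, rotated]) (rule wl)
    qed
    have r: "(w has_real_derivative slope ?F \<epsilon> x (w x)) (at x within {0..L})" if "x \<in> {0..L}"
    proof -
      have "((\<lambda>x. wu (- x)) has_real_derivative slope (reversed (reversed ?F)) \<epsilon> x (wu (- x)))
          (at x within {-0..-(-L)})"
        by (rule graph_derivative_reversed) (use sol(2) that in \<open>simp_all add: right.solution_def\<close>)
      then have "((\<lambda>x. wu (- x)) has_real_derivative slope ?F \<epsilon> x (wu (- x))) (at x within {0..L})"
        by simp
      then show ?thesis
        unfolding wr[OF that] has_field_derivative_def
        by (rule has_derivative_transform[OF that, rotated]) (rule wr)
    qed
    have un: "{-L..L} = {-L..0} \<union> {0..L}" using L by auto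
    consider "x < 0" | "x = 0" | "x > 0" by linarith
    then show ?thesis
    proof cases
      case 1
      \<comment> \<open>Here x lies outside the closed interval, the filter is trivial and every
        derivative is correct; thus the union rule covers all three cases.\<close>
      then have "(w has_real_derivative slope ?F \<epsilon> x (w x)) (at x within {0..L})"
        by (simp add: has_field_derivative_iff at_within_eq_bot_iff not_in_closure_trivial_limitI)
      with l 1 x show ?thesis unfolding un by (intro has_field_derivative_within_union) auto
    next
      case 2
      with l r x show ?thesis unfolding un by (intro has_field_derivative_within_union) auto
    next
      case 3
      then have "(w has_real_derivative slope ?F \<epsilon> x (w x)) (at x within {-L..0})"
        by (simp add: has_field_derivative_iff at_within_eq_bot_iff not_in_closure_trivial_limitI)
      with r 3 x show ?thesis unfolding un by (intro has_field_derivative_within_union) auto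
    qed
  qed
  have \<epsilon>: "\<epsilon> \<noteq> 0" using reg(1) by (simp add: left.regular_def)
  have fb: "f0 \<le> c1 ?F (x, v) \<and> c1 ?F (x, v) \<le> f1" if "x \<in> {-L..L}" "\<bar>v - v0\<bar> \<le> \<eta>" for x v
  proof (cases "x \<le> 0")
    case True
    then have "x \<in> {-L0..0}" using that L by auto
    then show ?thesis using reg(1) that unfolding left.regular_def by blast
  next
    case False
    then have "- x \<in> {-L0..0}" using that L by auto
    then have "f0 \<le> c1 (reversed ?F) (- x, v) \<and> c1 (reversed ?F) (- x, v) \<le> f1"
      using reg(2) that unfolding right.regular_def by blast
    then show ?thesis by (simp add: reversed_def)
  qed
  obtain K1 where K1: "\<forall>x\<in>{-L0..0}. \<forall>u v. \<bar>u - v0\<bar> \<le> \<eta> \<longrightarrow> \<bar>v - v0\<bar> \<le> \<eta> \<longrightarrow>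
        \<bar>slope ?F \<epsilon> x u - slope ?F \<epsilon> x v\<bar> \<le> K1 * \<bar>u - v\<bar>"
    using reg(1) unfolding left.regular_def by blast
  obtain K2 where K2: "\<forall>x\<in>{-L0..0}. \<forall>u v. \<bar>u - v0\<bar> \<le> \<eta> \<longrightarrow> \<bar>v - v0\<bar> \<le> \<eta> \<longrightarrow>
        \<bar>slope (reversed ?F) \<epsilon> x u - slope (reversed ?F) \<epsilon> x v\<bar> \<le> K2 * \<bar>u - v\<bar>"
    using reg(2) unfolding right.regular_def by blast
  define K where "K = max K1 K2"
  have Lip: "\<bar>slope ?F \<epsilon> x u - slope ?F \<epsilon> x v\<bar> \<le> K * \<bar>u - v\<bar>"
    if "x \<in> {-L..L}" "\<bar>u - v0\<bar> \<le> \<eta>" "\<bar>v - v0\<bar> \<le> \<eta>" for x u v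
  proof (cases "x \<le> 0")
    case True
    then have "x \<in> {-L0..0}" using that L by auto
    then have "\<bar>slope ?F \<epsilon> x u - slope ?F \<epsilon> x v\<bar> \<le> K1 * \<bar>u - v\<bar>" using K1 that by blast
    also have "\<dots> \<le> K * \<bar>u - v\<bar>" by (intro mult_right_mono) (auto simp: K_def)
    finally show ?thesis .
  next
    case False
    then have "- x \<in> {-L0..0}" using that L by auto
    then have "\<bar>slope (reversed ?F) \<epsilon> (- x) u - slope (reversed ?F) \<epsilon> (- x) v\<bar> \<le> K2 * \<bar>u - v\<bar>"
      using K2 that by blast
    also have "\<dots> \<le> K * \<bar>u - v\<bar>" by (intro mult_right_mono) (auto simp: K_def)
    finally show ?thesis by (simp add: slope_reversed)
  qed
  have cont: "continuous_on {-L..L} (\<lambda>x. c1 ?F (x, w x))"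
  proof -
    have "continuous_on {-L..0} (\<lambda>x. c1 ?F (x, w x))"
      by (rule continuous_on_eq[OF left.continuous_on_field_along_solution[OF reg(1) sol(1) L(1)]])
        (simp add: wl)
    moreover have "continuous_on {0..L} (\<lambda>x. c1 ?F (x, w x))"
    proof -
      have "continuous_on {0..L} (\<lambda>x. c1 (reversed ?F) (- x, wu (- x)))"
        by (rule continuous_on_compose2[OF right.continuous_on_field_along_solution[OF reg(2) sol(2) L(1)]])
          (auto intro!: continuous_on_minus continuous_on_id)
      then show ?thesis by (rule continuous_on_eq) (simp add: reversed_def wr)
    qed
    moreover have "{-L..L} = {-L..0} \<union> {0..L}" using L by auto
    ultimately show ?thesis by (simp add: continuous_on_closed_Un)
  qed
  have pos: "0 < c1 ?F (x, v)" if "x \<in> {-L..L}" "\<bar>v - v0\<bar> \<le> \<eta>" for x v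
    using fb[OF that] left.pos(4) by linarith
  have gs: "graph_over {-L..-\<kappa>} ms = graph_over {-L..-\<kappa>} w"
    using m(1) wl L unfolding graph_over_def by (intro Collect_cong) (metis atLeastAtMost_iff le_minus_iff minus_zero order_trans)
  have gu: "graph_over {\<kappa>..L} mu = graph_over {\<kappa>..L} w"
  proof -
    have "mu x = w x" if "x \<in> {\<kappa>..L}" for x using m(2)[of "- x"] wr[of x] that L by auto
    then show ?thesis by (force simp: graph_over_def)
  qed
  have "forward_extension ?F \<epsilon> W (graph_over {-L..-\<kappa>} w) = graph_over {-L..L} w"
  proof (rule forward_extension_graph[where ?v0.0=v0 and \<eta>=\<eta> and B=f1 and K=K, OF \<epsilon>])
    show "(x, w x) \<in> W" if "x \<in> {-L..L}" for x
      by (rule W(1)[OF that less_imp_le[OF box[OF that]]])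
    show "c1 ?F (x, v) \<le> f1" if "x \<in> {-L..L}" "\<bar>v - v0\<bar> \<le> \<eta>" for x v
      using fb[OF that] by blast
    show "- \<kappa> \<in> {-L..L}" using L by simp
  qed (fact w' box pos Lip cont W(2))+
  moreover have "forward_extension (reversed ?F) \<epsilon> (reflect ` W)
      (graph_over {-L..-\<kappa>} (\<lambda>x. w (- x))) = graph_over {-L..L} (\<lambda>x. w (- x))"
  proof (rule forward_extension_graph[where ?v0.0=v0 and \<eta>=\<eta> and B=f1 and K=K, OF \<epsilon>])
    show "((\<lambda>x. w (- x)) has_real_derivative slope (reversed ?F) \<epsilon> x (w (- x))) (at x within {-L..L})"
      if "x \<in> {-L..L}" for x
      using graph_derivative_reversed[of "- L" L w ?F \<epsilon> x, OF w'] that by simp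
    show "continuous_on {-L..L} (\<lambda>x. c1 (reversed ?F) (x, w (- x)))"
    proof -
      have "continuous_on {-L..L} (\<lambda>x. c1 ?F (- x, w (- x)))"
        by (rule continuous_on_compose2[OF cont]) (auto intro!: continuous_on_minus continuous_on_id)
      then show ?thesis by (simp add: reversed_def)
    qed
    show "0 < c1 (reversed ?F) (x, v)" "c1 (reversed ?F) (x, v) \<le> f1"
      if "x \<in> {-L..L}" "\<bar>v - v0\<bar> \<le> \<eta>" for x v
      using pos[of "- x" v] fb[of "- x" v] that by (auto simp: reversed_def)
    show "\<bar>slope (reversed ?F) \<epsilon> x u - slope (reversed ?F) \<epsilon> x v\<bar> \<le> K * \<bar>u - v\<bar>"
      if "x \<in> {-L..L}" "\<bar>u - v0\<bar> \<le> \<eta>" "\<bar>v - v0\<bar> \<le> \<eta>" for x u v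
      using Lip[of "- x" u v] that by (simp add: slope_reversed)
    show "(x, w (- x)) \<in> reflect ` W" if "x \<in> {-L..L}" for x
      unfolding image_reflect_iff using W(1)[of "- x" "w (- x)"] box[of "- x"] that
      by (simp add: reflect_def)
    show "fst z \<in> {-L..L}" if "z \<in> reflect ` W" for z
      using W(2)[of "reflect z"] that by (auto simp: reflect_def case_prod_unfold)
  qed (use L box in auto)
  then have "backward_extension ?F \<epsilon> W (graph_over {\<kappa>..L} w) = graph_over {-L..L} w"
    by (simp add: backward_extension_reversed reflect_image_graph)
  ultimately show ?thesis by (simp add: gs gu)
qed

end

text \<open>Adds the geometry to \<open>branch_at_fold\<close>: the solution with the initial value
  of m at -L is m itself as far as -\<kappa>, by invariance, and its graph up to x = 0 is the whole
  extension by the flow, by uniqueness. The estimates at the fold thereby become estimates for the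
  extended manifold.\<close>

theorem (in attracting_branch) fold_passage:
  assumes L: "0 < \<kappa>" "\<kappa> \<le> L" "L \<le> L0" and D: "0 < D"
    and U: "\<forall>\<^sub>F \<epsilon> in at_right 0. \<forall>x\<in>{-L0..0}. \<forall>v. \<bar>v - v0\<bar> \<le> \<eta> \<longrightarrow> (x, \<epsilon> * v) \<in> U"
    and m: "\<exists>C. \<forall>\<^sub>F \<epsilon> in at_right 0. continuous_on {-(D*\<epsilon>)..D*\<epsilon>} (\<lambda>\<alpha>. m \<alpha> \<epsilon> (- L)) \<and>
      (\<forall>\<alpha>\<in>{-(D*\<epsilon>)..D*\<epsilon>}.
         locally_invariant (F \<alpha> \<epsilon>) \<epsilon> (strip U \<epsilon> {-L..-\<kappa>}) (graph_over {-L..-\<kappa>} (m \<alpha> \<epsilon>)) \<and>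
         \<bar>m \<alpha> \<epsilon> (- L) - v0\<bar> \<le> \<eta> \<and> \<bar>\<phi> (m \<alpha> \<epsilon> (- L)) - \<psi> (- L)\<bar> \<le> C * \<epsilon>)"
  shows "\<exists>C \<beta>. \<forall>B\<ge>0. \<exists>C'. \<forall>\<^sub>F \<epsilon> in at_right 0. \<exists>w.
    continuous_on {-(D*\<epsilon>)..D*\<epsilon>} (\<lambda>\<alpha>. w \<alpha> 0) \<and>
    (\<forall>\<alpha>\<in>{-(D*\<epsilon>)..D*\<epsilon>}. regular \<alpha> \<epsilon> \<and> solution \<alpha> \<epsilon> L (w \<alpha>) \<and>
       (\<forall>x\<in>{-L..-\<kappa>}. w \<alpha> x = m \<alpha> \<epsilon> x) \<and>
       forward_extension (F \<alpha> \<epsilon>) \<epsilon> (strip U \<epsilon> {-L..0}) (graph_over {-L..-\<kappa>} (m \<alpha> \<epsilon>)) =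
         graph_over {-L..0} (w \<alpha>) \<and>
       \<bar>\<phi> (w \<alpha> 0) - \<phi> v0\<bar> \<le> C * sqrt \<epsilon> \<and>
       (\<forall>\<sigma>\<in>{1, -1}. \<beta> * \<epsilon> * sqrt \<epsilon> \<le> \<sigma> * (c0 * (\<alpha> - \<delta>C * \<epsilon>)) \<longrightarrow> 0 < \<sigma> * (\<phi> (w \<alpha> 0) - \<phi> v0)) \<and>
       (\<bar>c0 * (\<alpha> - \<delta>C * \<epsilon>)\<bar> \<le> B * \<epsilon> * sqrt \<epsilon> \<longrightarrow> \<bar>\<phi> (w \<alpha> 0) - \<phi> v0\<bar> \<le> C' * \<epsilon>))"
proof -
  have L': "0 < L" "0 \<le> \<kappa>" using L by auto
  obtain Ci where Ci: "\<forall>\<^sub>F \<epsilon> in at_right 0. continuous_on {-(D*\<epsilon>)..D*\<epsilon>} (\<lambda>\<alpha>. m \<alpha> \<epsilon> (- L)) \<and>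
      (\<forall>\<alpha>\<in>{-(D*\<epsilon>)..D*\<epsilon>}.
         locally_invariant (F \<alpha> \<epsilon>) \<epsilon> (strip U \<epsilon> {-L..-\<kappa>}) (graph_over {-L..-\<kappa>} (m \<alpha> \<epsilon>)) \<and>
         \<bar>m \<alpha> \<epsilon> (- L) - v0\<bar> \<le> \<eta> \<and> \<bar>\<phi> (m \<alpha> \<epsilon> (- L)) - \<psi> (- L)\<bar> \<le> Ci * \<epsilon>)"
    using m by (elim exE)
  have "\<exists>C. \<forall>\<^sub>F \<epsilon> in at_right 0. continuous_on {-(D*\<epsilon>)..D*\<epsilon>} (\<lambda>\<alpha>. m \<alpha> \<epsilon> (- L)) \<and>
      (\<forall>\<alpha>\<in>{-(D*\<epsilon>)..D*\<epsilon>}. \<bar>m \<alpha> \<epsilon> (- L) - v0\<bar> \<le> \<eta> \<and> \<bar>\<phi> (m \<alpha> \<epsilon> (- L)) - \<psi> (- L)\<bar> \<le> C * \<epsilon>)"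
    by (rule exI[of _ Ci], rule eventually_mono[OF Ci]) blast
  from branch_at_fold[OF L'(1) L(3) D this] obtain C \<beta> where *: "\<forall>B\<ge>0. \<exists>C'. \<forall>\<^sub>F \<epsilon> in at_right 0. \<exists>w.
    continuous_on {-(D*\<epsilon>)..D*\<epsilon>} (\<lambda>\<alpha>. w \<alpha> 0) \<and>
    (\<forall>\<alpha>\<in>{-(D*\<epsilon>)..D*\<epsilon>}. w \<alpha> (- L) = m \<alpha> \<epsilon> (- L) \<and> solution \<alpha> \<epsilon> L (w \<alpha>) \<and>
       \<bar>\<phi> (w \<alpha> 0) - \<phi> v0\<bar> \<le> C * sqrt \<epsilon> \<and>
       (\<forall>\<sigma>\<in>{1, -1}. \<beta> * \<epsilon> * sqrt \<epsilon> \<le> \<sigma> * (c0 * (\<alpha> - \<delta>C * \<epsilon>)) \<longrightarrow> 0 < \<sigma> * (\<phi> (w \<alpha> 0) - \<phi> v0)) \<and>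
       (\<bar>c0 * (\<alpha> - \<delta>C * \<epsilon>)\<bar> \<le> B * \<epsilon> * sqrt \<epsilon> \<longrightarrow> \<bar>\<phi> (w \<alpha> 0) - \<phi> v0\<bar> \<le> C' * \<epsilon>))"
    by (elim exE)
  show ?thesis
  proof (rule exI[of _ C], rule exI[of _ \<beta>], intro allI impI)
    fix B :: real assume "0 \<le> B"
    with * obtain C' where C': "\<forall>\<^sub>F \<epsilon> in at_right 0. \<exists>w.
    continuous_on {-(D*\<epsilon>)..D*\<epsilon>} (\<lambda>\<alpha>. w \<alpha> 0) \<and>
    (\<forall>\<alpha>\<in>{-(D*\<epsilon>)..D*\<epsilon>}. w \<alpha> (- L) = m \<alpha> \<epsilon> (- L) \<and> solution \<alpha> \<epsilon> L (w \<alpha>) \<and>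
       \<bar>\<phi> (w \<alpha> 0) - \<phi> v0\<bar> \<le> C * sqrt \<epsilon> \<and>
       (\<forall>\<sigma>\<in>{1, -1}. \<beta> * \<epsilon> * sqrt \<epsilon> \<le> \<sigma> * (c0 * (\<alpha> - \<delta>C * \<epsilon>)) \<longrightarrow> 0 < \<sigma> * (\<phi> (w \<alpha> 0) - \<phi> v0)) \<and>
       (\<bar>c0 * (\<alpha> - \<delta>C * \<epsilon>)\<bar> \<le> B * \<epsilon> * sqrt \<epsilon> \<longrightarrow> \<bar>\<phi> (w \<alpha> 0) - \<phi> v0\<bar> \<le> C' * \<epsilon>))"
      by (elim allE impE exE)
    show "\<exists>C'. \<forall>\<^sub>F \<epsilon> in at_right 0. \<exists>w.
    continuous_on {-(D*\<epsilon>)..D*\<epsilon>} (\<lambda>\<alpha>. w \<alpha> 0) \<and>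
    (\<forall>\<alpha>\<in>{-(D*\<epsilon>)..D*\<epsilon>}. regular \<alpha> \<epsilon> \<and> solution \<alpha> \<epsilon> L (w \<alpha>) \<and>
       (\<forall>x\<in>{-L..-\<kappa>}. w \<alpha> x = m \<alpha> \<epsilon> x) \<and>
       forward_extension (F \<alpha> \<epsilon>) \<epsilon> (strip U \<epsilon> {-L..0}) (graph_over {-L..-\<kappa>} (m \<alpha> \<epsilon>)) =
         graph_over {-L..0} (w \<alpha>) \<and>
       \<bar>\<phi> (w \<alpha> 0) - \<phi> v0\<bar> \<le> C * sqrt \<epsilon> \<and>
       (\<forall>\<sigma>\<in>{1, -1}. \<beta> * \<epsilon> * sqrt \<epsilon> \<le> \<sigma> * (c0 * (\<alpha> - \<delta>C * \<epsilon>)) \<longrightarrow> 0 < \<sigma> * (\<phi> (w \<alpha> 0) - \<phi> v0)) \<and>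
       (\<bar>c0 * (\<alpha> - \<delta>C * \<epsilon>)\<bar> \<le> B * \<epsilon> * sqrt \<epsilon> \<longrightarrow> \<bar>\<phi> (w \<alpha> 0) - \<phi> v0\<bar> \<le> C' * \<epsilon>))"
    proof (rule exI[of _ C'], use C' Ci U eventually_regular[OF D] in eventually_elim)
      case (elim \<epsilon>)
      obtain w where cw: "continuous_on {-(D*\<epsilon>)..D*\<epsilon>} (\<lambda>\<alpha>. w \<alpha> 0)" and w: "\<forall>\<alpha>\<in>{-(D*\<epsilon>)..D*\<epsilon>}.
          w \<alpha> (- L) = m \<alpha> \<epsilon> (- L) \<and> solution \<alpha> \<epsilon> L (w \<alpha>) \<and>
       \<bar>\<phi> (w \<alpha> 0) - \<phi> v0\<bar> \<le> C * sqrt \<epsilon> \<and>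
       (\<forall>\<sigma>\<in>{1, -1}. \<beta> * \<epsilon> * sqrt \<epsilon> \<le> \<sigma> * (c0 * (\<alpha> - \<delta>C * \<epsilon>)) \<longrightarrow> 0 < \<sigma> * (\<phi> (w \<alpha> 0) - \<phi> v0)) \<and>
       (\<bar>c0 * (\<alpha> - \<delta>C * \<epsilon>)\<bar> \<le> B * \<epsilon> * sqrt \<epsilon> \<longrightarrow> \<bar>\<phi> (w \<alpha> 0) - \<phi> v0\<bar> \<le> C' * \<epsilon>)"
        using elim(1) by (elim exE conjE)
      have S: "(x, v) \<in> strip U \<epsilon> I" if "x \<in> I" "x \<in> {-L..0}" "\<bar>v - v0\<bar> \<le> \<eta>" for x v I
      proof -
        have "x \<in> {-L0..0}" using that(2) L(3) by auto
        then show ?thesis using elim(3) that(1,3) by (simp add: strip_def)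
      qed
      have "regular \<alpha> \<epsilon> \<and> (\<forall>x\<in>{-L..-\<kappa>}. w \<alpha> x = m \<alpha> \<epsilon> x) \<and>
         forward_extension (F \<alpha> \<epsilon>) \<epsilon> (strip U \<epsilon> {-L..0}) (graph_over {-L..-\<kappa>} (m \<alpha> \<epsilon>)) =
           graph_over {-L..0} (w \<alpha>)" if \<alpha>: "\<alpha> \<in> {-(D*\<epsilon>)..D*\<epsilon>}" for \<alpha>
      proof -
        have reg: "regular \<alpha> \<epsilon>" and sol: "solution \<alpha> \<epsilon> L (w \<alpha>)" and init: "w \<alpha> (- L) = m \<alpha> \<epsilon> (- L)"
          and inv: "locally_invariant (F \<alpha> \<epsilon>) \<epsilon> (strip U \<epsilon> {-L..-\<kappa>}) (graph_over {-L..-\<kappa>} (m \<alpha> \<epsilon>))"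
          using w elim(2,4) \<alpha> by blast+
        have eq: "w \<alpha> x = m \<alpha> \<epsilon> x" if "x \<in> {-L..-\<kappa>}" for x
          by (rule solution_eq_invariant_graph[OF reg sol L(3) L'(2) L(2) init inv _ that])
            (rule S, use L in auto)
        have "forward_extension (F \<alpha> \<epsilon>) \<epsilon> (strip U \<epsilon> {-L..0}) (graph_over {-L..-\<kappa>} (m \<alpha> \<epsilon>)) =
           graph_over {-L..0} (w \<alpha>)"
        proof (rule solution_extension[OF reg sol L(3) L'(2) L(2) eq])
          show "(x, v) \<in> strip U \<epsilon> {-L..0}" if "x \<in> {-L..0}" "\<bar>v - v0\<bar> \<le> \<eta>" for x v
            using S[OF that(1) that] .
          show "fst z \<in> {-L..0}" if "z \<in> strip U \<epsilon> {-L..0}" for z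
            using that by (auto simp: strip_def)
        qed
        with reg eq show ?thesis by blast
      qed
      with w cw show ?case by (intro exI[of _ w]) blast
    qed
  qed
qed

context canard_point
begin

lemma \<phi>_inverse_bound:
  "\<bar>v - v0\<bar> \<le> \<eta> \<Longrightarrow> \<bar>\<phi> v - \<phi> v0\<bar> \<le> r \<Longrightarrow> \<bar>v - v0\<bar> \<le> r / d0"
  using left.\<phi>_expand[of v v0] left.pos by (simp add: pos_le_divide_eq mult.commute)

lemma right_initial_data:
  assumes mu: "\<exists>C. \<forall>\<^sub>F \<epsilon> in at_right 0. continuous_on {-(D*\<epsilon>)..D*\<epsilon>} (\<lambda>\<alpha>. mu \<alpha> \<epsilon> L) \<and>
      (\<forall>\<alpha>\<in>{-(D*\<epsilon>)..D*\<epsilon>}.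
         locally_invariant (F \<alpha> \<epsilon>) \<epsilon> (strip U \<epsilon> {\<kappa>..L}) (graph_over {\<kappa>..L} (mu \<alpha> \<epsilon>)) \<and>
         \<bar>mu \<alpha> \<epsilon> L - v0\<bar> \<le> \<eta> \<and> \<bar>\<phi> (mu \<alpha> \<epsilon> L) - \<psi> L\<bar> \<le> C * \<epsilon>)"
  shows "\<exists>C. \<forall>\<^sub>F \<epsilon> in at_right 0. continuous_on {-(D*\<epsilon>)..D*\<epsilon>} (\<lambda>\<alpha>. mu \<alpha> \<epsilon> (- (- L))) \<and>
      (\<forall>\<alpha>\<in>{-(D*\<epsilon>)..D*\<epsilon>}.
         locally_invariant (reversed (F \<alpha> \<epsilon>)) \<epsilon> (strip (reflect ` U) \<epsilon> {-L..-\<kappa>})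
           (graph_over {-L..-\<kappa>} (\<lambda>x. mu \<alpha> \<epsilon> (- x))) \<and>
         \<bar>mu \<alpha> \<epsilon> (- (- L)) - v0\<bar> \<le> \<eta> \<and> \<bar>\<phi> (mu \<alpha> \<epsilon> (- (- L))) - \<psi> (- (- L))\<bar> \<le> C * \<epsilon>)"
proof -
  have "locally_invariant (reversed (F \<alpha> \<epsilon>)) \<epsilon> (strip (reflect ` U) \<epsilon> {-L..-\<kappa>})
           (graph_over {-L..-\<kappa>} (\<lambda>x. mu \<alpha> \<epsilon> (- x)))"
    if "locally_invariant (F \<alpha> \<epsilon>) \<epsilon> (strip U \<epsilon> {\<kappa>..L}) (graph_over {\<kappa>..L} (mu \<alpha> \<epsilon>))" for \<alpha> \<epsilon>
    using locally_invariant_reversed[OF that] by (simp add: reflect_image_strip reflect_image_graph)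
  then show ?thesis
    unfolding minus_minus by (intro ex_forward[OF mu]) (elim eventually_mono, blast)
qed

lemma domain_left: "\<forall>\<^sub>F \<epsilon> in at_right 0. \<forall>x\<in>{-L0..0}. \<forall>v. \<bar>v - v0\<bar> \<le> \<eta> \<longrightarrow> (x, \<epsilon> * v) \<in> U"
  using domain left.pos by (elim eventually_mono) auto

lemma domain_right:
  "\<forall>\<^sub>F \<epsilon> in at_right 0. \<forall>x\<in>{-L0..0}. \<forall>v. \<bar>v - v0\<bar> \<le> \<eta> \<longrightarrow> (x, \<epsilon> * v) \<in> reflect ` U"
  using domain
proof eventually_elim
  case (elim \<epsilon>)
  have "reflect (x, \<epsilon> * v) \<in> U" if "x \<in> {-L0..0}" "\<bar>v - v0\<bar> \<le> \<eta>" for x v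
    using elim that by (simp add: reflect_def)
  then show ?case by simp
qed

lemma backward_extension_eq:
  assumes "forward_extension (reversed (F \<alpha> \<epsilon>)) \<epsilon> (strip (reflect ` U) \<epsilon> {-L..0})
      (graph_over {-L..-\<kappa>} (\<lambda>x. m (- x))) = graph_over {-L..0} w"
  shows "backward_extension (F \<alpha> \<epsilon>) \<epsilon> (strip U \<epsilon> {0..L}) (graph_over {\<kappa>..L} m)
    = graph_over {0..L} (\<lambda>x. w (- x))"
  using assms by (simp add: backward_extension_reversed reflect_image_strip reflect_image_graph)

theorem branch_extensions:
  assumes L: "0 < \<kappa>" "\<kappa> \<le> L" "L \<le> L0" and D: "0 < D"
    and ms: "\<exists>C. \<forall>\<^sub>F \<epsilon> in at_right 0. continuous_on {-(D*\<epsilon>)..D*\<epsilon>} (\<lambda>\<alpha>. ms \<alpha> \<epsilon> (- L)) \<and>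
      (\<forall>\<alpha>\<in>{-(D*\<epsilon>)..D*\<epsilon>}.
         locally_invariant (F \<alpha> \<epsilon>) \<epsilon> (strip U \<epsilon> {-L..-\<kappa>}) (graph_over {-L..-\<kappa>} (ms \<alpha> \<epsilon>)) \<and>
         \<bar>ms \<alpha> \<epsilon> (- L) - v0\<bar> \<le> \<eta> \<and> \<bar>\<phi> (ms \<alpha> \<epsilon> (- L)) - \<psi> (- L)\<bar> \<le> C * \<epsilon>)"
    and mu: "\<exists>C. \<forall>\<^sub>F \<epsilon> in at_right 0. continuous_on {-(D*\<epsilon>)..D*\<epsilon>} (\<lambda>\<alpha>. mu \<alpha> \<epsilon> L) \<and>
      (\<forall>\<alpha>\<in>{-(D*\<epsilon>)..D*\<epsilon>}.
         locally_invariant (F \<alpha> \<epsilon>) \<epsilon> (strip U \<epsilon> {\<kappa>..L}) (graph_over {\<kappa>..L} (mu \<alpha> \<epsilon>)) \<and>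
         \<bar>mu \<alpha> \<epsilon> L - v0\<bar> \<le> \<eta> \<and> \<bar>\<phi> (mu \<alpha> \<epsilon> L) - \<psi> L\<bar> \<le> C * \<epsilon>)"
  shows "\<exists>C. \<forall>\<^sub>F \<epsilon> in at_right 0. \<forall>\<alpha>\<in>{-(D*\<epsilon>)..D*\<epsilon>}.
    (\<exists>w. continuous_on {-L..0} w \<and> (\<forall>x\<in>{-L..-\<kappa>}. w x = ms \<alpha> \<epsilon> x) \<and>
       forward_extension (F \<alpha> \<epsilon>) \<epsilon> (strip U \<epsilon> {-L..0}) (graph_over {-L..-\<kappa>} (ms \<alpha> \<epsilon>)) =
         graph_over {-L..0} w \<and> \<bar>w 0 - v0\<bar> \<le> C * sqrt \<epsilon>) \<and>
    (\<exists>w. continuous_on {0..L} w \<and> (\<forall>x\<in>{\<kappa>..L}. w x = mu \<alpha> \<epsilon> x) \<and>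
       backward_extension (F \<alpha> \<epsilon>) \<epsilon> (strip U \<epsilon> {0..L}) (graph_over {\<kappa>..L} (mu \<alpha> \<epsilon>)) =
         graph_over {0..L} w \<and> \<bar>w 0 - v0\<bar> \<le> C * sqrt \<epsilon>)"
proof -
  have zero: "0 \<in> {-L..0}" using L by simp
  \<comment> \<open>The instance B = 0 is taken; what is read off from it below is the bound of
    order \<open>sqrt \<epsilon>\<close>.\<close>
  obtain Cs Cs' \<beta>s where s: "\<forall>\<^sub>F \<epsilon> in at_right 0. \<exists>w.
    continuous_on {-(D*\<epsilon>)..D*\<epsilon>} (\<lambda>\<alpha>. w \<alpha> 0) \<and>
    (\<forall>\<alpha>\<in>{-(D*\<epsilon>)..D*\<epsilon>}. left.regular \<alpha> \<epsilon> \<and> left.solution \<alpha> \<epsilon> L (w \<alpha>) \<and>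
       (\<forall>x\<in>{-L..-\<kappa>}. w \<alpha> x = ms \<alpha> \<epsilon> x) \<and>
       forward_extension (F \<alpha> \<epsilon>) \<epsilon> (strip U \<epsilon> {-L..0}) (graph_over {-L..-\<kappa>} (ms \<alpha> \<epsilon>)) =
         graph_over {-L..0} (w \<alpha>) \<and>
       \<bar>\<phi> (w \<alpha> 0) - \<phi> v0\<bar> \<le> Cs * sqrt \<epsilon> \<and>
       (\<forall>\<sigma>\<in>{1, -1}. \<beta>s * \<epsilon> * sqrt \<epsilon> \<le> \<sigma> * (c0 * (\<alpha> - \<delta>C * \<epsilon>)) \<longrightarrow> 0 < \<sigma> * (\<phi> (w \<alpha> 0) - \<phi> v0)) \<and>
       (\<bar>c0 * (\<alpha> - \<delta>C * \<epsilon>)\<bar> \<le> 0 * \<epsilon> * sqrt \<epsilon> \<longrightarrow> \<bar>\<phi> (w \<alpha> 0) - \<phi> v0\<bar> \<le> Cs' * \<epsilon>))"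
    using left.fold_passage[OF L D domain_left ms] by blast
  obtain Cu Cu' \<beta>u where u: "\<forall>\<^sub>F \<epsilon> in at_right 0. \<exists>w.
    continuous_on {-(D*\<epsilon>)..D*\<epsilon>} (\<lambda>\<alpha>. w \<alpha> 0) \<and>
    (\<forall>\<alpha>\<in>{-(D*\<epsilon>)..D*\<epsilon>}. right.regular \<alpha> \<epsilon> \<and> right.solution \<alpha> \<epsilon> L (w \<alpha>) \<and>
       (\<forall>x\<in>{-L..-\<kappa>}. w \<alpha> x = mu \<alpha> \<epsilon> (- x)) \<and>
       forward_extension (reversed (F \<alpha> \<epsilon>)) \<epsilon> (strip (reflect ` U) \<epsilon> {-L..0})
         (graph_over {-L..-\<kappa>} (\<lambda>x. mu \<alpha> \<epsilon> (- x))) = graph_over {-L..0} (w \<alpha>) \<and>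
       \<bar>\<phi> (w \<alpha> 0) - \<phi> v0\<bar> \<le> Cu * sqrt \<epsilon> \<and>
       (\<forall>\<sigma>\<in>{1, -1}. \<beta>u * \<epsilon> * sqrt \<epsilon> \<le> \<sigma> * (- c0 * (\<alpha> - \<delta>C * \<epsilon>)) \<longrightarrow> 0 < \<sigma> * (\<phi> (w \<alpha> 0) - \<phi> v0)) \<and>
       (\<bar>- c0 * (\<alpha> - \<delta>C * \<epsilon>)\<bar> \<le> 0 * \<epsilon> * sqrt \<epsilon> \<longrightarrow> \<bar>\<phi> (w \<alpha> 0) - \<phi> v0\<bar> \<le> Cu' * \<epsilon>))"
    using right.fold_passage[OF L D domain_right right_initial_data[OF mu]] by blast
  define C where "C = max (Cs / d0) (Cu / d0)"
  show ?thesis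
  proof (rule exI[of _ C], use s u eventually_at_right_less[of 0] in eventually_elim)
    case (elim \<epsilon>)
    have le: "Cs * sqrt \<epsilon> / d0 \<le> C * sqrt \<epsilon>" "Cu * sqrt \<epsilon> / d0 \<le> C * sqrt \<epsilon>"
      using mult_right_mono[of "Cs / d0" C "sqrt \<epsilon>"] mult_right_mono[of "Cu / d0" C "sqrt \<epsilon>"] elim(3)
      by (simp_all add: C_def)
    show ?case
    proof (intro ballI conjI)
      fix \<alpha> assume \<alpha>: "\<alpha> \<in> {-(D*\<epsilon>)..D*\<epsilon>}"
      obtain w where w: "left.solution \<alpha> \<epsilon> L w" "\<forall>x\<in>{-L..-\<kappa>}. w x = ms \<alpha> \<epsilon> x"
        "forward_extension (F \<alpha> \<epsilon>) \<epsilon> (strip U \<epsilon> {-L..0}) (graph_over {-L..-\<kappa>} (ms \<alpha> \<epsilon>)) =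
           graph_over {-L..0} w" "\<bar>\<phi> (w 0) - \<phi> v0\<bar> \<le> Cs * sqrt \<epsilon>"
        using elim(1) \<alpha> by blast
      have "\<bar>w 0 - v0\<bar> \<le> \<eta>" using w(1) zero by (auto simp: left.solution_def intro: less_imp_le)
      from order_trans[OF \<phi>_inverse_bound[OF this w(4)] le(1)] left.continuous_on_solution[OF w(1)] w(2,3)
      show "\<exists>w. continuous_on {-L..0} w \<and> (\<forall>x\<in>{-L..-\<kappa>}. w x = ms \<alpha> \<epsilon> x) \<and>
       forward_extension (F \<alpha> \<epsilon>) \<epsilon> (strip U \<epsilon> {-L..0}) (graph_over {-L..-\<kappa>} (ms \<alpha> \<epsilon>)) =
         graph_over {-L..0} w \<and> \<bar>w 0 - v0\<bar> \<le> C * sqrt \<epsilon>" by (intro exI[of _ w] conjI)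
    next
      fix \<alpha> assume \<alpha>: "\<alpha> \<in> {-(D*\<epsilon>)..D*\<epsilon>}"
      obtain w where w: "right.solution \<alpha> \<epsilon> L w" "\<forall>x\<in>{-L..-\<kappa>}. w x = mu \<alpha> \<epsilon> (- x)"
        "forward_extension (reversed (F \<alpha> \<epsilon>)) \<epsilon> (strip (reflect ` U) \<epsilon> {-L..0})
         (graph_over {-L..-\<kappa>} (\<lambda>x. mu \<alpha> \<epsilon> (- x))) = graph_over {-L..0} w"
        "\<bar>\<phi> (w 0) - \<phi> v0\<bar> \<le> Cu * sqrt \<epsilon>"
        using elim(2) \<alpha> by blast
      have "\<bar>w 0 - v0\<bar> \<le> \<eta>" using w(1) zero by (auto simp: right.solution_def intro: less_imp_le)
      from order_trans[OF \<phi>_inverse_bound[OF this w(4)] le(2)]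
      have "\<bar>w (- 0) - v0\<bar> \<le> C * sqrt \<epsilon>" by simp
      moreover have "continuous_on {0..L} (\<lambda>x. w (- x))"
        by (rule continuous_on_compose2[OF right.continuous_on_solution[OF w(1)]])
          (auto intro!: continuous_on_minus continuous_on_id)
      moreover have "\<forall>x\<in>{\<kappa>..L}. w (- x) = mu \<alpha> \<epsilon> x" using w(2) by simp
      ultimately
      show "\<exists>w. continuous_on {0..L} w \<and> (\<forall>x\<in>{\<kappa>..L}. w x = mu \<alpha> \<epsilon> x) \<and>
       backward_extension (F \<alpha> \<epsilon>) \<epsilon> (strip U \<epsilon> {0..L}) (graph_over {\<kappa>..L} (mu \<alpha> \<epsilon>)) =
         graph_over {0..L} w \<and> \<bar>w 0 - v0\<bar> \<le> C * sqrt \<epsilon>"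
        using backward_extension_eq[OF w(3)] by (intro exI[of _ "\<lambda>x. w (- x)"] conjI)
    qed
  qed
qed

text \<open>Only the values at x = 0 have to be matched; by \<open>two_sided_extensions\<close> a
  match there already makes the two extended manifolds coincide over the entire interval.\<close>

theorem canard_existence:
  assumes L: "0 < \<kappa>" "\<kappa> \<le> L" "L \<le> L0"
    and ms: "\<And>D. 0 < D \<Longrightarrow> \<exists>C. \<forall>\<^sub>F \<epsilon> in at_right 0. continuous_on {-(D*\<epsilon>)..D*\<epsilon>} (\<lambda>\<alpha>. ms \<alpha> \<epsilon> (- L)) \<and>
      (\<forall>\<alpha>\<in>{-(D*\<epsilon>)..D*\<epsilon>}.
         locally_invariant (F \<alpha> \<epsilon>) \<epsilon> (strip U \<epsilon> {-L..-\<kappa>}) (graph_over {-L..-\<kappa>} (ms \<alpha> \<epsilon>)) \<and>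
         \<bar>ms \<alpha> \<epsilon> (- L) - v0\<bar> \<le> \<eta> \<and> \<bar>\<phi> (ms \<alpha> \<epsilon> (- L)) - \<psi> (- L)\<bar> \<le> C * \<epsilon>)"
    and mu: "\<And>D. 0 < D \<Longrightarrow> \<exists>C. \<forall>\<^sub>F \<epsilon> in at_right 0. continuous_on {-(D*\<epsilon>)..D*\<epsilon>} (\<lambda>\<alpha>. mu \<alpha> \<epsilon> L) \<and>
      (\<forall>\<alpha>\<in>{-(D*\<epsilon>)..D*\<epsilon>}.
         locally_invariant (F \<alpha> \<epsilon>) \<epsilon> (strip U \<epsilon> {\<kappa>..L}) (graph_over {\<kappa>..L} (mu \<alpha> \<epsilon>)) \<and>
         \<bar>mu \<alpha> \<epsilon> L - v0\<bar> \<le> \<eta> \<and> \<bar>\<phi> (mu \<alpha> \<epsilon> L) - \<psi> L\<bar> \<le> C * \<epsilon>)"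
  shows "\<exists>\<alpha>C C. \<forall>\<^sub>F \<epsilon> in at_right 0. \<bar>\<alpha>C \<epsilon> - \<delta>C * \<epsilon>\<bar> \<le> C * (\<epsilon> * sqrt \<epsilon>) \<and>
    forward_extension (F (\<alpha>C \<epsilon>) \<epsilon>) \<epsilon> (strip U \<epsilon> {-L..L}) (graph_over {-L..-\<kappa>} (ms (\<alpha>C \<epsilon>) \<epsilon>)) =
      backward_extension (F (\<alpha>C \<epsilon>) \<epsilon>) \<epsilon> (strip U \<epsilon> {-L..L}) (graph_over {\<kappa>..L} (mu (\<alpha>C \<epsilon>) \<epsilon>)) \<and>
    (\<exists>ws wu. forward_extension (F (\<alpha>C \<epsilon>) \<epsilon>) \<epsilon> (strip U \<epsilon> {-L..0})
        (graph_over {-L..-\<kappa>} (ms (\<alpha>C \<epsilon>) \<epsilon>)) = graph_over {-L..0} ws \<and>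
      backward_extension (F (\<alpha>C \<epsilon>) \<epsilon>) \<epsilon> (strip U \<epsilon> {0..L})
        (graph_over {\<kappa>..L} (mu (\<alpha>C \<epsilon>) \<epsilon>)) = graph_over {0..L} wu \<and>
      wu 0 = ws 0 \<and> \<bar>ws 0 - v0\<bar> \<le> C * \<epsilon>)"
proof -
  have zero: "0 \<in> {-L..0}" using L by simp
  \<comment> \<open>The window around \<open>\<delta>C * \<epsilon>\<close> has a half-width below
    \<epsilon> for small \<epsilon>, so this D covers it.\<close>
  define D where "D = \<bar>\<delta>C\<bar> + 1"
  have D: "0 < D" by (simp add: D_def)
  obtain Cs \<beta>s where s: "\<forall>B\<ge>0. \<exists>Cs'. \<forall>\<^sub>F \<epsilon> in at_right 0. \<exists>w.
    continuous_on {-(D*\<epsilon>)..D*\<epsilon>} (\<lambda>\<alpha>. w \<alpha> 0) \<and>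
    (\<forall>\<alpha>\<in>{-(D*\<epsilon>)..D*\<epsilon>}. left.regular \<alpha> \<epsilon> \<and> left.solution \<alpha> \<epsilon> L (w \<alpha>) \<and>
       (\<forall>x\<in>{-L..-\<kappa>}. w \<alpha> x = ms \<alpha> \<epsilon> x) \<and>
       forward_extension (F \<alpha> \<epsilon>) \<epsilon> (strip U \<epsilon> {-L..0}) (graph_over {-L..-\<kappa>} (ms \<alpha> \<epsilon>)) =
         graph_over {-L..0} (w \<alpha>) \<and>
       \<bar>\<phi> (w \<alpha> 0) - \<phi> v0\<bar> \<le> Cs * sqrt \<epsilon> \<and>
       (\<forall>\<sigma>\<in>{1, -1}. \<beta>s * \<epsilon> * sqrt \<epsilon> \<le> \<sigma> * (c0 * (\<alpha> - \<delta>C * \<epsilon>)) \<longrightarrow> 0 < \<sigma> * (\<phi> (w \<alpha> 0) - \<phi> v0)) \<and>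
       (\<bar>c0 * (\<alpha> - \<delta>C * \<epsilon>)\<bar> \<le> B * \<epsilon> * sqrt \<epsilon> \<longrightarrow> \<bar>\<phi> (w \<alpha> 0) - \<phi> v0\<bar> \<le> Cs' * \<epsilon>))"
    using left.fold_passage[OF L D domain_left ms[OF D]] by (elim exE)
  obtain Cu \<beta>u where u: "\<forall>B\<ge>0. \<exists>Cu'. \<forall>\<^sub>F \<epsilon> in at_right 0. \<exists>w.
    continuous_on {-(D*\<epsilon>)..D*\<epsilon>} (\<lambda>\<alpha>. w \<alpha> 0) \<and>
    (\<forall>\<alpha>\<in>{-(D*\<epsilon>)..D*\<epsilon>}. right.regular \<alpha> \<epsilon> \<and> right.solution \<alpha> \<epsilon> L (w \<alpha>) \<and>
       (\<forall>x\<in>{-L..-\<kappa>}. w \<alpha> x = mu \<alpha> \<epsilon> (- x)) \<and>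
       forward_extension (reversed (F \<alpha> \<epsilon>)) \<epsilon> (strip (reflect ` U) \<epsilon> {-L..0})
         (graph_over {-L..-\<kappa>} (\<lambda>x. mu \<alpha> \<epsilon> (- x))) = graph_over {-L..0} (w \<alpha>) \<and>
       \<bar>\<phi> (w \<alpha> 0) - \<phi> v0\<bar> \<le> Cu * sqrt \<epsilon> \<and>
       (\<forall>\<sigma>\<in>{1, -1}. \<beta>u * \<epsilon> * sqrt \<epsilon> \<le> \<sigma> * (- c0 * (\<alpha> - \<delta>C * \<epsilon>)) \<longrightarrow> 0 < \<sigma> * (\<phi> (w \<alpha> 0) - \<phi> v0)) \<and>
       (\<bar>- c0 * (\<alpha> - \<delta>C * \<epsilon>)\<bar> \<le> B * \<epsilon> * sqrt \<epsilon> \<longrightarrow> \<bar>\<phi> (w \<alpha> 0) - \<phi> v0\<bar> \<le> Cu' * \<epsilon>))"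
    using right.fold_passage[OF L D domain_right right_initial_data[OF mu[OF D]]] by (elim exE)
  \<comment> \<open>One threshold for both sides, nonnegative so that it may also serve as the
    constant B of \<open>fold_passage\<close>. The same \<beta> then gives the signs at the ends of
    the window and the bound of order \<epsilon> inside it.\<close>
  define \<beta> where "\<beta> = max (max \<beta>s \<beta>u) 0"
  have \<beta>: "0 \<le> \<beta>" "\<beta>s \<le> \<beta>" "\<beta>u \<le> \<beta>" by (auto simp: \<beta>_def)
  obtain Cs' where s': "\<forall>\<^sub>F \<epsilon> in at_right 0. \<exists>w.
    continuous_on {-(D*\<epsilon>)..D*\<epsilon>} (\<lambda>\<alpha>. w \<alpha> 0) \<and>
    (\<forall>\<alpha>\<in>{-(D*\<epsilon>)..D*\<epsilon>}. left.regular \<alpha> \<epsilon> \<and> left.solution \<alpha> \<epsilon> L (w \<alpha>) \<and>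
       (\<forall>x\<in>{-L..-\<kappa>}. w \<alpha> x = ms \<alpha> \<epsilon> x) \<and>
       forward_extension (F \<alpha> \<epsilon>) \<epsilon> (strip U \<epsilon> {-L..0}) (graph_over {-L..-\<kappa>} (ms \<alpha> \<epsilon>)) =
         graph_over {-L..0} (w \<alpha>) \<and>
       \<bar>\<phi> (w \<alpha> 0) - \<phi> v0\<bar> \<le> Cs * sqrt \<epsilon> \<and>
       (\<forall>\<sigma>\<in>{1, -1}. \<beta>s * \<epsilon> * sqrt \<epsilon> \<le> \<sigma> * (c0 * (\<alpha> - \<delta>C * \<epsilon>)) \<longrightarrow> 0 < \<sigma> * (\<phi> (w \<alpha> 0) - \<phi> v0)) \<and>
       (\<bar>c0 * (\<alpha> - \<delta>C * \<epsilon>)\<bar> \<le> \<beta> * \<epsilon> * sqrt \<epsilon> \<longrightarrow> \<bar>\<phi> (w \<alpha> 0) - \<phi> v0\<bar> \<le> Cs' * \<epsilon>))"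
    using s[rule_format, OF \<beta>(1)] by (elim exE)
  obtain Cu' where u': "\<forall>\<^sub>F \<epsilon> in at_right 0. \<exists>w.
    continuous_on {-(D*\<epsilon>)..D*\<epsilon>} (\<lambda>\<alpha>. w \<alpha> 0) \<and>
    (\<forall>\<alpha>\<in>{-(D*\<epsilon>)..D*\<epsilon>}. right.regular \<alpha> \<epsilon> \<and> right.solution \<alpha> \<epsilon> L (w \<alpha>) \<and>
       (\<forall>x\<in>{-L..-\<kappa>}. w \<alpha> x = mu \<alpha> \<epsilon> (- x)) \<and>
       forward_extension (reversed (F \<alpha> \<epsilon>)) \<epsilon> (strip (reflect ` U) \<epsilon> {-L..0})
         (graph_over {-L..-\<kappa>} (\<lambda>x. mu \<alpha> \<epsilon> (- x))) = graph_over {-L..0} (w \<alpha>) \<and>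
       \<bar>\<phi> (w \<alpha> 0) - \<phi> v0\<bar> \<le> Cu * sqrt \<epsilon> \<and>
       (\<forall>\<sigma>\<in>{1, -1}. \<beta>u * \<epsilon> * sqrt \<epsilon> \<le> \<sigma> * (- c0 * (\<alpha> - \<delta>C * \<epsilon>)) \<longrightarrow> 0 < \<sigma> * (\<phi> (w \<alpha> 0) - \<phi> v0)) \<and>
       (\<bar>- c0 * (\<alpha> - \<delta>C * \<epsilon>)\<bar> \<le> \<beta> * \<epsilon> * sqrt \<epsilon> \<longrightarrow> \<bar>\<phi> (w \<alpha> 0) - \<phi> v0\<bar> \<le> Cu' * \<epsilon>))"
    using u[rule_format, OF \<beta>(1)] by (elim exE)
  define C where "C = max \<bar>\<beta> / c0\<bar> (Cs' / d0)"
  define P where "P = (\<lambda>\<epsilon> \<alpha>. \<bar>\<alpha> - \<delta>C * \<epsilon>\<bar> \<le> C * (\<epsilon> * sqrt \<epsilon>) \<and>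
    forward_extension (F \<alpha> \<epsilon>) \<epsilon> (strip U \<epsilon> {-L..L}) (graph_over {-L..-\<kappa>} (ms \<alpha> \<epsilon>)) =
      backward_extension (F \<alpha> \<epsilon>) \<epsilon> (strip U \<epsilon> {-L..L}) (graph_over {\<kappa>..L} (mu \<alpha> \<epsilon>)) \<and>
    (\<exists>ws wu. forward_extension (F \<alpha> \<epsilon>) \<epsilon> (strip U \<epsilon> {-L..0})
        (graph_over {-L..-\<kappa>} (ms \<alpha> \<epsilon>)) = graph_over {-L..0} ws \<and>
      backward_extension (F \<alpha> \<epsilon>) \<epsilon> (strip U \<epsilon> {0..L})
        (graph_over {\<kappa>..L} (mu \<alpha> \<epsilon>)) = graph_over {0..L} wu \<and>
      wu 0 = ws 0 \<and> \<bar>ws 0 - v0\<bar> \<le> C * \<epsilon>))"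
  have "\<forall>\<^sub>F \<epsilon> in at_right 0. \<exists>\<alpha>. P \<epsilon> \<alpha>"
    using s' u' eventually_at_right_less[of 0] domain left.eventually_sqrt_less[OF zero_less_one, of "\<bar>\<beta> / c0\<bar>"]
  proof eventually_elim
    case (elim \<epsilon>)
    let ?S = "{-(D*\<epsilon>)..D*\<epsilon>}"
    obtain ws where cws: "continuous_on ?S (\<lambda>\<alpha>. ws \<alpha> 0)" and ws: "\<forall>\<alpha>\<in>?S.
       left.regular \<alpha> \<epsilon> \<and> left.solution \<alpha> \<epsilon> L (ws \<alpha>) \<and>
       (\<forall>x\<in>{-L..-\<kappa>}. ws \<alpha> x = ms \<alpha> \<epsilon> x) \<and>
       forward_extension (F \<alpha> \<epsilon>) \<epsilon> (strip U \<epsilon> {-L..0}) (graph_over {-L..-\<kappa>} (ms \<alpha> \<epsilon>)) =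
         graph_over {-L..0} (ws \<alpha>) \<and>
       \<bar>\<phi> (ws \<alpha> 0) - \<phi> v0\<bar> \<le> Cs * sqrt \<epsilon> \<and>
       (\<forall>\<sigma>\<in>{1, -1}. \<beta>s * \<epsilon> * sqrt \<epsilon> \<le> \<sigma> * (c0 * (\<alpha> - \<delta>C * \<epsilon>)) \<longrightarrow> 0 < \<sigma> * (\<phi> (ws \<alpha> 0) - \<phi> v0)) \<and>
       (\<bar>c0 * (\<alpha> - \<delta>C * \<epsilon>)\<bar> \<le> \<beta> * \<epsilon> * sqrt \<epsilon> \<longrightarrow> \<bar>\<phi> (ws \<alpha> 0) - \<phi> v0\<bar> \<le> Cs' * \<epsilon>)"
      using elim(1) by (elim exE conjE)
    obtain wu where cwu: "continuous_on ?S (\<lambda>\<alpha>. wu \<alpha> 0)" and wu: "\<forall>\<alpha>\<in>?S.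
       right.regular \<alpha> \<epsilon> \<and> right.solution \<alpha> \<epsilon> L (wu \<alpha>) \<and>
       (\<forall>x\<in>{-L..-\<kappa>}. wu \<alpha> x = mu \<alpha> \<epsilon> (- x)) \<and>
       forward_extension (reversed (F \<alpha> \<epsilon>)) \<epsilon> (strip (reflect ` U) \<epsilon> {-L..0})
         (graph_over {-L..-\<kappa>} (\<lambda>x. mu \<alpha> \<epsilon> (- x))) = graph_over {-L..0} (wu \<alpha>) \<and>
       \<bar>\<phi> (wu \<alpha> 0) - \<phi> v0\<bar> \<le> Cu * sqrt \<epsilon> \<and>
       (\<forall>\<sigma>\<in>{1, -1}. \<beta>u * \<epsilon> * sqrt \<epsilon> \<le> \<sigma> * (- c0 * (\<alpha> - \<delta>C * \<epsilon>)) \<longrightarrow> 0 < \<sigma> * (\<phi> (wu \<alpha> 0) - \<phi> v0)) \<and>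
       (\<bar>- c0 * (\<alpha> - \<delta>C * \<epsilon>)\<bar> \<le> \<beta> * \<epsilon> * sqrt \<epsilon> \<longrightarrow> \<bar>\<phi> (wu \<alpha> 0) - \<phi> v0\<bar> \<le> Cu' * \<epsilon>)"
      using elim(2) by (elim exE conjE)
    have es: "0 \<le> \<epsilon> * sqrt \<epsilon>" using elim(3) by simp
    have box_s: "\<bar>ws \<alpha> 0 - v0\<bar> \<le> \<eta>" and box_u: "\<bar>wu \<alpha> 0 - v0\<bar> \<le> \<eta>" if "\<alpha> \<in> ?S" for \<alpha>
    proof -
      have "left.solution \<alpha> \<epsilon> L (ws \<alpha>)" "right.solution \<alpha> \<epsilon> L (wu \<alpha>)" using ws wu that by blast+
      then show "\<bar>ws \<alpha> 0 - v0\<bar> \<le> \<eta>" "\<bar>wu \<alpha> 0 - v0\<bar> \<le> \<eta>"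
        using zero by (auto simp: left.solution_def right.solution_def intro: less_imp_le)
    qed
    \<comment> \<open>The window is run through by t from -1 to 1. Dividing by c0 makes the drive
      equal to \<open>t * (\<beta> * \<epsilon> * sqrt \<epsilon>)\<close> whatever the sign of
      c0.\<close>
    define a where "a = (\<lambda>t. \<delta>C * \<epsilon> + t * (\<beta> / c0 * (\<epsilon> * sqrt \<epsilon>)))"
    have a_dev: "\<bar>a t - \<delta>C * \<epsilon>\<bar> \<le> \<bar>\<beta> / c0\<bar> * (\<epsilon> * sqrt \<epsilon>)" if "t \<in> {-1..1}" for t
    proof -
      have "\<bar>t * (\<beta> / c0 * (\<epsilon> * sqrt \<epsilon>))\<bar> \<le> 1 * \<bar>\<beta> / c0 * (\<epsilon> * sqrt \<epsilon>)\<bar>"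
        unfolding abs_mult[of t] using that by (intro mult_right_mono) auto
      then show ?thesis using elim(3) by (simp add: a_def abs_mult)
    qed
    have aS: "a t \<in> ?S" if t: "t \<in> {-1..1}" for t
    proof -
      have "(\<bar>\<beta> / c0\<bar> * sqrt \<epsilon>) * \<epsilon> \<le> 1 * \<epsilon>" using elim(3,5) by (intro mult_right_mono) auto
      then have "\<bar>\<beta> / c0\<bar> * (\<epsilon> * sqrt \<epsilon>) \<le> \<epsilon>" by (simp only: mult_ac mult_1)
      then have "\<bar>a t - \<delta>C * \<epsilon>\<bar> \<le> \<epsilon>" using a_dev[OF t] by linarith
      moreover have "\<bar>\<delta>C * \<epsilon>\<bar> = \<bar>\<delta>C\<bar> * \<epsilon>" using elim(3) by (simp add: abs_mult)
      ultimately have "\<bar>a t\<bar> \<le> D * \<epsilon>" unfolding D_def distrib_right by linarith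
      then show ?thesis by (simp add: abs_le_iff)
    qed
    have ca: "c0 * (a t - \<delta>C * \<epsilon>) = t * (\<beta> * \<epsilon> * sqrt \<epsilon>)" for t
      using c0 by (simp add: a_def)
    define d where "d = (\<lambda>t. \<phi> (ws (a t) 0) - \<phi> (wu (a t) 0))"
    have \<phi>_cont: "continuous_on {v. \<bar>v - v0\<bar> \<le> \<eta>} \<phi>"
      using left.\<phi>' by (intro continuous_at_imp_continuous_on ballI) (auto intro: DERIV_isCont)
    have a_cont: "continuous_on {-1..1} a" unfolding a_def by (intro continuous_intros)
    have "continuous_on {-1..1} d"
      unfolding d_def
    proof (intro continuous_on_diff)
      show "continuous_on {-1..1} (\<lambda>t. \<phi> (ws (a t) 0))"
        by (rule continuous_on_compose2[OF \<phi>_cont continuous_on_compose2[OF cws a_cont]])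
          (use aS box_s in auto)
      show "continuous_on {-1..1} (\<lambda>t. \<phi> (wu (a t) 0))"
        by (rule continuous_on_compose2[OF \<phi>_cont continuous_on_compose2[OF cwu a_cont]])
          (use aS box_u in auto)
    qed
    \<comment> \<open>At t = -1 the drive pushes the stable branch below \<open>\<phi> v0\<close>
      and the unstable one above it; at t = 1 the roles are exchanged.\<close>
    moreover have "d (-1) \<le> 0" and "0 \<le> d 1"
    proof -
      have m: "\<beta>s * \<epsilon> * sqrt \<epsilon> \<le> \<beta> * \<epsilon> * sqrt \<epsilon>" "\<beta>u * \<epsilon> * sqrt \<epsilon> \<le> \<beta> * \<epsilon> * sqrt \<epsilon>"
        using \<beta> elim(3) by (simp_all add: mult_right_mono)
      have sgn_s: "0 < \<sigma> * (\<phi> (ws (a t) 0) - \<phi> v0)"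
        if "\<sigma> \<in> {1, -1}" "t \<in> {-1..1}" "\<beta>s * \<epsilon> * sqrt \<epsilon> \<le> \<sigma> * (c0 * (a t - \<delta>C * \<epsilon>))" for \<sigma> t
        using ws aS[OF that(2)] that(1,3) by blast
      have sgn_u: "0 < \<sigma> * (\<phi> (wu (a t) 0) - \<phi> v0)"
        if "\<sigma> \<in> {1, -1}" "t \<in> {-1..1}" "\<beta>u * \<epsilon> * sqrt \<epsilon> \<le> \<sigma> * (- c0 * (a t - \<delta>C * \<epsilon>))" for \<sigma> t
        using wu aS[OF that(2)] that(1,3) by blast
      have "0 < -1 * (\<phi> (ws (a (-1)) 0) - \<phi> v0)"
        by (rule sgn_s) (use m ca[of "-1"] in auto)
      moreover have "0 < 1 * (\<phi> (wu (a (-1)) 0) - \<phi> v0)"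
        by (rule sgn_u) (use m ca[of "-1"] in auto)
      ultimately show "d (-1) \<le> 0" by (simp add: d_def)
      have "0 < 1 * (\<phi> (ws (a 1) 0) - \<phi> v0)"
        by (rule sgn_s) (use m ca[of 1] in auto)
      moreover have "0 < -1 * (\<phi> (wu (a 1) 0) - \<phi> v0)"
        by (rule sgn_u) (use m ca[of 1] in auto)
      ultimately show "0 \<le> d 1" by (simp add: d_def)
    qed
    ultimately obtain t where t: "t \<in> {-1..1}" and dt: "d t = 0"
      using IVT'[of d "-1" 0 1] by auto
    define \<alpha> where "\<alpha> = a t"
    have \<alpha>: "\<alpha> \<in> ?S" using aS[OF t] by (simp add: \<alpha>_def)
    \<comment> \<open>The zero was found for the values of \<phi>; expansion makes \<phi> injective
      on the box, so the branches themselves meet.\<close>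
    have "d0 * \<bar>ws \<alpha> 0 - wu \<alpha> 0\<bar> \<le> \<bar>\<phi> (ws \<alpha> 0) - \<phi> (wu \<alpha> 0)\<bar>"
      by (rule left.\<phi>_expand[OF box_s[OF \<alpha>] box_u[OF \<alpha>]])
    then have eq: "ws \<alpha> 0 = wu \<alpha> 0"
      using dt left.pos by (simp add: d_def \<alpha>_def mult_le_0_iff)
    have ws\<alpha>: "left.regular \<alpha> \<epsilon>" "left.solution \<alpha> \<epsilon> L (ws \<alpha>)" "\<And>x. x \<in> {-L..-\<kappa>} \<Longrightarrow> ws \<alpha> x = ms \<alpha> \<epsilon> x"
      and fwd: "forward_extension (F \<alpha> \<epsilon>) \<epsilon> (strip U \<epsilon> {-L..0}) (graph_over {-L..-\<kappa>} (ms \<alpha> \<epsilon>)) =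
         graph_over {-L..0} (ws \<alpha>)"
      using ws \<alpha> by blast+
    have wu\<alpha>: "right.regular \<alpha> \<epsilon>" "right.solution \<alpha> \<epsilon> L (wu \<alpha>)"
      "\<And>x. x \<in> {-L..-\<kappa>} \<Longrightarrow> wu \<alpha> x = mu \<alpha> \<epsilon> (- x)"
      and bwd: "forward_extension (reversed (F \<alpha> \<epsilon>)) \<epsilon> (strip (reflect ` U) \<epsilon> {-L..0})
         (graph_over {-L..-\<kappa>} (\<lambda>x. mu \<alpha> \<epsilon> (- x))) = graph_over {-L..0} (wu \<alpha>)"
      using wu \<alpha> by blast+
    have two: "forward_extension (F \<alpha> \<epsilon>) \<epsilon> (strip U \<epsilon> {-L..L}) (graph_over {-L..-\<kappa>} (ms \<alpha> \<epsilon>)) =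
      backward_extension (F \<alpha> \<epsilon>) \<epsilon> (strip U \<epsilon> {-L..L}) (graph_over {\<kappa>..L} (mu \<alpha> \<epsilon>))"
    proof (rule two_sided_extensions[OF ws\<alpha>(1) wu\<alpha>(1) ws\<alpha>(2) wu\<alpha>(2) eq L(3) less_imp_le[OF L(1)] L(2)
          ws\<alpha>(3) wu\<alpha>(3)])
      show "(x, v) \<in> strip U \<epsilon> {-L..L}" if "x \<in> {-L..L}" "\<bar>v - v0\<bar> \<le> \<eta>" for x v
      proof -
        have "x \<in> {-L0..L0}" using that L by auto
        then show ?thesis using elim(4) that by (simp add: strip_def)
      qed
      show "fst z \<in> {-L..L}" if "z \<in> strip U \<epsilon> {-L..L}" for z
        using that by (auto simp: strip_def)
    qed
    have "\<bar>\<alpha> - \<delta>C * \<epsilon>\<bar> \<le> C * (\<epsilon> * sqrt \<epsilon>)"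
    proof -
      have "\<bar>\<beta> / c0\<bar> * (\<epsilon> * sqrt \<epsilon>) \<le> C * (\<epsilon> * sqrt \<epsilon>)"
        using es by (intro mult_right_mono) (auto simp: C_def)
      with a_dev[OF t] show ?thesis by (simp only: \<alpha>_def)
    qed
    moreover have "\<bar>ws \<alpha> 0 - v0\<bar> \<le> C * \<epsilon>"
    proof -
      \<comment> \<open>Every t in the window satisfies the condition with B = \<beta>; this
        sharpens the bound at x = 0 from order \<open>sqrt \<epsilon>\<close> to order
        \<epsilon>.\<close>
      have "\<bar>t * (\<beta> * \<epsilon> * sqrt \<epsilon>)\<bar> \<le> 1 * \<bar>\<beta> * \<epsilon> * sqrt \<epsilon>\<bar>"
        unfolding abs_mult[of t] using t by (intro mult_right_mono) auto
      then have "\<bar>c0 * (\<alpha> - \<delta>C * \<epsilon>)\<bar> \<le> \<beta> * \<epsilon> * sqrt \<epsilon>"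
        unfolding \<alpha>_def ca using \<beta> elim(3) by simp
      then have "\<bar>\<phi> (ws \<alpha> 0) - \<phi> v0\<bar> \<le> Cs' * \<epsilon>" using ws \<alpha> by blast
      from \<phi>_inverse_bound[OF box_s[OF \<alpha>] this] have "\<bar>ws \<alpha> 0 - v0\<bar> \<le> Cs' / d0 * \<epsilon>" by simp
      also have "\<dots> \<le> C * \<epsilon>" using elim(3) by (intro mult_right_mono) (auto simp: C_def)
      finally show ?thesis .
    qed
    moreover have "(\<lambda>x. wu \<alpha> (- x)) 0 = ws \<alpha> 0" using eq by simp
    ultimately have "P \<epsilon> \<alpha>"
      unfolding P_def using two fwd backward_extension_eq[OF bwd] by blast
    then show ?case by blast
  qed
  \<comment> \<open>The parameter exists for each small \<epsilon> separately; Hilbert choice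
    assembles these values into one function of \<epsilon>.\<close>
  then have "\<forall>\<^sub>F \<epsilon> in at_right 0. P \<epsilon> (SOME \<alpha>. P \<epsilon> \<alpha>)"
    by (rule eventually_mono) (rule someI_ex)
  then obtain \<alpha>C where "\<forall>\<^sub>F \<epsilon> in at_right 0. P \<epsilon> (\<alpha>C \<epsilon>)" by (rule that)
  then show ?thesis unfolding P_def by (intro exI[of _ \<alpha>C] exI[of _ C])
qed

end

section \<open>Functions of class \<open>C\<^sup>k\<close>\<close>

lemma Ck_on_imp_continuous_on: "Ck_on k S f \<Longrightarrow> continuous_on S f"
  by (cases k) (auto intro!: continuous_at_imp_continuous_on differentiable_imp_continuous_within)

lemma Ck_on_Suc_D:
  assumes "Ck_on (Suc k) S f"
  shows "p \<in> S \<Longrightarrow> (f has_derivative frechet_derivative f (at p)) (at p)"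
    and "Ck_on k S (\<lambda>p. frechet_derivative f (at p) h)"
  using assms frechet_derivative_works by auto

text \<open>On an open set the derivative depends only on the values in the set, so the induction
  can pass to the derivatives, which again agree there.\<close>

lemma Ck_on_cong:
  assumes "open S" "\<And>p. p \<in> S \<Longrightarrow> f p = g p" "Ck_on k S f"
  shows "Ck_on k S g"
  using assms(2,3)
proof (induction k arbitrary: f g)
  case 0
  then show ?case by (simp cong: continuous_on_cong)
next
  case (Suc k)
  have der: "(g has_derivative frechet_derivative f (at p)) (at p)" if "p \<in> S" for p
    by (rule has_derivative_transform_within_open[OF Ck_on_Suc_D(1)[OF Suc.prems(2) that] assms(1) that])
      (rule Suc.prems(1))
  then have "frechet_derivative g (at p) = frechet_derivative f (at p)" if "p \<in> S" for p
    using frechet_derivative_at[OF der[OF that]] by simp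
  then have "Ck_on k S (\<lambda>p. frechet_derivative g (at p) h)" for h
    using Suc.IH[of "\<lambda>p. frechet_derivative f (at p) h" "\<lambda>p. frechet_derivative g (at p) h"]
      Ck_on_Suc_D(2)[OF Suc.prems(2)] by simp
  with der show ?case by (auto simp: differentiable_def)
qed

lemma Ck_on_bounded_linear:
  assumes S: "open S" and L: "bounded_linear L" and "Ck_on k S f"
  shows "Ck_on k S (\<lambda>p. L (f p))"
  using assms(3)
proof (induction k arbitrary: f)
  case 0
  then show ?case using bounded_linear.continuous_on[OF L] by simp
next
  case (Suc k)
  have der: "((\<lambda>p. L (f p)) has_derivative (\<lambda>h. L (frechet_derivative f (at p) h))) (at p)" if "p \<in> S" for p
    by (rule bounded_linear.has_derivative[OF L Ck_on_Suc_D(1)[OF Suc.prems that]])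
  have "Ck_on k S (\<lambda>p. frechet_derivative (\<lambda>p. L (f p)) (at p) h)" for h
    by (rule Ck_on_cong[OF S _ Suc.IH[OF Ck_on_Suc_D(2)[OF Suc.prems, of h]]])
      (simp add: frechet_derivative_at[OF der, symmetric])
  with der show ?case by (auto simp: differentiable_def)
qed

text \<open>\<open>Ck_on\<close> controls the derivative in each fixed direction separately. This
  passes from finitely many directions to the operator norm that the mean value inequality asks
  for.\<close>

lemma norm_linear_le_sum_Basis:
  fixes D :: "'a::euclidean_space \<Rightarrow> 'b::real_normed_vector"
  assumes "linear D" "\<And>b. b \<in> Basis \<Longrightarrow> norm (D b) \<le> B b"
  shows "norm (D h) \<le> sum B Basis * norm h"
proof -
  have "D h = D (\<Sum>b\<in>Basis. (h \<bullet> b) *\<^sub>R b)" by (simp add: euclidean_representation)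
  also have "\<dots> = (\<Sum>b\<in>Basis. (h \<bullet> b) *\<^sub>R D b)"
    using assms(1) by (simp add: linear_sum linear_scale)
  also have "norm \<dots> \<le> (\<Sum>b\<in>Basis. norm h * B b)"
    by (intro sum_norm_le) (auto intro!: mult_mono assms(2) simp: Basis_le_norm)
  also have "\<dots> = sum B Basis * norm h" 
    by (simp only: sum_distrib_left[symmetric] mult.commute[of "sum B Basis"])
  finally show ?thesis .
qed

text \<open>On a compact ball each directional derivative is bounded by continuity; summing over a
  basis bounds the operator norm, and the ball is convex.\<close>

lemma Ck_on_locally_lipschitz:
  fixes f :: "'a::euclidean_space \<Rightarrow> 'b::real_normed_vector"
  assumes f: "Ck_on (Suc k) S f" and S: "open S" "p \<in> S"
  obtains r K where "0 < r" "cball p r \<subseteq> S" "0 \<le> K"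
    "\<And>x y. x \<in> cball p r \<Longrightarrow> y \<in> cball p r \<Longrightarrow> norm (f x - f y) \<le> K * norm (x - y)"
proof -
  obtain r where r: "0 < r" "cball p r \<subseteq> S" using S open_contains_cball by blast
  define D where "D = (\<lambda>q. frechet_derivative f (at q))"
  have der: "(f has_derivative D q) (at q)" if "q \<in> S" for q
    unfolding D_def by (rule Ck_on_Suc_D(1)[OF f that])
  have "\<exists>B. \<forall>q\<in>cball p r. norm (D q b) \<le> B" for b
  proof -
    have "continuous_on (cball p r) (\<lambda>q. D q b)"
      unfolding D_def
      using Ck_on_imp_continuous_on[OF Ck_on_Suc_D(2)[OF f]] r(2) by (rule continuous_on_subset)
    then have "bounded ((\<lambda>q. D q b) ` cball p r)"
      by (intro compact_imp_bounded compact_continuous_image compact_cball)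
    then show ?thesis by (auto simp: bounded_iff)
  qed
  then obtain B where B: "\<And>q b. q \<in> cball p r \<Longrightarrow> norm (D q b) \<le> B b" by metis
  have "0 \<le> B b" for b using B[of p b] r order_trans[OF norm_ge_zero] by auto
  then have "0 \<le> sum B Basis" by (simp add: sum_nonneg)
  moreover have "norm (f x - f y) \<le> sum B Basis * norm (x - y)" if "x \<in> cball p r" "y \<in> cball p r" for x y
  proof (rule differentiable_bound[OF convex_cball _ _ that, where f'=D])
    fix q assume q: "q \<in> cball p r"
    with r have "q \<in> S" by blast
    then show "(f has_derivative D q) (at q within cball p r)"
      by (rule has_derivative_at_withinI[OF der])
    show "onorm (D q) \<le> sum B Basis"
      by (rule onorm_le, rule norm_linear_le_sum_Basis[OF has_derivative_linear[OF der[OF \<open>q \<in> S\<close>]] B[OF q]])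
  qed
  ultimately show thesis using r by (intro that[of r "sum B Basis"])
qed

text \<open>The mean value inequality for \<open>f - D p\<close>, whose derivative
  \<open>D q - D p\<close> is Lipschitz in q and vanishes at q = p. Two free points x and y are
  kept, so that an increment in some variables only appears as the factor
  \<open>norm (x - y)\<close>.\<close>

lemma Ck_on_quadratic_remainder:
  fixes f :: "'a::euclidean_space \<Rightarrow> 'b::real_normed_vector"
  assumes f: "Ck_on (Suc (Suc k)) S f" and S: "open S" "p \<in> S"
  obtains r K where "0 < r" "cball p r \<subseteq> S" "0 \<le> K"
    "\<And>x y. x \<in> cball p r \<Longrightarrow> y \<in> cball p r \<Longrightarrow>
      norm (f x - f y - frechet_derivative f (at p) (x - y)) \<le> K * max (norm (x - p)) (norm (y - p)) * norm (x - y)"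
proof -
  define D where "D = (\<lambda>q. frechet_derivative f (at q))"
  have der: "(f has_derivative D q) (at q)" if "q \<in> S" for q
    unfolding D_def by (rule Ck_on_Suc_D(1)[OF f that])
  have "\<exists>r K. 0 < r \<and> cball p r \<subseteq> S \<and> 0 \<le> K \<and> (\<forall>q\<in>cball p r. norm (D q b - D p b) \<le> K * norm (q - p))" for b
  proof -
    have "Ck_on (Suc k) S (\<lambda>q. D q b)" unfolding D_def by (rule Ck_on_Suc_D(2)[OF f])
    then obtain r K where "0 < r" "cball p r \<subseteq> S" "0 \<le> K"
      "\<And>x y. x \<in> cball p r \<Longrightarrow> y \<in> cball p r \<Longrightarrow> norm (D x b - D y b) \<le> K * norm (x - y)"
      using Ck_on_locally_lipschitz S by blast
    then show ?thesis by (intro exI[of _ r] exI[of _ K]) auto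
  qed
  then obtain R K where R: "\<And>b. 0 < R b" "\<And>b. cball p (R b) \<subseteq> S" "\<And>b. 0 \<le> K b"
    and K: "\<And>b q. q \<in> cball p (R b) \<Longrightarrow> norm (D q b - D p b) \<le> K b * norm (q - p)" by metis
  \<comment> \<open>Each basis direction has its own Lipschitz radius; the smallest of the finitely
    many serves all.\<close>
  define r where "r = Min (R ` Basis)"
  have r: "0 < r" using R(1) by (simp add: r_def)
  have rR: "cball p r \<subseteq> cball p (R b)" if "b \<in> Basis" for b
    using that by (intro subset_cball) (simp add: r_def)
  obtain b0 :: 'a where "b0 \<in> Basis" using nonempty_Basis by blast
  then have rS: "cball p r \<subseteq> S" using rR R(2) by blast
  have K0: "0 \<le> sum K Basis" using R(3) by (simp add: sum_nonneg)
  have "norm (f x - f y - D p (x - y)) \<le> sum K Basis * max (norm (x - p)) (norm (y - p)) * norm (x - y)"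
    if xy: "x \<in> cball p r" "y \<in> cball p r" for x y
  proof -
    \<comment> \<open>The smallest ball around p that contains both points: on it the derivative
      differs from the one at p by a multiple of \<rho> rather than of r, which supplies the
      quadratic factor.\<close>
    define \<rho> where "\<rho> = max (norm (x - p)) (norm (y - p))"
    have \<rho>: "0 \<le> \<rho>" "\<rho> \<le> r" using xy by (auto simp: \<rho>_def dist_norm norm_minus_commute le_max_iff_disj)
    have lin: "linear (D p)" using has_derivative_linear[OF der[OF S(2)]] .
    have sub: "cball p \<rho> \<subseteq> cball p r" using \<rho> by (intro subset_cball)
    have "norm ((f x - D p x) - (f y - D p y)) \<le> sum K Basis * \<rho> * norm (x - y)"
    proof (rule differentiable_bound[OF convex_cball[of p \<rho>], where f'="\<lambda>q h. D q h - D p h"])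
      show "x \<in> cball p \<rho>" "y \<in> cball p \<rho>"
        by (auto simp: \<rho>_def dist_norm norm_minus_commute)
      fix q assume q: "q \<in> cball p \<rho>"
      then have qr: "q \<in> cball p r" and qS: "q \<in> S" using sub rS by blast+
      show "((\<lambda>q. f q - D p q) has_derivative (\<lambda>h. D q h - D p h)) (at q within cball p \<rho>)"
        by (intro has_derivative_diff has_derivative_at_withinI[OF der[OF qS]]
            bounded_linear_imp_has_derivative has_derivative_bounded_linear[OF der[OF S(2)]])
      show "onorm (\<lambda>h. D q h - D p h) \<le> sum K Basis * \<rho>"
      proof (rule onorm_le)
        fix h
        have "norm (D q h - D p h) \<le> (\<Sum>b\<in>Basis. K b * \<rho>) * norm h"
        proof (rule norm_linear_le_sum_Basis)
          show "linear (\<lambda>h. D q h - D p h)"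
            using has_derivative_linear[OF der[OF qS]] lin by (rule linear_compose_sub)
          fix b :: 'a assume "b \<in> Basis"
          then have "norm (D q b - D p b) \<le> K b * norm (q - p)" using K rR qr by blast
          also have "\<dots> \<le> K b * \<rho>"
            using q R(3) by (intro mult_left_mono) (auto simp: dist_norm norm_minus_commute)
          finally show "norm (D q b - D p b) \<le> K b * \<rho>" .
        qed
        then show "norm (D q h - D p h) \<le> sum K Basis * \<rho> * norm h" by (simp add: sum_distrib_right)
      qed
    qed
    moreover have "(f x - D p x) - (f y - D p y) = f x - f y - D p (x - y)"
      using lin by (simp add: linear_diff)
    ultimately show ?thesis by (simp add: \<rho>_def)
  qed
  then show thesis using r rS K0 unfolding D_def by (intro that[of r "sum K Basis"])
qed

lemma frechet_derivative_line:
  assumes "Ck_on (Suc k) S f" "p + s *\<^sub>R e \<in> S"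
  shows "((\<lambda>s. f (p + s *\<^sub>R e)) has_vector_derivative frechet_derivative f (at (p + s *\<^sub>R e)) e) (at s)"
proof -
  have "((\<lambda>s. p + s *\<^sub>R e) has_derivative (\<lambda>h. 0 + h *\<^sub>R e)) (at s)"
    by (rule has_derivative_add[OF has_derivative_const
          bounded_linear_imp_has_derivative[OF bounded_linear_scaleR_left]])
  from has_derivative_compose[OF this Ck_on_Suc_D(1)[OF assms]]
  show ?thesis
    unfolding has_vector_derivative_def add_0_left
      linear_scale[OF has_derivative_linear[OF Ck_on_Suc_D(1)[OF assms]]] .
qed

text \<open>Here the third derivative is spent: two derivatives are taken along the line, and the
  next one makes the second derivative Lipschitz at 0, as the expansion of \<psi> at the fold
  demands.\<close>

lemma Ck_on_line:
  fixes f :: "'a::euclidean_space \<Rightarrow> real"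
  assumes f: "Ck_on (Suc (Suc (Suc k))) S f" and S: "open S" "p \<in> S"
  obtains r K g1 g2 where "0 < r" "0 \<le> K"
    "\<And>s. \<bar>s\<bar> \<le> r \<Longrightarrow> p + s *\<^sub>R e \<in> S"
    "\<And>s. \<bar>s\<bar> \<le> r \<Longrightarrow> ((\<lambda>s. f (p + s *\<^sub>R e)) has_real_derivative g1 s) (at s)"
    "\<And>s. \<bar>s\<bar> \<le> r \<Longrightarrow> (g1 has_real_derivative g2 s) (at s)"
    "\<And>s. \<bar>s\<bar> \<le> r \<Longrightarrow> \<bar>g2 s - g2 0\<bar> \<le> K * \<bar>s\<bar>"
proof -
  define f1 where "f1 = (\<lambda>q. frechet_derivative f (at q) e)"
  define f2 where "f2 = (\<lambda>q. frechet_derivative f1 (at q) e)"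
  have f1: "Ck_on (Suc (Suc k)) S f1" unfolding f1_def by (rule Ck_on_Suc_D(2)[OF f])
  have f2: "Ck_on (Suc k) S f2" unfolding f2_def by (rule Ck_on_Suc_D(2)[OF f1])
  obtain r K where r: "0 < r" "cball p r \<subseteq> S" "0 \<le> K"
    and K: "\<And>x y. x \<in> cball p r \<Longrightarrow> y \<in> cball p r \<Longrightarrow> norm (f2 x - f2 y) \<le> K * norm (x - y)"
    by (rule Ck_on_locally_lipschitz[OF f2 S]) blast
  \<comment> \<open>The summand 1 covers e = 0.\<close>
  define \<rho> where "\<rho> = r / (norm e + 1)"
  have \<rho>: "0 < \<rho>" using r by (simp add: \<rho>_def add_nonneg_pos)
  have ball: "p + s *\<^sub>R e \<in> cball p r" if "\<bar>s\<bar> \<le> \<rho>" for s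
  proof -
    have "\<bar>s\<bar> * norm e \<le> \<rho> * (norm e + 1)" using that by (intro mult_mono) auto
    also have "\<dots> = r" by (simp add: \<rho>_def add_nonneg_eq_0_iff)
    finally show ?thesis by (simp add: dist_norm)
  qed
  show thesis
  proof (rule that[of \<rho> "K * norm e" "\<lambda>s. f1 (p + s *\<^sub>R e)" "\<lambda>s. f2 (p + s *\<^sub>R e)"])
    fix s :: real assume s: "\<bar>s\<bar> \<le> \<rho>"
    then show pS: "p + s *\<^sub>R e \<in> S" using ball r by blast
    show "((\<lambda>s. f (p + s *\<^sub>R e)) has_real_derivative f1 (p + s *\<^sub>R e)) (at s)"
      "((\<lambda>s. f1 (p + s *\<^sub>R e)) has_real_derivative f2 (p + s *\<^sub>R e)) (at s)"
      using frechet_derivative_line[OF f pS] frechet_derivative_line[OF f1 pS]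
      by (simp_all add: has_real_derivative_iff_has_vector_derivative f1_def f2_def)
    show "\<bar>f2 (p + s *\<^sub>R e) - f2 (p + 0 *\<^sub>R e)\<bar> \<le> K * norm e * \<bar>s\<bar>"
      using K[OF ball[OF s] ball[of 0]] \<rho> by (simp add: mult_ac)
  qed (use \<rho> r in auto)
qed

section \<open>Local estimates for the fields\<close>

lemma mult_difference_bound:
  fixes f g :: real
  assumes "\<bar>f - f0\<bar> \<le> A" "\<bar>g - g0\<bar> \<le> B" "\<bar>g\<bar> \<le> G" "\<bar>f0\<bar> \<le> H" "0 \<le> A" "0 \<le> B"
  shows "\<bar>f * g - f0 * g0\<bar> \<le> A * G + H * B"
proof -
  have "f * g - f0 * g0 = (f - f0) * g + f0 * (g - g0)" by (simp add: algebra_simps)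
  also have "\<bar>\<dots>\<bar> \<le> \<bar>f - f0\<bar> * \<bar>g\<bar> + \<bar>f0\<bar> * \<bar>g - g0\<bar>"
    by (simp add: abs_triangle_ineq[THEN order_trans] abs_mult)
  also have "\<dots> \<le> A * G + H * B" using assms by (intro add_mono mult_mono) auto
  finally show ?thesis .
qed

text \<open>An expansion f(x) = c + O(|x|) at 0, with the point 0 itself excluded, because the
  quotients p(x)/x have no meaningful value there.\<close>

definition linear_near :: "(real \<Rightarrow> real) \<Rightarrow> real \<Rightarrow> bool" where
  "linear_near f c \<longleftrightarrow> (\<exists>C. \<forall>\<^sub>F x in at 0. \<bar>f x - c\<bar> \<le> C * \<bar>x\<bar>)"

lemma linear_nearI: "0 < r \<Longrightarrow> (\<And>x. \<bar>x\<bar> \<le> r \<Longrightarrow> x \<noteq> 0 \<Longrightarrow> \<bar>f x - c\<bar> \<le> C * \<bar>x\<bar>) \<Longrightarrow> linear_near f c"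
  unfolding linear_near_def eventually_at
  by (rule exI[of _ C], rule exI[of _ r]) (auto simp: dist_real_def)

lemma linear_nearD:
  assumes "linear_near f c"
  obtains C r where "0 < r" "0 \<le> C" "\<And>x. \<bar>x\<bar> < r \<Longrightarrow> x \<noteq> 0 \<Longrightarrow> \<bar>f x - c\<bar> \<le> C * \<bar>x\<bar>"
proof -
  obtain C r where "0 < r" and C: "\<And>x. \<bar>x\<bar> < r \<Longrightarrow> x \<noteq> 0 \<Longrightarrow> \<bar>f x - c\<bar> \<le> C * \<bar>x\<bar>"
    using assms unfolding linear_near_def eventually_at by (auto simp: dist_real_def)
  moreover have "\<bar>f x - c\<bar> \<le> max C 0 * \<bar>x\<bar>" if "\<bar>x\<bar> < r" "x \<noteq> 0" for x
    using C[OF that] mult_right_mono[of C "max C 0" "\<bar>x\<bar>"] by simp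
  ultimately show thesis using that[of r "max C 0"] by auto
qed

lemma linear_near_mult:
  assumes f: "linear_near f a" and g: "linear_near g b"
  shows "linear_near (\<lambda>x. f x * g x) (a * b)"
proof -
  obtain C1 r1 where 1: "0 < r1" "0 \<le> C1" "\<And>x. \<bar>x\<bar> < r1 \<Longrightarrow> x \<noteq> 0 \<Longrightarrow> \<bar>f x - a\<bar> \<le> C1 * \<bar>x\<bar>"
    using linear_nearD[OF f] by blast
  obtain C2 r2 where 2: "0 < r2" "0 \<le> C2" "\<And>x. \<bar>x\<bar> < r2 \<Longrightarrow> x \<noteq> 0 \<Longrightarrow> \<bar>g x - b\<bar> \<le> C2 * \<bar>x\<bar>"
    using linear_nearD[OF g] by blast
  define r where "r = min (min r1 r2) 1 / 2"
  show ?thesis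
  proof (rule linear_nearI[of r])
    show "0 < r" using 1 2 by (simp add: r_def)
    fix x :: real assume x: "\<bar>x\<bar> \<le> r" "x \<noteq> 0"
    then have xr: "\<bar>x\<bar> < r1" "\<bar>x\<bar> < r2" "\<bar>x\<bar> \<le> 1" using 1 2 by (auto simp: r_def min_def split: if_splits)
    have "C2 * \<bar>x\<bar> \<le> C2 * 1" using xr 2 by (intro mult_left_mono) auto
    then have "\<bar>g x\<bar> \<le> \<bar>b\<bar> + C2" using 2(3)[OF xr(2) x(2)] by linarith
    then have "\<bar>f x * g x - a * b\<bar> \<le> C1 * \<bar>x\<bar> * (\<bar>b\<bar> + C2) + \<bar>a\<bar> * (C2 * \<bar>x\<bar>)"
      using 1 2 xr x by (intro mult_difference_bound) auto
    then show "\<bar>f x * g x - a * b\<bar> \<le> (C1 * (\<bar>b\<bar> + C2) + \<bar>a\<bar> * C2) * \<bar>x\<bar>"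
      by (simp add: algebra_simps)
  qed
qed

lemma linear_near_inverse:
  assumes f: "linear_near f a" and a: "a \<noteq> 0"
  shows "linear_near (\<lambda>x. inverse (f x)) (inverse a)"
proof -
  obtain C r where C: "0 < r" "0 \<le> C" "\<And>x. \<bar>x\<bar> < r \<Longrightarrow> x \<noteq> 0 \<Longrightarrow> \<bar>f x - a\<bar> \<le> C * \<bar>x\<bar>"
    using linear_nearD[OF f] by blast
  define s where "s = min (r / 2) (\<bar>a\<bar> / (2 * (C + 1)))"
  show ?thesis
  proof (rule linear_nearI[of s])
    show "0 < s" using C a by (simp add: s_def)
    fix x :: real assume x: "\<bar>x\<bar> \<le> s" "x \<noteq> 0"
    then have xr: "\<bar>x\<bar> < r" "\<bar>x\<bar> \<le> \<bar>a\<bar> / (2 * (C + 1))" using C by (auto simp: s_def)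
    note fx = C(3)[OF xr(1) x(2)]
    have "C * \<bar>x\<bar> \<le> (C + 1) * (\<bar>a\<bar> / (2 * (C + 1)))" using xr C by (intro mult_mono) auto
    also have "\<dots> = \<bar>a\<bar> / 2" using C by (simp add: field_simps)
    finally have low: "\<bar>a\<bar> / 2 \<le> \<bar>f x\<bar>" using fx by linarith
    then have f0: "f x \<noteq> 0" using a by auto
    have "\<bar>inverse (f x) - inverse a\<bar> = \<bar>f x - a\<bar> / (\<bar>f x\<bar> * \<bar>a\<bar>)"
      using f0 a by (simp add: inverse_diff_inverse abs_mult abs_minus_commute divide_inverse)
    also have "\<dots> \<le> (C * \<bar>x\<bar>) / ((\<bar>a\<bar> / 2) * \<bar>a\<bar>)"
    proof (rule frac_le)
      show "0 < (\<bar>a\<bar> / 2) * \<bar>a\<bar>" using a by (intro mult_pos_pos) auto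
      show "(\<bar>a\<bar> / 2) * \<bar>a\<bar> \<le> \<bar>f x\<bar> * \<bar>a\<bar>" using low by (rule mult_right_mono) simp
    qed (use fx C in auto)
    finally show "\<bar>inverse (f x) - inverse a\<bar> \<le> C / ((\<bar>a\<bar> / 2) * \<bar>a\<bar>) * \<bar>x\<bar>"
      by (simp only: times_divide_eq_left)
  qed
qed

lemma linear_near_diff:
  assumes f: "linear_near f a" and g: "linear_near g b"
  shows "linear_near (\<lambda>x. f x - g x) (a - b)"
proof -
  obtain C1 where 1: "\<forall>\<^sub>F x in at 0. \<bar>f x - a\<bar> \<le> C1 * \<bar>x\<bar>" using f unfolding linear_near_def ..
  obtain C2 where 2: "\<forall>\<^sub>F x in at 0. \<bar>g x - b\<bar> \<le> C2 * \<bar>x\<bar>" using g unfolding linear_near_def ..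
  have "\<forall>\<^sub>F x in at 0. \<bar>(f x - g x) - (a - b)\<bar> \<le> (C1 + C2) * \<bar>x\<bar>"
    using 1 2 by eventually_elim (unfold distrib_right, linarith)
  then show ?thesis unfolding linear_near_def ..
qed

lemma linear_near_minus: "linear_near f a \<Longrightarrow> linear_near (\<lambda>x. - f x) (- a)"
  unfolding linear_near_def by (simp add: abs_minus_commute add.commute)

lemma le_linear_from_derivative:
  fixes f :: "real \<Rightarrow> real"
  assumes "\<And>s. \<bar>s\<bar> \<le> \<bar>x\<bar> \<Longrightarrow> (f has_real_derivative f' s) (at s)" "\<And>s. \<bar>s\<bar> \<le> \<bar>x\<bar> \<Longrightarrow> \<bar>f' s\<bar> \<le> B"
  shows "\<bar>f x - f 0\<bar> \<le> B * \<bar>x\<bar>"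
proof -
  have "norm (f x - f 0) \<le> B * norm (x - 0)"
    by (rule field_differentiable_bound[of "{-\<bar>x\<bar>..\<bar>x\<bar>}" f f'])
      (use assms in \<open>auto intro: has_field_derivative_at_within\<close>)
  then show ?thesis by simp
qed

text \<open>Division of a function by a simple zero. The value at 0 of the derivative of p(x)/x is
  half the second derivative of p; this is the origin of the factor 1/2 in M3.\<close>

lemma quotient_by_argument:
  fixes p p1 p2 :: "real \<Rightarrow> real"
  assumes r: "0 < r" "0 \<le> K"
    and p: "\<And>x. \<bar>x\<bar> \<le> r \<Longrightarrow> (p has_real_derivative p1 x) (at x)"
    and p1: "\<And>x. \<bar>x\<bar> \<le> r \<Longrightarrow> (p1 has_real_derivative p2 x) (at x)"
    and p2: "\<And>x. \<bar>x\<bar> \<le> r \<Longrightarrow> \<bar>p2 x - p2 0\<bar> \<le> K * \<bar>x\<bar>" and p0: "p 0 = 0"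
  shows "linear_near (\<lambda>x. p x / x) (p1 0)"
    and "linear_near (\<lambda>x. (x * p1 x - p x) / x\<^sup>2) (p2 0 / 2)"
    and "\<And>x. \<bar>x\<bar> \<le> r \<Longrightarrow> x \<noteq> 0 \<Longrightarrow> ((\<lambda>x. p x / x) has_real_derivative (x * p1 x - p x) / x\<^sup>2) (at x)"
proof -
  have p2b: "\<bar>p2 s\<bar> \<le> \<bar>p2 0\<bar> + K * r" if "\<bar>s\<bar> \<le> r" for s
    using p2[OF that] mult_left_mono[OF that r(2)] by linarith
  have p1b: "\<bar>p1 x - p1 0\<bar> \<le> (\<bar>p2 0\<bar> + K * r) * \<bar>x\<bar>" if "\<bar>x\<bar> \<le> r" for x
    using that by (intro le_linear_from_derivative[where f'=p2]) (auto intro: p1 p2b)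
  show "linear_near (\<lambda>x. p x / x) (p1 0)"
  proof (rule linear_nearI[OF r(1)])
    fix x assume x: "\<bar>x\<bar> \<le> r" "x \<noteq> 0"
    have "\<bar>(p x - p1 0 * x) - (p 0 - p1 0 * 0)\<bar> \<le> ((\<bar>p2 0\<bar> + K * r) * \<bar>x\<bar>) * \<bar>x\<bar>"
    proof (rule le_linear_from_derivative[where f'="\<lambda>s. p1 s - p1 0"])
      fix s assume s: "\<bar>s\<bar> \<le> \<bar>x\<bar>"
      then show "((\<lambda>x. p x - p1 0 * x) has_real_derivative p1 s - p1 0) (at s)"
        using x by (intro DERIV_diff p DERIV_cmult_Id) auto
      have "(\<bar>p2 0\<bar> + K * r) * \<bar>s\<bar> \<le> (\<bar>p2 0\<bar> + K * r) * \<bar>x\<bar>"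
        using s r by (intro mult_left_mono) auto
      with p1b[of s] s x show "\<bar>p1 s - p1 0\<bar> \<le> (\<bar>p2 0\<bar> + K * r) * \<bar>x\<bar>" by linarith
    qed
    then have "\<bar>p x - p1 0 * x\<bar> / \<bar>x\<bar> \<le> (\<bar>p2 0\<bar> + K * r) * \<bar>x\<bar>"
      using p0 x by (simp add: pos_divide_le_eq)
    moreover have "p x / x - p1 0 = (p x - p1 0 * x) / x" using x by (simp add: field_simps)
    ultimately show "\<bar>p x / x - p1 0\<bar> \<le> (\<bar>p2 0\<bar> + K * r) * \<bar>x\<bar>" by (simp add: abs_divide)
  qed
  show "linear_near (\<lambda>x. (x * p1 x - p x) / x\<^sup>2) (p2 0 / 2)"
  proof (rule linear_nearI[OF r(1)])
    fix x assume x: "\<bar>x\<bar> \<le> r" "x \<noteq> 0"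
    \<comment> \<open>The derivative of \<open>x * p1 x - p x\<close> is \<open>x * p2 x\<close>, so
      that of e is \<open>x * (p2 x - p2 0)\<close>; hence e is of third order, and of first order
      after division by the square of x.\<close>
    define e where "e = (\<lambda>x. x * p1 x - p x - p2 0 * x\<^sup>2 / 2)"
    have "\<bar>e x - e 0\<bar> \<le> (\<bar>x\<bar> * (K * \<bar>x\<bar>)) * \<bar>x\<bar>"
    proof (rule le_linear_from_derivative[where f'="\<lambda>s. s * (p2 s - p2 0)"])
      fix s assume s: "\<bar>s\<bar> \<le> \<bar>x\<bar>"
      with x have sr: "\<bar>s\<bar> \<le> r" by simp
      show "(e has_real_derivative s * (p2 s - p2 0)) (at s)"
        unfolding e_def by (rule derivative_eq_intros p1[OF sr] p[OF sr] refl | simp add: algebra_simps)+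
      have "K * \<bar>s\<bar> \<le> K * \<bar>x\<bar>" using s r by (intro mult_left_mono) auto
      with p2[OF sr] have "\<bar>p2 s - p2 0\<bar> \<le> K * \<bar>x\<bar>" by linarith
      then show "\<bar>s * (p2 s - p2 0)\<bar> \<le> \<bar>x\<bar> * (K * \<bar>x\<bar>)"
        unfolding abs_mult using s r by (intro mult_mono) auto
    qed
    then have "\<bar>e x\<bar> \<le> (K * \<bar>x\<bar>) * x\<^sup>2"
      using p0 by (simp add: e_def power2_eq_square mult_ac)
    then have "\<bar>e x\<bar> / x\<^sup>2 \<le> K * \<bar>x\<bar>" using x by (simp add: pos_divide_le_eq)
    moreover have "(x * p1 x - p x) / x\<^sup>2 - p2 0 / 2 = e x / x\<^sup>2"
      using x by (simp add: e_def field_simps)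
    ultimately show "\<bar>(x * p1 x - p x) / x\<^sup>2 - p2 0 / 2\<bar> \<le> K * \<bar>x\<bar>" by (simp add: abs_divide)
  qed
  show "((\<lambda>x. p x / x) has_real_derivative (x * p1 x - p x) / x\<^sup>2) (at x)" if "\<bar>x\<bar> \<le> r" "x \<noteq> 0" for x
    by (rule DERIV_cong[OF DERIV_divide[OF p[OF that(1)] DERIV_ident that(2)]])
      (simp add: power2_eq_square)
qed

text \<open>Cancelling the common zero at x = 0 writes the quotient as -P/Q with P = p/x and Q =
  q/x, where Q stays near \<open>q1 0 > 0\<close>. The arithmetic of \<open>linear_near\<close> then
  yields the value and the derivative at the fold, each with an error O(|x|).\<close>

lemma critical_level:
  fixes p p1 p2 q q1 q2 :: "real \<Rightarrow> real"
  assumes r: "0 < r" "0 \<le> K"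
    and p: "\<And>x. \<bar>x\<bar> \<le> r \<Longrightarrow> (p has_real_derivative p1 x) (at x)"
      "\<And>x. \<bar>x\<bar> \<le> r \<Longrightarrow> (p1 has_real_derivative p2 x) (at x)"
      "\<And>x. \<bar>x\<bar> \<le> r \<Longrightarrow> \<bar>p2 x - p2 0\<bar> \<le> K * \<bar>x\<bar>" "p 0 = 0"
    and q: "\<And>x. \<bar>x\<bar> \<le> r \<Longrightarrow> (q has_real_derivative q1 x) (at x)"
      "\<And>x. \<bar>x\<bar> \<le> r \<Longrightarrow> (q1 has_real_derivative q2 x) (at x)"
      "\<And>x. \<bar>x\<bar> \<le> r \<Longrightarrow> \<bar>q2 x - q2 0\<bar> \<le> K * \<bar>x\<bar>" "q 0 = 0" and q10: "q1 0 > 0"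
  obtains s C \<psi>' where "0 < s" "0 \<le> C"
    "\<And>x. \<bar>x\<bar> \<le> s \<Longrightarrow> x \<noteq> 0 \<Longrightarrow> q1 0 / 2 \<le> q x / x \<and> q x / x \<le> 2 * q1 0"
    "\<And>x. \<bar>x\<bar> \<le> s \<Longrightarrow> x \<noteq> 0 \<Longrightarrow> ((\<lambda>x. - p x / q x) has_real_derivative \<psi>' x) (at x)"
    "\<And>x. \<bar>x\<bar> \<le> s \<Longrightarrow> x \<noteq> 0 \<Longrightarrow> \<bar>- p x / q x - (- p1 0 / q1 0)\<bar> \<le> C * \<bar>x\<bar>"
    "\<And>x. \<bar>x\<bar> \<le> s \<Longrightarrow> x \<noteq> 0 \<Longrightarrow>
      \<bar>\<psi>' x - (- (p2 0 * q1 0 - p1 0 * q2 0) / (2 * (q1 0)\<^sup>2))\<bar> \<le> C * \<bar>x\<bar>"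
proof -
  define P Q P' Q' where "P = (\<lambda>x. p x / x)" and "Q = (\<lambda>x. q x / x)"
    and "P' = (\<lambda>x. (x * p1 x - p x) / x\<^sup>2)" and "Q' = (\<lambda>x. (x * q1 x - q x) / x\<^sup>2)"
  have P: "linear_near P (p1 0)" "linear_near P' (p2 0 / 2)"
    and dP: "\<And>x. \<bar>x\<bar> \<le> r \<Longrightarrow> x \<noteq> 0 \<Longrightarrow> (P has_real_derivative P' x) (at x)"
    using quotient_by_argument[OF r p] unfolding P_def P'_def by blast+
  have Q: "linear_near Q (q1 0)" "linear_near Q' (q2 0 / 2)"
    and dQ: "\<And>x. \<bar>x\<bar> \<le> r \<Longrightarrow> x \<noteq> 0 \<Longrightarrow> (Q has_real_derivative Q' x) (at x)"
    using quotient_by_argument[OF r q] unfolding Q_def Q'_def by blast+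
  define \<psi> where "\<psi> = (\<lambda>x. - (P x * inverse (Q x)))"
  define \<psi>' where "\<psi>' = (\<lambda>x. - ((P' x * Q x - P x * Q' x) * inverse (Q x * Q x)))"
  have nz: "q1 0 \<noteq> 0" "q1 0 * q1 0 \<noteq> 0" using q10 by auto
  have n\<psi>: "linear_near \<psi> (- (p1 0 * inverse (q1 0)))"
    unfolding \<psi>_def by (intro linear_near_minus linear_near_mult linear_near_inverse P Q nz)
  have n\<psi>': "linear_near \<psi>' (- ((p2 0 / 2 * q1 0 - p1 0 * (q2 0 / 2)) * inverse (q1 0 * q1 0)))"
    unfolding \<psi>'_def by (intro linear_near_minus linear_near_mult linear_near_inverse linear_near_diff P Q nz)
  obtain C1 s1 where 1: "0 < s1" "0 \<le> C1"
    "\<And>x. \<bar>x\<bar> < s1 \<Longrightarrow> x \<noteq> 0 \<Longrightarrow> \<bar>\<psi> x - (- (p1 0 * inverse (q1 0)))\<bar> \<le> C1 * \<bar>x\<bar>"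
    by (rule linear_nearD[OF n\<psi>]) (rule that)
  obtain C2 s2 where 2: "0 < s2" "0 \<le> C2" "\<And>x. \<bar>x\<bar> < s2 \<Longrightarrow> x \<noteq> 0 \<Longrightarrow>
      \<bar>\<psi>' x - (- ((p2 0 / 2 * q1 0 - p1 0 * (q2 0 / 2)) * inverse (q1 0 * q1 0)))\<bar> \<le> C2 * \<bar>x\<bar>"
    by (rule linear_nearD[OF n\<psi>']) (rule that)
  obtain C3 s3 where 3: "0 < s3" "0 \<le> C3" "\<And>x. \<bar>x\<bar> < s3 \<Longrightarrow> x \<noteq> 0 \<Longrightarrow> \<bar>Q x - q1 0\<bar> \<le> C3 * \<bar>x\<bar>"
    by (rule linear_nearD[OF Q(1)]) (rule that)
  \<comment> \<open>Up to this distance q/x deviates from its limit by at most half of that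
    limit.\<close>
  define s4 where "s4 = q1 0 / (2 * (C3 + 1))"
  define s where "s = min (min (s1 / 2) (s2 / 2)) (min (min (s3 / 2) s4) r)"
  have s4: "0 < s4" using q10 3 by (simp add: s4_def)
  have s: "0 < s" "s < s1" "s < s2" "s < s3" "s \<le> s4" "s \<le> r"
    using 1 2 3 s4 r by (auto simp: s_def min_def)
  have Qb: "q1 0 / 2 \<le> Q x \<and> Q x \<le> 2 * q1 0" if x: "\<bar>x\<bar> \<le> s" "x \<noteq> 0" for x
  proof -
    have "C3 * \<bar>x\<bar> \<le> (C3 + 1) * s4" using 3 x s by (intro mult_mono) auto
    also have "\<dots> = q1 0 / 2" using 3 by (simp add: s4_def field_simps)
    finally have "\<bar>Q x - q1 0\<bar> \<le> q1 0 / 2" using 3(3)[of x] x s by linarith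
    then show ?thesis using q10 by linarith
  qed
  have \<psi>_eq: "- p x / q x = \<psi> x" if "x \<noteq> 0" for x
    using that by (simp add: \<psi>_def P_def Q_def divide_inverse)
  show thesis
  proof (rule that[of s "max C1 C2" \<psi>'])
    fix x :: real assume x: "\<bar>x\<bar> \<le> s" "x \<noteq> 0"
    show "q1 0 / 2 \<le> q x / x \<and> q x / x \<le> 2 * q1 0" using Qb[OF x] by (simp add: Q_def)
    have Qx: "Q x \<noteq> 0" using Qb[OF x] q10 by linarith
    have "((\<lambda>x. - (P x / Q x)) has_real_derivative - ((P' x * Q x - P x * Q' x) / (Q x * Q x))) (at x)"
      using x s by (intro DERIV_minus DERIV_divide dP dQ Qx) auto
    then have d: "(\<psi> has_real_derivative \<psi>' x) (at x)"
      by (simp only: \<psi>_def \<psi>'_def divide_inverse)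
    have ev: "\<forall>\<^sub>F y in nhds x. \<psi> y = - p y / q y"
      by (rule eventually_mono[OF t1_space_nhds[OF x(2)]]) (rule \<psi>_eq[symmetric])
    show "((\<lambda>x. - p x / q x) has_real_derivative \<psi>' x) (at x)"
      by (rule iffD1[OF DERIV_cong_ev[OF refl ev refl] d])
    have "\<bar>\<psi> x - (- (p1 0 * inverse (q1 0)))\<bar> \<le> C1 * \<bar>x\<bar>" using 1(3)[of x] x s by linarith
    also have "\<dots> \<le> max C1 C2 * \<bar>x\<bar>" by (intro mult_right_mono) auto
    also have "- (p1 0 * inverse (q1 0)) = - p1 0 / q1 0" by (simp add: divide_inverse)
    finally show "\<bar>- p x / q x - (- p1 0 / q1 0)\<bar> \<le> max C1 C2 * \<bar>x\<bar>"
      by (simp only: \<psi>_eq[OF x(2)])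
    have "\<bar>\<psi>' x - (- ((p2 0 / 2 * q1 0 - p1 0 * (q2 0 / 2)) * inverse (q1 0 * q1 0)))\<bar> \<le> C2 * \<bar>x\<bar>"
      using 2(3)[of x] x s by linarith
    also have "\<dots> \<le> max C1 C2 * \<bar>x\<bar>" by (intro mult_right_mono) auto
    also have "- ((p2 0 / 2 * q1 0 - p1 0 * (q2 0 / 2)) * inverse (q1 0 * q1 0)) =
        - (p2 0 * q1 0 - p1 0 * q2 0) / (2 * (q1 0)\<^sup>2)"
      using nz by (simp add: field_simps power2_eq_square)
    finally show "\<bar>\<psi>' x - (- (p2 0 * q1 0 - p1 0 * q2 0) / (2 * (q1 0)\<^sup>2))\<bar> \<le> max C1 C2 * \<bar>x\<bar>" .
  qed (use s 1 in auto)
qed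

text \<open>\<open>a\<close> is the derivative of the family with respect to the parameter at the origin.\<close>

locale family_bounds =
  fixes U :: "(real \<times> real) set" and f :: "real \<Rightarrow> real \<times> real \<Rightarrow> real" and a r K :: real
    and g1 g2 :: "real \<Rightarrow> real"
  assumes r: "0 < r" and K: "0 \<le> K" and domain: "{-r..r} \<times> {-r..r} \<subseteq> U"
    and cont: "continuous_on ({-r..r} \<times> {-r..r} \<times> {-r..r}) (\<lambda>(\<alpha>, p). f \<alpha> p)"
    and lipschitz: "\<And>\<alpha> x y \<alpha>' x' y'.
      \<bar>\<alpha>\<bar> \<le> r \<Longrightarrow> \<bar>x\<bar> \<le> r \<Longrightarrow> \<bar>y\<bar> \<le> r \<Longrightarrow> \<bar>\<alpha>'\<bar> \<le> r \<Longrightarrow> \<bar>x'\<bar> \<le> r \<Longrightarrow> \<bar>y'\<bar> \<le> r \<Longrightarrow>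
        \<bar>f \<alpha> (x, y) - f \<alpha>' (x', y')\<bar> \<le> K * (\<bar>\<alpha> - \<alpha>'\<bar> + \<bar>x - x'\<bar> + \<bar>y - y'\<bar>)"
    and expansion: "\<And>\<alpha> x y. \<bar>\<alpha>\<bar> \<le> r \<Longrightarrow> \<bar>x\<bar> \<le> r \<Longrightarrow> \<bar>y\<bar> \<le> r \<Longrightarrow>
        \<bar>f \<alpha> (x, y) - f 0 (x, 0) - (\<alpha> * a + y * dy (f 0) 0)\<bar> \<le> K * (\<bar>\<alpha>\<bar> + \<bar>y\<bar>) * (\<bar>\<alpha>\<bar> + \<bar>x\<bar> + \<bar>y\<bar>)"
    and g1: "\<And>x. \<bar>x\<bar> \<le> r \<Longrightarrow> ((\<lambda>x. f 0 (x, 0)) has_real_derivative g1 x) (at x)"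
    and g2: "\<And>x. \<bar>x\<bar> \<le> r \<Longrightarrow> (g1 has_real_derivative g2 x) (at x)"
    and g2_lipschitz: "\<And>x. \<bar>x\<bar> \<le> r \<Longrightarrow> \<bar>g2 x - g2 0\<bar> \<le> K * \<bar>x\<bar>"
    and g1_0: "g1 0 = dx (f 0) 0" and g2_0: "g2 0 = dx (dx (f 0)) 0"

text \<open>The four scalar components of X and Y come with radii and constants of their own; this
  brings them to a common r and a common K.\<close>

lemma family_bounds_mono:
  assumes fb: "family_bounds U f a r K g1 g2" and r': "0 < r'" "r' \<le> r" and K': "K \<le> K'"
  shows "family_bounds U f a r' K' g1 g2"
proof -
  interpret family_bounds U f a r K g1 g2 by (fact fb)
  have le: "c \<le> K * d \<Longrightarrow> 0 \<le> d \<Longrightarrow> c \<le> K' * d" for c d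
    using mult_right_mono[OF K', of d] by linarith
  have sub: "{-r'..r'} \<subseteq> {-r..r}" using r' by auto
  show ?thesis
  proof
    show "0 \<le> K'" using K K' by linarith
    show "{-r'..r'} \<times> {-r'..r'} \<subseteq> U" using Sigma_mono[OF sub sub] domain by (rule order_trans)
    show "continuous_on ({-r'..r'} \<times> {-r'..r'} \<times> {-r'..r'}) (\<lambda>(\<alpha>, p). f \<alpha> p)"
      by (rule continuous_on_subset[OF cont]) (intro Sigma_mono sub)
  next
    fix \<alpha> x y \<alpha>' x' y' :: real
    assume *: "\<bar>\<alpha>\<bar> \<le> r'" "\<bar>x\<bar> \<le> r'" "\<bar>y\<bar> \<le> r'" "\<bar>\<alpha>'\<bar> \<le> r'" "\<bar>x'\<bar> \<le> r'" "\<bar>y'\<bar> \<le> r'"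
    show "\<bar>f \<alpha> (x, y) - f \<alpha>' (x', y')\<bar> \<le> K' * (\<bar>\<alpha> - \<alpha>'\<bar> + \<bar>x - x'\<bar> + \<bar>y - y'\<bar>)"
      by (rule le, rule lipschitz) (use * r' in linarith)+
  next
    fix \<alpha> x y :: real assume *: "\<bar>\<alpha>\<bar> \<le> r'" "\<bar>x\<bar> \<le> r'" "\<bar>y\<bar> \<le> r'"
    have "\<bar>f \<alpha> (x, y) - f 0 (x, 0) - (\<alpha> * a + y * dy (f 0) 0)\<bar> \<le> K * (\<bar>\<alpha>\<bar> + \<bar>y\<bar>) * (\<bar>\<alpha>\<bar> + \<bar>x\<bar> + \<bar>y\<bar>)"
      by (rule expansion) (use * r' in linarith)+
    then show "\<bar>f \<alpha> (x, y) - f 0 (x, 0) - (\<alpha> * a + y * dy (f 0) 0)\<bar> \<le> K' * (\<bar>\<alpha>\<bar> + \<bar>y\<bar>) * (\<bar>\<alpha>\<bar> + \<bar>x\<bar> + \<bar>y\<bar>)"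
      unfolding mult.assoc by (rule le) simp
  next
    fix x :: real assume "\<bar>x\<bar> \<le> r'"
    then have x: "\<bar>x\<bar> \<le> r" using r' by simp
    show "((\<lambda>x. f 0 (x, 0)) has_real_derivative g1 x) (at x)" by (rule g1[OF x])
    show "(g1 has_real_derivative g2 x) (at x)" by (rule g2[OF x])
    show "\<bar>g2 x - g2 0\<bar> \<le> K' * \<bar>x\<bar>" by (rule le[OF g2_lipschitz[OF x]]) simp
  qed (fact r'(1) g1_0 g2_0)+
qed

lemma family_bounds_exist:
  fixes f :: "real \<Rightarrow> real \<times> real \<Rightarrow> real"
  assumes f: "Ck_on 3 (A \<times> U) (\<lambda>(\<alpha>, p). f \<alpha> p)" and AU: "open A" "0 \<in> A" "open U" "0 \<in> U"
    and a: "((\<lambda>\<alpha>. f \<alpha> 0) has_real_derivative a) (at 0)"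
  obtains r K g1 g2 where "family_bounds U f a r K g1 g2"
proof -
  define h where "h = (\<lambda>(\<alpha>, p). f \<alpha> p)"
  have h: "Ck_on (Suc (Suc (Suc 0))) (A \<times> U) h" using f by (simp add: h_def numeral_3_eq_3)
  have S: "open (A \<times> U)" "0 \<in> A \<times> U" using AU by (auto simp: open_Times zero_prod_def)
  obtain r1 K1 where 1: "0 < r1" "cball 0 r1 \<subseteq> A \<times> U" "0 \<le> K1"
    "\<And>x y. x \<in> cball 0 r1 \<Longrightarrow> y \<in> cball 0 r1 \<Longrightarrow> norm (h x - h y) \<le> K1 * norm (x - y)"
    by (rule Ck_on_locally_lipschitz[OF h S]) (rule that)
  obtain r2 K2 where 2: "0 < r2" "cball 0 r2 \<subseteq> A \<times> U" "0 \<le> K2"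
    "\<And>x y. x \<in> cball 0 r2 \<Longrightarrow> y \<in> cball 0 r2 \<Longrightarrow>
      norm (h x - h y - frechet_derivative h (at 0) (x - y)) \<le> K2 * max (norm (x - 0)) (norm (y - 0)) * norm (x - y)"
    by (rule Ck_on_quadratic_remainder[OF h S]) (rule that)
  \<comment> \<open>The direction of the x-axis in the space of (\<alpha>, x, y); \<open>g1\<close>
    and \<open>g2\<close> are the derivatives of the unperturbed field along y = 0.\<close>
  define e :: "real \<times> real \<times> real" where "e = (0, (1, 0))"
  obtain r3 K3 g1 g2 where 3: "0 < r3" "0 \<le> K3" "\<And>s. \<bar>s\<bar> \<le> r3 \<Longrightarrow> 0 + s *\<^sub>R e \<in> A \<times> U"
    "\<And>s. \<bar>s\<bar> \<le> r3 \<Longrightarrow> ((\<lambda>s. h (0 + s *\<^sub>R e)) has_real_derivative g1 s) (at s)"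
    "\<And>s. \<bar>s\<bar> \<le> r3 \<Longrightarrow> (g1 has_real_derivative g2 s) (at s)"
    "\<And>s. \<bar>s\<bar> \<le> r3 \<Longrightarrow> \<bar>g2 s - g2 0\<bar> \<le> K3 * \<bar>s\<bar>"
    by (rule Ck_on_line[OF h S, of e]) (rule that)
  define D where "D = frechet_derivative h (at 0)"
  have lin: "linear D"
    unfolding D_def by (rule has_derivative_linear[OF Ck_on_Suc_D(1)[OF h S(2)]])
  have line: "((\<lambda>s. h (s *\<^sub>R d)) has_vector_derivative D d) (at 0)" for d
    using frechet_derivative_line[OF h, of 0 0 d] S(2)
    by (simp only: scaleR_zero_left add_0_left D_def)
  have Da: "D (1, (0, 0)) = a"
  proof -
    have "((\<lambda>\<alpha>. f \<alpha> 0) has_real_derivative D (1, (0, 0))) (at 0)"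
      using line[of "(1, (0, 0))"] by (simp add: h_def has_real_derivative_iff_has_vector_derivative zero_prod_def)
    then show ?thesis using a by (rule DERIV_unique)
  qed
  have Dy: "D (0, (0, 1)) = dy (f 0) 0"
  proof -
    have "((\<lambda>s. f 0 (0, s)) has_real_derivative D (0, (0, 1))) (at 0)"
      using line[of "(0, (0, 1))"] by (simp add: h_def has_real_derivative_iff_has_vector_derivative zero_prod_def)
    then show ?thesis by (simp add: dy_def DERIV_imp_deriv)
  qed
  \<comment> \<open>The norm of a triple is at most the sum of its three entries, hence the division
    by 3.\<close>
  define r where "r = min (min r1 r2) r3 / 3"
  define K where "K = max (max K1 K2) K3"
  have r: "0 < r" "3 * r \<le> r1" "3 * r \<le> r2" "r \<le> r3" using 1 2 3 by (auto simp: r_def)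
  have K: "K1 \<le> K" "K2 \<le> K" "K3 \<le> K" "0 \<le> K" using 1 by (auto simp: K_def)
  have norm3: "norm (\<alpha>, (x, y)) \<le> \<bar>\<alpha>\<bar> + \<bar>x\<bar> + \<bar>y\<bar>" for \<alpha> x y :: real
    using norm_Pair_le[of \<alpha> "(x, y)"] norm_Pair_le[of x y] by simp
  have ball: "(\<alpha>, (x, y)) \<in> cball 0 r1" "(\<alpha>, (x, y)) \<in> cball 0 r2"
    if "\<bar>\<alpha>\<bar> \<le> r" "\<bar>x\<bar> \<le> r" "\<bar>y\<bar> \<le> r" for \<alpha> x y :: real
    using norm3[of \<alpha> x y] that r by auto
  have dom: "(\<alpha>, (x, y)) \<in> A \<times> U" if "\<bar>\<alpha>\<bar> \<le> r" "\<bar>x\<bar> \<le> r" "\<bar>y\<bar> \<le> r" for \<alpha> x y :: real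
    using ball(1)[OF that] 1(2) by blast
  have g1: "((\<lambda>x. f 0 (x, 0)) has_real_derivative g1 x) (at x)" if "\<bar>x\<bar> \<le> r3" for x
    using 3(4)[OF that] by (simp add: h_def e_def zero_prod_def)
  have "family_bounds U f a r K g1 g2"
  proof
    show "{-r..r} \<times> {-r..r} \<subseteq> U" using dom[of 0] r by (auto simp: abs_le_iff)
    show "continuous_on ({-r..r} \<times> {-r..r} \<times> {-r..r}) (\<lambda>(\<alpha>, p). f \<alpha> p)"
    proof (rule continuous_on_subset[OF Ck_on_imp_continuous_on[OF f]], rule subsetI)
      fix z assume "z \<in> {-r..r} \<times> {-r..r} \<times> {-r..r}"
      then have "(fst z, (fst (snd z), snd (snd z))) \<in> A \<times> U"
        by (intro dom) (auto simp: abs_le_iff)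
      then show "z \<in> A \<times> U" by simp
    qed
  next
    fix \<alpha> x y \<alpha>' x' y' :: real
    assume *: "\<bar>\<alpha>\<bar> \<le> r" "\<bar>x\<bar> \<le> r" "\<bar>y\<bar> \<le> r" "\<bar>\<alpha>'\<bar> \<le> r" "\<bar>x'\<bar> \<le> r" "\<bar>y'\<bar> \<le> r"
    have "\<bar>f \<alpha> (x, y) - f \<alpha>' (x', y')\<bar> \<le> K1 * norm (\<alpha> - \<alpha>', (x - x', y - y'))"
      using 1(4)[OF ball(1)[OF *(1-3)] ball(1)[OF *(4-6)]] by (simp add: h_def)
    also have "\<dots> \<le> K * (\<bar>\<alpha> - \<alpha>'\<bar> + \<bar>x - x'\<bar> + \<bar>y - y'\<bar>)"
      using K norm3 by (intro mult_mono) auto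
    finally show "\<bar>f \<alpha> (x, y) - f \<alpha>' (x', y')\<bar> \<le> K * (\<bar>\<alpha> - \<alpha>'\<bar> + \<bar>x - x'\<bar> + \<bar>y - y'\<bar>)" .
  next
    fix \<alpha> x y :: real assume *: "\<bar>\<alpha>\<bar> \<le> r" "\<bar>x\<bar> \<le> r" "\<bar>y\<bar> \<le> r"
    have z: "\<bar>0\<bar> \<le> r" using r by simp
    have "D (\<alpha>, (0, y)) = D (\<alpha> *\<^sub>R (1, (0, 0)) + y *\<^sub>R (0, (0, 1)))" by simp
    also have "\<dots> = \<alpha> * a + y * dy (f 0) 0"
      unfolding linear_add[OF lin] linear_scale[OF lin] Da Dy by simp
    finally have D: "D (\<alpha>, (0, y)) = \<alpha> * a + y * dy (f 0) 0" .
    \<comment> \<open>The points compared, (\<alpha>, x, y) and (0, x, 0), have the same x. So the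
      increment has the size of \<alpha> and y alone, which are of order \<epsilon> later, while x
      enters only through the distance to the origin.\<close>
    have "\<bar>f \<alpha> (x, y) - f 0 (x, 0) - (\<alpha> * a + y * dy (f 0) 0)\<bar>
        \<le> K2 * max (norm (\<alpha>, (x, y))) (norm (0::real, (x, 0::real))) * norm (\<alpha>, (0::real, y))"
      using 2(4)[OF ball(2)[OF *] ball(2)[OF z *(2) z], folded D_def] by (simp add: h_def D)
    also have "\<dots> \<le> K * (\<bar>\<alpha>\<bar> + \<bar>x\<bar> + \<bar>y\<bar>) * (\<bar>\<alpha>\<bar> + \<bar>y\<bar>)"
      using K norm3[of \<alpha> x y] norm3[of 0 x 0] norm3[of \<alpha> 0 y]
      by (intro mult_mono mult_nonneg_nonneg) (auto simp: le_max_iff_disj)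
    finally show "\<bar>f \<alpha> (x, y) - f 0 (x, 0) - (\<alpha> * a + y * dy (f 0) 0)\<bar>
        \<le> K * (\<bar>\<alpha>\<bar> + \<bar>y\<bar>) * (\<bar>\<alpha>\<bar> + \<bar>x\<bar> + \<bar>y\<bar>)" by (simp only: mult_ac)
  next
    fix x assume x: "\<bar>x\<bar> \<le> r"
    then have x3: "\<bar>x\<bar> \<le> r3" using r by simp
    show "((\<lambda>x. f 0 (x, 0)) has_real_derivative g1 x) (at x)" by (rule g1[OF x3])
    show "(g1 has_real_derivative g2 x) (at x)" by (rule 3(5)[OF x3])
    have "K3 * \<bar>x\<bar> \<le> K * \<bar>x\<bar>" using K by (intro mult_right_mono) auto
    with 3(6)[OF x3] show "\<bar>g2 x - g2 0\<bar> \<le> K * \<bar>x\<bar>" by linarith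
  next
    have dx_g1: "dx (f 0) (s, 0) = g1 s" if "\<bar>s\<bar> \<le> r3" for s
      using g1[OF that] by (simp add: dx_def DERIV_imp_deriv)
    show "g1 0 = dx (f 0) 0" using dx_g1[of 0] 3(1) by (simp add: zero_prod_def)
    have "\<forall>\<^sub>F s in nhds 0. dx (f 0) (s, 0) = g1 s"
      using 3(1) dx_g1 unfolding eventually_nhds_metric
      by (intro exI[of _ r3]) (auto simp: dist_real_def)
    then have "((\<lambda>s. dx (f 0) (s, 0)) has_real_derivative g2 0) (at 0)"
      using iffD2[OF DERIV_cong_ev[OF refl _ refl] 3(5)[of 0]] 3(1) by simp
    then show "g2 0 = dx (dx (f 0)) 0"
      unfolding dx_def[of "dx (f 0)"] by (simp add: DERIV_imp_deriv)
  qed (use r K in auto)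
  then show thesis by (rule that)
qed

text \<open>The quadratic remainder, taken at the origin, identifies \<open>X' 0\<close> as the
  derivative with respect to the parameter there.\<close>

lemma smooth_unfolding_parameter_derivative:
  assumes "smooth_unfolding A U X X'" "0 \<in> U"
  shows "((\<lambda>\<alpha>. X \<alpha> 0) has_vector_derivative X' 0) (at 0)"
proof -
  obtain C where C: "\<forall>\<^sub>F \<alpha> in nhds 0. norm (X \<alpha> 0 - X 0 0 - \<alpha> *\<^sub>R X' 0) \<le> C * \<alpha>\<^sup>2"
    using assms by (auto simp: smooth_unfolding_def)
  have "((\<lambda>h. norm (X (0 + h) 0 - X 0 0 - h *\<^sub>R X' 0) / norm h) \<longlongrightarrow> 0) (at 0)"
  proof (rule Lim_null_comparison)
    show "\<forall>\<^sub>F h in at 0. norm (norm (X (0 + h) 0 - X 0 0 - h *\<^sub>R X' 0) / norm h) \<le> C * \<bar>h\<bar>"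
      using C unfolding eventually_at_filter
    proof eventually_elim
      case (elim h)
      have "C * h\<^sup>2 = C * \<bar>h\<bar> * \<bar>h\<bar>" by (simp add: power2_eq_square mult.assoc)
      with elim show ?case by (simp add: pos_divide_le_eq)
    qed
    have "((\<lambda>h. C * \<bar>h\<bar>) \<longlongrightarrow> C * \<bar>0\<bar>) (at 0)" by (intro tendsto_intros)
    then show "((\<lambda>h. C * \<bar>h\<bar>) \<longlongrightarrow> 0) (at 0)" by simp
  qed
  then show ?thesis
    unfolding has_vector_derivative_def has_derivative_at
    by (simp add: bounded_linear_scaleR_left)
qed

lemma smooth_unfolding_family_bounds:
  assumes X: "smooth_unfolding A U X X'" and AU: "open A" "0 \<in> A" "open U" "0 \<in> U"
    and L: "bounded_linear (L :: real \<times> real \<Rightarrow> real)"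
  obtains r K g1 g2 where "family_bounds U (\<lambda>\<alpha> p. L (X \<alpha> p)) (L (X' 0)) r K g1 g2"
proof (rule family_bounds_exist[of A U "\<lambda>\<alpha> p. L (X \<alpha> p)" "L (X' 0)"])
  have "Ck_on 3 (A \<times> U) (\<lambda>z. L (case z of (\<alpha>, p) \<Rightarrow> X \<alpha> p))"
    using X AU by (intro Ck_on_bounded_linear[OF _ L]) (auto simp: smooth_unfolding_def open_Times)
  then show "Ck_on 3 (A \<times> U) (\<lambda>(\<alpha>, p). L (X \<alpha> p))" by (simp add: case_prod_unfold)
  show "((\<lambda>\<alpha>. L (X \<alpha> 0)) has_real_derivative L (X' 0)) (at 0)"
    unfolding has_real_derivative_iff_has_vector_derivative
    by (rule bounded_linear.has_vector_derivative[OF L smooth_unfolding_parameter_derivative[OF X AU(4)]])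
qed (use AU that in auto)

section \<open>The regularized fold\<close>

lemma reversed_field:
  assumes "\<forall>\<^sub>F \<epsilon> in at_right 0.
       continuous_on ({-(D*\<epsilon>)..D*\<epsilon>} \<times> {-L0..L0} \<times> {v0-\<eta>..v0+\<eta>}) (\<lambda>(\<alpha>, p). F \<alpha> \<epsilon> p) \<and>
       (\<exists>K. \<forall>\<alpha>\<in>{-(D*\<epsilon>)..D*\<epsilon>}. \<forall>x\<in>{-L0..L0}. \<forall>u v. \<bar>u - v0\<bar> \<le> \<eta> \<longrightarrow> \<bar>v - v0\<bar> \<le> \<eta> \<longrightarrow>
          \<bar>slope (F \<alpha> \<epsilon>) \<epsilon> x u - slope (F \<alpha> \<epsilon>) \<epsilon> x v\<bar> \<le> K * \<bar>u - v\<bar>) \<and>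
       (\<forall>\<alpha>\<in>{-(D*\<epsilon>)..D*\<epsilon>}. \<forall>x\<in>{-L0..L0}. \<forall>v. \<bar>v - v0\<bar> \<le> \<eta> \<longrightarrow>
          f0 \<le> c1 (F \<alpha> \<epsilon>) (x, v) \<and> c1 (F \<alpha> \<epsilon>) (x, v) \<le> f1)"
  shows "\<forall>\<^sub>F \<epsilon> in at_right 0.
       continuous_on ({-(D*\<epsilon>)..D*\<epsilon>} \<times> {-L0..L0} \<times> {v0-\<eta>..v0+\<eta>}) (\<lambda>(\<alpha>, p). reversed (F \<alpha> \<epsilon>) p) \<and>
       (\<exists>K. \<forall>\<alpha>\<in>{-(D*\<epsilon>)..D*\<epsilon>}. \<forall>x\<in>{-L0..L0}. \<forall>u v. \<bar>u - v0\<bar> \<le> \<eta> \<longrightarrow> \<bar>v - v0\<bar> \<le> \<eta> \<longrightarrow>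
          \<bar>slope (reversed (F \<alpha> \<epsilon>)) \<epsilon> x u - slope (reversed (F \<alpha> \<epsilon>)) \<epsilon> x v\<bar> \<le> K * \<bar>u - v\<bar>) \<and>
       (\<forall>\<alpha>\<in>{-(D*\<epsilon>)..D*\<epsilon>}. \<forall>x\<in>{-L0..L0}. \<forall>v. \<bar>v - v0\<bar> \<le> \<eta> \<longrightarrow>
          f0 \<le> c1 (reversed (F \<alpha> \<epsilon>)) (x, v) \<and> c1 (reversed (F \<alpha> \<epsilon>)) (x, v) \<le> f1)"
  using assms
proof eventually_elim
  case (elim \<epsilon>)
  let ?S = "{-(D*\<epsilon>)..D*\<epsilon>}" and ?V = "{v0-\<eta>..v0+\<eta>}"
  obtain K where cont: "continuous_on (?S \<times> {-L0..L0} \<times> ?V) (\<lambda>(\<alpha>, p). F \<alpha> \<epsilon> p)"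
    and K: "\<forall>\<alpha>\<in>?S. \<forall>x\<in>{-L0..L0}. \<forall>u v. \<bar>u - v0\<bar> \<le> \<eta> \<longrightarrow> \<bar>v - v0\<bar> \<le> \<eta> \<longrightarrow>
          \<bar>slope (F \<alpha> \<epsilon>) \<epsilon> x u - slope (F \<alpha> \<epsilon>) \<epsilon> x v\<bar> \<le> K * \<bar>u - v\<bar>"
    and b: "\<forall>\<alpha>\<in>?S. \<forall>x\<in>{-L0..L0}. \<forall>v. \<bar>v - v0\<bar> \<le> \<eta> \<longrightarrow>
          f0 \<le> c1 (F \<alpha> \<epsilon>) (x, v) \<and> c1 (F \<alpha> \<epsilon>) (x, v) \<le> f1"
    using elim by (elim conjE exE)
  show ?case
  proof (intro conjI exI[of _ K] ballI allI impI)
    have "continuous_on (?S \<times> {-L0..L0} \<times> ?V)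
        (\<lambda>z. (\<lambda>(\<alpha>, p). F \<alpha> \<epsilon> p) (fst z, (- fst (snd z), snd (snd z))))"
      by (rule continuous_on_compose2[OF cont]) (auto intro!: continuous_intros)
    then have "continuous_on (?S \<times> {-L0..L0} \<times> ?V)
        (\<lambda>z. (c1 (F (fst z) \<epsilon>) (- fst (snd z), snd (snd z)), - c2 (F (fst z) \<epsilon>) (- fst (snd z), snd (snd z))))"
      by (intro continuous_on_Pair continuous_on_minus continuous_on_fst continuous_on_snd)
        (simp_all add: case_prod_unfold)
    then show "continuous_on (?S \<times> {-L0..L0} \<times> ?V) (\<lambda>(\<alpha>, p). reversed (F \<alpha> \<epsilon>) p)"
      by (simp add: reversed_def case_prod_unfold)
  next
    fix \<alpha> x u v assume *: "\<alpha> \<in> ?S" "x \<in> {-L0..L0}" "\<bar>u - v0\<bar> \<le> \<eta>" "\<bar>v - v0\<bar> \<le> \<eta>"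
    then have "- x \<in> {-L0..L0}" by auto
    with * K show "\<bar>slope (reversed (F \<alpha> \<epsilon>)) \<epsilon> x u - slope (reversed (F \<alpha> \<epsilon>)) \<epsilon> x v\<bar> \<le> K * \<bar>u - v\<bar>"
      by (simp add: slope_reversed abs_minus_commute)
  next
    fix \<alpha> x v assume *: "\<alpha> \<in> ?S" "x \<in> {-L0..L0}" "\<bar>v - v0\<bar> \<le> \<eta>"
    then have "- x \<in> {-L0..L0}" by auto
    with * b show "f0 \<le> c1 (reversed (F \<alpha> \<epsilon>)) (x, v)" "c1 (reversed (F \<alpha> \<epsilon>)) (x, v) \<le> f1"
      by (simp_all add: reversed_def)
  qed
qed

text \<open>The hypotheses are symmetric in x, so the reflected field satisfies them with the
  reflected \<psi> and with -c0. Nothing is required of the derivative of \<psi> at 0, where it is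
  given by a quotient.\<close>

lemma canard_pointI:
  fixes F :: "real \<Rightarrow> real \<Rightarrow> vfield"
  assumes pos: "0 < \<eta>" "0 < L0" "0 < g0" "0 < f0" "0 < d0" and c0: "c0 \<noteq> 0"
    and \<phi>': "\<And>v. \<bar>v - v0\<bar> \<le> \<eta> \<Longrightarrow> (\<phi> has_real_derivative \<phi>' v) (at v)"
    and \<phi>_expand: "\<And>u v. \<bar>u - v0\<bar> \<le> \<eta> \<Longrightarrow> \<bar>v - v0\<bar> \<le> \<eta> \<Longrightarrow> d0 * \<bar>u - v\<bar> \<le> \<bar>\<phi> u - \<phi> v\<bar>"
    and \<psi>': "\<And>x. \<bar>x\<bar> \<le> L0 \<Longrightarrow> x \<noteq> 0 \<Longrightarrow> (\<psi> has_real_derivative \<psi>' x) (at x)"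
    and \<psi>_cont: "continuous_on {-L0..L0} \<psi>" and \<psi>_0: "\<psi> 0 = \<phi> v0"
    and \<psi>_close: "\<And>x. \<bar>x\<bar> \<le> L0 \<Longrightarrow> \<bar>\<psi> x - \<phi> v0\<bar> \<le> d0 * \<eta> / 2"
    and gap: "\<And>x v. \<bar>x\<bar> \<le> L0 \<Longrightarrow> \<bar>v - v0\<bar> \<le> \<eta> \<Longrightarrow> \<bar>\<phi> v - \<psi> x\<bar> \<le> 2"
    and field: "\<And>D. 0 < D \<Longrightarrow> \<forall>\<^sub>F \<epsilon> in at_right 0.
       continuous_on ({-(D*\<epsilon>)..D*\<epsilon>} \<times> {-L0..L0} \<times> {v0-\<eta>..v0+\<eta>}) (\<lambda>(\<alpha>, p). F \<alpha> \<epsilon> p) \<and>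
       (\<exists>K. \<forall>\<alpha>\<in>{-(D*\<epsilon>)..D*\<epsilon>}. \<forall>x\<in>{-L0..L0}. \<forall>u v. \<bar>u - v0\<bar> \<le> \<eta> \<longrightarrow> \<bar>v - v0\<bar> \<le> \<eta> \<longrightarrow>
          \<bar>slope (F \<alpha> \<epsilon>) \<epsilon> x u - slope (F \<alpha> \<epsilon>) \<epsilon> x v\<bar> \<le> K * \<bar>u - v\<bar>) \<and>
       (\<forall>\<alpha>\<in>{-(D*\<epsilon>)..D*\<epsilon>}. \<forall>x\<in>{-L0..L0}. \<forall>v. \<bar>v - v0\<bar> \<le> \<eta> \<longrightarrow>
          f0 \<le> c1 (F \<alpha> \<epsilon>) (x, v) \<and> c1 (F \<alpha> \<epsilon>) (x, v) \<le> f1)"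
    and normal_form: "\<And>D. 0 < D \<Longrightarrow> \<exists>C. \<forall>\<^sub>F \<epsilon> in at_right 0.
       \<forall>\<alpha>\<in>{-(D*\<epsilon>)..D*\<epsilon>}. \<forall>x\<in>{-L0..L0} - {0}. \<forall>v. \<bar>v - v0\<bar> \<le> \<eta> \<longrightarrow> (\<exists>g\<in>{g0..g1}.
          \<bar>\<phi>' v * c2 (F \<alpha> \<epsilon>) (x, v) - \<epsilon> * c1 (F \<alpha> \<epsilon>) (x, v) * \<psi>' x
            - g * x * (\<phi> v - \<psi> x) * c1 (F \<alpha> \<epsilon>) (x, v) - c0 * (\<alpha> - \<delta>C * \<epsilon>)\<bar>
          \<le> C * \<epsilon> * (\<bar>x\<bar> + \<bar>\<phi> v - \<psi> x\<bar> + \<epsilon>))"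
    and domain: "\<forall>\<^sub>F \<epsilon> in at_right 0. \<forall>x\<in>{-L0..L0}. \<forall>v. \<bar>v - v0\<bar> \<le> \<eta> \<longrightarrow> (x, \<epsilon> * v) \<in> U"
  shows "canard_point F \<phi> \<phi>' \<psi> \<psi>' v0 \<eta> L0 g0 g1 f0 f1 d0 c0 \<delta>C U"
proof -
  \<comment> \<open>One argument for both sides: G stands for F and then for its reflection, each
    with its own critical level and its own sign of c.\<close>
  have half: "attracting_branch G \<phi> \<phi>' \<psi>1 \<psi>1' v0 \<eta> L0 g0 g1 f0 f1 d0 c \<delta>C"
    if \<psi>1': "\<And>x. \<bar>x\<bar> \<le> L0 \<Longrightarrow> x \<noteq> 0 \<Longrightarrow> (\<psi>1 has_real_derivative \<psi>1' x) (at x)"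
      and \<psi>1_cont: "continuous_on {-L0..L0} \<psi>1" and \<psi>1: "\<psi>1 0 = \<phi> v0"
      "\<And>x. \<bar>x\<bar> \<le> L0 \<Longrightarrow> \<bar>\<psi>1 x - \<phi> v0\<bar> \<le> d0 * \<eta> / 2"
      "\<And>x v. \<bar>x\<bar> \<le> L0 \<Longrightarrow> \<bar>v - v0\<bar> \<le> \<eta> \<Longrightarrow> \<bar>\<phi> v - \<psi>1 x\<bar> \<le> 2"
      and fG: "\<And>D. 0 < D \<Longrightarrow> \<forall>\<^sub>F \<epsilon> in at_right 0.
       continuous_on ({-(D*\<epsilon>)..D*\<epsilon>} \<times> {-L0..L0} \<times> {v0-\<eta>..v0+\<eta>}) (\<lambda>(\<alpha>, p). G \<alpha> \<epsilon> p) \<and>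
       (\<exists>K. \<forall>\<alpha>\<in>{-(D*\<epsilon>)..D*\<epsilon>}. \<forall>x\<in>{-L0..L0}. \<forall>u v. \<bar>u - v0\<bar> \<le> \<eta> \<longrightarrow> \<bar>v - v0\<bar> \<le> \<eta> \<longrightarrow>
          \<bar>slope (G \<alpha> \<epsilon>) \<epsilon> x u - slope (G \<alpha> \<epsilon>) \<epsilon> x v\<bar> \<le> K * \<bar>u - v\<bar>) \<and>
       (\<forall>\<alpha>\<in>{-(D*\<epsilon>)..D*\<epsilon>}. \<forall>x\<in>{-L0..L0}. \<forall>v. \<bar>v - v0\<bar> \<le> \<eta> \<longrightarrow>
          f0 \<le> c1 (G \<alpha> \<epsilon>) (x, v) \<and> c1 (G \<alpha> \<epsilon>) (x, v) \<le> f1)"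
      and nG: "\<And>D. 0 < D \<Longrightarrow> \<exists>C. \<forall>\<^sub>F \<epsilon> in at_right 0.
       \<forall>\<alpha>\<in>{-(D*\<epsilon>)..D*\<epsilon>}. \<forall>x\<in>{-L0..L0} - {0}. \<forall>v. \<bar>v - v0\<bar> \<le> \<eta> \<longrightarrow> (\<exists>g\<in>{g0..g1}.
          \<bar>\<phi>' v * c2 (G \<alpha> \<epsilon>) (x, v) - \<epsilon> * c1 (G \<alpha> \<epsilon>) (x, v) * \<psi>1' x
            - g * x * (\<phi> v - \<psi>1 x) * c1 (G \<alpha> \<epsilon>) (x, v) - c * (\<alpha> - \<delta>C * \<epsilon>)\<bar>
          \<le> C * \<epsilon> * (\<bar>x\<bar> + \<bar>\<phi> v - \<psi>1 x\<bar> + \<epsilon>))"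
    for G \<psi>1 \<psi>1' c
  proof
    show "(\<psi>1 has_real_derivative \<psi>1' x) (at x)" if "x \<in> {-L0..<0}" for x
      using that by (intro \<psi>1') auto
    show "continuous_on {-L0..0} \<psi>1"
      by (rule continuous_on_subset[OF \<psi>1_cont]) (use pos in auto)
    show "\<bar>\<psi>1 x - \<phi> v0\<bar> \<le> d0 * \<eta> / 2" if "x \<in> {-L0..0}" for x using that by (intro \<psi>1(2)) auto
    show "\<bar>\<phi> v - \<psi>1 x\<bar> \<le> 2" if "x \<in> {-L0..0}" "\<bar>v - v0\<bar> \<le> \<eta>" for x v using that by (intro \<psi>1(3)) auto
    have sub: "{-L0..0} \<subseteq> {-L0..L0}" "{-L0..<0} \<subseteq> {-L0..L0} - {0}" using pos by auto
    fix D :: real assume D: "0 < D"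
    show "\<forall>\<^sub>F \<epsilon> in at_right 0.
       continuous_on ({-(D*\<epsilon>)..D*\<epsilon>} \<times> {-L0..0} \<times> {v0-\<eta>..v0+\<eta>}) (\<lambda>(\<alpha>, p). G \<alpha> \<epsilon> p) \<and>
       (\<exists>K. \<forall>\<alpha>\<in>{-(D*\<epsilon>)..D*\<epsilon>}. \<forall>x\<in>{-L0..0}. \<forall>u v. \<bar>u - v0\<bar> \<le> \<eta> \<longrightarrow> \<bar>v - v0\<bar> \<le> \<eta> \<longrightarrow>
          \<bar>slope (G \<alpha> \<epsilon>) \<epsilon> x u - slope (G \<alpha> \<epsilon>) \<epsilon> x v\<bar> \<le> K * \<bar>u - v\<bar>) \<and>
       (\<forall>\<alpha>\<in>{-(D*\<epsilon>)..D*\<epsilon>}. \<forall>x\<in>{-L0..0}. \<forall>v. \<bar>v - v0\<bar> \<le> \<eta> \<longrightarrow>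
          f0 \<le> c1 (G \<alpha> \<epsilon>) (x, v) \<and> c1 (G \<alpha> \<epsilon>) (x, v) \<le> f1)"
      using fG[OF D]
    proof eventually_elim
      case (elim \<epsilon>)
      have "continuous_on ({-(D*\<epsilon>)..D*\<epsilon>} \<times> {-L0..0} \<times> {v0-\<eta>..v0+\<eta>}) (\<lambda>(\<alpha>, p). G \<alpha> \<epsilon> p)"
        by (rule continuous_on_subset[OF conjunct1[OF elim]]) (intro Sigma_mono sub order_refl)
      with conjunct2[OF elim] sub(1) show ?case by blast
    qed
    obtain C where C: "\<forall>\<^sub>F \<epsilon> in at_right 0.
       \<forall>\<alpha>\<in>{-(D*\<epsilon>)..D*\<epsilon>}. \<forall>x\<in>{-L0..L0} - {0}. \<forall>v. \<bar>v - v0\<bar> \<le> \<eta> \<longrightarrow> (\<exists>g\<in>{g0..g1}.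
          \<bar>\<phi>' v * c2 (G \<alpha> \<epsilon>) (x, v) - \<epsilon> * c1 (G \<alpha> \<epsilon>) (x, v) * \<psi>1' x
            - g * x * (\<phi> v - \<psi>1 x) * c1 (G \<alpha> \<epsilon>) (x, v) - c * (\<alpha> - \<delta>C * \<epsilon>)\<bar>
          \<le> C * \<epsilon> * (\<bar>x\<bar> + \<bar>\<phi> v - \<psi>1 x\<bar> + \<epsilon>))"
      using nG[OF D] by (elim exE)
    show "\<exists>C. \<forall>\<^sub>F \<epsilon> in at_right 0.
       \<forall>\<alpha>\<in>{-(D*\<epsilon>)..D*\<epsilon>}. \<forall>x\<in>{-L0..<0}. \<forall>v. \<bar>v - v0\<bar> \<le> \<eta> \<longrightarrow> (\<exists>g\<in>{g0..g1}.
          \<bar>\<phi>' v * c2 (G \<alpha> \<epsilon>) (x, v) - \<epsilon> * c1 (G \<alpha> \<epsilon>) (x, v) * \<psi>1' x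
            - g * x * (\<phi> v - \<psi>1 x) * c1 (G \<alpha> \<epsilon>) (x, v) - c * (\<alpha> - \<delta>C * \<epsilon>)\<bar>
          \<le> C * \<epsilon> * (\<bar>x\<bar> + \<bar>\<phi> v - \<psi>1 x\<bar> + \<epsilon>))"
      by (rule exI[of _ C], rule eventually_mono[OF C]) (use sub(2) in blast)
  qed (fact pos \<phi>' \<phi>_expand \<psi>1(1))+
  have left: "attracting_branch F \<phi> \<phi>' \<psi> \<psi>' v0 \<eta> L0 g0 g1 f0 f1 d0 c0 \<delta>C"
    by (rule half[OF \<psi>' \<psi>_cont \<psi>_0 \<psi>_close gap field normal_form])
  have right: "attracting_branch (\<lambda>\<alpha> \<epsilon>. reversed (F \<alpha> \<epsilon>)) \<phi> \<phi>' (\<lambda>x. \<psi> (- x)) (\<lambda>x. - \<psi>' (- x))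
      v0 \<eta> L0 g0 g1 f0 f1 d0 (- c0) \<delta>C"
  proof (rule half)
    show "((\<lambda>x. \<psi> (- x)) has_real_derivative - \<psi>' (- x)) (at x)" if "\<bar>x\<bar> \<le> L0" "x \<noteq> 0" for x
      using \<psi>'[of "- x"] that by (simp add: DERIV_mirror)
    show "continuous_on {-L0..L0} (\<lambda>x. \<psi> (- x))"
      by (rule continuous_on_compose2[OF \<psi>_cont]) (auto intro!: continuous_intros)
    show "\<bar>\<psi> (- x) - \<phi> v0\<bar> \<le> d0 * \<eta> / 2" if "\<bar>x\<bar> \<le> L0" for x using that by (intro \<psi>_close) auto
    show "\<bar>\<phi> v - \<psi> (- x)\<bar> \<le> 2" if "\<bar>x\<bar> \<le> L0" "\<bar>v - v0\<bar> \<le> \<eta>" for x v using that by (intro gap) auto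
    show "\<psi> (- 0) = \<phi> v0" using \<psi>_0 by simp
    fix D :: real assume D: "0 < D"
    show "\<forall>\<^sub>F \<epsilon> in at_right 0.
       continuous_on ({-(D*\<epsilon>)..D*\<epsilon>} \<times> {-L0..L0} \<times> {v0-\<eta>..v0+\<eta>}) (\<lambda>(\<alpha>, p). reversed (F \<alpha> \<epsilon>) p) \<and>
       (\<exists>K. \<forall>\<alpha>\<in>{-(D*\<epsilon>)..D*\<epsilon>}. \<forall>x\<in>{-L0..L0}. \<forall>u v. \<bar>u - v0\<bar> \<le> \<eta> \<longrightarrow> \<bar>v - v0\<bar> \<le> \<eta> \<longrightarrow>
          \<bar>slope (reversed (F \<alpha> \<epsilon>)) \<epsilon> x u - slope (reversed (F \<alpha> \<epsilon>)) \<epsilon> x v\<bar> \<le> K * \<bar>u - v\<bar>) \<and>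
       (\<forall>\<alpha>\<in>{-(D*\<epsilon>)..D*\<epsilon>}. \<forall>x\<in>{-L0..L0}. \<forall>v. \<bar>v - v0\<bar> \<le> \<eta> \<longrightarrow>
          f0 \<le> c1 (reversed (F \<alpha> \<epsilon>)) (x, v) \<and> c1 (reversed (F \<alpha> \<epsilon>)) (x, v) \<le> f1)"
      by (rule reversed_field[OF field[OF D]])
    obtain C where C: "\<forall>\<^sub>F \<epsilon> in at_right 0.
       \<forall>\<alpha>\<in>{-(D*\<epsilon>)..D*\<epsilon>}. \<forall>x\<in>{-L0..L0} - {0}. \<forall>v. \<bar>v - v0\<bar> \<le> \<eta> \<longrightarrow> (\<exists>g\<in>{g0..g1}.
          \<bar>\<phi>' v * c2 (F \<alpha> \<epsilon>) (x, v) - \<epsilon> * c1 (F \<alpha> \<epsilon>) (x, v) * \<psi>' x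
            - g * x * (\<phi> v - \<psi> x) * c1 (F \<alpha> \<epsilon>) (x, v) - c0 * (\<alpha> - \<delta>C * \<epsilon>)\<bar>
          \<le> C * \<epsilon> * (\<bar>x\<bar> + \<bar>\<phi> v - \<psi> x\<bar> + \<epsilon>))"
      using normal_form[OF D] by (elim exE)
    show "\<exists>C. \<forall>\<^sub>F \<epsilon> in at_right 0.
       \<forall>\<alpha>\<in>{-(D*\<epsilon>)..D*\<epsilon>}. \<forall>x\<in>{-L0..L0} - {0}. \<forall>v. \<bar>v - v0\<bar> \<le> \<eta> \<longrightarrow> (\<exists>g\<in>{g0..g1}.
          \<bar>\<phi>' v * c2 (reversed (F \<alpha> \<epsilon>)) (x, v) - \<epsilon> * c1 (reversed (F \<alpha> \<epsilon>)) (x, v) * - \<psi>' (- x)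
            - g * x * (\<phi> v - \<psi> (- x)) * c1 (reversed (F \<alpha> \<epsilon>)) (x, v) - - c0 * (\<alpha> - \<delta>C * \<epsilon>)\<bar>
          \<le> C * \<epsilon> * (\<bar>x\<bar> + \<bar>\<phi> v - \<psi> (- x)\<bar> + \<epsilon>))"
    proof (rule exI[of _ C], rule eventually_mono[OF C], intro ballI allI impI)
      fix \<epsilon> \<alpha> x v
      assume *: "\<forall>\<alpha>\<in>{-(D*\<epsilon>)..D*\<epsilon>}. \<forall>x\<in>{-L0..L0} - {0}. \<forall>v. \<bar>v - v0\<bar> \<le> \<eta> \<longrightarrow> (\<exists>g\<in>{g0..g1}.
          \<bar>\<phi>' v * c2 (F \<alpha> \<epsilon>) (x, v) - \<epsilon> * c1 (F \<alpha> \<epsilon>) (x, v) * \<psi>' x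
            - g * x * (\<phi> v - \<psi> x) * c1 (F \<alpha> \<epsilon>) (x, v) - c0 * (\<alpha> - \<delta>C * \<epsilon>)\<bar>
          \<le> C * \<epsilon> * (\<bar>x\<bar> + \<bar>\<phi> v - \<psi> x\<bar> + \<epsilon>))"
        and \<alpha>: "\<alpha> \<in> {-(D*\<epsilon>)..D*\<epsilon>}" and x: "x \<in> {-L0..L0} - {0}" and v: "\<bar>v - v0\<bar> \<le> \<eta>"
      have "- x \<in> {-L0..L0} - {0}" using x by auto
      from *[rule_format, OF \<alpha> this v] obtain g where g: "g \<in> {g0..g1}"
        and E: "\<bar>\<phi>' v * c2 (F \<alpha> \<epsilon>) (- x, v) - \<epsilon> * c1 (F \<alpha> \<epsilon>) (- x, v) * \<psi>' (- x)
            - g * (- x) * (\<phi> v - \<psi> (- x)) * c1 (F \<alpha> \<epsilon>) (- x, v) - c0 * (\<alpha> - \<delta>C * \<epsilon>)\<bar>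
          \<le> C * \<epsilon> * (\<bar>- x\<bar> + \<bar>\<phi> v - \<psi> (- x)\<bar> + \<epsilon>)" by (elim bexE)
      \<comment> \<open>Under the reflection every term changes sign: the first by the reversal of
        time, the second by the derivative of the reflected \<psi>, the third by the factor x, and
        the last because c0 is replaced by -c0. So the reflected expression is the negative of
        R.\<close>
      define R where "R = \<phi>' v * c2 (F \<alpha> \<epsilon>) (- x, v) - \<epsilon> * c1 (F \<alpha> \<epsilon>) (- x, v) * \<psi>' (- x)
            - g * (- x) * (\<phi> v - \<psi> (- x)) * c1 (F \<alpha> \<epsilon>) (- x, v) - c0 * (\<alpha> - \<delta>C * \<epsilon>)"
      have "\<phi>' v * c2 (reversed (F \<alpha> \<epsilon>)) (x, v) - \<epsilon> * c1 (reversed (F \<alpha> \<epsilon>)) (x, v) * - \<psi>' (- x)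
            - g * x * (\<phi> v - \<psi> (- x)) * c1 (reversed (F \<alpha> \<epsilon>)) (x, v) - - c0 * (\<alpha> - \<delta>C * \<epsilon>) = - R"
        by (simp add: R_def reversed_def)
      then have "\<bar>\<phi>' v * c2 (reversed (F \<alpha> \<epsilon>)) (x, v) - \<epsilon> * c1 (reversed (F \<alpha> \<epsilon>)) (x, v) * - \<psi>' (- x)
            - g * x * (\<phi> v - \<psi> (- x)) * c1 (reversed (F \<alpha> \<epsilon>)) (x, v) - - c0 * (\<alpha> - \<delta>C * \<epsilon>)\<bar>
          \<le> C * \<epsilon> * (\<bar>x\<bar> + \<bar>\<phi> v - \<psi> (- x)\<bar> + \<epsilon>)"
        using E[folded R_def] by (simp only: abs_minus_cancel)
      with g show "\<exists>g\<in>{g0..g1}.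
          \<bar>\<phi>' v * c2 (reversed (F \<alpha> \<epsilon>)) (x, v) - \<epsilon> * c1 (reversed (F \<alpha> \<epsilon>)) (x, v) * - \<psi>' (- x)
            - g * x * (\<phi> v - \<psi> (- x)) * c1 (reversed (F \<alpha> \<epsilon>)) (x, v) - - c0 * (\<alpha> - \<delta>C * \<epsilon>)\<bar>
          \<le> C * \<epsilon> * (\<bar>x\<bar> + \<bar>\<phi> v - \<psi> (- x)\<bar> + \<epsilon>)" by (rule bexI[rotated])
    qed
  qed
  show ?thesis
    by (intro canard_point.intro canard_point_axioms.intro left right c0 domain)
qed

lemma mean_value_bounds:
  fixes f f' :: "real \<Rightarrow> real"
  assumes f': "\<And>v. \<bar>v - c\<bar> \<le> \<eta> \<Longrightarrow> (f has_real_derivative f' v) (at v)"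
    and b: "\<And>v. \<bar>v - c\<bar> \<le> \<eta> \<Longrightarrow> d0 \<le> f' v \<and> f' v \<le> d1" "0 \<le> d0"
    and uv: "\<bar>u - c\<bar> \<le> \<eta>" "\<bar>v - c\<bar> \<le> \<eta>"
  shows "d0 * \<bar>u - v\<bar> \<le> \<bar>f u - f v\<bar>" "\<bar>f u - f v\<bar> \<le> d1 * \<bar>u - v\<bar>"
proof -
  have ordered: "d0 * \<bar>u - v\<bar> \<le> \<bar>f u - f v\<bar> \<and> \<bar>f u - f v\<bar> \<le> d1 * \<bar>u - v\<bar>"
    if uv: "\<bar>u - c\<bar> \<le> \<eta>" "\<bar>v - c\<bar> \<le> \<eta>" "u < v" for u v
  proof -
    obtain z where z: "u < z" "z < v" "f v - f u = (v - u) * f' z"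
      using MVT2[of u v f f'] uv f' by force
    then have zb: "d0 \<le> f' z" "f' z \<le> d1" using b(1)[of z] uv by auto
    have "0 \<le> (v - u) * f' z" using zb b(2) uv(3) by (intro mult_nonneg_nonneg) auto
    then have eq: "\<bar>f u - f v\<bar> = (v - u) * f' z" "\<bar>u - v\<bar> = v - u" using z uv(3) by linarith+
    show ?thesis
      unfolding eq using mult_left_mono[OF zb(1), of "v - u"] mult_left_mono[OF zb(2), of "v - u"] uv(3)
      by (simp add: mult.commute)
  qed
  consider "u < v" | "u = v" | "v < u" by linarith
  then have "d0 * \<bar>u - v\<bar> \<le> \<bar>f u - f v\<bar> \<and> \<bar>f u - f v\<bar> \<le> d1 * \<bar>u - v\<bar>"
  proof cases
    case 1
    then show ?thesis using ordered uv by blast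
  next
    case 2
    then show ?thesis by simp
  next
    case 3
    then show ?thesis using ordered[OF uv(2,1)] by (simp add: abs_minus_commute)
  qed
  then show "d0 * \<bar>u - v\<bar> \<le> \<bar>f u - f v\<bar>" "\<bar>f u - f v\<bar> \<le> d1 * \<bar>u - v\<bar>" by auto
qed

section \<open>The transition function and blends of the two fields\<close>

lemma transition_function_DERIV:
  assumes "transition_function \<phi>"
  shows "(\<phi> has_real_derivative deriv \<phi> v) (at v)"
  using assms unfolding transition_function_def
  by (simp add: DERIV_deriv_iff_real_differentiable numeral_3_eq_3)

lemma transition_function_deriv_lipschitz:
  assumes "transition_function \<phi>"
  obtains r K where "0 < r" "0 \<le> K" "\<And>v. \<bar>v - u\<bar> \<le> r \<Longrightarrow> \<bar>deriv \<phi> v - deriv \<phi> u\<bar> \<le> K * \<bar>v - u\<bar>"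
proof -
  have C: "Ck_on (Suc (Suc (Suc 0))) UNIV \<phi>"
    using assms by (simp add: transition_function_def numeral_3_eq_3)
  obtain r K g1 g2 where r: "0 < r" "0 \<le> K"
    and g1: "\<And>s. \<bar>s\<bar> \<le> r \<Longrightarrow> ((\<lambda>s. \<phi> (u + s *\<^sub>R 1)) has_real_derivative g1 s) (at s)"
    and g2: "\<And>s. \<bar>s\<bar> \<le> r \<Longrightarrow> (g1 has_real_derivative g2 s) (at s)"
    and g2b: "\<And>s. \<bar>s\<bar> \<le> r \<Longrightarrow> \<bar>g2 s - g2 0\<bar> \<le> K * \<bar>s\<bar>"
    by (rule Ck_on_line[OF C open_UNIV UNIV_I[of u], of 1]) (rule that)
  have eq: "deriv \<phi> (u + s) = g1 s" if "\<bar>s\<bar> \<le> r" for s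
  proof -
    have "((\<lambda>s. \<phi> (u + s)) has_real_derivative deriv \<phi> (u + s)) (at s)"
      using transition_function_DERIV[OF assms, of "u + s"] by (simp add: DERIV_shift add.commute)
    then show ?thesis using g1[OF that] DERIV_unique by fastforce
  qed
  have b: "\<bar>g2 s\<bar> \<le> \<bar>g2 0\<bar> + K * r" if "\<bar>s\<bar> \<le> r" for s
    using g2b[OF that] mult_left_mono[OF that r(2)] by linarith
  have "\<bar>deriv \<phi> v - deriv \<phi> u\<bar> \<le> (\<bar>g2 0\<bar> + K * r) * \<bar>v - u\<bar>" if v: "\<bar>v - u\<bar> \<le> r" for v
  proof -
    have "\<bar>g1 (v - u) - g1 0\<bar> \<le> (\<bar>g2 0\<bar> + K * r) * \<bar>v - u\<bar>"
      using v by (intro le_linear_from_derivative[where f'=g2]) (auto intro: g2 b)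
    then show ?thesis using eq[of "v - u"] eq[of 0] v r by simp
  qed
  then show thesis using r by (intro that[of r "\<bar>g2 0\<bar> + K * r"]) auto
qed

lemma transition_function_continuous:
  "transition_function \<phi> \<Longrightarrow> continuous_on S \<phi>"
  by (intro continuous_at_imp_continuous_on ballI DERIV_isCont[OF transition_function_DERIV])

lemma transition_function_less:
  assumes "transition_function \<phi>" "-1 \<le> u" "u < v" "v \<le> 1"
  shows "\<phi> u < \<phi> v"
proof (rule DERIV_pos_imp_increasing_open[OF assms(3)])
  fix x assume "u < x" "x < v"
  then have "x \<in> {-1<..<1}" using assms by auto
  then show "\<exists>y. (\<phi> has_real_derivative y) (at x) \<and> 0 < y"
    using assms(1) transition_function_DERIV[OF assms(1)] unfolding transition_function_def by blast
qed (rule transition_function_continuous[OF assms(1)])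

text \<open>\<open>phi_inv\<close> is an \<open>inv_into\<close> and means something only on the
  image of the open interval; the intermediate value theorem places y there.\<close>

lemma transition_function_inverse:
  assumes \<phi>: "transition_function \<phi>" and y: "-1 < y" "y < 1"
  shows "phi_inv \<phi> y \<in> {-1<..<1}" "\<phi> (phi_inv \<phi> y) = y"
proof -
  have e: "\<phi> (-1) = -1" "\<phi> 1 = 1" using \<phi> by (auto simp: transition_function_def)
  obtain v where v: "-1 \<le> v" "v \<le> 1" "\<phi> v = y"
    using IVT'[of \<phi> "-1" y 1] y e transition_function_continuous[OF \<phi>] by auto
  moreover have "v \<noteq> -1" "v \<noteq> 1" using v e y by auto
  ultimately have "y \<in> \<phi> ` {-1<..<1}" by (intro image_eqI[of _ _ v]) auto
  then show "phi_inv \<phi> y \<in> {-1<..<1}" "\<phi> (phi_inv \<phi> y) = y"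
    by (rule inv_into_into, rule f_inv_into_f)
qed

lemma transition_function_abs_le:
  assumes "transition_function \<phi>" "\<bar>v\<bar> \<le> 1"
  shows "\<bar>\<phi> v\<bar> \<le> 1"
proof -
  have e: "\<phi> (-1) = -1" "\<phi> 1 = 1" using assms(1) by (auto simp: transition_function_def)
  have v: "-1 \<le> v" "v \<le> 1" using assms(2) by auto
  have "\<phi> (-1) \<le> \<phi> v"
    using transition_function_less[OF assms(1) order_refl _ v(2)] v(1) by (metis less_eq_real_def)
  moreover have "\<phi> v \<le> \<phi> 1"
    using transition_function_less[OF assms(1) v(1) _ order_refl] v(2) by (metis less_eq_real_def)
  ultimately show ?thesis using e by linarith
qed

lemma slow_fast_components:
  "fst (slow_fast X Y \<phi> \<epsilon> (x, v)) = (1 + \<phi> v) * fst (X (x, \<epsilon> * v)) + (1 - \<phi> v) * fst (Y (x, \<epsilon> * v))"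
  "snd (slow_fast X Y \<phi> \<epsilon> (x, v)) = (1 + \<phi> v) * snd (X (x, \<epsilon> * v)) + (1 - \<phi> v) * snd (Y (x, \<epsilon> * v))"
  by (simp_all add: slow_fast_def algebra_simps)

text \<open>For |t| at most 1 the weights 1 + t and 1 - t are nonnegative and add up to 2.\<close>

lemma blend_le:
  fixes t :: real
  assumes "\<bar>t\<bar> \<le> 1" "\<bar>a\<bar> \<le> c" "\<bar>b\<bar> \<le> c"
  shows "\<bar>(1 + t) * a + (1 - t) * b\<bar> \<le> 2 * c"
proof -
  have "\<bar>(1 + t) * a\<bar> \<le> (1 + t) * c" "\<bar>(1 - t) * b\<bar> \<le> (1 - t) * c"
    unfolding abs_mult using assms by (intro mult_mono; simp)+
  moreover have "(1 + t) * c + (1 - t) * c = 2 * c" by (simp add: algebra_simps)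
  ultimately show ?thesis by linarith
qed

text \<open>Separates the change of the blended fields from the change of the weight.\<close>

lemma blend_diff:
  fixes s t :: real
  shows "((1 + s) * a + (1 - s) * b) - ((1 + t) * c + (1 - t) * d)
    = ((1 + s) * (a - c) + (1 - s) * (b - d)) + (s - t) * (c - d)"
  by (simp add: algebra_simps)

lemma quotient_difference_bound:
  fixes a b c d :: real
  assumes "f0 \<le> b" "f0 \<le> d" "0 < f0" "\<bar>a - c\<bar> \<le> A" "\<bar>b - d\<bar> \<le> B" "\<bar>c\<bar> \<le> G"
  shows "\<bar>a / b - c / d\<bar> \<le> A / f0 + G * B / (f0 * f0)"
proof -
  have bd: "0 < b" "0 < d" using assms by auto
  have "a / b - c / d = (a - c) / b + c * (d - b) / (b * d)" using bd by (simp add: field_simps)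
  also have "\<bar>\<dots>\<bar> \<le> \<bar>(a - c) / b\<bar> + \<bar>c * (d - b) / (b * d)\<bar>" by (rule abs_triangle_ineq)
  also have "\<dots> = \<bar>a - c\<bar> / b + \<bar>c\<bar> * \<bar>b - d\<bar> / (b * d)"
    using bd by (simp add: abs_mult abs_minus_commute)
  also have "\<dots> \<le> A / f0 + G * B / (f0 * f0)"
    using assms bd by (intro add_mono frac_le mult_mono) (auto intro: mult_pos_pos)
  finally show ?thesis .
qed

section \<open>Signs at the fold\<close>

locale regularized_fold =
  fixes A :: "real set" and U :: "(real \<times> real) set"
    and X Y :: "real \<Rightarrow> vfield" and X' Y' :: vfield and \<phi> :: "real \<Rightarrow> real"
  assumes AU: "open A" "0 \<in> A" "open U" "0 \<in> U"
    and X: "smooth_unfolding A U X X'" and Y: "smooth_unfolding A U Y Y'"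
    and \<phi>: "transition_function \<phi>"
    and fold: "in_Lambda_F (X 0) (Y 0)"
    and versal: "versal (X 0) (Y 0) X' Y'"
    and opposite: "c1 (X 0) 0 * c1 (Y 0) 0 < 0"
    and det: "dx (det_Z (X 0) (Y 0)) 0 < 0"
begin

abbreviation "vb \<equiv> v_bar (X 0) (Y 0) \<phi>"
abbreviation "ax \<equiv> dx (c2 (X 0)) 0"
abbreviation "ay \<equiv> dx (c2 (Y 0)) 0"
abbreviation "m0 \<equiv> M0 (X 0) (Y 0) \<phi>"
abbreviation "m1 \<equiv> M1 (X 0) (Y 0) \<phi>"
abbreviation "m2 \<equiv> M2 (X 0) (Y 0) X' Y' \<phi>"
abbreviation "m3 \<equiv> M3 (X 0) (Y 0) \<phi>"
abbreviation "m4 \<equiv> M4 (X 0) (Y 0) \<phi>"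

lemma fold_signs: "0 < ax" "ay < 0" "0 < c1 (X 0) 0" "c1 (Y 0) 0 < 0" "c2 (X 0) 0 = 0" "c2 (Y 0) 0 = 0"
proof -
  show x1: "0 < c1 (X 0) 0" and z: "c2 (X 0) 0 = 0" "c2 (Y 0) 0 = 0"
    using fold by (simp_all add: in_Lambda_F_def visible_fold_upper_def invisible_fold_lower_def)
  have a: "0 < ax * c1 (X 0) 0" "0 < ay * c1 (Y 0) 0"
    using fold by (simp_all add: in_Lambda_F_def visible_fold_upper_def invisible_fold_lower_def)
  show y1: "c1 (Y 0) 0 < 0" using opposite x1 by (simp add: mult_less_0_iff)
  show "0 < ax" using a(1) x1 by (simp add: zero_less_mult_iff)
  show "ay < 0" using a(2) y1 by (simp add: zero_less_mult_iff)
qed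

text \<open>Because \<open>ax > 0 > ay\<close>, the quotient lies strictly between -1 and 1, where
  \<open>phi_inv\<close> is a true inverse. Writing it with the positive denominator
  \<open>ax - ay\<close> matches the limit of -p/q at the fold.\<close>

lemma v_bar_facts: "\<bar>vb\<bar> < 1" "\<phi> vb = - (ax + ay) / (ax - ay)" "0 < deriv \<phi> vb"
proof -
  have q: "- (ax + ay) / (ax - ay) = (ax + ay) / (ay - ax)"
    by (metis minus_diff_eq minus_divide_divide minus_minus)
  have "-1 < - (ax + ay) / (ax - ay)" "- (ax + ay) / (ax - ay) < 1"
    using fold_signs by (simp_all add: pos_less_divide_eq pos_divide_less_eq)
  from transition_function_inverse[OF \<phi> this]
  have v: "vb \<in> {-1<..<1}" "\<phi> vb = - (ax + ay) / (ax - ay)" unfolding v_bar_def q by auto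
  then show "\<bar>vb\<bar> < 1" "\<phi> vb = - (ax + ay) / (ax - ay)" by auto
  show "0 < deriv \<phi> vb" using v(1) \<phi> unfolding transition_function_def by blast
qed

text \<open>Both second components vanish at the fold, so the product rule leaves only the terms in
  which they are differentiated.\<close>

lemma dx_det: "dx (det_Z (X 0) (Y 0)) 0 = c1 (X 0) 0 * ay - ax * c1 (Y 0) 0"
proof -
  obtain r1 K1 p1 q1 where 1: "family_bounds U (\<lambda>\<alpha> p. fst (X \<alpha> p)) (fst (X' 0)) r1 K1 p1 q1"
    by (rule smooth_unfolding_family_bounds[OF X AU bounded_linear_fst])
  obtain r2 K2 p2 q2 where 2: "family_bounds U (\<lambda>\<alpha> p. snd (X \<alpha> p)) (snd (X' 0)) r2 K2 p2 q2"
    by (rule smooth_unfolding_family_bounds[OF X AU bounded_linear_snd])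
  obtain r3 K3 p3 q3 where 3: "family_bounds U (\<lambda>\<alpha> p. fst (Y \<alpha> p)) (fst (Y' 0)) r3 K3 p3 q3"
    by (rule smooth_unfolding_family_bounds[OF Y AU bounded_linear_fst])
  obtain r4 K4 p4 q4 where 4: "family_bounds U (\<lambda>\<alpha> p. snd (Y \<alpha> p)) (snd (Y' 0)) r4 K4 p4 q4"
    by (rule smooth_unfolding_family_bounds[OF Y AU bounded_linear_snd])
  have d: "((\<lambda>x. fst (X 0 (x, 0))) has_real_derivative p1 0) (at 0)"
    "((\<lambda>x. snd (X 0 (x, 0))) has_real_derivative ax) (at 0)"
    "((\<lambda>x. fst (Y 0 (x, 0))) has_real_derivative p3 0) (at 0)"
    "((\<lambda>x. snd (Y 0 (x, 0))) has_real_derivative ay) (at 0)"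
    using family_bounds.g1[OF 1, of 0] family_bounds.g1[OF 2, of 0] family_bounds.g1[OF 3, of 0]
      family_bounds.g1[OF 4, of 0] family_bounds.r[OF 1] family_bounds.r[OF 2] family_bounds.r[OF 3]
      family_bounds.r[OF 4] family_bounds.g1_0[OF 2] family_bounds.g1_0[OF 4]
    by simp_all
  have "((\<lambda>x. fst (X 0 (x, 0)) * snd (Y 0 (x, 0)) - snd (X 0 (x, 0)) * fst (Y 0 (x, 0)))
      has_real_derivative
      (p1 0 * snd (Y 0 (0, 0)) + ay * fst (X 0 (0, 0))) - (ax * fst (Y 0 (0, 0)) + p3 0 * snd (X 0 (0, 0)))) (at 0)"
    by (intro DERIV_diff DERIV_mult d)
  then show ?thesis
    using fold_signs(5,6) by (simp add: dx_def[of "det_Z (X 0) (Y 0)"] det_Z_def DERIV_imp_deriv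
        zero_prod_def[symmetric] mult.commute)
qed

text \<open>Inserting the value of \<phi> at \<open>vb\<close> gives both coefficients the
  denominator \<open>ax - ay > 0\<close>. The numerator of \<open>m0\<close> is -2 times the
  x-derivative of det Z; that of \<open>m2\<close> is \<open>2 * ax * ay\<close>, which is negative,
  times the versality quantity. A positive \<open>m0\<close> lets the slow flow pass from the
  attracting to the repelling side.\<close>

lemma coefficient_signs: "0 < m0" "m2 < 0"
proof -
  have s: "0 < ax - ay" using fold_signs by simp
  have "m0 * (ax - ay) = 2 * (ax * c1 (Y 0) 0 - ay * c1 (X 0) 0)"
    unfolding M0_def v_bar_facts(2) using s by (simp add: field_simps)
  moreover have "0 < 2 * (ax * c1 (Y 0) 0 - ay * c1 (X 0) 0)" using det dx_det by (simp add: mult.commute)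
  ultimately show "0 < m0" using s by (metis zero_less_mult_pos2)
  have "m2 * (ax - ay) = 2 * (ax * c2 Y' 0 - ay * c2 X' 0)"
    unfolding M2_def v_bar_facts(2) using s by (simp add: field_simps)
  also have "ax * c2 Y' 0 - ay * c2 X' 0 = (ax * ay) * (c2 Y' 0 / ay - c2 X' 0 / ax)"
    using fold_signs by (simp add: field_simps)
  finally have "m2 * (ax - ay) < 0"
    using versal fold_signs unfolding versal_def
    by (simp add: mult_pos_neg mult_neg_pos mult_less_0_iff)
  then show "m2 < 0" using s by (simp add: mult_less_0_iff)
qed

end

lemma abs_add_le_add:
  fixes a b :: real
  shows "\<bar>a\<bar> \<le> A \<Longrightarrow> \<bar>b\<bar> \<le> B \<Longrightarrow> \<bar>a + b\<bar> \<le> A + B"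
  by linarith

section \<open>Expansion of the slow-fast field near the fold\<close>

locale regularized_fold_bounds = regularized_fold +
  X1: family_bounds U "\<lambda>\<alpha> p. fst (X \<alpha> p)" "fst (X' 0)" r K gx1 hx1 +
  X2: family_bounds U "\<lambda>\<alpha> p. snd (X \<alpha> p)" "snd (X' 0)" r K gx2 hx2 +
  Y1: family_bounds U "\<lambda>\<alpha> p. fst (Y \<alpha> p)" "fst (Y' 0)" r K gy1 hy1 +
  Y2: family_bounds U "\<lambda>\<alpha> p. snd (Y \<alpha> p)" "snd (Y' 0)" r K gy2 hy2
  for r K gx1 hx1 gx2 hx2 gy1 hy1 gy2 hy2
begin

abbreviation "F \<alpha> \<epsilon> \<equiv> slow_fast (X \<alpha>) (Y \<alpha>) \<phi> \<epsilon>"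

text \<open>The part of \<open>F\<^sup>2\<close> that is linear in \<open>(\<alpha>, \<epsilon>)\<close>, taken at \<open>x = 0\<close>.\<close>

definition "\<Theta> \<alpha> \<epsilon> v = (1 + \<phi> v) * (\<alpha> * snd (X' 0) + \<epsilon> * v * dy (c2 (X 0)) 0)
  + (1 - \<phi> v) * (\<alpha> * snd (Y' 0) + \<epsilon> * v * dy (c2 (Y 0)) 0)"

definition "p x = snd (X 0 (x, 0)) + snd (Y 0 (x, 0))"
definition "q x = snd (X 0 (x, 0)) - snd (Y 0 (x, 0))"

lemma first_component_near:
  assumes "\<bar>\<alpha>\<bar> \<le> r" "\<bar>x\<bar> \<le> r" "\<bar>\<epsilon> * v\<bar> \<le> r" "\<bar>\<phi> v\<bar> \<le> 1"
  shows "\<bar>c1 (F \<alpha> \<epsilon>) (x, v) - m0\<bar>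
    \<le> 2 * (K * (\<bar>\<alpha>\<bar> + \<bar>x\<bar> + \<bar>\<epsilon> * v\<bar>)) + \<bar>\<phi> v - \<phi> vb\<bar> * \<bar>c1 (X 0) 0 - c1 (Y 0) 0\<bar>"
proof -
  have z: "\<bar>0\<bar> \<le> r" using X1.r by simp
  have m0: "m0 = (1 + \<phi> vb) * fst (X 0 (0, 0)) + (1 - \<phi> vb) * fst (Y 0 (0, 0))"
    by (simp add: M0_def zero_prod_def algebra_simps)
  have 1: "\<bar>fst (X \<alpha> (x, \<epsilon> * v)) - fst (X 0 (0, 0))\<bar> \<le> K * (\<bar>\<alpha>\<bar> + \<bar>x\<bar> + \<bar>\<epsilon> * v\<bar>)"
    using X1.lipschitz[OF assms(1-3) z z z] by simp
  have 2: "\<bar>fst (Y \<alpha> (x, \<epsilon> * v)) - fst (Y 0 (0, 0))\<bar> \<le> K * (\<bar>\<alpha>\<bar> + \<bar>x\<bar> + \<bar>\<epsilon> * v\<bar>)"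
    using Y1.lipschitz[OF assms(1-3) z z z] by simp
  show ?thesis
    unfolding slow_fast_components m0 blend_diff
    by (rule abs_add_le_add[OF blend_le[OF assms(4) 1 2]]) (simp add: abs_mult zero_prod_def)
qed

text \<open>\<open>p x + \<phi> v * q x\<close> is the second component at \<alpha> = \<epsilon> =
  0, and \<open>\<Theta>\<close> is its linear response to \<alpha> and \<epsilon>. Since the values
  at (0, x, 0) are subtracted exactly and not expanded in x, the remainder keeps a factor |\<alpha>|
  + |\<epsilon> v|, hence a factor \<epsilon>.\<close>

lemma second_component_expansion:
  assumes "\<bar>\<alpha>\<bar> \<le> r" "\<bar>x\<bar> \<le> r" "\<bar>\<epsilon> * v\<bar> \<le> r" "\<bar>\<phi> v\<bar> \<le> 1"
  shows "\<bar>c2 (F \<alpha> \<epsilon>) (x, v) - (p x + \<phi> v * q x) - \<Theta> \<alpha> \<epsilon> v\<bar>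
    \<le> 2 * (K * (\<bar>\<alpha>\<bar> + \<bar>\<epsilon> * v\<bar>) * (\<bar>\<alpha>\<bar> + \<bar>x\<bar> + \<bar>\<epsilon> * v\<bar>))"
proof -
  have "c2 (F \<alpha> \<epsilon>) (x, v) - (p x + \<phi> v * q x) - \<Theta> \<alpha> \<epsilon> v =
    (1 + \<phi> v) * (snd (X \<alpha> (x, \<epsilon> * v)) - snd (X 0 (x, 0)) - (\<alpha> * snd (X' 0) + \<epsilon> * v * dy (c2 (X 0)) 0))
    + (1 - \<phi> v) * (snd (Y \<alpha> (x, \<epsilon> * v)) - snd (Y 0 (x, 0)) - (\<alpha> * snd (Y' 0) + \<epsilon> * v * dy (c2 (Y 0)) 0))"
    unfolding slow_fast_components p_def q_def \<Theta>_def by (simp add: algebra_simps)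
  then show ?thesis
    using blend_le[OF assms(4) X2.expansion[OF assms(1-3)] Y2.expansion[OF assms(1-3)]] by simp
qed

lemma \<Theta>_vb: "\<Theta> \<alpha> \<epsilon> vb = \<alpha> * m2 + \<epsilon> * m1"
  by (simp add: \<Theta>_def M1_def M2_def algebra_simps)

text \<open>Both bounds carry a factor \<epsilon> because |\<alpha>| is at most D \<epsilon>. In the
  second one, 2 N comes from the explicit v in \<open>\<Theta>\<close> and the part with d1 from the
  change of the weight \<phi>.\<close>

lemma \<Theta>_bounds:
  assumes \<epsilon>: "0 < \<epsilon>" and \<alpha>: "\<bar>\<alpha>\<bar> \<le> D * \<epsilon>" and v: "\<bar>v\<bar> \<le> 1" "\<bar>\<phi> v\<bar> \<le> 1"
    and d: "\<bar>\<phi> v - \<phi> vb\<bar> \<le> d1 * \<bar>v - vb\<bar>"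
  defines "N \<equiv> D * (\<bar>snd (X' 0)\<bar> + \<bar>snd (Y' 0)\<bar>) + (\<bar>dy (c2 (X 0)) 0\<bar> + \<bar>dy (c2 (Y 0)) 0\<bar>)"
  shows "\<bar>\<Theta> \<alpha> \<epsilon> v\<bar> \<le> 2 * (\<epsilon> * N)"
    and "\<bar>\<Theta> \<alpha> \<epsilon> v - \<Theta> \<alpha> \<epsilon> vb\<bar> \<le> \<epsilon> * (2 * N + d1 * (2 * N)) * \<bar>v - vb\<bar>"
proof -
  have D: "0 \<le> D" using \<alpha> \<epsilon> by (smt (verit) mult_neg_pos)
  have le: "\<bar>\<alpha> * a + \<epsilon> * u * b\<bar> \<le> \<epsilon> * (D * \<bar>a\<bar> + \<bar>b\<bar>)" if "\<bar>u\<bar> \<le> 1" for u a b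
  proof -
    have "\<bar>\<alpha> * a\<bar> \<le> (D * \<epsilon>) * \<bar>a\<bar>" unfolding abs_mult using \<alpha> by (intro mult_right_mono) auto
    moreover have "\<bar>\<epsilon> * u * b\<bar> \<le> (\<epsilon> * 1) * \<bar>b\<bar>"
      unfolding abs_mult using \<epsilon> that by (intro mult_right_mono mult_mono) auto
    ultimately show ?thesis by (simp add: algebra_simps)
  qed
  have N: "D * \<bar>snd (X' 0)\<bar> + \<bar>dy (c2 (X 0)) 0\<bar> \<le> N" "D * \<bar>snd (Y' 0)\<bar> + \<bar>dy (c2 (Y 0)) 0\<bar> \<le> N"
    "\<bar>dy (c2 (X 0)) 0\<bar> \<le> N" "\<bar>dy (c2 (Y 0)) 0\<bar> \<le> N"
    using D by (simp_all add: N_def distrib_left)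
  have leX: "\<bar>\<alpha> * snd (X' 0) + \<epsilon> * u * dy (c2 (X 0)) 0\<bar> \<le> \<epsilon> * N"
    and leY: "\<bar>\<alpha> * snd (Y' 0) + \<epsilon> * u * dy (c2 (Y 0)) 0\<bar> \<le> \<epsilon> * N" if "\<bar>u\<bar> \<le> 1" for u
    using order_trans[OF le[OF that] mult_left_mono[OF N(1)]]
      order_trans[OF le[OF that] mult_left_mono[OF N(2)]] \<epsilon> by auto
  show "\<bar>\<Theta> \<alpha> \<epsilon> v\<bar> \<le> 2 * (\<epsilon> * N)"
    unfolding \<Theta>_def by (rule blend_le[OF v(2) leX[OF v(1)] leY[OF v(1)]])
  have vb1: "\<bar>vb\<bar> \<le> 1" using v_bar_facts(1) by simp
  let ?ax = "\<alpha> * snd (X' 0) + \<epsilon> * vb * dy (c2 (X 0)) 0" and ?ay = "\<alpha> * snd (Y' 0) + \<epsilon> * vb * dy (c2 (Y 0)) 0"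
  have eq: "\<Theta> \<alpha> \<epsilon> v - \<Theta> \<alpha> \<epsilon> vb = ((1 + \<phi> v) * (\<epsilon> * (v - vb) * dy (c2 (X 0)) 0)
      + (1 - \<phi> v) * (\<epsilon> * (v - vb) * dy (c2 (Y 0)) 0)) + (\<phi> v - \<phi> vb) * (?ax - ?ay)"
    unfolding \<Theta>_def blend_diff by (simp add: algebra_simps)
  have b: "\<bar>\<epsilon> * (v - vb) * c\<bar> \<le> \<epsilon> * \<bar>v - vb\<bar> * N" if "\<bar>c\<bar> \<le> N" for c
    unfolding abs_mult using \<epsilon> that by (intro mult_mono) auto
  have "\<bar>(1 + \<phi> v) * (\<epsilon> * (v - vb) * dy (c2 (X 0)) 0) + (1 - \<phi> v) * (\<epsilon> * (v - vb) * dy (c2 (Y 0)) 0)\<bar>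
      \<le> 2 * (\<epsilon> * \<bar>v - vb\<bar> * N)"
    by (rule blend_le[OF v(2) b[OF N(3)] b[OF N(4)]])
  moreover have "\<bar>(\<phi> v - \<phi> vb) * (?ax - ?ay)\<bar> \<le> (d1 * \<bar>v - vb\<bar>) * (2 * (\<epsilon> * N))"
  proof -
    have "\<bar>?ax - ?ay\<bar> \<le> 2 * (\<epsilon> * N)" using leX[OF vb1] leY[OF vb1] by linarith
    then show ?thesis unfolding abs_mult by (rule mult_mono[OF d]) (use d in linarith)+
  qed
  ultimately have "\<bar>\<Theta> \<alpha> \<epsilon> v - \<Theta> \<alpha> \<epsilon> vb\<bar> \<le> 2 * (\<epsilon> * \<bar>v - vb\<bar> * N) + (d1 * \<bar>v - vb\<bar>) * (2 * (\<epsilon> * N))"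
    unfolding eq by (rule abs_add_le_add)
  also have "\<dots> = \<epsilon> * (2 * N + d1 * (2 * N)) * \<bar>v - vb\<bar>" by (simp add: algebra_simps)
  finally show "\<bar>\<Theta> \<alpha> \<epsilon> v - \<Theta> \<alpha> \<epsilon> vb\<bar> \<le> \<epsilon> * (2 * N + d1 * (2 * N)) * \<bar>v - vb\<bar>" .
qed

lemma field_continuous:
  assumes S: "S \<subseteq> {-r..r}" "I \<subseteq> {-r..r}" and V: "\<And>v. v \<in> V \<Longrightarrow> \<bar>\<epsilon> * v\<bar> \<le> r"
  shows "continuous_on (S \<times> I \<times> V) (\<lambda>(\<alpha>, p). F \<alpha> \<epsilon> p)"
proof -
  have \<phi>c: "continuous_on (S \<times> I \<times> V) (\<lambda>z. \<phi> (snd (snd z)))"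
    by (rule continuous_on_compose2[OF transition_function_continuous[OF \<phi>, of UNIV]])
      (auto intro!: continuous_intros)
  have comp: "continuous_on (S \<times> I \<times> V) (\<lambda>z. f (fst z) (fst (snd z), \<epsilon> * snd (snd z)))"
    if "continuous_on ({-r..r} \<times> {-r..r} \<times> {-r..r}) (\<lambda>(\<alpha>, p). f \<alpha> p)" for f :: "real \<Rightarrow> real \<times> real \<Rightarrow> real"
  proof -
    have "continuous_on (S \<times> I \<times> V) (\<lambda>z. (\<lambda>(\<alpha>, p). f \<alpha> p) (fst z, (fst (snd z), \<epsilon> * snd (snd z))))"
    proof (rule continuous_on_compose2[OF that])
      show "continuous_on (S \<times> I \<times> V) (\<lambda>z. (fst z, (fst (snd z), \<epsilon> * snd (snd z))))"
        by (intro continuous_intros)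
      show "(\<lambda>z. (fst z, (fst (snd z), \<epsilon> * snd (snd z)))) ` (S \<times> I \<times> V) \<subseteq> {-r..r} \<times> {-r..r} \<times> {-r..r}"
      proof (rule image_subsetI)
        fix z assume z: "z \<in> S \<times> I \<times> V"
        then have "\<bar>\<epsilon> * snd (snd z)\<bar> \<le> r" by (intro V) auto
        then show "(fst z, (fst (snd z), \<epsilon> * snd (snd z))) \<in> {-r..r} \<times> {-r..r} \<times> {-r..r}"
          using z S by (auto simp: abs_le_iff)
      qed
    qed
    then show ?thesis by simp
  qed
  have "continuous_on (S \<times> I \<times> V) (\<lambda>z.
      ((1 + \<phi> (snd (snd z))) * fst (X (fst z) (fst (snd z), \<epsilon> * snd (snd z)))
        + (1 - \<phi> (snd (snd z))) * fst (Y (fst z) (fst (snd z), \<epsilon> * snd (snd z))),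
       (1 + \<phi> (snd (snd z))) * snd (X (fst z) (fst (snd z), \<epsilon> * snd (snd z)))
        + (1 - \<phi> (snd (snd z))) * snd (Y (fst z) (fst (snd z), \<epsilon> * snd (snd z)))))"
    by (intro continuous_on_Pair continuous_on_add continuous_on_mult continuous_on_diff continuous_on_const
        \<phi>c comp[OF X1.cont] comp[OF X2.cont] comp[OF Y1.cont] comp[OF Y2.cont])
  then show ?thesis
  proof (rule continuous_on_eq)
    fix z :: "real \<times> real \<times> real" assume "z \<in> S \<times> I \<times> V"
    show "((1 + \<phi> (snd (snd z))) * fst (X (fst z) (fst (snd z), \<epsilon> * snd (snd z)))
        + (1 - \<phi> (snd (snd z))) * fst (Y (fst z) (fst (snd z), \<epsilon> * snd (snd z))),
       (1 + \<phi> (snd (snd z))) * snd (X (fst z) (fst (snd z), \<epsilon> * snd (snd z)))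
        + (1 - \<phi> (snd (snd z))) * snd (Y (fst z) (fst (snd z), \<epsilon> * snd (snd z)))) = (case z of (\<alpha>, w) \<Rightarrow> F \<alpha> \<epsilon> w)"
    proof -
      obtain \<alpha> x v where z: "z = (\<alpha>, x, v)" by (rule prod_cases3)
      show ?thesis unfolding z by (simp add: prod_eq_iff slow_fast_components)
    qed
  qed
qed

lemma slope_lipschitz:
  assumes \<alpha>: "\<bar>\<alpha>\<bar> \<le> r" "\<bar>x\<bar> \<le> r" and \<epsilon>: "0 < \<epsilon>"
    and u: "\<bar>\<epsilon> * u\<bar> \<le> r" "\<bar>\<phi> u\<bar> \<le> 1" and v: "\<bar>\<epsilon> * v\<bar> \<le> r" "\<bar>\<phi> v\<bar> \<le> 1"
    and d: "\<bar>\<phi> u - \<phi> v\<bar> \<le> d1 * \<bar>u - v\<bar>"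
    and f0: "0 < f0" "f0 \<le> c1 (F \<alpha> \<epsilon>) (x, u)" "f0 \<le> c1 (F \<alpha> \<epsilon>) (x, v)"
  defines "G \<equiv> \<bar>c1 (X 0) 0\<bar> + \<bar>c1 (Y 0) 0\<bar> + 3 * K * r"
  shows "\<bar>slope (F \<alpha> \<epsilon>) \<epsilon> x u - slope (F \<alpha> \<epsilon>) \<epsilon> x v\<bar>
    \<le> ((2 * (K * \<epsilon>) + d1 * (2 * G)) / f0 + 2 * G * (2 * (K * \<epsilon>) + d1 * (2 * G)) / (f0 * f0)) / \<epsilon> * \<bar>u - v\<bar>"
proof -
  have z: "\<bar>0\<bar> \<le> r" using X1.r by simp
  have KG: "0 \<le> K * (3 * r)" using X1.K X1.r by simp
  \<comment> \<open>G bounds all four components: the second components vanish at the origin, the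
    first are covered by their values there, and the Lipschitz growth over the box adds at most 3 K
    r.\<close>
  have size: "\<bar>f \<alpha> (x, y)\<bar> \<le> G"
    if "family_bounds U f a r K g h" "\<bar>f 0 (0, 0)\<bar> \<le> \<bar>c1 (X 0) 0\<bar> + \<bar>c1 (Y 0) 0\<bar>" "\<bar>y\<bar> \<le> r" for f a g h y
  proof -
    have "\<bar>f \<alpha> (x, y) - f 0 (0, 0)\<bar> \<le> K * (\<bar>\<alpha>\<bar> + \<bar>x\<bar> + \<bar>y\<bar>)"
      using family_bounds.lipschitz[OF that(1) \<alpha> that(3) z z z] by simp
    also have "\<dots> \<le> K * (3 * r)" using \<alpha> that(3) X1.K by (intro mult_left_mono) auto
    finally have "\<bar>f \<alpha> (x, y) - f 0 (0, 0)\<bar> \<le> K * (3 * r)" .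
    then have "\<bar>f \<alpha> (x, y)\<bar> \<le> \<bar>f 0 (0, 0)\<bar> + K * (3 * r)" by linarith
    then show ?thesis using that(2) by (simp add: G_def mult_ac)
  qed
  have lip: "\<bar>f \<alpha> (x, \<epsilon> * u) - f \<alpha> (x, \<epsilon> * v)\<bar> \<le> K * \<epsilon> * \<bar>u - v\<bar>" if "family_bounds U f a r K g h" for f a g h
  proof -
    have "\<bar>f \<alpha> (x, \<epsilon> * u) - f \<alpha> (x, \<epsilon> * v)\<bar> \<le> K * \<bar>\<epsilon> * u - \<epsilon> * v\<bar>"
      using family_bounds.lipschitz[OF that \<alpha> u(1) \<alpha> v(1)] by simp
    also have "\<bar>\<epsilon> * u - \<epsilon> * v\<bar> = \<epsilon> * \<bar>u - v\<bar>" using \<epsilon> by (simp add: abs_mult flip: right_diff_distrib)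
    finally show ?thesis by (simp add: mult.assoc)
  qed
  have diff: "\<bar>((1 + \<phi> u) * f \<alpha> (x, \<epsilon> * u) + (1 - \<phi> u) * h \<alpha> (x, \<epsilon> * u))
      - ((1 + \<phi> v) * f \<alpha> (x, \<epsilon> * v) + (1 - \<phi> v) * h \<alpha> (x, \<epsilon> * v))\<bar> \<le> (2 * (K * \<epsilon>) + d1 * (2 * G)) * \<bar>u - v\<bar>"
    if f: "family_bounds U f a r K g g'" "\<bar>f 0 (0, 0)\<bar> \<le> \<bar>c1 (X 0) 0\<bar> + \<bar>c1 (Y 0) 0\<bar>"
      and h: "family_bounds U h b r K k k'" "\<bar>h 0 (0, 0)\<bar> \<le> \<bar>c1 (X 0) 0\<bar> + \<bar>c1 (Y 0) 0\<bar>" for f h a b g g' k k'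
  proof -
    have "\<bar>(1 + \<phi> u) * (f \<alpha> (x, \<epsilon> * u) - f \<alpha> (x, \<epsilon> * v)) + (1 - \<phi> u) * (h \<alpha> (x, \<epsilon> * u) - h \<alpha> (x, \<epsilon> * v))\<bar>
        \<le> 2 * (K * \<epsilon> * \<bar>u - v\<bar>)"
      by (rule blend_le[OF u(2) lip[OF f(1)] lip[OF h(1)]])
    moreover have "\<bar>(\<phi> u - \<phi> v) * (f \<alpha> (x, \<epsilon> * v) - h \<alpha> (x, \<epsilon> * v))\<bar> \<le> (d1 * \<bar>u - v\<bar>) * (2 * G)"
    proof -
      have "\<bar>f \<alpha> (x, \<epsilon> * v) - h \<alpha> (x, \<epsilon> * v)\<bar> \<le> 2 * G" using size[OF f v(1)] size[OF h v(1)] by linarith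
      then show ?thesis unfolding abs_mult by (rule mult_mono[OF d]) (use d in linarith)+
    qed
    ultimately have "\<bar>((1 + \<phi> u) * f \<alpha> (x, \<epsilon> * u) + (1 - \<phi> u) * h \<alpha> (x, \<epsilon> * u))
      - ((1 + \<phi> v) * f \<alpha> (x, \<epsilon> * v) + (1 - \<phi> v) * h \<alpha> (x, \<epsilon> * v))\<bar> \<le> 2 * (K * \<epsilon> * \<bar>u - v\<bar>) + (d1 * \<bar>u - v\<bar>) * (2 * G)"
      unfolding blend_diff by (rule abs_add_le_add)
    then show ?thesis by (simp add: algebra_simps)
  qed
  have zX: "\<bar>fst (X 0 (0, 0))\<bar> \<le> \<bar>c1 (X 0) 0\<bar> + \<bar>c1 (Y 0) 0\<bar>" "\<bar>fst (Y 0 (0, 0))\<bar> \<le> \<bar>c1 (X 0) 0\<bar> + \<bar>c1 (Y 0) 0\<bar>"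
    "\<bar>snd (X 0 (0, 0))\<bar> \<le> \<bar>c1 (X 0) 0\<bar> + \<bar>c1 (Y 0) 0\<bar>" "\<bar>snd (Y 0 (0, 0))\<bar> \<le> \<bar>c1 (X 0) 0\<bar> + \<bar>c1 (Y 0) 0\<bar>"
    using fold_signs(5,6) by (simp_all add: zero_prod_def)
  note D1 = diff[OF X1.family_bounds_axioms zX(1) Y1.family_bounds_axioms zX(2)]
    and D2 = diff[OF X2.family_bounds_axioms zX(3) Y2.family_bounds_axioms zX(4)]
  have "\<bar>c2 (F \<alpha> \<epsilon>) (x, v)\<bar> \<le> 2 * G"
    unfolding slow_fast_components
    by (rule blend_le[OF v(2) size[OF X2.family_bounds_axioms zX(3) v(1)] size[OF Y2.family_bounds_axioms zX(4) v(1)]])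
  then have "\<bar>c2 (F \<alpha> \<epsilon>) (x, u) / c1 (F \<alpha> \<epsilon>) (x, u) - c2 (F \<alpha> \<epsilon>) (x, v) / c1 (F \<alpha> \<epsilon>) (x, v)\<bar>
      \<le> (2 * (K * \<epsilon>) + d1 * (2 * G)) * \<bar>u - v\<bar> / f0
        + 2 * G * ((2 * (K * \<epsilon>) + d1 * (2 * G)) * \<bar>u - v\<bar>) / (f0 * f0)"
    by (intro quotient_difference_bound f0) (use D1 D2 in \<open>simp_all only: slow_fast_components\<close>)
  also have "\<dots> = ((2 * (K * \<epsilon>) + d1 * (2 * G)) / f0 + 2 * G * (2 * (K * \<epsilon>) + d1 * (2 * G)) / (f0 * f0)) * \<bar>u - v\<bar>"
    by (simp only: distrib_right times_divide_eq_left mult.assoc)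
  finally have le: "\<bar>c2 (F \<alpha> \<epsilon>) (x, u) / c1 (F \<alpha> \<epsilon>) (x, u) - c2 (F \<alpha> \<epsilon>) (x, v) / c1 (F \<alpha> \<epsilon>) (x, v)\<bar> \<le> \<dots>" .
  have "slope (F \<alpha> \<epsilon>) \<epsilon> x u - slope (F \<alpha> \<epsilon>) \<epsilon> x v
      = (c2 (F \<alpha> \<epsilon>) (x, u) / c1 (F \<alpha> \<epsilon>) (x, u) - c2 (F \<alpha> \<epsilon>) (x, v) / c1 (F \<alpha> \<epsilon>) (x, v)) / \<epsilon>"
    by (simp add: slope_def diff_divide_distrib mult.commute)
  then show ?thesis using divide_right_mono[OF le, of \<epsilon>] \<epsilon> by (simp add: abs_divide)
qed

end

section \<open>The critical level and the canard value\<close>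

text \<open>With s the sum and q the difference of the two x-derivatives, \<phi> at
  \<open>vb\<close> is -s/q and M4 is d q, so the derivative of \<psi> at 0 equals -M3/q.
  Substituting this on the right side and factoring out d m2 produces the quotient that defines
  \<open>delta_C\<close>.\<close>

lemma delta_identity:
  fixes q d m2 :: real
  assumes "q \<noteq> 0" "d \<noteq> 0" "m2 \<noteq> 0"
  shows "d * m2 * (\<alpha> - - (m0 * (1 / 2 * (a + - s / q * b)) + m1 * (d * q)) / (m2 * (d * q)) * \<epsilon>)
    = d * (\<alpha> * m2 + \<epsilon> * m1) - \<epsilon> * m0 * (- (a * q - s * b) / (2 * q\<^sup>2))"
  using assms by (simp add: field_simps power2_eq_square)

context regularized_fold_bounds
begin

definition "qx = ax - ay"

text \<open>The derivative of \<open>\<psi>\<close> at 0.\<close>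

definition "\<psi>1 = - ((hx2 0 + hy2 0) * qx - (ax + ay) * (hx2 0 - hy2 0)) / (2 * qx\<^sup>2)"

text \<open>At the fold p and q vanish together; the value inserted at 0 is the limit of -p/q, so
  this is the smooth extension in terms of \<phi>.\<close>

definition "\<psi> x = (if x = 0 then \<phi> vb else - p x / q x)"

lemma qx_pos: "0 < qx"
  using fold_signs by (simp add: qx_def)

text \<open>The right side is the drive that remains at x = 0, v = \<open>vb\<close> when the
  attraction is removed: the response \<open>\<Theta>\<close> of the fast equation minus the motion
  of the critical level under the slow flow. \<open>delta_C\<close> is the ratio of \<alpha> to
  \<epsilon> at which the two balance.\<close>

lemma delta_C_eq:
  "deriv \<phi> vb * m2 * (\<alpha> - delta_C (X 0) (Y 0) X' Y' \<phi> * \<epsilon>) = deriv \<phi> vb * \<Theta> \<alpha> \<epsilon> vb - \<epsilon> * m0 * \<psi>1"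
proof -
  have m4: "m4 = deriv \<phi> vb * qx" by (simp only: M4_def qx_def)
  have nz: "qx \<noteq> 0" "deriv \<phi> vb \<noteq> 0" "m2 \<noteq> 0"
    using qx_pos v_bar_facts(3) coefficient_signs(2) by linarith+
  have m3: "m3 = 1 / 2 * ((hx2 0 + hy2 0) + - (ax + ay) / qx * (hx2 0 - hy2 0))"
    unfolding M3_def v_bar_facts(2) X2.g2_0 Y2.g2_0 qx_def ..
  show ?thesis
    unfolding delta_C_def \<Theta>_vb \<psi>1_def m4 m3 by (rule delta_identity[OF nz])
qed

lemma critical_level_bounds:
  obtains s C \<psi>' where "0 < s" "s \<le> r" "0 \<le> C"
    "\<And>x. \<bar>x\<bar> \<le> s \<Longrightarrow> x \<noteq> 0 \<Longrightarrow> qx / 2 \<le> q x / x \<and> q x / x \<le> 2 * qx"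
    "\<And>x. \<bar>x\<bar> \<le> s \<Longrightarrow> x \<noteq> 0 \<Longrightarrow> (\<psi> has_real_derivative \<psi>' x) (at x)"
    "\<And>x. \<bar>x\<bar> \<le> s \<Longrightarrow> \<bar>\<psi> x - \<phi> vb\<bar> \<le> C * \<bar>x\<bar>"
    "\<And>x. \<bar>x\<bar> \<le> s \<Longrightarrow> x \<noteq> 0 \<Longrightarrow> \<bar>\<psi>' x - \<psi>1\<bar> \<le> C * \<bar>x\<bar>"
proof -
  have g0: "gx2 0 = ax" "gy2 0 = ay" using X2.g1_0 Y2.g1_0 by simp_all
  have K2: "0 \<le> 2 * K" using X1.K by simp
  have z: "p 0 = 0" "q 0 = 0" using fold_signs(5,6) by (simp_all add: p_def q_def zero_prod_def)
  have dp: "(p has_real_derivative gx2 x + gy2 x) (at x)" "((\<lambda>x. gx2 x + gy2 x) has_real_derivative hx2 x + hy2 x) (at x)"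
    "(q has_real_derivative gx2 x - gy2 x) (at x)" "((\<lambda>x. gx2 x - gy2 x) has_real_derivative hx2 x - hy2 x) (at x)"
    if "\<bar>x\<bar> \<le> r" for x
    unfolding p_def[abs_def] q_def[abs_def]
    by (fact DERIV_add[OF X2.g1[OF that] Y2.g1[OF that]] DERIV_add[OF X2.g2[OF that] Y2.g2[OF that]]
        DERIV_diff[OF X2.g1[OF that] Y2.g1[OF that]] DERIV_diff[OF X2.g2[OF that] Y2.g2[OF that]])+
  have lip: "\<bar>(hx2 x + hy2 x) - (hx2 0 + hy2 0)\<bar> \<le> 2 * K * \<bar>x\<bar>" "\<bar>(hx2 x - hy2 x) - (hx2 0 - hy2 0)\<bar> \<le> 2 * K * \<bar>x\<bar>"
    if "\<bar>x\<bar> \<le> r" for x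
    using X2.g2_lipschitz[OF that] Y2.g2_lipschitz[OF that] by linarith+
  have q0: "0 < gx2 0 - gy2 0" using qx_pos g0 by (simp add: qx_def)
  obtain s C \<psi>' where s: "0 < s" "0 \<le> C"
    and qb: "\<And>x. \<bar>x\<bar> \<le> s \<Longrightarrow> x \<noteq> 0 \<Longrightarrow> (gx2 0 - gy2 0) / 2 \<le> q x / x \<and> q x / x \<le> 2 * (gx2 0 - gy2 0)"
    and d: "\<And>x. \<bar>x\<bar> \<le> s \<Longrightarrow> x \<noteq> 0 \<Longrightarrow> ((\<lambda>x. - p x / q x) has_real_derivative \<psi>' x) (at x)"
    and c: "\<And>x. \<bar>x\<bar> \<le> s \<Longrightarrow> x \<noteq> 0 \<Longrightarrow> \<bar>- p x / q x - (- (gx2 0 + gy2 0) / (gx2 0 - gy2 0))\<bar> \<le> C * \<bar>x\<bar>"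
    and c': "\<And>x. \<bar>x\<bar> \<le> s \<Longrightarrow> x \<noteq> 0 \<Longrightarrow> \<bar>\<psi>' x - (- ((hx2 0 + hy2 0) * (gx2 0 - gy2 0)
        - (gx2 0 + gy2 0) * (hx2 0 - hy2 0)) / (2 * (gx2 0 - gy2 0)\<^sup>2))\<bar> \<le> C * \<bar>x\<bar>"
  proof (rule critical_level[where p=p and ?p1.0="\<lambda>x. gx2 x + gy2 x" and ?p2.0="\<lambda>x. hx2 x + hy2 x"
        and q=q and ?q1.0="\<lambda>x. gx2 x - gy2 x" and ?q2.0="\<lambda>x. hx2 x - hy2 x", OF X1.r K2])
    fix s C \<psi>'
    assume "0 < s" "0 \<le> C"
      "\<And>x. \<bar>x\<bar> \<le> s \<Longrightarrow> x \<noteq> 0 \<Longrightarrow> (gx2 0 - gy2 0) / 2 \<le> q x / x \<and> q x / x \<le> 2 * (gx2 0 - gy2 0)"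
      "\<And>x. \<bar>x\<bar> \<le> s \<Longrightarrow> x \<noteq> 0 \<Longrightarrow> ((\<lambda>x. - p x / q x) has_real_derivative \<psi>' x) (at x)"
      "\<And>x. \<bar>x\<bar> \<le> s \<Longrightarrow> x \<noteq> 0 \<Longrightarrow> \<bar>- p x / q x - (- (gx2 0 + gy2 0) / (gx2 0 - gy2 0))\<bar> \<le> C * \<bar>x\<bar>"
      "\<And>x. \<bar>x\<bar> \<le> s \<Longrightarrow> x \<noteq> 0 \<Longrightarrow> \<bar>\<psi>' x - (- ((hx2 0 + hy2 0) * (gx2 0 - gy2 0)
        - (gx2 0 + gy2 0) * (hx2 0 - hy2 0)) / (2 * (gx2 0 - gy2 0)\<^sup>2))\<bar> \<le> C * \<bar>x\<bar>"
    from that[OF this] show thesis .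
  qed (rule dp lip z q0; assumption)+
  show thesis
  proof (rule that[of "min s r" C \<psi>'])
    show "0 < min s r" "min s r \<le> r" "0 \<le> C" using s X1.r by auto
    fix x :: real assume x: "\<bar>x\<bar> \<le> min s r"
    then have xs: "\<bar>x\<bar> \<le> s" by simp
    show "\<bar>\<psi> x - \<phi> vb\<bar> \<le> C * \<bar>x\<bar>"
    proof (cases "x = 0")
      case False
      show ?thesis using c[OF xs False] False unfolding \<psi>_def v_bar_facts(2) g0 by simp
    qed (simp add: \<psi>_def)
    assume x0: "x \<noteq> 0"
    show "qx / 2 \<le> q x / x \<and> q x / x \<le> 2 * qx" using qb[OF xs x0] unfolding g0 qx_def .
    show "\<bar>\<psi>' x - \<psi>1\<bar> \<le> C * \<bar>x\<bar>" using c'[OF xs x0] unfolding \<psi>1_def g0 qx_def .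
    have ev: "\<forall>\<^sub>F y in nhds x. - p y / q y = \<psi> y"
      by (rule eventually_mono[OF t1_space_nhds[OF x0]]) (simp add: \<psi>_def)
    show "(\<psi> has_real_derivative \<psi>' x) (at x)"
      by (rule iffD1[OF DERIV_cong_ev[OF refl ev refl] d[OF xs x0]])
  qed
qed

lemma \<psi>_continuous:
  assumes L: "0 < L" "L \<le> s" and d: "\<And>x. \<bar>x\<bar> \<le> s \<Longrightarrow> x \<noteq> 0 \<Longrightarrow> (\<psi> has_real_derivative \<psi>' x) (at x)"
    and c: "\<And>x. \<bar>x\<bar> \<le> s \<Longrightarrow> \<bar>\<psi> x - \<phi> vb\<bar> \<le> C * \<bar>x\<bar>"
  shows "continuous_on {-L..L} \<psi>"
proof (rule continuous_at_imp_continuous_on, rule ballI)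
  fix x assume x: "x \<in> {-L..L}"
  show "isCont \<psi> x"
  proof (cases "x = 0")
    case False
    have "\<bar>x\<bar> \<le> s" using x L by auto
    from d[OF this False] show ?thesis by (rule DERIV_isCont)
  next
    case True
    have "\<forall>\<^sub>F x in at 0. norm (\<psi> x - \<phi> vb) \<le> C * \<bar>x\<bar>"
      unfolding eventually_at using c L by (intro exI[of _ s]) (auto simp: dist_real_def)
    moreover have "((\<lambda>x. C * \<bar>x\<bar>) \<longlongrightarrow> 0) (at 0)"
      using tendsto_mult[OF tendsto_const[of C] tendsto_rabs[OF tendsto_ident_at[of "0::real" UNIV]]] by simp
    ultimately have "((\<lambda>x. \<psi> x - \<phi> vb) \<longlongrightarrow> 0) (at 0)" by (rule Lim_null_comparison)
    then have "(\<psi> \<longlongrightarrow> \<phi> vb) (at 0)" by (rule LIM_zero_cancel)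
    then show ?thesis by (simp add: True isCont_def \<psi>_def[of 0])
  qed
qed

text \<open>\<open>m_0\<close> is built with \<open>phi_inv\<close>, so \<open>\<psi> x\<close> must
  first be placed in the image of \<phi>. Growth at rate d0 puts it between the values of \<phi> at
  \<open>vb - \<eta> / 2\<close> and \<open>vb + \<eta> / 2\<close>; monotonicity then confines the
  preimage to the same interval.\<close>

lemma critical_manifold_level:
  assumes x: "x \<noteq> 0" and close: "\<bar>\<psi> x - \<phi> vb\<bar> \<le> d0 * \<eta> / 2" and \<eta>: "0 < \<eta>" "\<bar>vb\<bar> + \<eta> \<le> 1"
    and expand: "\<And>u v. \<bar>u - vb\<bar> \<le> \<eta> \<Longrightarrow> \<bar>v - vb\<bar> \<le> \<eta> \<Longrightarrow> d0 * \<bar>u - v\<bar> \<le> \<bar>\<phi> u - \<phi> v\<bar>"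
  shows "\<phi> (m_0 (X 0) (Y 0) \<phi> x) = \<psi> x" "\<bar>m_0 (X 0) (Y 0) \<phi> x - vb\<bar> \<le> \<eta> / 2"
proof -
  define l u where "l = vb - \<eta> / 2" and "u = vb + \<eta> / 2"
  have lu: "-1 < l" "l < vb" "vb < u" "u < 1" "\<bar>l - vb\<bar> \<le> \<eta>" "\<bar>u - vb\<bar> \<le> \<eta>" "\<bar>vb - vb\<bar> \<le> \<eta>"
    using \<eta> by (auto simp: l_def u_def)
  have ord: "\<phi> l < \<phi> vb" "\<phi> vb < \<phi> u" "-1 < \<phi> l" "\<phi> u < 1"
    using transition_function_less[OF \<phi>, of l vb] transition_function_less[OF \<phi>, of vb u]
      transition_function_less[OF \<phi>, of "-1" l] transition_function_less[OF \<phi>, of u 1] lu \<phi>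
    by (auto simp: transition_function_def)
  have "d0 * (\<eta> / 2) \<le> \<phi> u - \<phi> vb" "d0 * (\<eta> / 2) \<le> \<phi> vb - \<phi> l"
    using expand[OF lu(6,7)] expand[OF lu(5,7)] ord lu(2,3) \<eta>(1) by (simp_all add: u_def l_def)
  then have "\<psi> x \<le> \<phi> u" "\<phi> l \<le> \<psi> x" using close by linarith+
  then have \<psi>: "\<phi> l \<le> \<psi> x" "\<psi> x \<le> \<phi> u" "-1 < \<psi> x" "\<psi> x < 1" using ord by auto
  have "m_0 (X 0) (Y 0) \<phi> x = phi_inv \<phi> (p x / (- q x))" using x by (simp add: m_0_def p_def q_def)
  also have "p x / (- q x) = \<psi> x" using x by (simp add: \<psi>_def)
  finally have m: "m_0 (X 0) (Y 0) \<phi> x = phi_inv \<phi> (\<psi> x)" .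
  define w where "w = phi_inv \<phi> (\<psi> x)"
  have w: "w \<in> {-1<..<1}" "\<phi> w = \<psi> x"
    unfolding w_def using transition_function_inverse[OF \<phi> \<psi>(3,4)] by auto
  show "\<phi> (m_0 (X 0) (Y 0) \<phi> x) = \<psi> x" using w by (simp add: m w_def)
  have "\<not> u < w" using transition_function_less[OF \<phi>, of u w] lu w \<psi> by auto
  moreover have "\<not> w < l" using transition_function_less[OF \<phi>, of w l] lu w \<psi> by auto
  ultimately show "\<bar>m_0 (X 0) (Y 0) \<phi> x - vb\<bar> \<le> \<eta> / 2"
    unfolding m w_def[symmetric] l_def u_def by linarith
qed

end

lemma factor_identity: "e * (a * s * p + m * (c * s)) = (a * p + m * c) * e * s" for a :: real
  by (simp add: algebra_simps)

lemma abs_sum_le_coefficients: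
  fixes a :: real
  assumes "\<bar>a\<bar> \<le> x * e * s" "\<bar>b\<bar> \<le> y * e * s" "\<bar>c\<bar> \<le> z * e * s"
  shows "\<bar>(a + b) + c\<bar> \<le> (x + y + z) * e * s"
proof -
  have "(x + y + z) * e * s = x * e * s + y * e * s + z * e * s" by (simp add: algebra_simps)
  then show ?thesis using assms by linarith
qed

section \<open>The box around the fold and the normal form in it\<close>

text \<open>The items of \<open>small\<close>, in order: \<open>\<phi>'\<close> stays within a
  factor 2 of its value at \<open>vb\<close>; \<psi> stays in the range that
  \<open>critical_manifold_level\<close> asks for with \<open>d0 = ds / 2\<close>; the deviation is
  at most 2; and the last two keep the first component within a factor 2 of
  \<open>m0\<close>.\<close>

locale fold_box = regularized_fold_bounds +
  fixes \<psi>' :: "real \<Rightarrow> real" and \<eta> L C K\<phi> :: real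
  assumes L: "0 < L" "L \<le> r" and \<eta>: "0 < \<eta>" "\<bar>vb\<bar> + \<eta> \<le> 1" and C: "0 \<le> C" "0 \<le> K\<phi>"
    and q_bounds: "\<And>x. \<bar>x\<bar> \<le> L \<Longrightarrow> x \<noteq> 0 \<Longrightarrow> qx / 2 \<le> q x / x \<and> q x / x \<le> 2 * qx"
    and \<psi>': "\<And>x. \<bar>x\<bar> \<le> L \<Longrightarrow> x \<noteq> 0 \<Longrightarrow> (\<psi> has_real_derivative \<psi>' x) (at x)"
    and \<psi>_near: "\<And>x. \<bar>x\<bar> \<le> L \<Longrightarrow> \<bar>\<psi> x - \<phi> vb\<bar> \<le> C * \<bar>x\<bar>"
    and \<psi>'_near: "\<And>x. \<bar>x\<bar> \<le> L \<Longrightarrow> x \<noteq> 0 \<Longrightarrow> \<bar>\<psi>' x - \<psi>1\<bar> \<le> C * \<bar>x\<bar>"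
    and \<phi>'_near: "\<And>v. \<bar>v - vb\<bar> \<le> \<eta> \<Longrightarrow> \<bar>deriv \<phi> v - deriv \<phi> vb\<bar> \<le> K\<phi> * \<bar>v - vb\<bar>"
    and small: "K\<phi> * \<eta> \<le> deriv \<phi> vb / 2" "C * L \<le> deriv \<phi> vb / 2 * \<eta> / 2" "deriv \<phi> vb * \<eta> \<le> 1 / 2"
      "2 * (K * L) \<le> m0 / 8" "2 * deriv \<phi> vb * \<eta> * \<bar>c1 (X 0) 0 - c1 (Y 0) 0\<bar> \<le> m0 / 8"
begin

abbreviation "ds \<equiv> deriv \<phi> vb"
abbreviation "N1 \<equiv> \<bar>c1 (X 0) 0 - c1 (Y 0) 0\<bar>"

lemma derivative_bounds: "\<bar>v - vb\<bar> \<le> \<eta> \<Longrightarrow> ds / 2 \<le> deriv \<phi> v \<and> deriv \<phi> v \<le> 2 * ds"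
proof -
  assume v: "\<bar>v - vb\<bar> \<le> \<eta>"
  have "K\<phi> * \<bar>v - vb\<bar> \<le> K\<phi> * \<eta>" using v C by (intro mult_left_mono) auto
  then show ?thesis using \<phi>'_near[OF v] small(1) v_bar_facts(3) by linarith
qed

lemma expand: "\<bar>u - vb\<bar> \<le> \<eta> \<Longrightarrow> \<bar>v - vb\<bar> \<le> \<eta> \<Longrightarrow> ds / 2 * \<bar>u - v\<bar> \<le> \<bar>\<phi> u - \<phi> v\<bar>"
  and lipschitz: "\<bar>u - vb\<bar> \<le> \<eta> \<Longrightarrow> \<bar>v - vb\<bar> \<le> \<eta> \<Longrightarrow> \<bar>\<phi> u - \<phi> v\<bar> \<le> 2 * ds * \<bar>u - v\<bar>"
proof -
  assume uv: "\<bar>u - vb\<bar> \<le> \<eta>" "\<bar>v - vb\<bar> \<le> \<eta>"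
  have d: "0 \<le> ds / 2" using v_bar_facts(3) by simp
  show "ds / 2 * \<bar>u - v\<bar> \<le> \<bar>\<phi> u - \<phi> v\<bar>" "\<bar>\<phi> u - \<phi> v\<bar> \<le> 2 * ds * \<bar>u - v\<bar>"
    using mean_value_bounds[OF transition_function_DERIV[OF \<phi>] derivative_bounds d uv] by simp_all
qed

lemma box: assumes "\<bar>v - vb\<bar> \<le> \<eta>" shows "\<bar>v\<bar> \<le> 1" "\<bar>\<phi> v\<bar> \<le> 1"
proof -
  show "\<bar>v\<bar> \<le> 1" using assms \<eta>(2) by linarith
  then show "\<bar>\<phi> v\<bar> \<le> 1" by (rule transition_function_abs_le[OF \<phi>])
qed

lemma \<phi>_near: assumes "\<bar>v - vb\<bar> \<le> \<eta>" shows "\<bar>\<phi> v - \<phi> vb\<bar> \<le> 2 * ds * \<bar>v - vb\<bar>"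
  using lipschitz[OF assms, of vb] \<eta>(1) by simp

lemma \<psi>_close: "\<bar>x\<bar> \<le> L \<Longrightarrow> \<bar>\<psi> x - \<phi> vb\<bar> \<le> ds / 2 * \<eta> / 2"
  using \<psi>_near[of x] mult_left_mono[of "\<bar>x\<bar>" L C] C small(2) by linarith

lemma gap: "\<bar>x\<bar> \<le> L \<Longrightarrow> \<bar>v - vb\<bar> \<le> \<eta> \<Longrightarrow> \<bar>\<phi> v - \<psi> x\<bar> \<le> 2"
proof -
  assume x: "\<bar>x\<bar> \<le> L" and v: "\<bar>v - vb\<bar> \<le> \<eta>"
  have "2 * ds * \<bar>v - vb\<bar> \<le> 2 * ds * \<eta>" using v v_bar_facts(3) by (intro mult_left_mono) auto
  then show ?thesis using \<phi>_near[OF v] \<psi>_close[OF x] small(3) by linarith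
qed

lemma scaled: assumes "0 < \<epsilon>" "\<epsilon> \<le> b" "\<bar>v - vb\<bar> \<le> \<eta>" shows "\<bar>\<epsilon> * v\<bar> \<le> \<epsilon>" "\<bar>\<epsilon> * v\<bar> \<le> b"
proof -
  show "\<bar>\<epsilon> * v\<bar> \<le> \<epsilon>" using mult_left_mono[OF box(1)[OF assms(3)], of \<epsilon>] assms(1) by (simp add: abs_mult)
  then show "\<bar>\<epsilon> * v\<bar> \<le> b" using assms(2) by simp
qed

lemma first_component_bounds:
  assumes \<epsilon>: "0 < \<epsilon>" "\<epsilon> \<le> r" and \<alpha>: "\<bar>\<alpha>\<bar> \<le> r" and x: "\<bar>x\<bar> \<le> L" and v: "\<bar>v - vb\<bar> \<le> \<eta>"
    and b: "2 * (K * (\<bar>\<alpha>\<bar> + \<epsilon>)) \<le> m0 / 8"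
  shows "m0 / 2 \<le> c1 (F \<alpha> \<epsilon>) (x, v) \<and> c1 (F \<alpha> \<epsilon>) (x, v) \<le> 2 * m0"
proof -
  have xr: "\<bar>x\<bar> \<le> r" using x L by simp
  note near = first_component_near[OF \<alpha> xr scaled(2)[OF \<epsilon> v] box(2)[OF v]]
  have "K * (\<bar>\<alpha>\<bar> + \<bar>x\<bar> + \<bar>\<epsilon> * v\<bar>) \<le> K * ((\<bar>\<alpha>\<bar> + \<epsilon>) + L)"
    using scaled(1)[OF \<epsilon> v] x X1.K by (intro mult_left_mono) auto
  also have "\<dots> = K * (\<bar>\<alpha>\<bar> + \<epsilon>) + K * L" by (rule distrib_left)
  \<comment> \<open>The errors add up to at most 3/8 of \<open>m0\<close>: two eighths here, from
    the parameters and from x, and one from the weight \<phi>.\<close>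
  finally have 1: "2 * (K * (\<bar>\<alpha>\<bar> + \<bar>x\<bar> + \<bar>\<epsilon> * v\<bar>)) \<le> m0 / 8 + m0 / 8" using b small(4) by linarith
  have "\<bar>\<phi> v - \<phi> vb\<bar> * N1 \<le> (2 * ds * \<eta>) * N1"
  proof (rule mult_right_mono)
    have "2 * ds * \<bar>v - vb\<bar> \<le> 2 * ds * \<eta>" using v v_bar_facts(3) by (intro mult_left_mono) auto
    then show "\<bar>\<phi> v - \<phi> vb\<bar> \<le> 2 * ds * \<eta>" using \<phi>_near[OF v] by linarith
  qed simp
  then show ?thesis using near 1 small(5) coefficient_signs(1) by linarith
qed

text \<open>Here the abstract normal form is verified. The attraction term is matched exactly, so
  every error comes from the order-\<epsilon> terms and has the size \<epsilon> times S, where S is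
  |x| plus the deviation plus \<epsilon>. The constant is the sum of the three error constants
  below.\<close>

lemma normal_form_bound:
  assumes \<epsilon>: "0 < \<epsilon>" "\<epsilon> \<le> r" and D: "0 < D" and \<alpha>: "\<bar>\<alpha>\<bar> \<le> D * \<epsilon>" "\<bar>\<alpha>\<bar> \<le> r"
    and x: "\<bar>x\<bar> \<le> L" "x \<noteq> 0" and v: "\<bar>v - vb\<bar> \<le> \<eta>"
    and F1: "m0 / 2 \<le> c1 (F \<alpha> \<epsilon>) (x, v)" "c1 (F \<alpha> \<epsilon>) (x, v) \<le> 2 * m0"
  defines "N \<equiv> D * (\<bar>snd (X' 0)\<bar> + \<bar>snd (Y' 0)\<bar>) + (\<bar>dy (c2 (X 0)) 0\<bar> + \<bar>dy (c2 (Y 0)) 0\<bar>)"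
  shows "\<exists>g\<in>{ds / 2 * (qx / 2) / (2 * m0)..2 * ds * (2 * qx) / (m0 / 2)}.
    \<bar>deriv \<phi> v * c2 (F \<alpha> \<epsilon>) (x, v) - \<epsilon> * c1 (F \<alpha> \<epsilon>) (x, v) * \<psi>' x
      - g * x * (\<phi> v - \<psi> x) * c1 (F \<alpha> \<epsilon>) (x, v) - ds * m2 * (\<alpha> - delta_C (X 0) (Y 0) X' Y' \<phi> * \<epsilon>)\<bar>
    \<le> (4 * ds * (K * (D + 1)\<^sup>2) + (K\<phi> * (2 * N) + ds * (2 * N + 2 * ds * (2 * N))) * ((1 + C) / (ds / 2))
        + ((2 * (K * (D + 1)) + (1 + C) * N1) * (\<bar>\<psi>1\<bar> + C * L) + m0 * C))
      * \<epsilon> * (\<bar>x\<bar> + \<bar>\<phi> v - \<psi> x\<bar> + \<epsilon>)"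
proof -
  have ds: "0 < ds" by (rule v_bar_facts(3))
  have m0: "0 < m0" by (rule coefficient_signs(1))
  have xr: "\<bar>x\<bar> \<le> r" using x L by simp
  have K: "0 \<le> K" by (rule X1.K)
  note d = derivative_bounds[OF v, THEN conjunct1] derivative_bounds[OF v, THEN conjunct2]
  note qb = q_bounds[OF x, THEN conjunct1] q_bounds[OF x, THEN conjunct2]
  define S where "S = \<bar>x\<bar> + \<bar>\<phi> v - \<psi> x\<bar> + \<epsilon>"
  have S: "0 \<le> S" "\<bar>x\<bar> \<le> S" "\<bar>\<phi> v - \<psi> x\<bar> + \<bar>x\<bar> \<le> S" "\<bar>x\<bar> + \<epsilon> \<le> S"
    using \<epsilon>(1) by (auto simp: S_def)
  define w where "w = \<phi> v - \<psi> x"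
  define f1 f2 where "f1 = c1 (F \<alpha> \<epsilon>) (x, v)" and "f2 = c2 (F \<alpha> \<epsilon>) (x, v)"
  define t tb where "t = \<Theta> \<alpha> \<epsilon> v" and "tb = \<Theta> \<alpha> \<epsilon> vb"
  have f1: "0 < f1" using F1(1) m0 by (simp add: f1_def)
  \<comment> \<open>Since \<open>q (\<phi> - \<psi>) = p + \<phi> q\<close> holds identically, this
    g absorbs all of order zero; the division by f1 offsets the factor F1 in the normal
    form.\<close>
  define g where "g = deriv \<phi> v * (q x / x) / f1"
  have qx: "0 < qx" by (rule qx_pos)
  have q0: "q x \<noteq> 0" using qb(1) qx x by auto
  have g_mem: "g \<in> {ds / 2 * (qx / 2) / (2 * m0)..2 * ds * (2 * qx) / (m0 / 2)}"
  proof -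
    have e: "ds / 2 * (qx / 2) \<le> deriv \<phi> v * (q x / x)" "deriv \<phi> v * (q x / x) \<le> 2 * ds * (2 * qx)"
      by (rule mult_mono; use d qb ds qx in linarith)+
    have p: "0 \<le> deriv \<phi> v * (q x / x)" by (rule mult_nonneg_nonneg; use d qb ds qx in linarith)
    have "ds / 2 * (qx / 2) / (2 * m0) \<le> g"
      unfolding g_def by (rule frac_le[OF p e(1) f1]) (use F1 in \<open>simp add: f1_def\<close>)
    moreover have "g \<le> 2 * ds * (2 * qx) / (m0 / 2)"
      unfolding g_def
    proof (rule frac_le[OF _ e(2)])
      show "0 \<le> 2 * ds * (2 * qx)" using p e(2) by linarith
    qed (use m0 F1 in \<open>simp_all add: f1_def\<close>)
    ultimately show ?thesis by simp
  qed
  have le: "\<bar>deriv \<phi> v * f2 - \<epsilon> * f1 * \<psi>' x - g * x * w * f1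
      - ds * m2 * (\<alpha> - delta_C (X 0) (Y 0) X' Y' \<phi> * \<epsilon>)\<bar>
    \<le> (4 * ds * (K * (D + 1)\<^sup>2) + (K\<phi> * (2 * N) + ds * (2 * N + 2 * ds * (2 * N))) * ((1 + C) / (ds / 2))
        + ((2 * (K * (D + 1)) + (1 + C) * N1) * (\<bar>\<psi>1\<bar> + C * L) + m0 * C)) * \<epsilon> * S"
  proof -
    define R where "R = f2 - (p x + \<phi> v * q x) - t"
    have gx: "g * x * w * f1 = deriv \<phi> v * (q x * w)" using f1 x by (simp add: g_def)
    have qw: "q x * w = p x + \<phi> v * q x" using q0 x by (simp add: w_def \<psi>_def field_simps)
    \<comment> \<open>Three errors: the Taylor remainder R of the second component, the change of
      \<open>\<phi>' \<Theta>\<close> between v and \<open>vb\<close>, and the change of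
      \<open>F1 \<psi>'\<close> against its limit at the fold. What is left cancels by
      \<open>delta_C_eq\<close>.\<close>
    have split: "deriv \<phi> v * f2 - \<epsilon> * f1 * \<psi>' x - g * x * w * f1
        - ds * m2 * (\<alpha> - delta_C (X 0) (Y 0) X' Y' \<phi> * \<epsilon>)
      = (deriv \<phi> v * R + (deriv \<phi> v * t - ds * tb)) + - (\<epsilon> * (f1 * \<psi>' x - m0 * \<psi>1))"
      unfolding gx qw delta_C_eq R_def t_def tb_def by (simp add: algebra_simps)
    have T1: "\<bar>deriv \<phi> v * R\<bar> \<le> 4 * ds * (K * (D + 1)\<^sup>2) * \<epsilon> * S"
    proof -
      have e: "\<bar>\<alpha>\<bar> + \<bar>\<epsilon> * v\<bar> \<le> (D + 1) * \<epsilon>" using \<alpha>(1) scaled(1)[OF \<epsilon> v] by (simp add: distrib_right)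
      have "(D + 1) * \<epsilon> + \<bar>x\<bar> \<le> (D + 1) * (\<epsilon> + \<bar>x\<bar>)" using D by (simp add: distrib_left distrib_right)
      also have "\<dots> \<le> (D + 1) * S" using S(4) D by (intro mult_left_mono) auto
      finally have e2: "\<bar>\<alpha>\<bar> + \<bar>x\<bar> + \<bar>\<epsilon> * v\<bar> \<le> (D + 1) * S" using e by linarith
      have "\<bar>R\<bar> \<le> 2 * (K * (\<bar>\<alpha>\<bar> + \<bar>\<epsilon> * v\<bar>) * (\<bar>\<alpha>\<bar> + \<bar>x\<bar> + \<bar>\<epsilon> * v\<bar>))"
        unfolding R_def f2_def t_def by (rule second_component_expansion[OF \<alpha>(2) xr scaled(2)[OF \<epsilon> v] box(2)[OF v]])
      also have "\<dots> \<le> 2 * (K * ((D + 1) * \<epsilon>) * ((D + 1) * S))"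
        using e e2 K D \<epsilon> S by (intro mult_left_mono mult_mono) auto
      finally have "\<bar>R\<bar> \<le> 2 * (K * ((D + 1) * \<epsilon>) * ((D + 1) * S))" .
      then have "\<bar>deriv \<phi> v * R\<bar> \<le> (2 * ds) * (2 * (K * ((D + 1) * \<epsilon>) * ((D + 1) * S)))"
        unfolding abs_mult using d ds by (intro mult_mono) auto
      also have "\<dots> = 4 * ds * (K * (D + 1)\<^sup>2) * \<epsilon> * S" by (simp add: power2_eq_square algebra_simps)
      finally show ?thesis .
    qed
    \<comment> \<open>Both factors are Lipschitz in v and \<open>\<Theta>\<close> is of order
      \<epsilon>. The distance of v from \<open>vb\<close> is bounded by S through the expansion of
      \<phi>, because \<open>\<phi> v - \<phi> vb\<close> differs from the deviation by at most C
      |x|.\<close>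
    have T2: "\<bar>deriv \<phi> v * t - ds * tb\<bar>
        \<le> (K\<phi> * (2 * N) + ds * (2 * N + 2 * ds * (2 * N))) * ((1 + C) / (ds / 2)) * \<epsilon> * S"
    proof -
      have N: "0 \<le> N" using D by (simp add: N_def)
      define B where "B = K\<phi> * (2 * N) + ds * (2 * N + 2 * ds * (2 * N))"
      have B: "0 \<le> B" using C ds N by (simp add: B_def)
      note th = \<Theta>_bounds[OF \<epsilon>(1) \<alpha>(1) box[OF v] \<phi>_near[OF v], folded N_def t_def tb_def]
      have "\<bar>deriv \<phi> v * t - ds * tb\<bar>
          \<le> (K\<phi> * \<bar>v - vb\<bar>) * (2 * (\<epsilon> * N)) + ds * (\<epsilon> * (2 * N + 2 * ds * (2 * N)) * \<bar>v - vb\<bar>)"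
        by (rule mult_difference_bound[OF \<phi>'_near[OF v] th(2,1)]) (use ds C N \<epsilon> in auto)
      also have "\<dots> = B * \<epsilon> * \<bar>v - vb\<bar>" by (simp add: B_def algebra_simps)
      also have "\<dots> \<le> B * \<epsilon> * ((1 + C) / (ds / 2) * S)"
      proof (rule mult_left_mono)
        have "ds / 2 * \<bar>v - vb\<bar> \<le> \<bar>\<phi> v - \<phi> vb\<bar>" using expand[OF v, of vb] \<eta>(1) by simp
        also have "\<dots> \<le> \<bar>\<phi> v - \<psi> x\<bar> + C * \<bar>x\<bar>" using \<psi>_near[OF x(1)] by linarith
        also have "\<dots> \<le> S + C * S" using S C by (intro add_mono mult_left_mono) auto
        also have "\<dots> = (1 + C) * S" by (simp add: distrib_right)
        finally have "\<bar>v - vb\<bar> \<le> (1 + C) * S / (ds / 2)" using ds by (simp add: pos_le_divide_eq mult.commute)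
        then show "\<bar>v - vb\<bar> \<le> (1 + C) / (ds / 2) * S" by (simp only: times_divide_eq_left)
      qed (use B \<epsilon> in simp)
      finally show ?thesis unfolding B_def[symmetric] by (simp only: mult_ac)
    qed
    \<comment> \<open>The factor \<epsilon> is explicit here; it remains that F1 is within O(S) of
      \<open>m0\<close> and \<open>\<psi>'\<close> within O(S) of \<open>\<psi>1\<close>.\<close>
    have T3: "\<bar>- (\<epsilon> * (f1 * \<psi>' x - m0 * \<psi>1))\<bar>
        \<le> ((2 * (K * (D + 1)) + (1 + C) * N1) * (\<bar>\<psi>1\<bar> + C * L) + m0 * C) * \<epsilon> * S"
    proof -
      have "K * (\<bar>\<alpha>\<bar> + \<bar>x\<bar> + \<bar>\<epsilon> * v\<bar>) \<le> K * ((D + 1) * S)"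
      proof (rule mult_left_mono[OF _ K])
        have "\<bar>\<alpha>\<bar> + \<bar>x\<bar> + \<bar>\<epsilon> * v\<bar> \<le> D * \<epsilon> + (\<bar>x\<bar> + \<epsilon>)" using \<alpha>(1) scaled(1)[OF \<epsilon> v] by linarith
        also have "\<dots> \<le> D * S + S" using S(4) D by (intro add_mono mult_left_mono) auto
        finally show "\<bar>\<alpha>\<bar> + \<bar>x\<bar> + \<bar>\<epsilon> * v\<bar> \<le> (D + 1) * S" by (simp add: distrib_right)
      qed
      moreover have "\<bar>\<phi> v - \<phi> vb\<bar> * N1 \<le> ((1 + C) * S) * N1"
      proof (rule mult_right_mono)
        have "\<bar>\<phi> v - \<phi> vb\<bar> \<le> \<bar>\<phi> v - \<psi> x\<bar> + C * \<bar>x\<bar>" using \<psi>_near[OF x(1)] by linarith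
        also have "\<dots> \<le> S + C * S" using S C by (intro add_mono mult_left_mono) auto
        finally show "\<bar>\<phi> v - \<phi> vb\<bar> \<le> (1 + C) * S" by (simp add: distrib_right)
      qed simp
      ultimately have "\<bar>f1 - m0\<bar> \<le> 2 * (K * ((D + 1) * S)) + ((1 + C) * S) * N1"
        using first_component_near[OF \<alpha>(2) xr scaled(2)[OF \<epsilon> v] box(2)[OF v]] unfolding f1_def by linarith
      also have "\<dots> = (2 * (K * (D + 1)) + (1 + C) * N1) * S" by (simp add: algebra_simps)
      finally have f: "\<bar>f1 - m0\<bar> \<le> (2 * (K * (D + 1)) + (1 + C) * N1) * S" .
      have p: "\<bar>\<psi>' x - \<psi>1\<bar> \<le> C * S" using \<psi>'_near[OF x] mult_left_mono[OF S(2) C(1)] by linarith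
      have p': "\<bar>\<psi>' x\<bar> \<le> \<bar>\<psi>1\<bar> + C * L" using \<psi>'_near[OF x] mult_left_mono[OF x(1) C(1)] by linarith
      have "\<bar>f1 * \<psi>' x - m0 * \<psi>1\<bar>
          \<le> (2 * (K * (D + 1)) + (1 + C) * N1) * S * (\<bar>\<psi>1\<bar> + C * L) + m0 * (C * S)"
        by (rule mult_difference_bound[OF f p p']) (use m0 K D C S in auto)
      then have "\<epsilon> * \<bar>f1 * \<psi>' x - m0 * \<psi>1\<bar>
          \<le> \<epsilon> * ((2 * (K * (D + 1)) + (1 + C) * N1) * S * (\<bar>\<psi>1\<bar> + C * L) + m0 * (C * S))"
        using \<epsilon> by (intro mult_left_mono) auto
      also have "\<dots> = ((2 * (K * (D + 1)) + (1 + C) * N1) * (\<bar>\<psi>1\<bar> + C * L) + m0 * C) * \<epsilon> * S"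
        by (rule factor_identity)
      finally show ?thesis using \<epsilon> by (simp only: abs_minus_cancel abs_mult abs_of_pos)
    qed
    show ?thesis
      unfolding split by (rule abs_sum_le_coefficients[OF T1 T2 T3])
  qed
  show ?thesis by (rule bexI[of _ g]) (fact le[unfolded f1_def f2_def S_def w_def] g_mem)+
qed

lemma eventually_small:
  assumes "0 < D"
  shows "\<forall>\<^sub>F \<epsilon> in at_right 0. 0 < \<epsilon> \<and> \<epsilon> \<le> r \<and> D * \<epsilon> \<le> r \<and> 2 * (K * (D * \<epsilon> + \<epsilon>)) \<le> m0 / 8"
proof -
  have m0: "0 < m0" by (rule coefficient_signs(1))
  have K: "0 \<le> K" by (rule X1.K)
  define b where "b = min (r / (D + 1)) (m0 / (16 * (K + 1) * (D + 1)))"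
  have "0 < b" using X1.r m0 K assms by (simp add: b_def)
  then have "\<forall>\<^sub>F \<epsilon> in at_right 0. \<epsilon> \<in> {0<..<b}" by (rule eventually_at_right_real)
  then show ?thesis
  proof eventually_elim
    case (elim \<epsilon>)
    then have \<epsilon>: "0 < \<epsilon>" "\<epsilon> \<le> r / (D + 1)" "\<epsilon> \<le> m0 / (16 * (K + 1) * (D + 1))" by (auto simp: b_def)
    have 1: "D * \<epsilon> + \<epsilon> \<le> r"
      using \<epsilon>(2) assms by (simp add: pos_le_divide_eq distrib_left mult.commute)
    have "K * (D * \<epsilon> + \<epsilon>) \<le> (K + 1) * (D * \<epsilon> + \<epsilon>)" using \<epsilon> assms by (intro mult_right_mono) auto
    moreover have "16 * ((K + 1) * (D * \<epsilon> + \<epsilon>)) \<le> m0"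
    proof -
      have "0 < 16 * (K + 1) * (D + 1)" using K assms by simp
      with \<epsilon>(3) have "\<epsilon> * (16 * (K + 1) * (D + 1)) \<le> m0" by (simp only: pos_le_divide_eq)
      moreover have "\<epsilon> * (16 * (K + 1) * (D + 1)) = 16 * ((K + 1) * (D * \<epsilon> + \<epsilon>))" by (simp add: algebra_simps)
      ultimately show ?thesis by linarith
    qed
    moreover have "0 < D * \<epsilon>" using \<epsilon> assms by simp
    ultimately show ?case using 1 \<epsilon>(1) by (auto; linarith)
  qed
qed

lemma \<psi>_continuous_on: "continuous_on {-L..L} \<psi>"
  by (rule \<psi>_continuous[OF L(1) order_refl \<psi>' \<psi>_near])

text \<open>The constants come from the factor-2 bounds in the box: g is \<open>\<phi>'\<close>
  times q/x divided by F1, with these three between half and twice \<open>ds\<close>,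
  \<open>qx\<close> and \<open>m0\<close>. The drive coefficient \<open>ds * m2\<close> is nonzero
  by \<open>coefficient_signs\<close>.\<close>

theorem is_canard_point:
  "canard_point F \<phi> (deriv \<phi>) \<psi> \<psi>' vb \<eta> L (ds / 2 * (qx / 2) / (2 * m0)) (2 * ds * (2 * qx) / (m0 / 2))
    (m0 / 2) (2 * m0) (ds / 2) (ds * m2) (delta_C (X 0) (Y 0) X' Y' \<phi>) U"
proof (rule canard_pointI)
  show "0 < ds / 2 * (qx / 2) / (2 * m0)" "0 < m0 / 2" "0 < ds / 2" "ds * m2 \<noteq> 0"
    using v_bar_facts(3) qx_pos coefficient_signs by auto
  show "\<psi> 0 = \<phi> vb" by (simp add: \<psi>_def)
  fix D :: real assume D: "0 < D"
  show "\<forall>\<^sub>F \<epsilon> in at_right 0.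
       continuous_on ({-(D*\<epsilon>)..D*\<epsilon>} \<times> {-L..L} \<times> {vb-\<eta>..vb+\<eta>}) (\<lambda>(\<alpha>, p). F \<alpha> \<epsilon> p) \<and>
       (\<exists>K. \<forall>\<alpha>\<in>{-(D*\<epsilon>)..D*\<epsilon>}. \<forall>x\<in>{-L..L}. \<forall>u v. \<bar>u - vb\<bar> \<le> \<eta> \<longrightarrow> \<bar>v - vb\<bar> \<le> \<eta> \<longrightarrow>
          \<bar>slope (F \<alpha> \<epsilon>) \<epsilon> x u - slope (F \<alpha> \<epsilon>) \<epsilon> x v\<bar> \<le> K * \<bar>u - v\<bar>) \<and>
       (\<forall>\<alpha>\<in>{-(D*\<epsilon>)..D*\<epsilon>}. \<forall>x\<in>{-L..L}. \<forall>v. \<bar>v - vb\<bar> \<le> \<eta> \<longrightarrow>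
          m0 / 2 \<le> c1 (F \<alpha> \<epsilon>) (x, v) \<and> c1 (F \<alpha> \<epsilon>) (x, v) \<le> 2 * m0)"
    using eventually_small[OF D]
  proof eventually_elim
    case (elim \<epsilon>)
    then have \<epsilon>: "0 < \<epsilon>" "\<epsilon> \<le> r" "D * \<epsilon> \<le> r" "2 * (K * (D * \<epsilon> + \<epsilon>)) \<le> m0 / 8" by auto
    have first: "m0 / 2 \<le> c1 (F \<alpha> \<epsilon>) (x, v) \<and> c1 (F \<alpha> \<epsilon>) (x, v) \<le> 2 * m0"
      if "\<bar>\<alpha>\<bar> \<le> D * \<epsilon>" "\<bar>x\<bar> \<le> L" "\<bar>v - vb\<bar> \<le> \<eta>" for \<alpha> x v
    proof (rule first_component_bounds[OF \<epsilon>(1,2) _ that(2,3)])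
      show "\<bar>\<alpha>\<bar> \<le> r" using that(1) \<epsilon>(3) by linarith
      have "K * (\<bar>\<alpha>\<bar> + \<epsilon>) \<le> K * (D * \<epsilon> + \<epsilon>)" using that(1) X1.K by (intro mult_left_mono) auto
      then show "2 * (K * (\<bar>\<alpha>\<bar> + \<epsilon>)) \<le> m0 / 8" using \<epsilon>(4) by linarith
    qed
    have "continuous_on ({-(D*\<epsilon>)..D*\<epsilon>} \<times> {-L..L} \<times> {vb-\<eta>..vb+\<eta>}) (\<lambda>(\<alpha>, p). F \<alpha> \<epsilon> p)"
    proof (rule field_continuous)
      show "{-(D*\<epsilon>)..D*\<epsilon>} \<subseteq> {-r..r}" "{-L..L} \<subseteq> {-r..r}" using \<epsilon>(3) L by auto
      fix v assume "v \<in> {vb-\<eta>..vb+\<eta>}"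
      then have "\<bar>v - vb\<bar> \<le> \<eta>" by (auto simp: abs_le_iff)
      then show "\<bar>\<epsilon> * v\<bar> \<le> r" by (rule scaled(2)[OF \<epsilon>(1,2)])
    qed
    moreover have "\<exists>K. \<forall>\<alpha>\<in>{-(D*\<epsilon>)..D*\<epsilon>}. \<forall>x\<in>{-L..L}. \<forall>u v. \<bar>u - vb\<bar> \<le> \<eta> \<longrightarrow> \<bar>v - vb\<bar> \<le> \<eta> \<longrightarrow>
          \<bar>slope (F \<alpha> \<epsilon>) \<epsilon> x u - slope (F \<alpha> \<epsilon>) \<epsilon> x v\<bar> \<le> K * \<bar>u - v\<bar>"
    \<comment> \<open>The witness stays schematic until \<open>slope_lipschitz\<close> fixes it;
      introduced before the bound variables, it may depend on \<epsilon> but not on \<alpha>, x, u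
      and v.\<close>
    proof (rule exI, intro ballI allI impI)
      fix \<alpha> x u v assume "\<alpha> \<in> {-(D*\<epsilon>)..D*\<epsilon>}" "x \<in> {-L..L}" and u: "\<bar>u - vb\<bar> \<le> \<eta>" and v: "\<bar>v - vb\<bar> \<le> \<eta>"
      then have \<alpha>: "\<bar>\<alpha>\<bar> \<le> D * \<epsilon>" and x: "\<bar>x\<bar> \<le> L" by auto
      have \<alpha>r: "\<bar>\<alpha>\<bar> \<le> r" and xr: "\<bar>x\<bar> \<le> r" using \<alpha> x \<epsilon>(3) L(2) by linarith+
      have f0: "0 < m0 / 2" using coefficient_signs(1) by simp
      show "\<bar>slope (F \<alpha> \<epsilon>) \<epsilon> x u - slope (F \<alpha> \<epsilon>) \<epsilon> x v\<bar>
        \<le> ((2 * (K * \<epsilon>) + 2 * ds * (2 * (\<bar>c1 (X 0) 0\<bar> + \<bar>c1 (Y 0) 0\<bar> + 3 * K * r))) / (m0 / 2)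
            + 2 * (\<bar>c1 (X 0) 0\<bar> + \<bar>c1 (Y 0) 0\<bar> + 3 * K * r)
              * (2 * (K * \<epsilon>) + 2 * ds * (2 * (\<bar>c1 (X 0) 0\<bar> + \<bar>c1 (Y 0) 0\<bar> + 3 * K * r))) / (m0 / 2 * (m0 / 2))) / \<epsilon> * \<bar>u - v\<bar>"
        by (rule slope_lipschitz[OF \<alpha>r xr \<epsilon>(1) scaled(2)[OF \<epsilon>(1,2) u] box(2)[OF u] scaled(2)[OF \<epsilon>(1,2) v]
              box(2)[OF v] lipschitz[OF u v] f0 first[OF \<alpha> x u, THEN conjunct1] first[OF \<alpha> x v, THEN conjunct1]])
    qed
    moreover have "\<forall>\<alpha>\<in>{-(D*\<epsilon>)..D*\<epsilon>}. \<forall>x\<in>{-L..L}. \<forall>v. \<bar>v - vb\<bar> \<le> \<eta> \<longrightarrow>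
          m0 / 2 \<le> c1 (F \<alpha> \<epsilon>) (x, v) \<and> c1 (F \<alpha> \<epsilon>) (x, v) \<le> 2 * m0"
      by (intro ballI allI impI first) auto
    ultimately show ?case by (intro conjI)
  qed
  define N where "N = D * (\<bar>snd (X' 0)\<bar> + \<bar>snd (Y' 0)\<bar>) + (\<bar>dy (c2 (X 0)) 0\<bar> + \<bar>dy (c2 (Y 0)) 0\<bar>)"
  show "\<exists>C. \<forall>\<^sub>F \<epsilon> in at_right 0.
       \<forall>\<alpha>\<in>{-(D*\<epsilon>)..D*\<epsilon>}. \<forall>x\<in>{-L..L} - {0}. \<forall>v. \<bar>v - vb\<bar> \<le> \<eta> \<longrightarrow>
        (\<exists>g\<in>{ds / 2 * (qx / 2) / (2 * m0)..2 * ds * (2 * qx) / (m0 / 2)}.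
          \<bar>deriv \<phi> v * c2 (F \<alpha> \<epsilon>) (x, v) - \<epsilon> * c1 (F \<alpha> \<epsilon>) (x, v) * \<psi>' x
            - g * x * (\<phi> v - \<psi> x) * c1 (F \<alpha> \<epsilon>) (x, v) - ds * m2 * (\<alpha> - delta_C (X 0) (Y 0) X' Y' \<phi> * \<epsilon>)\<bar>
          \<le> C * \<epsilon> * (\<bar>x\<bar> + \<bar>\<phi> v - \<psi> x\<bar> + \<epsilon>))"
  proof (rule exI, rule eventually_mono[OF eventually_small[OF D]], intro ballI allI impI)
    fix \<epsilon> \<alpha> x v
    assume e: "0 < \<epsilon> \<and> \<epsilon> \<le> r \<and> D * \<epsilon> \<le> r \<and> 2 * (K * (D * \<epsilon> + \<epsilon>)) \<le> m0 / 8"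
      and "\<alpha> \<in> {-(D*\<epsilon>)..D*\<epsilon>}" "x \<in> {-L..L} - {0}" and v: "\<bar>v - vb\<bar> \<le> \<eta>"
    then have \<alpha>: "\<bar>\<alpha>\<bar> \<le> D * \<epsilon>" and x: "\<bar>x\<bar> \<le> L" "x \<noteq> 0" by auto
    from e have \<epsilon>: "0 < \<epsilon>" "\<epsilon> \<le> r" "D * \<epsilon> \<le> r" "2 * (K * (D * \<epsilon> + \<epsilon>)) \<le> m0 / 8" by auto
    have \<alpha>r: "\<bar>\<alpha>\<bar> \<le> r" using \<alpha> \<epsilon>(3) by linarith
    have "K * (\<bar>\<alpha>\<bar> + \<epsilon>) \<le> K * (D * \<epsilon> + \<epsilon>)" using \<alpha> X1.K by (intro mult_left_mono) auto
    then have b: "2 * (K * (\<bar>\<alpha>\<bar> + \<epsilon>)) \<le> m0 / 8" using \<epsilon>(4) by linarith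
    note f = first_component_bounds[OF \<epsilon>(1,2) \<alpha>r x(1) v b]
    show "\<exists>g\<in>{ds / 2 * (qx / 2) / (2 * m0)..2 * ds * (2 * qx) / (m0 / 2)}.
          \<bar>deriv \<phi> v * c2 (F \<alpha> \<epsilon>) (x, v) - \<epsilon> * c1 (F \<alpha> \<epsilon>) (x, v) * \<psi>' x
            - g * x * (\<phi> v - \<psi> x) * c1 (F \<alpha> \<epsilon>) (x, v) - ds * m2 * (\<alpha> - delta_C (X 0) (Y 0) X' Y' \<phi> * \<epsilon>)\<bar>
          \<le> (4 * ds * (K * (D + 1)\<^sup>2) + (K\<phi> * (2 * N) + ds * (2 * N + 2 * ds * (2 * N))) * ((1 + C) / (ds / 2))
              + ((2 * (K * (D + 1)) + (1 + C) * N1) * (\<bar>\<psi>1\<bar> + C * L) + m0 * C))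
            * \<epsilon> * (\<bar>x\<bar> + \<bar>\<phi> v - \<psi> x\<bar> + \<epsilon>)"
      unfolding N_def by (rule normal_form_bound[OF \<epsilon>(1,2) D \<alpha> \<alpha>r x v f[THEN conjunct1] f[THEN conjunct2]])
  qed
next
  show "\<forall>\<^sub>F \<epsilon> in at_right 0. \<forall>x\<in>{-L..L}. \<forall>v. \<bar>v - vb\<bar> \<le> \<eta> \<longrightarrow> (x, \<epsilon> * v) \<in> U"
  proof (rule eventually_mono[OF eventually_small[OF zero_less_one]], intro ballI allI impI)
    fix \<epsilon> x v
    assume e: "0 < \<epsilon> \<and> \<epsilon> \<le> r \<and> 1 * \<epsilon> \<le> r \<and> 2 * (K * (1 * \<epsilon> + \<epsilon>)) \<le> m0 / 8"
      and x: "x \<in> {-L..L}" and v: "\<bar>v - vb\<bar> \<le> \<eta>"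
    have "\<bar>\<epsilon> * v\<bar> \<le> r" using e by (intro scaled(2)[OF _ _ v]) auto
    then have "(x, \<epsilon> * v) \<in> {-r..r} \<times> {-r..r}" using x L(2) by (auto simp: abs_le_iff)
    then show "(x, \<epsilon> * v) \<in> U" by (rule subsetD[OF X1.domain])
  qed
qed (rule \<eta>(1) L(1) transition_function_DERIV[OF \<phi>] expand \<psi>' \<psi>_continuous_on \<psi>_close gap; assumption)+

lemma critical_manifold:
  assumes "\<bar>x\<bar> \<le> L" "x \<noteq> 0"
  shows "\<phi> (m_0 (X 0) (Y 0) \<phi> x) = \<psi> x" "\<bar>m_0 (X 0) (Y 0) \<phi> x - vb\<bar> \<le> \<eta> / 2"
  by (rule critical_manifold_level[OF assms(2) \<psi>_close[OF assms(1)] \<eta> expand]; assumption)+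

end

lemma graph_over_section: "0 \<in> I \<Longrightarrow> graph_over I w \<inter> section_0 = {(0, w 0)}"
  by (auto simp: graph_over_def)

lemma powr_three_halves: "0 < \<epsilon> \<Longrightarrow> \<epsilon> powr (3/2) = \<epsilon> * sqrt \<epsilon>" for \<epsilon> :: real
  using powr_add[of \<epsilon> 1 "1/2"] by (simp add: powr_half_sqrt)

section \<open>Fenichel manifolds as initial data\<close>

context fold_box
begin

text \<open>Translates closeness to \<open>m_0\<close> in v into a deviation of order \<epsilon>: at
  c the critical manifold has deviation 0, and \<phi> has Lipschitz constant \<open>2 * ds\<close>
  on the box. At the outer ends c = -L1 and c = L1 this yields the initial data for the two
  branches.\<close>

lemma fenichel_endpoint:
  assumes m: "fenichel_manifolds U X Y \<phi> I m" and c: "c \<in> I" "\<bar>c\<bar> \<le> L" "c \<noteq> 0" and D: "0 < D"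
  shows "\<exists>C. \<forall>\<^sub>F \<epsilon> in at_right 0. continuous_on {-(D*\<epsilon>)..D*\<epsilon>} (\<lambda>\<alpha>. m \<alpha> \<epsilon> c) \<and>
    (\<forall>\<alpha>\<in>{-(D*\<epsilon>)..D*\<epsilon>}. locally_invariant (F \<alpha> \<epsilon>) \<epsilon> (strip U \<epsilon> I) (graph_over I (m \<alpha> \<epsilon>)) \<and>
       \<bar>m \<alpha> \<epsilon> c - vb\<bar> \<le> \<eta> \<and> \<bar>\<phi> (m \<alpha> \<epsilon> c) - \<psi> c\<bar> \<le> C * \<epsilon>)"
proof -
  obtain C0 where C0: "\<forall>\<^sub>F \<epsilon> in at_right 0.
      continuous_on ({-(D*\<epsilon>)..D*\<epsilon>} \<times> I) (\<lambda>(\<alpha>, x). m \<alpha> \<epsilon> x) \<and>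
      (\<forall>\<alpha>\<in>{-(D*\<epsilon>)..D*\<epsilon>}. locally_invariant (F \<alpha> \<epsilon>) \<epsilon> (strip U \<epsilon> I) (graph_over I (m \<alpha> \<epsilon>)) \<and>
        (\<forall>x\<in>I. \<bar>m \<alpha> \<epsilon> x - m_0 (X 0) (Y 0) \<phi> x\<bar> \<le> C0 * \<epsilon>))"
    using m D unfolding fenichel_manifolds_def by (elim allE impE exE)
  \<comment> \<open>\<open>C0\<close> may be negative, so a positive majorant is used. For
    \<epsilon> below b the distance to \<open>m_0\<close> is at most \<open>\<eta> / 2\<close>; with
    the other half from \<open>critical_manifold\<close> the end point lies in the box.\<close>
  define c0 b where "c0 = \<bar>C0\<bar> + 1" and "b = \<eta> / (2 * c0)"
  have c0: "0 < c0" "C0 \<le> c0" by (auto simp: c0_def)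
  then have "0 < b" using \<eta> by (simp add: b_def)
  then have "\<forall>\<^sub>F \<epsilon> in at_right 0. \<epsilon> \<in> {0<..<b}" by (rule eventually_at_right_real)
  with C0 have "\<forall>\<^sub>F \<epsilon> in at_right 0. continuous_on {-(D*\<epsilon>)..D*\<epsilon>} (\<lambda>\<alpha>. m \<alpha> \<epsilon> c) \<and>
    (\<forall>\<alpha>\<in>{-(D*\<epsilon>)..D*\<epsilon>}. locally_invariant (F \<alpha> \<epsilon>) \<epsilon> (strip U \<epsilon> I) (graph_over I (m \<alpha> \<epsilon>)) \<and>
       \<bar>m \<alpha> \<epsilon> c - vb\<bar> \<le> \<eta> \<and> \<bar>\<phi> (m \<alpha> \<epsilon> c) - \<psi> c\<bar> \<le> 2 * ds * C0 * \<epsilon>)"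
  proof eventually_elim
    case (elim \<epsilon>)
    note el = elim(1)[THEN conjunct2, rule_format]
    have \<epsilon>: "0 < \<epsilon>" "\<epsilon> < b" using elim(2) by auto
    have "continuous_on {-(D*\<epsilon>)..D*\<epsilon>} (\<lambda>\<alpha>. (\<lambda>(\<alpha>, x). m \<alpha> \<epsilon> x) (\<alpha>, c))"
      by (rule continuous_on_compose2[OF elim(1)[THEN conjunct1]]) (use c in \<open>auto intro!: continuous_intros\<close>)
    moreover have "\<bar>m \<alpha> \<epsilon> c - vb\<bar> \<le> \<eta> \<and> \<bar>\<phi> (m \<alpha> \<epsilon> c) - \<psi> c\<bar> \<le> 2 * ds * C0 * \<epsilon>"
      if \<alpha>: "\<alpha> \<in> {-(D*\<epsilon>)..D*\<epsilon>}" for \<alpha>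
    proof
      have d: "\<bar>m \<alpha> \<epsilon> c - m_0 (X 0) (Y 0) \<phi> c\<bar> \<le> C0 * \<epsilon>"
        using el[OF \<alpha>, THEN conjunct2] c(1) by (rule bspec)
      have "C0 * \<epsilon> \<le> c0 * b" using \<epsilon> c0 by (intro mult_mono) auto
      also have "\<dots> = \<eta> / 2" using c0(1) by (simp add: b_def)
      finally have d2: "C0 * \<epsilon> \<le> \<eta> / 2" .
      note m0 = critical_manifold[OF c(2,3)]
      show le: "\<bar>m \<alpha> \<epsilon> c - vb\<bar> \<le> \<eta>" using d d2 m0(2) by linarith
      have le0: "\<bar>m_0 (X 0) (Y 0) \<phi> c - vb\<bar> \<le> \<eta>" using m0(2) \<eta>(1) by linarith
      have "\<bar>\<phi> (m \<alpha> \<epsilon> c) - \<psi> c\<bar> \<le> 2 * ds * \<bar>m \<alpha> \<epsilon> c - m_0 (X 0) (Y 0) \<phi> c\<bar>"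
        using lipschitz[OF le le0] unfolding m0(1) .
      also have "\<dots> \<le> 2 * ds * (C0 * \<epsilon>)" using d v_bar_facts(3) by (intro mult_left_mono) auto
      finally show "\<bar>\<phi> (m \<alpha> \<epsilon> c) - \<psi> c\<bar> \<le> 2 * ds * C0 * \<epsilon>" by (simp only: mult.assoc)
    qed
    ultimately show ?case using el by simp
  qed
  then show ?thesis by (rule exI[of _ "2 * ds * C0"])
qed

context
  fixes L1 \<kappa> ms mu
  assumes \<kappa>: "0 < \<kappa>" "\<kappa> < L1" "L1 \<le> L"
    and ms: "fenichel_manifolds U X Y \<phi> {-L1..-\<kappa>} ms"
    and mu: "fenichel_manifolds U X Y \<phi> {\<kappa>..L1} mu"
begin

lemma endpoints:
  assumes "0 < D"
  shows "\<exists>C. \<forall>\<^sub>F \<epsilon> in at_right 0. continuous_on {-(D*\<epsilon>)..D*\<epsilon>} (\<lambda>\<alpha>. ms \<alpha> \<epsilon> (- L1)) \<and>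
      (\<forall>\<alpha>\<in>{-(D*\<epsilon>)..D*\<epsilon>}.
         locally_invariant (F \<alpha> \<epsilon>) \<epsilon> (strip U \<epsilon> {-L1..-\<kappa>}) (graph_over {-L1..-\<kappa>} (ms \<alpha> \<epsilon>)) \<and>
         \<bar>ms \<alpha> \<epsilon> (- L1) - vb\<bar> \<le> \<eta> \<and> \<bar>\<phi> (ms \<alpha> \<epsilon> (- L1)) - \<psi> (- L1)\<bar> \<le> C * \<epsilon>)"
    "\<exists>C. \<forall>\<^sub>F \<epsilon> in at_right 0. continuous_on {-(D*\<epsilon>)..D*\<epsilon>} (\<lambda>\<alpha>. mu \<alpha> \<epsilon> L1) \<and>
      (\<forall>\<alpha>\<in>{-(D*\<epsilon>)..D*\<epsilon>}.
         locally_invariant (F \<alpha> \<epsilon>) \<epsilon> (strip U \<epsilon> {\<kappa>..L1}) (graph_over {\<kappa>..L1} (mu \<alpha> \<epsilon>)) \<and>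
         \<bar>mu \<alpha> \<epsilon> L1 - vb\<bar> \<le> \<eta> \<and> \<bar>\<phi> (mu \<alpha> \<epsilon> L1) - \<psi> L1\<bar> \<le> C * \<epsilon>)"
  by (rule fenichel_endpoint[OF ms _ _ _ assms] fenichel_endpoint[OF mu _ _ _ assms]; use \<kappa> in simp)+

lemma extensions_to_section:
  assumes D: "0 < D"
  shows "\<exists>C. \<forall>\<^sub>F \<epsilon> in at_right 0. \<forall>\<alpha>\<in>{-(D*\<epsilon>)..D*\<epsilon>}.
         (\<exists>w. continuous_on {-L1..0} w \<and> (\<forall>x\<in>{-L1..-\<kappa>}. w x = ms \<alpha> \<epsilon> x) \<and>
              ext_stable U X Y \<phi> L1 \<kappa> ms {-L1..0} \<alpha> \<epsilon> = graph_over {-L1..0} w) \<and>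
         (\<exists>w. continuous_on {0..L1} w \<and> (\<forall>x\<in>{\<kappa>..L1}. w x = mu \<alpha> \<epsilon> x) \<and>
              ext_unstable U X Y \<phi> L1 \<kappa> mu {0..L1} \<alpha> \<epsilon> = graph_over {0..L1} w) \<and>
         (\<exists>v. ext_stable U X Y \<phi> L1 \<kappa> ms {-L1..0} \<alpha> \<epsilon> \<inter> section_0 = {(0, v)} \<and>
              \<bar>v - vb\<bar> \<le> C * \<epsilon> powr (1/2)) \<and>
         (\<exists>v. ext_unstable U X Y \<phi> L1 \<kappa> mu {0..L1} \<alpha> \<epsilon> \<inter> section_0 = {(0, v)} \<and>
              \<bar>v - vb\<bar> \<le> C * \<epsilon> powr (1/2))"
proof -
  obtain C where C: "\<forall>\<^sub>F \<epsilon> in at_right 0. \<forall>\<alpha>\<in>{-(D*\<epsilon>)..D*\<epsilon>}.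
    (\<exists>w. continuous_on {-L1..0} w \<and> (\<forall>x\<in>{-L1..-\<kappa>}. w x = ms \<alpha> \<epsilon> x) \<and>
       ext_stable U X Y \<phi> L1 \<kappa> ms {-L1..0} \<alpha> \<epsilon> = graph_over {-L1..0} w \<and> \<bar>w 0 - vb\<bar> \<le> C * sqrt \<epsilon>) \<and>
    (\<exists>w. continuous_on {0..L1} w \<and> (\<forall>x\<in>{\<kappa>..L1}. w x = mu \<alpha> \<epsilon> x) \<and>
       ext_unstable U X Y \<phi> L1 \<kappa> mu {0..L1} \<alpha> \<epsilon> = graph_over {0..L1} w \<and> \<bar>w 0 - vb\<bar> \<le> C * sqrt \<epsilon>)"
    using canard_point.branch_extensions[OF is_canard_point \<kappa>(1) less_imp_le[OF \<kappa>(2)] \<kappa>(3) D endpoints[OF D]]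
    unfolding ext_stable_def ext_unstable_def by (elim exE)
  show ?thesis
  proof (rule exI[of _ C], rule eventually_mono[OF eventually_conj[OF C eventually_at_right_less]], rule ballI)
    fix \<epsilon> \<alpha> :: real
    assume *: "(\<forall>\<alpha>\<in>{-(D*\<epsilon>)..D*\<epsilon>}.
      (\<exists>w. continuous_on {-L1..0} w \<and> (\<forall>x\<in>{-L1..-\<kappa>}. w x = ms \<alpha> \<epsilon> x) \<and>
         ext_stable U X Y \<phi> L1 \<kappa> ms {-L1..0} \<alpha> \<epsilon> = graph_over {-L1..0} w \<and> \<bar>w 0 - vb\<bar> \<le> C * sqrt \<epsilon>) \<and>
      (\<exists>w. continuous_on {0..L1} w \<and> (\<forall>x\<in>{\<kappa>..L1}. w x = mu \<alpha> \<epsilon> x) \<and>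
         ext_unstable U X Y \<phi> L1 \<kappa> mu {0..L1} \<alpha> \<epsilon> = graph_over {0..L1} w \<and> \<bar>w 0 - vb\<bar> \<le> C * sqrt \<epsilon>)) \<and> 0 < \<epsilon>"
      and \<alpha>: "\<alpha> \<in> {-(D*\<epsilon>)..D*\<epsilon>}"
    have s: "\<epsilon> powr (1/2) = sqrt \<epsilon>" using * by (simp add: powr_half_sqrt)
    have z: "0 \<in> {-L1..0}" "0 \<in> {0..L1}" using \<kappa> by auto
    from bspec[OF conjunct1[OF *] \<alpha>] obtain w w' where
      w: "continuous_on {-L1..0} w" "\<forall>x\<in>{-L1..-\<kappa>}. w x = ms \<alpha> \<epsilon> x"
        "ext_stable U X Y \<phi> L1 \<kappa> ms {-L1..0} \<alpha> \<epsilon> = graph_over {-L1..0} w" "\<bar>w 0 - vb\<bar> \<le> C * sqrt \<epsilon>"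
      and w': "continuous_on {0..L1} w'" "\<forall>x\<in>{\<kappa>..L1}. w' x = mu \<alpha> \<epsilon> x"
        "ext_unstable U X Y \<phi> L1 \<kappa> mu {0..L1} \<alpha> \<epsilon> = graph_over {0..L1} w'" "\<bar>w' 0 - vb\<bar> \<le> C * sqrt \<epsilon>"
      by (elim conjE exE)
    show "(\<exists>w. continuous_on {-L1..0} w \<and> (\<forall>x\<in>{-L1..-\<kappa>}. w x = ms \<alpha> \<epsilon> x) \<and>
              ext_stable U X Y \<phi> L1 \<kappa> ms {-L1..0} \<alpha> \<epsilon> = graph_over {-L1..0} w) \<and>
         (\<exists>w. continuous_on {0..L1} w \<and> (\<forall>x\<in>{\<kappa>..L1}. w x = mu \<alpha> \<epsilon> x) \<and>
              ext_unstable U X Y \<phi> L1 \<kappa> mu {0..L1} \<alpha> \<epsilon> = graph_over {0..L1} w) \<and>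
         (\<exists>v. ext_stable U X Y \<phi> L1 \<kappa> ms {-L1..0} \<alpha> \<epsilon> \<inter> section_0 = {(0, v)} \<and>
              \<bar>v - vb\<bar> \<le> C * \<epsilon> powr (1/2)) \<and>
         (\<exists>v. ext_unstable U X Y \<phi> L1 \<kappa> mu {0..L1} \<alpha> \<epsilon> \<inter> section_0 = {(0, v)} \<and>
              \<bar>v - vb\<bar> \<le> C * \<epsilon> powr (1/2))"
      unfolding s using w(1,2) w'(1,2)
      by (intro conjI exI[of _ w] exI[of _ w'] exI[of _ "w 0"] exI[of _ "w' 0"] w w'
          graph_over_section[OF z(1), of w, folded w(3)] graph_over_section[OF z(2), of w', folded w'(3)])
  qed
qed

lemma maximal_canard_exists:
  "\<exists>\<alpha>C :: real \<Rightarrow> real. \<exists>C. \<forall>\<^sub>F \<epsilon> in at_right 0.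
     \<bar>\<alpha>C \<epsilon> - delta_C (X 0) (Y 0) X' Y' \<phi> * \<epsilon>\<bar> \<le> C * \<epsilon> powr (3/2) \<and>
     maximal_canard U X Y \<phi> L1 \<kappa> ms mu (\<alpha>C \<epsilon>) \<epsilon> \<and>
     (\<exists>v. ext_stable U X Y \<phi> L1 \<kappa> ms {-L1..0} (\<alpha>C \<epsilon>) \<epsilon> \<inter> section_0 = {(0, v)} \<and>
          ext_unstable U X Y \<phi> L1 \<kappa> mu {0..L1} (\<alpha>C \<epsilon>) \<epsilon> \<inter> section_0 = {(0, v)} \<and>
          \<bar>v - vb\<bar> \<le> C * \<epsilon>)"
proof -
  have "\<exists>\<alpha>C C. \<forall>\<^sub>F \<epsilon> in at_right 0.
    \<bar>\<alpha>C \<epsilon> - delta_C (X 0) (Y 0) X' Y' \<phi> * \<epsilon>\<bar> \<le> C * (\<epsilon> * sqrt \<epsilon>) \<and>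
    ext_stable U X Y \<phi> L1 \<kappa> ms {-L1..L1} (\<alpha>C \<epsilon>) \<epsilon> = ext_unstable U X Y \<phi> L1 \<kappa> mu {-L1..L1} (\<alpha>C \<epsilon>) \<epsilon> \<and>
    (\<exists>ws wu. ext_stable U X Y \<phi> L1 \<kappa> ms {-L1..0} (\<alpha>C \<epsilon>) \<epsilon> = graph_over {-L1..0} ws \<and>
      ext_unstable U X Y \<phi> L1 \<kappa> mu {0..L1} (\<alpha>C \<epsilon>) \<epsilon> = graph_over {0..L1} wu \<and>
      wu 0 = ws 0 \<and> \<bar>ws 0 - vb\<bar> \<le> C * \<epsilon>)" (is "\<exists>\<alpha>C C. eventually (?P \<alpha>C C) _")
    unfolding ext_stable_def ext_unstable_def
    by (rule canard_point.canard_existence[OF is_canard_point \<kappa>(1) less_imp_le[OF \<kappa>(2)] \<kappa>(3)])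
      (rule endpoints; assumption)+
  then obtain \<alpha>C C where C: "eventually (?P \<alpha>C C) (at_right 0)" by (elim exE)
  have z: "0 \<in> {-L1..0}" "0 \<in> {0..L1}" using \<kappa> by auto
  show ?thesis
  proof (rule exI[of _ \<alpha>C], rule exI[of _ C],
      rule eventually_mono[OF eventually_conj[OF C eventually_at_right_less]], elim conjE exE, intro conjI exI)
    fix \<epsilon> :: real and ws wu
    assume \<epsilon>: "0 < \<epsilon>" and eq: "\<bar>\<alpha>C \<epsilon> - delta_C (X 0) (Y 0) X' Y' \<phi> * \<epsilon>\<bar> \<le> C * (\<epsilon> * sqrt \<epsilon>)"
      "ext_stable U X Y \<phi> L1 \<kappa> ms {-L1..L1} (\<alpha>C \<epsilon>) \<epsilon> = ext_unstable U X Y \<phi> L1 \<kappa> mu {-L1..L1} (\<alpha>C \<epsilon>) \<epsilon>"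
      and w: "ext_stable U X Y \<phi> L1 \<kappa> ms {-L1..0} (\<alpha>C \<epsilon>) \<epsilon> = graph_over {-L1..0} ws"
        "ext_unstable U X Y \<phi> L1 \<kappa> mu {0..L1} (\<alpha>C \<epsilon>) \<epsilon> = graph_over {0..L1} wu"
        "wu 0 = ws 0" "\<bar>ws 0 - vb\<bar> \<le> C * \<epsilon>"
    show "\<bar>\<alpha>C \<epsilon> - delta_C (X 0) (Y 0) X' Y' \<phi> * \<epsilon>\<bar> \<le> C * \<epsilon> powr (3/2)"
      unfolding powr_three_halves[OF \<epsilon>] by (rule eq(1))
    show "maximal_canard U X Y \<phi> L1 \<kappa> ms mu (\<alpha>C \<epsilon>) \<epsilon>" unfolding maximal_canard_def by (rule eq(2))
    show "ext_stable U X Y \<phi> L1 \<kappa> ms {-L1..0} (\<alpha>C \<epsilon>) \<epsilon> \<inter> section_0 = {(0, ws 0)}"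
      unfolding w(1) by (rule graph_over_section[OF z(1)])
    show "ext_unstable U X Y \<phi> L1 \<kappa> mu {0..L1} (\<alpha>C \<epsilon>) \<epsilon> \<inter> section_0 = {(0, ws 0)}"
      unfolding w(2) w(3)[symmetric] by (rule graph_over_section[OF z(2)])
    show "\<bar>ws 0 - vb\<bar> \<le> C * \<epsilon>" by (rule w(4))
  qed
qed

end

end

section \<open>Choice of the constants\<close>

text \<open>Turns a bound with \<open>k + 1\<close> in the denominator into a bound for the product
  with k, so that k = 0 needs no separate treatment.\<close>

lemma le_from_le_quotient:
  fixes k e c b :: real
  assumes "0 \<le> k" "0 \<le> e" "0 < c" "e \<le> b / (c * (k + 1))"
  shows "c * (k * e) \<le> b"
proof -
  have "0 < c * (k + 1)" using assms by (intro mult_pos_pos) auto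
  then have "e * (c * (k + 1)) \<le> b" using assms(4) by (simp only: pos_le_divide_eq)
  moreover have "e * (c * (k + 1)) = c * (k * e) + c * e" by (simp add: algebra_simps)
  moreover have "0 \<le> c * e" using assms by simp
  ultimately show ?thesis by linarith
qed

context regularized_fold
begin

lemma common_bounds:
  obtains r K gx1 hx1 gx2 hx2 gy1 hy1 gy2 hy2
  where "regularized_fold_bounds A U X Y X' Y' \<phi> r K gx1 hx1 gx2 hx2 gy1 hy1 gy2 hy2"
proof -
  obtain r1 K1 p1 q1 where 1: "family_bounds U (\<lambda>\<alpha> p. fst (X \<alpha> p)) (fst (X' 0)) r1 K1 p1 q1"
    by (rule smooth_unfolding_family_bounds[OF X AU bounded_linear_fst])
  obtain r2 K2 p2 q2 where 2: "family_bounds U (\<lambda>\<alpha> p. snd (X \<alpha> p)) (snd (X' 0)) r2 K2 p2 q2"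
    by (rule smooth_unfolding_family_bounds[OF X AU bounded_linear_snd])
  obtain r3 K3 p3 q3 where 3: "family_bounds U (\<lambda>\<alpha> p. fst (Y \<alpha> p)) (fst (Y' 0)) r3 K3 p3 q3"
    by (rule smooth_unfolding_family_bounds[OF Y AU bounded_linear_fst])
  obtain r4 K4 p4 q4 where 4: "family_bounds U (\<lambda>\<alpha> p. snd (Y \<alpha> p)) (snd (Y' 0)) r4 K4 p4 q4"
    by (rule smooth_unfolding_family_bounds[OF Y AU bounded_linear_snd])
  define r K where "r = min (min r1 r2) (min r3 r4)" and "K = max (max K1 K2) (max K3 K4)"
  have r: "0 < r" "r \<le> r1" "r \<le> r2" "r \<le> r3" "r \<le> r4"
    using family_bounds.r[OF 1] family_bounds.r[OF 2] family_bounds.r[OF 3] family_bounds.r[OF 4]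
    by (auto simp: r_def)
  have K: "K1 \<le> K" "K2 \<le> K" "K3 \<le> K" "K4 \<le> K" by (auto simp: K_def)
  have "regularized_fold_bounds A U X Y X' Y' \<phi> r K p1 q1 p2 q2 p3 q3 p4 q4"
    by (rule regularized_fold_bounds.intro[OF regularized_fold_axioms
          family_bounds_mono[OF 1 r(1,2) K(1)] family_bounds_mono[OF 2 r(1,3) K(2)]
          family_bounds_mono[OF 3 r(1,4) K(3)] family_bounds_mono[OF 4 r(1,5) K(4)]])
  then show thesis by (rule that)
qed

lemma fold_box_exists:
  obtains r K gx1 hx1 gx2 hx2 gy1 hy1 gy2 hy2 \<psi>' \<eta> L C K\<phi>
  where "fold_box A U X Y X' Y' \<phi> r K gx1 hx1 gx2 hx2 gy1 hy1 gy2 hy2 \<psi>' \<eta> L C K\<phi>"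
proof -
  obtain r K gx1 hx1 gx2 hx2 gy1 hy1 gy2 hy2
    where B: "regularized_fold_bounds A U X Y X' Y' \<phi> r K gx1 hx1 gx2 hx2 gy1 hy1 gy2 hy2"
    by (rule common_bounds)
  interpret B: regularized_fold_bounds A U X Y X' Y' \<phi> r K gx1 hx1 gx2 hx2 gy1 hy1 gy2 hy2 by (rule B)
  obtain s C \<psi>' where s: "0 < s" "s \<le> r" "0 \<le> C"
    and q: "\<And>x. \<bar>x\<bar> \<le> s \<Longrightarrow> x \<noteq> 0 \<Longrightarrow> B.qx / 2 \<le> B.q x / x \<and> B.q x / x \<le> 2 * B.qx"
    and \<psi>': "\<And>x. \<bar>x\<bar> \<le> s \<Longrightarrow> x \<noteq> 0 \<Longrightarrow> (B.\<psi> has_real_derivative \<psi>' x) (at x)"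
    and \<psi>_near: "\<And>x. \<bar>x\<bar> \<le> s \<Longrightarrow> \<bar>B.\<psi> x - \<phi> vb\<bar> \<le> C * \<bar>x\<bar>"
    and \<psi>'_near: "\<And>x. \<bar>x\<bar> \<le> s \<Longrightarrow> x \<noteq> 0 \<Longrightarrow> \<bar>\<psi>' x - B.\<psi>1\<bar> \<le> C * \<bar>x\<bar>"
    by (rule B.critical_level_bounds) (rule that)
  obtain r\<phi> K\<phi> where r\<phi>: "0 < r\<phi>" "0 \<le> K\<phi>"
    and K\<phi>: "\<And>v. \<bar>v - vb\<bar> \<le> r\<phi> \<Longrightarrow> \<bar>deriv \<phi> v - deriv \<phi> vb\<bar> \<le> K\<phi> * \<bar>v - vb\<bar>"
    by (rule transition_function_deriv_lipschitz[OF \<phi>]) (rule that)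
  define d N1 where "d = deriv \<phi> vb" and "N1 = \<bar>c1 (X 0) 0 - c1 (Y 0) 0\<bar>"
  have d: "0 < d" using v_bar_facts(3) by (simp add: d_def)
  have m0: "0 < m0" by (rule coefficient_signs(1))
  have K: "0 \<le> K" by (rule B.X1.K)
  have N1: "0 \<le> N1" by (simp add: N1_def)
  \<comment> \<open>One entry per requirement: the radius on which \<open>\<phi>'\<close> is
    Lipschitz, the inequality \<open>\<bar>vb\<bar> + \<eta> \<le> 1\<close>, and then the first,
    third and fifth item of \<open>small\<close>.\<close>
  define \<eta> where "\<eta> = min (min r\<phi> (1 - \<bar>vb\<bar>)) (min (d / (2 * (K\<phi> + 1))) (min (1 / (2 * d)) (m0 / (16 * d * (N1 + 1)))))"
  have \<eta>: "0 < \<eta>" using r\<phi> v_bar_facts(1) d m0 N1 by (simp add: \<eta>_def)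
  have \<eta>_le: "\<eta> \<le> r\<phi>" "\<eta> \<le> 1 - \<bar>vb\<bar>" "\<eta> \<le> d / (2 * (K\<phi> + 1))" "\<eta> \<le> 1 / (2 * d)" "\<eta> \<le> m0 / (16 * d * (N1 + 1))"
    unfolding \<eta>_def by linarith+
  \<comment> \<open>Chosen after \<eta>, since the second item of \<open>small\<close> compares L
    with \<eta>; the middle entry serves the fourth item.\<close>
  define L where "L = min s (min (m0 / (16 * (K + 1))) ((d * \<eta>) / (4 * (C + 1))))"
  have L: "0 < L" using s d \<eta> m0 K by (simp add: L_def)
  have L_le: "L \<le> s" "L \<le> m0 / (16 * (K + 1))" "L \<le> (d * \<eta>) / (4 * (C + 1))" unfolding L_def by linarith+
  have "fold_box A U X Y X' Y' \<phi> r K gx1 hx1 gx2 hx2 gy1 hy1 gy2 hy2 \<psi>' \<eta> L C K\<phi>"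
  proof
    show "L \<le> r" using L_le s by linarith
    show "\<bar>vb\<bar> + \<eta> \<le> 1" using \<eta>_le by linarith
    have "2 * (K\<phi> * \<eta>) \<le> d" by (rule le_from_le_quotient) (use r\<phi> \<eta> \<eta>_le in auto)
    then show "K\<phi> * \<eta> \<le> deriv \<phi> vb / 2" unfolding d_def by linarith
    have "4 * (C * L) \<le> d * \<eta>" by (rule le_from_le_quotient) (use s L L_le in auto)
    then show "C * L \<le> deriv \<phi> vb / 2 * \<eta> / 2" unfolding d_def by simp
    have "\<eta> * (2 * d) \<le> 1" using \<eta>_le(4) d by (simp only: pos_le_divide_eq)
    then show "deriv \<phi> vb * \<eta> \<le> 1 / 2" unfolding d_def by (simp add: mult.commute)
    have "16 * (K * L) \<le> m0" by (rule le_from_le_quotient) (use K L L_le in auto)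
    then show "2 * (K * L) \<le> m0 / 8" by simp
    have "(16 * d) * (N1 * \<eta>) \<le> m0" by (rule le_from_le_quotient) (use d N1 \<eta> \<eta>_le in auto)
    then show "2 * deriv \<phi> vb * \<eta> * \<bar>c1 (X 0) 0 - c1 (Y 0) 0\<bar> \<le> m0 / 8"
      unfolding d_def[symmetric] N1_def[symmetric] by (simp add: mult_ac)
    fix x :: real assume "\<bar>x\<bar> \<le> L"
    then have x: "\<bar>x\<bar> \<le> s" using L_le by linarith
    show "\<bar>B.\<psi> x - \<phi> vb\<bar> \<le> C * \<bar>x\<bar>" by (rule \<psi>_near[OF x])
    assume x0: "x \<noteq> 0"
    show "B.qx / 2 \<le> B.q x / x \<and> B.q x / x \<le> 2 * B.qx" by (rule q[OF x x0])
    show "(B.\<psi> has_real_derivative \<psi>' x) (at x)" by (rule \<psi>'[OF x x0])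
    show "\<bar>\<psi>' x - B.\<psi>1\<bar> \<le> C * \<bar>x\<bar>" by (rule \<psi>'_near[OF x x0])
  next
    fix v assume "\<bar>v - vb\<bar> \<le> \<eta>"
    then have "\<bar>v - vb\<bar> \<le> r\<phi>" using \<eta>_le by linarith
    then show "\<bar>deriv \<phi> v - deriv \<phi> vb\<bar> \<le> K\<phi> * \<bar>v - vb\<bar>" by (rule K\<phi>)
  qed (fact L \<eta> s r\<phi>)+
  then show thesis by (rule that)
qed

end

theorem proposition4p6:
  fixes A :: "real set" and U :: "(real \<times> real) set"
    and X Y :: "real \<Rightarrow> vfield" and X' Y' :: vfield and \<phi> :: "real \<Rightarrow> real"
  assumes "open A" "0 \<in> A" "open U" "0 \<in> U"
    and "smooth_unfolding A U X X'" "smooth_unfolding A U Y Y'"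
    and "transition_function \<phi>"
    and "in_Lambda_F (X 0) (Y 0)"
    and "versal (X 0) (Y 0) X' Y'"
    and "c1 (X 0) 0 * c1 (Y 0) 0 < 0"
    and "dx (det_Z (X 0) (Y 0)) 0 < 0"
  shows "\<exists>L0>0. \<forall>L \<kappa> ms mu.
    0 < \<kappa> \<and> \<kappa> < L \<and> L \<le> L0 \<and>
    fenichel_manifolds U X Y \<phi> {-L..-\<kappa>} ms \<and> fenichel_manifolds U X Y \<phi> {\<kappa>..L} mu \<longrightarrow>
      (\<forall>D>0. \<exists>C. \<forall>\<^sub>F \<epsilon> in at_right 0. \<forall>\<alpha>\<in>{-(D*\<epsilon>)..D*\<epsilon>}.
         (\<exists>w. continuous_on {-L..0} w \<and> (\<forall>x\<in>{-L..-\<kappa>}. w x = ms \<alpha> \<epsilon> x) \<and>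
              ext_stable U X Y \<phi> L \<kappa> ms {-L..0} \<alpha> \<epsilon> = graph_over {-L..0} w) \<and>
         (\<exists>w. continuous_on {0..L} w \<and> (\<forall>x\<in>{\<kappa>..L}. w x = mu \<alpha> \<epsilon> x) \<and>
              ext_unstable U X Y \<phi> L \<kappa> mu {0..L} \<alpha> \<epsilon> = graph_over {0..L} w) \<and>
         (\<exists>v. ext_stable U X Y \<phi> L \<kappa> ms {-L..0} \<alpha> \<epsilon> \<inter> section_0 = {(0, v)} \<and>
              \<bar>v - v_bar (X 0) (Y 0) \<phi>\<bar> \<le> C * \<epsilon> powr (1/2)) \<and>
         (\<exists>v. ext_unstable U X Y \<phi> L \<kappa> mu {0..L} \<alpha> \<epsilon> \<inter> section_0 = {(0, v)} \<and>
              \<bar>v - v_bar (X 0) (Y 0) \<phi>\<bar> \<le> C * \<epsilon> powr (1/2))) \<and>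
      (\<exists>\<alpha>C :: real \<Rightarrow> real. \<exists>C. \<forall>\<^sub>F \<epsilon> in at_right 0.
         \<bar>\<alpha>C \<epsilon> - delta_C (X 0) (Y 0) X' Y' \<phi> * \<epsilon>\<bar> \<le> C * \<epsilon> powr (3/2) \<and>
         maximal_canard U X Y \<phi> L \<kappa> ms mu (\<alpha>C \<epsilon>) \<epsilon> \<and>
         (\<exists>v. ext_stable U X Y \<phi> L \<kappa> ms {-L..0} (\<alpha>C \<epsilon>) \<epsilon> \<inter> section_0 = {(0, v)} \<and>
              ext_unstable U X Y \<phi> L \<kappa> mu {0..L} (\<alpha>C \<epsilon>) \<epsilon> \<inter> section_0 = {(0, v)} \<and>
              \<bar>v - v_bar (X 0) (Y 0) \<phi>\<bar> \<le> C * \<epsilon>))"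
proof -
  interpret regularized_fold A U X Y X' Y' \<phi> by (rule regularized_fold.intro) (fact assms)+
  obtain r K gx1 hx1 gx2 hx2 gy1 hy1 gy2 hy2 \<psi>' \<eta> L C K\<phi>
    where "fold_box A U X Y X' Y' \<phi> r K gx1 hx1 gx2 hx2 gy1 hy1 gy2 hy2 \<psi>' \<eta> L C K\<phi>"
    by (rule fold_box_exists)
  then interpret B: fold_box A U X Y X' Y' \<phi> r K gx1 hx1 gx2 hx2 gy1 hy1 gy2 hy2 \<psi>' \<eta> L C K\<phi> .
  \<comment> \<open>The half-width L of the box is the required \<open>L0\<close>: it is obtained
    from the fields and \<phi> alone, before \<kappa>, the outer ends and the Fenichel manifolds are
    given.\<close>
  show ?thesis
    by (rule exI[of _ L], rule conjI[OF B.L(1)], intro allI impI, elim conjE, rule conjI)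
      (intro allI impI, rule B.extensions_to_section, assumption+, rule B.maximal_canard_exists)
qed

end
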